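(* Let $1\le p\le q$ be integers and consider the finitized bead process with parameters $p,q$ (defined in the context), where $(t,x)$ refers to the position $x\in(0,1)$ on line $t\in\{1,\dots,p+q-1\}$. For a configuration $Y=\bigcup_{i=1}^n\{(t_i,x_i)\}$ the correlation function is $$\rho(Y)=\det\left[K(t_i,x_i;t_j,x_j)\right]_{i,j=1,\dots,n},$$ where $$K(s,y;t,x)=\begin{cases}\displaystyle a_s(y)b_t(x)\sum_{l=1}^{\alpha(s,t)}\frac{\mathcal C_l^{(s)}}{\mathcal C_l^{(t)}}\,\frac{Q_l^{(s)}(y)\,Q_l^{(t)}(x)}{\mathcal N_l^{(t)}}, & s\ge t,\\[2ex]\displaystyle -a_s(y)b_t(x)\sum_{l=-\infty}^{0}\frac{\mathcal C_l^{(s)}}{\mathcal C_l^{(t)}}\,\frac{Q_l^{(s)}(y)\,Q_l^{(t)}(x)}{\mathcal N_l^{(t)}}, & s<t,\end{cases}$$ with $\alpha(s,t)=\min[p+q-s,\,t,\,p]$ and $$a_s(y)=\begin{cases}(-y)^{p-s}(1-y)^{q-s}, & 0<s\le p,\\ (1-y)^{q-s}, & p<s\le q,\\ 1, & q<s\le p+q-1,\end{cases}\qquad b_t(x)=\begin{cases}(-1)^{p-t}, & 0<t\le p,\\ x^{t-p}, & p<t\le q,\\ x^{t-p}(1-x)^{t-q}, & q<t\le p+q-1,\end{cases}$$ $$\mathcal C_l^{(t)}=\begin{cases}\dfrac{(t-l)!}{(p-l)!}, & 0<t\le p,\\[1.5ex] \dfrac{(q-l)!}{(p+q-t-l)!},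 & p<t\le q,\\[1.5ex] \dfrac{(t-l)!}{(p-l)!}, & q<t\le p+q-1,\end{cases}$$ $$Q_l^{(t)}(x)=\begin{cases}\tilde P_{t-l}^{(p-t,\,q-t)}(x), & 0<t\le p,\\ \tilde P_{p-l}^{(t-p,\,q-t)}(x), & p<t\le q,\\ \tilde P_{p+q-t-l}^{(t-p,\,t-q)}(x), & q<t\le p+q-1,\end{cases}\qquad \mathcal N_l^{(t)}=\begin{cases}\mathcal N_{t-l}^{(p-t,\,q-t)}, & 0<t\le p,\\ \mathcal N_{p-l}^{(t-p,\,q-t)}, & p<t\le q,\\ \mathcal N_{p+q-t-l}^{(t-p,\,t-q)}, & q<t\le p+q-1.\end{cases}$$
   Context: Finitized bead process: fix integers $1\le p\le q$. On each line $t=1,\dots,p+q-1$ (a copy of the segment $(0,1)$) there are $r(t)$ particles, where $r(t)=t$ for $t\le p$, $r(t)=p$ for $p\le t\le q$, $r(t)=p+q-t$ for $t\ge q$. Their positions are $x^{(t)}=\{x^{(t)}_1>\dots>x^{(t)}_{r(t)}\}\subset(0,1)$. The joint probability density function (with respect to Lebesgue measure) of all the positions is proportional to $$\prod_{t=1}^{p-1}\chi(x^{(t)},x^{(t+1)})\prod_{t=p}^{q-1}\chi(x^{(t)},x^{(t+1)}\cup\{0\})\prod_{t=q}^{p+q-1}\chi(x^{(t)},x^{(t+1)}\cup\{0,1\}),$$ where $x^{(p+q)}=\emptyset$ and, for finite sets $y=\{y_1>\dots>y_m\}$, $z=\{z_1>\dots>z_{m+1}\}$, $\chi(y,z)=1$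 if $z_{m+1}<y_m<z_m<\dots<z_2<y_1<z_1$ and $\chi(y,z)=0$ otherwise. Correlation function: $\rho(Y)$ for $Y=\{(t_1,x_1),\dots,(t_n,x_n)\}$ is the $n$-point correlation function (joint intensity) of this point process on $\{1,\dots,p+q-1\}\times(0,1)$ with respect to counting measure times Lebesgue measure; as usual it is understood up to null sets. Polynomials: $\tilde P_n^{(a,b)}(x)=P_n^{(a,b)}(1-2x)$, with $P_n^{(a,b)}$ the classical Jacobi polynomial, i.e. $\tilde P_n^{(a,b)}(x)=\frac{1}{n!}\frac{1}{x^a(1-x)^b}\frac{d^n}{dx^n}\left(x^{n+a}(1-x)^{n+b}\right)$ for $n\ge0$ and $\tilde P_n^{(a,b)}=0$ for $n<0$. The normalization is $\mathcal N_n^{(a,b)}=\int_0^1x^a(1-x)^b\left(\tilde P_n^{(a,b)}(x)\right)^2dx=\frac{1}{2n+a+b+1}\frac{(n+a)!\,(n+b)!}{n!\,(n+a+b)!}$. *)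

theory Defs
  imports "HOL-Probability.Probability" "Jordan_Normal_Form.Determinant"
begin

section \<open>Correlation functions\<close>

text \<open>
  \<open>X \<omega>\<close> is a random finite set of points (simple point process) on the reference space \<open>\<mu>\<close>.
  A function \<open>\<rho>\<close> of \<open>n\<close>-tuples of points is its \<open>n\<close>-point correlation function (joint intensity)
  if it is the density, with respect to the \<open>n\<close>-fold product of \<open>\<mu>\<close>, of the \<open>n\<close>-th factorial
  moment measure, which maps \<open>B\<close> to the expected number of \<open>n\<close>-tuples of pairwise distinct
  points of the process that lie in \<open>B\<close>.  Such a \<open>\<rho>\<close> is determined only up to null sets.
  Almost everywhere nonnegativity is demanded explicitly because \<open>ennreal\<close> truncates
  negative reals to \<open>0\<close>.
\<close>

definition is_correlation_function ::
  "'w measure \<Rightarrow> ('w \<Rightarrow> 'a set) \<Rightarrow> 'a measure \<Rightarrow> nat \<Rightarrow> ((nat \<Rightarrow> 'a) \<Rightarrow> real) \<Rightarrow> bool" where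
  "is_correlation_function M X \<mu> n \<rho> \<longleftrightarrow>
     \<rho> \<in> borel_measurable (Pi\<^sub>M {..<n} (\<lambda>_. \<mu>)) \<and>
     (AE Y in Pi\<^sub>M {..<n} (\<lambda>_. \<mu>). 0 \<le> \<rho> Y) \<and>
     (\<forall>B \<in> sets (Pi\<^sub>M {..<n} (\<lambda>_. \<mu>)).
        (\<integral>\<^sup>+ \<omega>. of_nat (card {Y \<in> B. Y \<in> {..<n} \<rightarrow>\<^sub>E X \<omega> \<and> inj_on Y {..<n}}) \<partial>M)
        = (\<integral>\<^sup>+ Y. ennreal (\<rho> Y) * indicator B Y \<partial>(Pi\<^sub>M {..<n} (\<lambda>_. \<mu>))))"

section \<open>The finitized bead process\<close>

definition num_particles :: "nat \<Rightarrow> nat \<Rightarrow> nat \<Rightarrow> nat" where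
  "num_particles p q t = (if t \<le> p then t else if t \<le> q then p else p + q - t)"

definition nth_largest :: "real set \<Rightarrow> nat \<Rightarrow> real" where
  "nth_largest A k = rev (sorted_list_of_set A) ! (k - 1)"

definition chi :: "real set \<Rightarrow> real set \<Rightarrow> real" where
  "chi y z = (if finite y \<and> finite z \<and> card z = card y + 1 \<and>
      (\<forall>k \<in> {1..card y}. nth_largest z (k + 1) < nth_largest y k \<and>
                          nth_largest y k < nth_largest z k)
    then 1 else 0)"

text \<open>
  The pair \<open>(t, i)\<close> labels the \<open>i\<close>-th largest particle on line \<open>t\<close>; a configuration \<open>x\<close> assigns
  a position in \<open>(0,1)\<close> to every label.
\<close>

definition particle_labels :: "nat \<Rightarrow> nat \<Rightarrow> (nat \<times> nat) set" where
  "particle_labels p q = (SIGMA t:{1..p + q - 1}. {1..num_particles p q t})"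

definition line_positions :: "nat \<Rightarrow> nat \<Rightarrow> (nat \<times> nat \<Rightarrow> real) \<Rightarrow> nat \<Rightarrow> real set" where
  "line_positions p q x t = (\<lambda>i. x (t, i)) ` {1..num_particles p q t}"

text \<open>
  The unnormalised density.  Since \<open>num_particles p q (p + q) = 0\<close>, the last factor sees
  the empty line \<open>t = p + q\<close>.
\<close>

definition bead_weight :: "nat \<Rightarrow> nat \<Rightarrow> (nat \<times> nat \<Rightarrow> real) \<Rightarrow> real" where
  "bead_weight p q x =
    (if \<forall>t \<in> {1..p + q - 1}. \<forall>i \<in> {1..num_particles p q t}. \<forall>j \<in> {1..num_particles p q t}.
          i < j \<longrightarrow> x (t, j) < x (t, i)
     then
      (\<Prod>t = 1..p - 1. chi (line_positions p q x t) (line_positions p q x (t + 1))) *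
      (\<Prod>t = p..<q. chi (line_positions p q x t) (line_positions p q x (t + 1) \<union> {0})) *
      (\<Prod>t = q..p + q - 1. chi (line_positions p q x t) (line_positions p q x (t + 1) \<union> {0, 1}))
     else 0)"

definition unit_lebesgue :: "real measure" where
  "unit_lebesgue = restrict_space lborel {0<..<1}"

definition bead_base :: "nat \<Rightarrow> nat \<Rightarrow> (nat \<times> nat \<Rightarrow> real) measure" where
  "bead_base p q = Pi\<^sub>M (particle_labels p q) (\<lambda>_. unit_lebesgue)"

definition bead_process :: "nat \<Rightarrow> nat \<Rightarrow> (nat \<times> nat \<Rightarrow> real) measure" where
  "bead_process p q = density (bead_base p q)
     (\<lambda>x. ennreal (bead_weight p q x) / (\<integral>\<^sup>+ x'. ennreal (bead_weight p q x') \<partial>bead_base p q))"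

definition bead_points :: "nat \<Rightarrow> nat \<Rightarrow> (nat \<times> nat \<Rightarrow> real) \<Rightarrow> (nat \<times> real) set" where
  "bead_points p q x = (SIGMA t:{1..p + q - 1}. line_positions p q x t)"

definition bead_reference :: "nat \<Rightarrow> nat \<Rightarrow> (nat \<times> real) measure" where
  "bead_reference p q = count_space {1..p + q - 1} \<Otimes>\<^sub>M unit_lebesgue"

section \<open>Jacobi polynomials on the unit interval\<close>

text \<open>Rodrigues formula; it is used for \<open>x\<close> in the open unit interval only.\<close>

definition jacobi01 :: "nat \<Rightarrow> nat \<Rightarrow> int \<Rightarrow> real \<Rightarrow> real" where
  "jacobi01 a b n x =
    (if n < 0 then 0
     else 1 / fact (nat n) * (1 / (x ^ a * (1 - x) ^ b)) *
          (deriv ^^ nat n) (\<lambda>u. u ^ (nat n + a) * (1 - u) ^ (nat n + b)) x)"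

definition jacobi01_norm :: "nat \<Rightarrow> nat \<Rightarrow> int \<Rightarrow> real" where
  "jacobi01_norm a b n =
     (LINT x:{0<..<1}|lborel. x ^ a * (1 - x) ^ b * (jacobi01 a b n x)\<^sup>2)"

section \<open>The kernel\<close>

definition a_fun :: "nat \<Rightarrow> nat \<Rightarrow> nat \<Rightarrow> real \<Rightarrow> real" where
  "a_fun p q s y =
    (if s \<le> p then (- y) ^ (p - s) * (1 - y) ^ (q - s)
     else if s \<le> q then (1 - y) ^ (q - s)
     else 1)"

definition b_fun :: "nat \<Rightarrow> nat \<Rightarrow> nat \<Rightarrow> real \<Rightarrow> real" where
  "b_fun p q t x =
    (if t \<le> p then (- 1) ^ (p - t)
     else if t \<le> q then x ^ (t - p)
     else x ^ (t - p) * (1 - x) ^ (t - q))"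

text \<open>
  The factorials occurring in the kernel all have nonnegative arguments,
  so that the truncation by \<open>nat\<close> has no effect there.
\<close>

definition C_coeff :: "nat \<Rightarrow> nat \<Rightarrow> nat \<Rightarrow> int \<Rightarrow> real" where
  "C_coeff p q t l =
    (if t \<le> p then fact (nat (int t - l)) / fact (nat (int p - l))
     else if t \<le> q then fact (nat (int q - l)) / fact (nat (int p + int q - int t - l))
     else fact (nat (int t - l)) / fact (nat (int p - l)))"

definition Q_fun :: "nat \<Rightarrow> nat \<Rightarrow> nat \<Rightarrow> int \<Rightarrow> real \<Rightarrow> real" where
  "Q_fun p q t l x =
    (if t \<le> p then jacobi01 (p - t) (q - t) (int t - l) x
     else if t \<le> q then jacobi01 (t - p) (q - t) (int p - l) x
     else jacobi01 (t - p) (t - q) (int p + int q - int t - l) x)"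

definition N_norm :: "nat \<Rightarrow> nat \<Rightarrow> nat \<Rightarrow> int \<Rightarrow> real" where
  "N_norm p q t l =
    (if t \<le> p then jacobi01_norm (p - t) (q - t) (int t - l)
     else if t \<le> q then jacobi01_norm (t - p) (q - t) (int p - l)
     else jacobi01_norm (t - p) (t - q) (int p + int q - int t - l))"

definition kernel_term :: "nat \<Rightarrow> nat \<Rightarrow> nat \<Rightarrow> real \<Rightarrow> nat \<Rightarrow> real \<Rightarrow> int \<Rightarrow> real" where
  "kernel_term p q s y t x l =
     C_coeff p q s l / C_coeff p q t l * (Q_fun p q s l y * Q_fun p q t l x / N_norm p q t l)"

text \<open>
  The sum over \<open>l \<le> 0\<close> is the limit of the sums over \<open>-m \<le> l \<le> 0\<close>; for \<open>t = s + 1\<close> it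
  converges only conditionally.
\<close>

definition bead_kernel :: "nat \<Rightarrow> nat \<Rightarrow> nat \<Rightarrow> real \<Rightarrow> nat \<Rightarrow> real \<Rightarrow> real" where
  "bead_kernel p q s y t x =
    (if t \<le> s
     then a_fun p q s y * b_fun p q t x *
          (\<Sum>l = 1..int (Min {p + q - s, t, p}). kernel_term p q s y t x l)
     else - a_fun p q s y * b_fun p q t x *
          (\<Sum>m. kernel_term p q s y t x (- int m)))"

end

theory Submission
  imports Defs
begin

text \<open>
  Write \<open>\<phi>\<close> for the propagator \<open>(x - y)\<^sub>+ ^ (t - s - 1) / (t - s - 1)!\<close> and
  \<open>K = - \<phi> + \<Sum> \<phi>(\<cdot>, (p + q - i, 1)) (G\<^sup>-\<^sup>1)\<^sub>i\<^sub>j \<phi>((j, 0), \<cdot>)\<close>, where \<open>G\<close> is the Gram matrix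
  of propagators from the auxiliary particles \<open>(j, 0)\<close>, \<open>j < p\<close>, to the auxiliary particles
  \<open>(p + q - i, 1)\<close>, \<open>i < p\<close>.  By the Schur complement, \<open>det K\<close> at \<open>p q\<close> points is up to a constant the
  determinant of a matrix bordered by the auxiliary particles.  That matrix is block structured
  along the lines; its determinant vanishes unless there are \<open>r(t)\<close> points on each line \<open>t\<close>, and otherwise is, up to sign,
  the indicator of interlacing.  The composition of \<open>K\<close> with itself is \<open>(s - t + 1) K\<close>; the terms \<open>s - t\<close> cancel along cycles, so
  integrating one variable out of an \<open>(n + 1)\<close>-point determinant gives \<open>(p q - n)\<close> times the \<open>n\<close>-point
  determinant, and all correlation functions are determinants of \<open>K\<close>.

  The Gram matrix is inverted by Jacobi polynomials, since suitable multiples of them are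
  successive derivatives of each other as one moves from line to line.  This yields the finite sum for
  \<open>s \<ge> t\<close>.  For \<open>s < t\<close>, raising \<open>p\<close>, \<open>q\<close> and all line numbers by \<open>M\<close> adds the terms
  \<open>- M < l \<le> 0\<close> to \<open>K\<close>, so \<open>- K\<close> has the same Jacobi coefficients as the infinite series.  The series is orthogonal
  with coefficients small enough to converge almost everywhere, and its sum is \<open>- K\<close> by completeness of
  the polynomials.
\<close>

section \<open>Propagators\<close>

text \<open>The propagator is the \<open>(t - s)\<close>-fold convolution of the step function
  \<open>y < x\<close>: the volume of increasing chains from \<open>y\<close> to \<open>x\<close>
  with one point on each line in between. Hence its semigroup law, and on neighbouring lines it is
  the step function, whose determinants detect interlacing. Auxiliary particles make the blocks of
  step functions square: 0 as an extra row while lines grow, 1 as an extra column while they shrink.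
  The 0 that \<open>chi\<close> adjoins imposes nothing on positions in the open interval. The
  normalisation is never computed. The top determinant is a constant multiple of the weight; the
  determinant of no points is 1, which forces that constant to be the reciprocal of the total mass,
  so it is positive. The difficulty of the infinite series is convergence without pointwise bounds
  on Jacobi polynomials. The squared norms of its terms in \<open>y\<close> are at most of order
  \<open>1 / m^2\<close> times a function of \<open>x\<close> with integral 1, up to a factor
  depending on \<open>x\<close> alone. This yields convergence for almost all \<open>x\<close> and
  then almost all \<open>y\<close>. Diagonal pairs form a null set and need a separate argument:
  there the sum is finite and the identity exact.\<close>

definition propagator :: "nat \<times> real \<Rightarrow> nat \<times> real \<Rightarrow> real" where
  "propagator z w =
    (if fst z < fst w \<and> snd z < snd w
     then (snd w - snd z) ^ (fst w - fst z - 1) / fact (fst w - fst z - 1) else 0)"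

lemma space_unit_lebesgue [simp]: "space unit_lebesgue = {0<..<1}"
  by (simp add: unit_lebesgue_def space_restrict_space)

lemma prob_space_unit_lebesgue: "prob_space unit_lebesgue"
  by (rule prob_spaceI)
     (simp add: unit_lebesgue_def emeasure_restrict_space space_restrict_space)

lemma measurable_unit_lebesgueI:
  "f \<in> borel_measurable borel \<Longrightarrow> f \<in> borel_measurable unit_lebesgue"
  unfolding unit_lebesgue_def by (intro measurable_restrict_space1) simp

lemma measurable_unit_lebesgue_ident: "(\<lambda>x. x) \<in> unit_lebesgue \<rightarrow>\<^sub>M borel"
  by (rule measurable_unit_lebesgueI) simp

lemma integral_unit_lebesgue:
  fixes f :: "real \<Rightarrow> real"
  shows "(\<integral>x. f x \<partial>unit_lebesgue) = (\<integral>x. f x * indicator {0..1} x \<partial>lborel)"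
proof -
  have "(\<integral>x. f x \<partial>unit_lebesgue) = (\<integral>x. indicator {0<..<1} x *\<^sub>R f x \<partial>lborel)"
    unfolding unit_lebesgue_def by (subst integral_restrict_space) simp_all
  also have "\<dots> = (\<integral>x. indicator {0..1} x *\<^sub>R f x \<partial>lborel)"
  proof (rule integral_discrete_difference[where X = "{0, 1}"])
    show "indicator {0<..<1} x *\<^sub>R f x = indicator {0..1} x *\<^sub>R f x" if "x \<notin> {0, 1}" for x
      using that by (auto split: split_indicator)
  qed auto
  finally show ?thesis by (simp add: mult.commute)
qed

lemma integral_unit_lebesgue_FTC:
  fixes f F :: "real \<Rightarrow> real"
  assumes "\<And>x. (F has_real_derivative f x) (at x)" and "\<And>x. isCont f x"
  shows "(\<integral>x. f x \<partial>unit_lebesgue) = F 1 - F 0"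
  unfolding integral_unit_lebesgue
  by (rule integral_FTC_Icc_real) (use assms in auto)

lemma integrable_unit_lebesgue_bounded:
  fixes f :: "real \<Rightarrow> real"
  assumes "f \<in> borel_measurable unit_lebesgue" "\<And>x. 0 < x \<Longrightarrow> x < 1 \<Longrightarrow> \<bar>f x\<bar> \<le> B"
  shows "integrable unit_lebesgue f"
proof -
  interpret prob_space unit_lebesgue by (rule prob_space_unit_lebesgue)
  show ?thesis
    by (rule integrable_const_bound[where B = B]) (use assms in auto)
qed

lemma integrable_unit_lebesgue_continuous:
  fixes f :: "real \<Rightarrow> real"
  assumes "\<And>x. isCont f x"
  shows "integrable unit_lebesgue f"
proof -
  have cont: "continuous_on {0..1} f" using assms by (simp add: continuous_at_imp_continuous_on)
  have "compact (f ` {0..1})" by (rule compact_continuous_image[OF cont]) simp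
  then obtain B where "\<And>y. y \<in> f ` {0..1} \<Longrightarrow> norm y \<le> B"
    by (meson bounded_iff compact_imp_bounded)
  moreover have "f \<in> borel_measurable borel"
    using assms by (intro borel_measurable_continuous_onI) (simp add: continuous_at_imp_continuous_on)
  ultimately show ?thesis
    by (intro integrable_unit_lebesgue_bounded[where B = B] measurable_unit_lebesgueI) auto
qed

lemma continuous_bounded_unit_interval:
  fixes f :: "real \<Rightarrow> real"
  assumes "continuous_on UNIV f"
  obtains C where "\<forall>x\<in>{0..1}. \<bar>f x\<bar> \<le> C"
proof -
  have "compact (f ` {0..1})" by (intro compact_continuous_image continuous_on_subset[OF assms]) auto
  from compact_imp_bounded[OF this] that show thesis by (auto simp: bounded_iff)
qed

lemma integrable_continuous_UNIV: "continuous_on UNIV f \<Longrightarrow> integrable unit_lebesgue f" for f :: "real \<Rightarrow> real"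
  by (rule integrable_unit_lebesgue_continuous) (simp add: continuous_on_eq_continuous_at)

lemma DERIV_divided_power_left:
  "((\<lambda>v::real. (v - y) ^ Suc n / fact (Suc n)) has_real_derivative (v - y) ^ n / fact n) (at v)"
proof -
  have "((\<lambda>v::real. (v - y) ^ Suc n / fact (Suc n)) has_real_derivative
     (real (Suc n) * (v - y) ^ n) / fact (Suc n)) (at v)"
    by (intro DERIV_cdivide DERIV_power_Suc[THEN DERIV_cong, of _ 1]) (auto intro!: derivative_eq_intros)
  then show ?thesis by (simp add: fact_Suc del: of_nat_Suc)
qed

lemma DERIV_divided_power_right:
  "((\<lambda>v::real. (x - v) ^ Suc n / fact (Suc n)) has_real_derivative - ((x - v) ^ n / fact n)) (at v)"
proof -
  have "((\<lambda>v::real. (x - v) ^ Suc n / fact (Suc n)) has_real_derivative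
     (- (real (Suc n) * (x - v) ^ n)) / fact (Suc n)) (at v)"
    by (intro DERIV_cdivide DERIV_power_Suc[THEN DERIV_cong, of _ "- 1"]) (auto intro!: derivative_eq_intros simp: algebra_simps)
  then show ?thesis by (simp add: fact_Suc del: of_nat_Suc)
qed

text \<open>The antiderivative telescopes under differentiation.\<close>

lemma beta_integral_interval:
  fixes x y :: real
  assumes "y \<le> x"
  shows "(\<integral>v. ((v - y) ^ a / fact a * ((x - v) ^ b / fact b)) * indicator {y..x} v \<partial>lborel)
    = (x - y) ^ (a + b + 1) / fact (a + b + 1)"
proof -
  define F where "F = (\<lambda>v. \<Sum>c\<le>b. (v - y) ^ (a + 1 + c) / fact (a + 1 + c) * ((x - v) ^ (b - c) / fact (b - c)))"
  \<comment> \<open>The cutoff makes \<open>g v (Suc b)\<close> zero, so the differences telescope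
    to the integrand \<open>g v 0\<close> alone.\<close>
  define g where "g = (\<lambda>v c. (v - y) ^ (a + c) / fact (a + c) *
     (if c \<le> b then (x - v) ^ (b - c) / fact (b - c) else 0))"
  have d: "((\<lambda>v. (v - y) ^ (a + 1 + c) / fact (a + 1 + c) * ((x - v) ^ (b - c) / fact (b - c)))
     has_real_derivative (g v c - g v (Suc c))) (at v)" if "c \<le> b" for c v
  proof (cases "c = b")
    case True
    show ?thesis unfolding True g_def
      using DERIV_divided_power_left[of y "a + b" v] by simp
  next
    case False
    define e where "e = b - Suc c"
    then have e: "b - c = Suc e" "b - Suc c = e" using that False by auto
    have g: "g v c - g v (Suc c) = (v - y) ^ (a + c) / fact (a + c) * ((x - v) ^ Suc e / fact (Suc e))
       + - ((x - v) ^ e / fact e) * ((v - y) ^ Suc (a + c) / fact (Suc (a + c)))"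
    proof -
      have "g v c = (v - y) ^ (a + c) / fact (a + c) * ((x - v) ^ Suc e / fact (Suc e))"
        using that by (simp only: g_def e if_True)
      moreover have "g v (Suc c) = (v - y) ^ Suc (a + c) / fact (Suc (a + c)) * ((x - v) ^ e / fact e)"
        using that False by (simp only: g_def e if_True add_Suc_right Suc_leI le_neq_implies_less)
      ultimately show ?thesis by (simp only: mult_minus_left diff_conv_add_uminus mult.commute)
    qed
    have "a + 1 + c = Suc (a + c)" by simp
    then show ?thesis unfolding e g
      by (simp only: DERIV_mult[OF DERIV_divided_power_left DERIV_divided_power_right])
  qed
  have dF: "(F has_real_derivative (v - y) ^ a / fact a * ((x - v) ^ b / fact b)) (at v)" for v
  proof -
    have "(F has_real_derivative (\<Sum>c\<le>b. g v c - g v (Suc c))) (at v)"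
      unfolding F_def by (rule DERIV_sum) (use d in auto)
    also have "(\<Sum>c\<le>b. g v c - g v (Suc c)) = g v 0 - g v (Suc b)"
      by (rule sum_telescope)
    finally show ?thesis by (simp add: g_def mult.commute)
  qed
  have "(\<integral>v. ((v - y) ^ a / fact a * ((x - v) ^ b / fact b)) * indicator {y..x} v \<partial>lborel) = F x - F y"
    by (rule integral_FTC_Icc_real[OF assms dF]) (auto intro!: continuous_intros)
  also have "F y = 0" by (simp add: F_def)
  also have "F x = (\<Sum>c\<le>b. if c = b then (x - y) ^ (a + b + 1) / fact (a + b + 1) else 0)"
    unfolding F_def by (intro sum.cong) auto
  finally show ?thesis by simp
qed

text \<open>Semigroup law of convolution powers, through the Beta integral. The bounds on
  \<open>y\<close> and \<open>x\<close> keep \<open>{y..x}\<close> inside the unit interval, so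
  nothing is cut off.\<close>

lemma propagator_convolution:
  assumes "0 \<le> y" "x \<le> 1"
  shows "(\<integral>v. propagator (s, y) (t, v) * propagator (t, v) (u, x) \<partial>unit_lebesgue)
    = (if s < t \<and> t < u then propagator (s, y) (u, x) else 0)"
proof (cases "s < t \<and> t < u \<and> y < x")
  case False
  then have "(\<lambda>v. propagator (s, y) (t, v) * propagator (t, v) (u, x)) = (\<lambda>v. 0)"
    by (auto simp: propagator_def)
  with False show ?thesis by (auto simp: propagator_def)
next
  case True
  have e: "u - Suc s = t - s - 1 + (u - t - 1) + 1" using True by auto
  have "(\<integral>v. propagator (s, y) (t, v) * propagator (t, v) (u, x) \<partial>unit_lebesgue) =
    (\<integral>v. ((v - y) ^ (t - s - 1) / fact (t - s - 1) * ((x - v) ^ (u - t - 1) / fact (u - t - 1))) * indicator {y..x} v \<partial>lborel)"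
    unfolding integral_unit_lebesgue
  proof (rule integral_discrete_difference[where X = "{x, y}"])
    fix v assume "v \<notin> {x, y}"
    then show "propagator (s, y) (t, v) * propagator (t, v) (u, x) * indicator {0..1} v =
       ((v - y) ^ (t - s - 1) / fact (t - s - 1) * ((x - v) ^ (u - t - 1) / fact (u - t - 1))) * indicator {y..x} v"
      using True assms by (auto simp: propagator_def split: split_indicator)
  qed auto
  also have "\<dots> = (x - y) ^ (u - s - 1) / fact (u - s - 1)"
    using True e by (subst beta_integral_interval) (simp_all del: fact_Suc)
  finally show ?thesis using True by (simp add: propagator_def)
qed

lemma propagator_nonneg: "0 \<le> propagator z w"
  by (simp add: propagator_def)

lemma propagator_le_1:
  assumes "0 \<le> snd z" "snd w \<le> 1"
  shows "propagator z w \<le> 1"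
proof -
  have *: "(snd w - snd z) ^ n \<le> 1" if "snd z < snd w" for n
    using assms that by (intro power_le_one) auto
  have "(snd w - snd z) ^ n \<le> fact n" if "snd z < snd w" for n
    by (rule order_trans[OF *[OF that] fact_ge_1])
  then show ?thesis
    by (simp add: propagator_def divide_le_eq_1)
qed

lemma abs_propagator_le_1:
  "0 \<le> snd z \<Longrightarrow> snd w \<le> 1 \<Longrightarrow> \<bar>propagator z w\<bar> \<le> 1"
  using propagator_le_1 propagator_nonneg by simp

lemma measurable_propagator [measurable (raw)]:
  assumes "(\<lambda>x. fst (f x)) \<in> M \<rightarrow>\<^sub>M count_space UNIV" "(\<lambda>x. snd (f x)) \<in> borel_measurable M"
    and "(\<lambda>x. fst (g x)) \<in> M \<rightarrow>\<^sub>M count_space UNIV" "(\<lambda>x. snd (g x)) \<in> borel_measurable M"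
  shows "(\<lambda>x. propagator (f x) (g x)) \<in> borel_measurable M"
proof -
  have *: "(\<lambda>x. propagator (s, snd (f x)) (t, snd (g x))) \<in> borel_measurable M" for s t
    unfolding propagator_def fst_conv snd_conv using assms(2,4) by measurable
  have "(\<lambda>x. propagator (fst (f x), snd (f x)) (t, snd (g x))) \<in> borel_measurable M" for t
    by (rule measurable_compose_countable[OF * assms(1)])
  from measurable_compose_countable[OF this assms(3), of "\<lambda>t. t"] show ?thesis by simp
qed

lemma space_bead_reference: "space (bead_reference p q) = {1..p + q - 1} \<times> {0<..<1}"
  by (simp add: bead_reference_def space_pair_measure)

lemma finite_measure_bead_reference: "finite_measure (bead_reference p q)"
proof -
  interpret U: prob_space unit_lebesgue by (rule prob_space_unit_lebesgue)
  interpret C: finite_measure "count_space {1..p + q - 1}"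
    by (rule finite_measure_count_space) simp
  show ?thesis unfolding bead_reference_def
    by (rule finite_measure_pair_measure) unfold_locales
qed

lemma bead_reference_measurable_fst: "fst \<in> bead_reference p q \<rightarrow>\<^sub>M count_space UNIV"
  unfolding bead_reference_def
  by (rule measurable_compose[OF measurable_fst]) simp

lemma bead_reference_measurable_snd: "snd \<in> borel_measurable (bead_reference p q)"
  unfolding bead_reference_def
  by (rule measurable_compose[OF measurable_snd measurable_unit_lebesgue_ident])

lemma measurable_bead_referenceD:
  assumes "f \<in> M \<rightarrow>\<^sub>M bead_reference p q"
  shows "(\<lambda>x. fst (f x)) \<in> M \<rightarrow>\<^sub>M count_space UNIV" "(\<lambda>x. snd (f x)) \<in> borel_measurable M"
  using measurable_compose[OF assms bead_reference_measurable_fst]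
    measurable_compose[OF assms bead_reference_measurable_snd] by auto

lemma integrable_bead_reference_bounded:
  fixes f :: "nat \<times> real \<Rightarrow> real"
  assumes "f \<in> borel_measurable (bead_reference p q)"
    "\<And>z. z \<in> space (bead_reference p q) \<Longrightarrow> \<bar>f z\<bar> \<le> B"
  shows "integrable (bead_reference p q) f"
proof -
  interpret finite_measure "bead_reference p q" by (rule finite_measure_bead_reference)
  show ?thesis
    by (rule integrable_const_bound[where B = B]) (use assms in auto)
qed

lemma integral_bead_reference:
  fixes f :: "nat \<times> real \<Rightarrow> real"
  assumes "integrable (bead_reference p q) f"
  shows "(\<integral>z. f z \<partial>bead_reference p q) = (\<Sum>t = 1..p + q - 1. \<integral>v. f (t, v) \<partial>unit_lebesgue)"
proof -
  interpret U: prob_space unit_lebesgue by (rule prob_space_unit_lebesgue)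
  interpret C: finite_measure "count_space {1..p + q - 1}"
    by (rule finite_measure_count_space) simp
  interpret P: pair_sigma_finite "count_space {1..p + q - 1}" unit_lebesgue ..
  have "(\<integral>z. f z \<partial>bead_reference p q) = (\<integral>t. (\<integral>v. f (t, v) \<partial>unit_lebesgue) \<partial>count_space {1..p + q - 1})"
    using P.integral_fst'[of f] assms unfolding bead_reference_def by simp
  also have "\<dots> = (\<Sum>t = 1..p + q - 1. \<integral>v. f (t, v) \<partial>unit_lebesgue)"
    by (rule lebesgue_integral_count_space_finite) simp
  finally show ?thesis .
qed

lemma integrable_propagator_product:
  assumes "0 \<le> snd a" "snd b \<le> 1"
  shows "integrable (bead_reference p q) (\<lambda>v. propagator a v * propagator v b)"
proof (rule integrable_bead_reference_bounded[where B = 1])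
  show "(\<lambda>v. propagator a v * propagator v b) \<in> borel_measurable (bead_reference p q)"
    by (intro borel_measurable_times measurable_propagator)
       (auto intro: bead_reference_measurable_fst bead_reference_measurable_snd)
  show "\<bar>propagator a v * propagator v b\<bar> \<le> 1" if "v \<in> space (bead_reference p q)" for v
    unfolding abs_mult using that assms
    by (intro mult_le_one abs_propagator_le_1) (auto simp: space_bead_reference)
qed

text \<open>Each line strictly between contributes one copy of the propagator. With real subtraction
  the count may be negative, but then the propagator is zero. The bound on \<open>fst b\<close>
  ensures that all lines in between belong to the process.\<close>

lemma propagator_convolution_reference:
  assumes "0 \<le> snd a" "snd b \<le> 1" "fst b \<le> p + q"
  shows "(\<integral>v. propagator a v * propagator v b \<partial>bead_reference p q)
    = (real (fst b) - real (fst a) - 1) * propagator a b"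
proof -
  obtain s y where a: "a = (s, y)" by fastforce
  obtain u x where b: "b = (u, x)" by fastforce
  have "(\<integral>v. propagator a v * propagator v b \<partial>bead_reference p q) =
    (\<Sum>t = 1..p + q - 1. \<integral>v. propagator a (t, v) * propagator (t, v) b \<partial>unit_lebesgue)"
    by (rule integral_bead_reference[OF integrable_propagator_product[OF assms(1,2)]])
  also have "\<dots> = (\<Sum>t = 1..p + q - 1. if s < t \<and> t < u then propagator a b else 0)"
    using assms unfolding a b snd_conv by (intro sum.cong refl propagator_convolution) auto
  also have "\<dots> = (\<Sum>t\<in>{s<..<u}. propagator a b)"
    using assms(3) unfolding b fst_conv by (intro sum.mono_neutral_cong_right) auto
  also have "\<dots> = real (u - s - 1) * propagator a b" by simp
  also have "\<dots> = (real u - real s - 1) * propagator a b"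
  proof (cases "s < u")
    case False
    then show ?thesis by (simp add: propagator_def a b)
  qed (simp add: of_nat_diff)
  finally show ?thesis by (simp add: a b)
qed

section \<open>The correlation kernel\<close>

lemma sum_lessThan_add:
  fixes f :: "nat \<Rightarrow> 'a::comm_monoid_add"
  shows "(\<Sum>a<n + m. f a) = (\<Sum>a<n. f a) + (\<Sum>j<m. f (n + j))"
  by (induction m) (simp_all add: add.assoc)

lemma det_mat_Leibniz:
  fixes f :: "nat \<Rightarrow> nat \<Rightarrow> real"
  shows "Determinant.det (Matrix.mat n n (\<lambda>(i, j). f i j)) =
    (\<Sum>\<pi> | \<pi> permutes {..<n}. of_int (sign \<pi>) * (\<Prod>i<n. f i (\<pi> i)))"
proof -
  have "\<pi> i < n" if "\<pi> permutes {..<n}" "i < n" for \<pi> i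
    using permutes_in_image[OF that(1), of i] that(2) by simp
  then show ?thesis
    by (subst det_def'[where n = n]) (auto simp: atLeast0LessThan intro!: sum.cong prod.cong)
qed

definition bead_gram :: "nat \<Rightarrow> nat \<Rightarrow> nat \<Rightarrow> nat \<Rightarrow> real" where
  "bead_gram p q j i = propagator (j, 0) (p + q - i, 1)"

text \<open>The determinantal structure uses \<open>T\<close> only as a two-sided inverse; its
  Jacobi form enters later through \<open>inv_gram\<close>. The first index of \<open>T\<close>
  belongs to the endpoints \<open>(p + q - i, 1)\<close>, the second to the starting points
  \<open>(j, 0)\<close>.\<close>

locale gram_inverse =
  fixes p q :: nat and T :: "nat \<Rightarrow> nat \<Rightarrow> real"
  assumes p_pos: "1 \<le> p" and p_le_q: "p \<le> q"
    and T_gram: "\<And>i l. i < p \<Longrightarrow> l < p \<Longrightarrow>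
      (\<Sum>j<p. T i j * bead_gram p q j l) = (if i = l then 1 else 0)"
    and gram_T: "\<And>j l. j < p \<Longrightarrow> l < p \<Longrightarrow>
      (\<Sum>i<p. bead_gram p q j i * T i l) = (if j = l then 1 else 0)"
begin

abbreviation "ref \<equiv> bead_reference p q"
abbreviation "gram \<equiv> bead_gram p q"

definition corr_kernel :: "nat \<times> real \<Rightarrow> nat \<times> real \<Rightarrow> real" where
  "corr_kernel z w = - propagator z w +
     (\<Sum>i<p. \<Sum>j<p. T i j * (propagator z (p + q - i, 1) * propagator (j, 0) w))"

text \<open>The weight is a function of \<open>k\<close> minus a function of \<open>j\<close>; in
  each part one of the two copies of \<open>T\<close> cancels against \<open>gram\<close>.\<close>

lemma T_gram_T_weighted:
  fixes c :: real
  assumes "i < p" "l < p"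
  shows "(\<Sum>j<p. \<Sum>k<p. T i j * ((c - real k - real j) * gram j k) * T k l)
    = (c - real i - real l) * T i l"
proof -
  have "(\<Sum>j<p. \<Sum>k<p. T i j * ((c - real k - real j) * gram j k) * T k l) =
    (\<Sum>j<p. \<Sum>k<p. (c - real k) * T k l * (T i j * gram j k)) -
    (\<Sum>j<p. \<Sum>k<p. real j * T i j * (gram j k * T k l))"
    by (simp add: sum_subtractf[symmetric] algebra_simps)
  also have "(\<Sum>j<p. \<Sum>k<p. (c - real k) * T k l * (T i j * gram j k)) =
    (\<Sum>k<p. (c - real k) * T k l * (\<Sum>j<p. T i j * gram j k))"
    by (subst sum.swap) (simp add: sum_distrib_left)
  also have "\<dots> = (\<Sum>k<p. if i = k then (c - real k) * T k l else 0)"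
    using assms by (intro sum.cong) (auto simp: T_gram)
  also have "\<dots> = (c - real i) * T i l" using assms by simp
  also have "(\<Sum>j<p. \<Sum>k<p. real j * T i j * (gram j k * T k l)) =
    (\<Sum>j<p. real j * T i j * (\<Sum>k<p. gram j k * T k l))"
    by (simp add: sum_distrib_left)
  also have "\<dots> = (\<Sum>j<p. if j = l then real j * T i j else 0)"
    using assms by (intro sum.cong) (auto simp: gram_T)
  also have "\<dots> = real l * T i l" using assms by simp
  finally show ?thesis by (simp add: algebra_simps)
qed

lemma has_bochner_integral_propagator:
  assumes "0 \<le> snd a" "snd b \<le> 1" "fst b \<le> p + q"
  shows "has_bochner_integral ref (\<lambda>v. propagator a v * propagator v b)
    ((real (fst b) - real (fst a) - 1) * propagator a b)"
  using integrable_propagator_product[OF assms(1,2)] propagator_convolution_reference[OF assms]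
  by (simp add: has_bochner_integral_iff)

lemma has_bochner_integral_gram:
  assumes "k < p"
  shows "has_bochner_integral ref (\<lambda>v. propagator (j, 0) v * propagator v (p + q - k, 1))
    ((real p + real q - 1 - real k - real j) * gram j k)"
  using has_bochner_integral_propagator[of "(j, 0)" "(p + q - k, 1)"] assms
  by (simp add: bead_gram_def of_nat_diff algebra_simps)

text \<open>Convolution counts lines, so the four products carry the factors
  \<open>u - s - 1\<close>, \<open>p + q - k - s - 1\<close>, \<open>u - j - 1\<close> and
  \<open>p + q - 1 - k - j\<close>. In the coefficient of \<open>T i j\<close> they combine to
  \<open>- (p + q - i - s - 1) - (u - j - 1) + (p + q - 1 - i - j) = s - u + 1\<close>, which is
  also minus the first factor.\<close>

lemma corr_kernel_composition:
  assumes z: "z \<in> space ref" and w: "w \<in> space ref"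
  shows "has_bochner_integral ref (\<lambda>v. corr_kernel z v * corr_kernel v w)
    ((real (fst z) - real (fst w) + 1) * corr_kernel z w)"
proof -
  define s u where "s = real (fst z)" and "u = real (fst w)"
  have zz: "0 \<le> snd z" "snd w \<le> 1" "fst w \<le> p + q"
    using z w by (auto simp: space_bead_reference)
  let ?P = "\<lambda>i. propagator z (p + q - i, 1)" and ?F = "\<lambda>j. propagator (j, 0) w"
  have nat: "real (p + q - i) = real p + real q - real i" if "i < p" for i
    using that by (simp add: of_nat_diff)
  have 1: "has_bochner_integral ref (\<lambda>v. propagator z v * propagator v w)
     ((u - s - 1) * propagator z w)"
    using has_bochner_integral_propagator[OF zz] by (simp add: s_def u_def)
  have 2: "has_bochner_integral ref
      (\<lambda>v. \<Sum>k<p. \<Sum>l<p. T k l * ?F l * (propagator z v * propagator v (p + q - k, 1)))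
      (\<Sum>k<p. \<Sum>l<p. T k l * ?F l * ((real p + real q - real k - s - 1) * ?P k))"
  proof (intro has_bochner_integral_sum has_bochner_integral_mult_right)
    fix k assume "k \<in> {..<p}"
    then show "has_bochner_integral ref (\<lambda>v. propagator z v * propagator v (p + q - k, 1))
       ((real p + real q - real k - s - 1) * ?P k)"
      using has_bochner_integral_propagator[OF zz(1), of "(p + q - k, 1)"] by (simp add: s_def nat)
  qed
  have 3: "has_bochner_integral ref
      (\<lambda>v. \<Sum>i<p. \<Sum>j<p. T i j * ?P i * (propagator (j, 0) v * propagator v w))
      (\<Sum>i<p. \<Sum>j<p. T i j * ?P i * ((u - real j - 1) * ?F j))"
    using has_bochner_integral_propagator[OF _ zz(2,3), of "(j, 0)" for j]
    by (intro has_bochner_integral_sum has_bochner_integral_mult_right)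
       (simp add: u_def)
  have 4: "has_bochner_integral ref
      (\<lambda>v. \<Sum>i<p. \<Sum>l<p. \<Sum>j<p. \<Sum>k<p. ?P i * ?F l * T i j * T k l *
         (propagator (j, 0) v * propagator v (p + q - k, 1)))
      (\<Sum>i<p. \<Sum>l<p. \<Sum>j<p. \<Sum>k<p. ?P i * ?F l * T i j * T k l *
         ((real p + real q - 1 - real k - real j) * gram j k))"
    by (intro has_bochner_integral_sum has_bochner_integral_mult_right has_bochner_integral_gram) auto
  have "has_bochner_integral ref (\<lambda>v. corr_kernel z v * corr_kernel v w)
    ((u - s - 1) * propagator z w
     - (\<Sum>k<p. \<Sum>l<p. T k l * ?F l * ((real p + real q - real k - s - 1) * ?P k))
     - (\<Sum>i<p. \<Sum>j<p. T i j * ?P i * ((u - real j - 1) * ?F j))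
     + (\<Sum>i<p. \<Sum>l<p. \<Sum>j<p. \<Sum>k<p. ?P i * ?F l * T i j * T k l *
         ((real p + real q - 1 - real k - real j) * gram j k)))"
    (is "has_bochner_integral _ _ ?V")
  proof (rule has_bochner_integral_cong[THEN iffD1, OF refl _ refl
        has_bochner_integral_add[OF has_bochner_integral_diff[OF has_bochner_integral_diff[OF 1 2] 3] 4]])
    fix v
    have prod: "(\<Sum>i<p. \<Sum>j<p. T i j * (?P i * propagator (j, 0) v)) *
         (\<Sum>k<p. \<Sum>l<p. T k l * (propagator v (p + q - k, 1) * ?F l)) =
      (\<Sum>i<p. \<Sum>l<p. \<Sum>j<p. \<Sum>k<p. ?P i * ?F l * T i j * T k l *
         (propagator (j, 0) v * propagator v (p + q - k, 1)))"
    proof -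
      have "(\<Sum>i<p. \<Sum>j<p. T i j * (?P i * propagator (j, 0) v)) *
         (\<Sum>k<p. \<Sum>l<p. T k l * (propagator v (p + q - k, 1) * ?F l)) =
         (\<Sum>i<p. \<Sum>j<p. T i j * (?P i * propagator (j, 0) v)) *
         (\<Sum>l<p. \<Sum>k<p. T k l * (propagator v (p + q - k, 1) * ?F l))"
        by (subst (2) sum.swap) simp
      also have "\<dots> = (\<Sum>i<p. \<Sum>l<p. (\<Sum>j<p. T i j * (?P i * propagator (j, 0) v)) *
         (\<Sum>k<p. T k l * (propagator v (p + q - k, 1) * ?F l)))"
        by (rule sum_product)
      also have "\<dots> = (\<Sum>i<p. \<Sum>l<p. \<Sum>j<p. \<Sum>k<p. T i j * (?P i * propagator (j, 0) v) *
         (T k l * (propagator v (p + q - k, 1) * ?F l)))"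
        by (simp only: sum_product)
      finally show ?thesis by (simp add: mult_ac)
    qed
    have a: "(\<Sum>k<p. \<Sum>l<p. T k l * ?F l * (propagator z v * propagator v (p + q - k, 1))) =
      propagator z v * (\<Sum>k<p. \<Sum>l<p. T k l * (propagator v (p + q - k, 1) * ?F l))"
      by (simp add: sum_distrib_left mult_ac)
    have b: "(\<Sum>i<p. \<Sum>j<p. T i j * ?P i * (propagator (j, 0) v * propagator v w)) =
      propagator v w * (\<Sum>i<p. \<Sum>j<p. T i j * (?P i * propagator (j, 0) v))"
      by (simp add: sum_distrib_left mult_ac)
    show "propagator z v * propagator v w -
       (\<Sum>k<p. \<Sum>l<p. T k l * ?F l * (propagator z v * propagator v (p + q - k, 1))) -
       (\<Sum>i<p. \<Sum>j<p. T i j * ?P i * (propagator (j, 0) v * propagator v w)) +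
       (\<Sum>i<p. \<Sum>l<p. \<Sum>j<p. \<Sum>k<p. ?P i * ?F l * T i j * T k l *
         (propagator (j, 0) v * propagator v (p + q - k, 1))) =
       corr_kernel z v * corr_kernel v w"
      unfolding a b prod[symmetric] corr_kernel_def by (simp add: algebra_simps)
  qed
  also have "?V = (s - u + 1) * corr_kernel z w"
  proof -
    have "(\<Sum>i<p. \<Sum>l<p. \<Sum>j<p. \<Sum>k<p. ?P i * ?F l * T i j * T k l *
         ((real p + real q - 1 - real k - real j) * gram j k)) =
      (\<Sum>i<p. \<Sum>l<p. ?P i * ?F l * (\<Sum>j<p. \<Sum>k<p. T i j *
         ((real p + real q - 1 - real k - real j) * gram j k) * T k l))"
      by (simp add: sum_distrib_left mult_ac)
    also have "\<dots> = (\<Sum>i<p. \<Sum>l<p. ?P i * ?F l * ((real p + real q - 1 - real i - real l) * T i l))"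
      by (intro sum.cong refl) (simp add: T_gram_T_weighted)
    finally show ?thesis
      unfolding corr_kernel_def
      by (simp add: sum_subtractf[symmetric] sum.distrib[symmetric] sum_distrib_left algebra_simps)
  qed
  finally show ?thesis by (simp add: s_def u_def)
qed

text \<open>The propagator vanishes on the diagonal, and cancelling \<open>gram\<close> against
  \<open>T\<close> leaves the sum of \<open>p + q - 1 - 2 i\<close> over \<open>i < p\<close>, which
  is the number of particles.\<close>

lemma corr_kernel_trace: "has_bochner_integral ref (\<lambda>v. corr_kernel v v) (real (p * q))"
proof -
  have "has_bochner_integral ref
      (\<lambda>v. \<Sum>i<p. \<Sum>j<p. T i j * (propagator (j, 0) v * propagator v (p + q - i, 1)))
      (\<Sum>i<p. \<Sum>j<p. T i j * ((real p + real q - 1 - real i - real j) * gram j i))"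
    by (intro has_bochner_integral_sum has_bochner_integral_mult_right has_bochner_integral_gram) auto
  also have "(\<lambda>v. \<Sum>i<p. \<Sum>j<p. T i j * (propagator (j, 0) v * propagator v (p + q - i, 1))) =
      (\<lambda>v. corr_kernel v v)"
    by (simp add: corr_kernel_def propagator_def mult.commute)
  also have "(\<Sum>i<p. \<Sum>j<p. T i j * ((real p + real q - 1 - real i - real j) * gram j i)) =
    (\<Sum>i<p. \<Sum>j<p. (real p + real q - 1 - real i) * (T i j * gram j i)) -
    (\<Sum>i<p. \<Sum>j<p. real j * (gram j i * T i j))"
    by (simp add: sum_subtractf[symmetric] algebra_simps)
  also have "(\<Sum>i<p. \<Sum>j<p. real j * (gram j i * T i j)) = (\<Sum>j<p. real j * (\<Sum>i<p. gram j i * T i j))"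
    by (subst sum.swap) (simp add: sum_distrib_left)
  also have "(\<Sum>i<p. \<Sum>j<p. (real p + real q - 1 - real i) * (T i j * gram j i)) =
    (\<Sum>i<p. (real p + real q - 1 - real i) * (\<Sum>j<p. T i j * gram j i))"
    by (simp add: sum_distrib_left)
  also have "(\<Sum>i<p. (real p + real q - 1 - real i) * (\<Sum>j<p. T i j * gram j i)) -
      (\<Sum>j<p. real j * (\<Sum>i<p. gram j i * T i j)) = (\<Sum>i<p. real p + real q - 1 - real i) - (\<Sum>j<p. real j)"
    by (simp add: T_gram gram_T)
  also have "\<dots> = real (p * q)"
  proof -
    have "(\<Sum>j<n. real j) = real n * (real n - 1) / 2" for n
      by (induction n) (auto simp: field_simps)
    from this[of p] show ?thesis by (simp add: sum_subtractf sum.distrib algebra_simps)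
  qed
  finally show ?thesis .
qed

definition corr_det :: "nat \<Rightarrow> (nat \<Rightarrow> nat \<times> real) \<Rightarrow> real" where
  "corr_det n Y = (\<Sum>\<pi> | \<pi> permutes {..<n}. of_int (sign \<pi>) * (\<Prod>i<n. corr_kernel (Y i) (Y (\<pi> i))))"

lemma corr_det_eq_det:
  "corr_det n Y = Determinant.det (Matrix.mat n n (\<lambda>(i, j). corr_kernel (Y i) (Y j)))"
  by (simp add: corr_det_def det_mat_Leibniz)

text \<open>A permutation of \<open>n + 1\<close> points either fixes the new one or inserts it
  after some \<open>a\<close> into a cycle of a permutation of the old points, which reverses the
  sign. In the second case \<open>v\<close> occurs in just two factors, ready for
  composition.\<close>

lemma corr_det_Suc_upd:
  "corr_det (Suc n) (Y(n := v)) = corr_kernel v v * corr_det n Y -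
    (\<Sum>\<pi> | \<pi> permutes {..<n}. of_int (sign \<pi>) * (\<Sum>a<n.
       corr_kernel (Y a) v * corr_kernel v (Y (\<pi> a)) *
       (\<Prod>i\<in>{..<n} - {a}. corr_kernel (Y i) (Y (\<pi> i)))))"
proof -
  let ?Y = "Y(n := v)" and ?S = "{..<n}"
  define f where "f = (\<lambda>\<pi>. of_int (sign \<pi>) * (\<Prod>i<Suc n. corr_kernel (?Y i) (?Y (\<pi> i))))"
  have ins: "{..<Suc n} = insert n ?S" by auto
  have "corr_det (Suc n) ?Y = (\<Sum>b\<in>insert n ?S. \<Sum>\<pi> | \<pi> permutes ?S. f (Transposition.transpose n b \<circ> \<pi>))"
    unfolding corr_det_def f_def ins by (rule sum_over_permutations_insert) auto
  also have "\<dots> = (\<Sum>\<pi> | \<pi> permutes ?S. f \<pi>) +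
      (\<Sum>\<pi> | \<pi> permutes ?S. \<Sum>b\<in>?S. f (Transposition.transpose n b \<circ> \<pi>))"
    by (simp add: sum.swap[of _ ?S])
  also have "(\<Sum>\<pi> | \<pi> permutes ?S. f \<pi>) = corr_kernel v v * corr_det n Y"
    unfolding corr_det_def sum_distrib_left
  proof (intro sum.cong refl)
    fix \<pi> assume "\<pi> \<in> {\<pi>. \<pi> permutes ?S}"
    then have \<pi>: "\<pi> permutes ?S" by simp
    then have "\<pi> n = n" "\<And>i. i < n \<Longrightarrow> \<pi> i < n"
      using permutes_not_in[OF \<pi>, of n] permutes_in_image[OF \<pi>] by auto
    then have "(\<Prod>i<Suc n. corr_kernel (?Y i) (?Y (\<pi> i))) =
      (\<Prod>i<n. corr_kernel (Y i) (Y (\<pi> i))) * corr_kernel v v"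
      unfolding prod.lessThan_Suc by (intro arg_cong2[where f = "(*)"] prod.cong) (auto simp: less_imp_neq)
    then show "f \<pi> = corr_kernel v v * (of_int (sign \<pi>) * (\<Prod>i<n. corr_kernel (Y i) (Y (\<pi> i))))"
      by (simp add: f_def mult_ac)
  qed
  also have "(\<Sum>\<pi> | \<pi> permutes ?S. \<Sum>b\<in>?S. f (Transposition.transpose n b \<circ> \<pi>)) =
    (\<Sum>\<pi> | \<pi> permutes ?S. - (of_int (sign \<pi>) * (\<Sum>a<n.
       corr_kernel (Y a) v * corr_kernel v (Y (\<pi> a)) *
       (\<Prod>i\<in>?S - {a}. corr_kernel (Y i) (Y (\<pi> i))))))"
  proof (intro sum.cong refl)
    fix \<pi> assume "\<pi> \<in> {\<pi>. \<pi> permutes ?S}"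
    then have \<pi>: "\<pi> permutes ?S" by simp
    have \<pi>n: "\<pi> n = n" "\<And>i. i < n \<Longrightarrow> \<pi> i < n"
      using permutes_not_in[OF \<pi>, of n] permutes_in_image[OF \<pi>] by auto
    have inj: "\<pi> i = \<pi> j \<longleftrightarrow> i = j" for i j
      using permutes_inj[OF \<pi>] by (auto dest: injD)
    \<comment> \<open>With \<open>b = \<pi> a\<close> the transposition routes \<open>a\<close> to
      \<open>n\<close> and \<open>n\<close> to \<open>\<pi> a\<close>.\<close>
    have "(\<Sum>b\<in>?S. f (Transposition.transpose n b \<circ> \<pi>)) = (\<Sum>a\<in>?S. f (Transposition.transpose n (\<pi> a) \<circ> \<pi>))"
      using sum.permute[OF \<pi>, of "\<lambda>b. f (Transposition.transpose n b \<circ> \<pi>)"] by (simp add: o_def)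
    also have "\<dots> = (\<Sum>a\<in>?S. - (of_int (sign \<pi>) * (corr_kernel (Y a) v * corr_kernel v (Y (\<pi> a)) *
       (\<Prod>i\<in>?S - {a}. corr_kernel (Y i) (Y (\<pi> i))))))"
    proof (intro sum.cong refl)
      fix a assume a: "a \<in> ?S"
      then have "n \<noteq> \<pi> a" using \<pi>n by force
      moreover have perm: "permutation \<pi>" using \<pi> unfolding permutation_permutes by (intro exI[of _ ?S]) simp
      ultimately have sgn: "sign (Transposition.transpose n (\<pi> a) \<circ> \<pi>) = - sign \<pi>"
        by (simp add: sign_compose[OF permutation_swap_id perm] sign_swap_id)
      have "(\<Prod>i<Suc n. corr_kernel (?Y i) (?Y ((Transposition.transpose n (\<pi> a) \<circ> \<pi>) i))) =
        (\<Prod>i\<in>?S. corr_kernel (?Y i) (?Y ((Transposition.transpose n (\<pi> a) \<circ> \<pi>) i))) * corr_kernel v (Y (\<pi> a))"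
        using \<pi>n \<open>n \<noteq> \<pi> a\<close> by simp
      also have "(\<Prod>i\<in>?S. corr_kernel (?Y i) (?Y ((Transposition.transpose n (\<pi> a) \<circ> \<pi>) i))) =
        corr_kernel (?Y a) (?Y ((Transposition.transpose n (\<pi> a) \<circ> \<pi>) a)) *
        (\<Prod>i\<in>?S - {a}. corr_kernel (?Y i) (?Y ((Transposition.transpose n (\<pi> a) \<circ> \<pi>) i)))"
        using a by (intro prod.remove) auto
      also have "(\<Prod>i\<in>?S - {a}. corr_kernel (?Y i) (?Y ((Transposition.transpose n (\<pi> a) \<circ> \<pi>) i))) =
        (\<Prod>i\<in>?S - {a}. corr_kernel (Y i) (Y (\<pi> i)))"
      proof (intro prod.cong refl)
        fix i assume i: "i \<in> ?S - {a}"
        then have "\<pi> i \<noteq> n" "\<pi> i \<noteq> \<pi> a" using \<pi>n(2)[of i] inj by auto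
        with i show "corr_kernel (?Y i) (?Y ((Transposition.transpose n (\<pi> a) \<circ> \<pi>) i)) = corr_kernel (Y i) (Y (\<pi> i))"
          by (auto simp: transpose_apply_other)
      qed
      also have "corr_kernel (?Y a) (?Y ((Transposition.transpose n (\<pi> a) \<circ> \<pi>) a)) = corr_kernel (Y a) v"
        using a by simp
      finally show "f (Transposition.transpose n (\<pi> a) \<circ> \<pi>) = - (of_int (sign \<pi>) * (corr_kernel (Y a) v *
         corr_kernel v (Y (\<pi> a)) * (\<Prod>i\<in>?S - {a}. corr_kernel (Y i) (Y (\<pi> i)))))"
        unfolding f_def sgn by (simp add: mult_ac)
    qed
    finally show "(\<Sum>b\<in>?S. f (Transposition.transpose n b \<circ> \<pi>)) = - (of_int (sign \<pi>) * (\<Sum>a<n.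
       corr_kernel (Y a) v * corr_kernel v (Y (\<pi> a)) *
       (\<Prod>i\<in>?S - {a}. corr_kernel (Y i) (Y (\<pi> i)))))"
      by (simp add: sum_negf sum_distrib_left)
  qed
  finally show ?thesis by (simp only: sum_negf add_uminus_conv_diff)
qed

lemma corr_det_integrate_last:
  assumes Y: "\<And>i. i < n \<Longrightarrow> Y i \<in> space ref"
  shows "has_bochner_integral ref (\<lambda>v. corr_det (Suc n) (Y(n := v)))
    ((real (p * q) - real n) * corr_det n Y)"
proof -
  let ?c = "\<lambda>a b. real (fst (Y a)) - real (fst (Y b)) + 1"
  have "has_bochner_integral ref (\<lambda>v. corr_det (Suc n) (Y(n := v)))
    (real (p * q) * corr_det n Y -
     (\<Sum>\<pi> | \<pi> permutes {..<n}. of_int (sign \<pi>) * (\<Sum>a<n.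
       ?c a (\<pi> a) * corr_kernel (Y a) (Y (\<pi> a)) *
       (\<Prod>i\<in>{..<n} - {a}. corr_kernel (Y i) (Y (\<pi> i))))))"
    unfolding corr_det_Suc_upd
  proof (intro has_bochner_integral_diff has_bochner_integral_sum has_bochner_integral_mult_left
      has_bochner_integral_mult_right corr_kernel_trace corr_kernel_composition Y)
    fix \<pi> a assume "\<pi> \<in> {\<pi>. \<pi> permutes {..<n}}" "a \<in> {..<n}"
    then show "a < n" "\<pi> a < n"
      using permutes_in_image[of \<pi> "{..<n}" a] by auto
  qed
  also have "(\<Sum>\<pi> | \<pi> permutes {..<n}. of_int (sign \<pi>) * (\<Sum>a<n.
       ?c a (\<pi> a) * corr_kernel (Y a) (Y (\<pi> a)) *
       (\<Prod>i\<in>{..<n} - {a}. corr_kernel (Y i) (Y (\<pi> i))))) = real n * corr_det n Y"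
    unfolding corr_det_def sum_distrib_left[of "real n"]
  proof (intro sum.cong refl)
    fix \<pi> assume "\<pi> \<in> {\<pi>. \<pi> permutes {..<n}}"
    then have \<pi>: "\<pi> permutes {..<n}" by simp
    let ?P = "\<Prod>i<n. corr_kernel (Y i) (Y (\<pi> i))"
    have "(\<Sum>a<n. ?c a (\<pi> a) * corr_kernel (Y a) (Y (\<pi> a)) *
       (\<Prod>i\<in>{..<n} - {a}. corr_kernel (Y i) (Y (\<pi> i)))) = (\<Sum>a<n. ?c a (\<pi> a) * ?P)"
    proof (intro sum.cong refl)
      fix a assume "a \<in> {..<n}"
      then have "?P = corr_kernel (Y a) (Y (\<pi> a)) * (\<Prod>i\<in>{..<n} - {a}. corr_kernel (Y i) (Y (\<pi> i)))"
        by (intro prod.remove) auto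
      then show "?c a (\<pi> a) * corr_kernel (Y a) (Y (\<pi> a)) *
         (\<Prod>i\<in>{..<n} - {a}. corr_kernel (Y i) (Y (\<pi> i))) = ?c a (\<pi> a) * ?P"
        by simp
    qed
    also have "\<dots> = (\<Sum>a<n. ?c a (\<pi> a)) * ?P" by (simp add: sum_distrib_right)
    also have "(\<Sum>a<n. ?c a (\<pi> a)) = real n"
      using sum.permute[OF \<pi>, of "\<lambda>a. real (fst (Y a))"]
      by (simp add: sum.distrib sum_subtractf o_def)
    finally show "of_int (sign \<pi>) * (\<Sum>a<n. ?c a (\<pi> a) * corr_kernel (Y a) (Y (\<pi> a)) *
       (\<Prod>i\<in>{..<n} - {a}. corr_kernel (Y i) (Y (\<pi> i)))) = real n * (of_int (sign \<pi>) * ?P)"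
      by (simp add: mult_ac)
  qed
  finally show ?thesis by (simp only: left_diff_distrib)
qed

lemma corr_kernel_bounded:
  obtains B where "\<And>z w. z \<in> space ref \<Longrightarrow> w \<in> space ref \<Longrightarrow> \<bar>corr_kernel z w\<bar> \<le> B"
proof
  fix z w assume zw: "z \<in> space ref" "w \<in> space ref"
  have "\<bar>corr_kernel z w\<bar> \<le> \<bar>propagator z w\<bar> +
    (\<Sum>i<p. \<Sum>j<p. \<bar>T i j * (propagator z (p + q - i, 1) * propagator (j, 0) w)\<bar>)"
    unfolding corr_kernel_def
    by (rule order_trans[OF abs_triangle_ineq add_mono]) (auto intro!: order_trans[OF sum_abs] sum_mono)
  also have "\<dots> \<le> 1 + (\<Sum>i<p. \<Sum>j<p. \<bar>T i j\<bar> * (1 * 1))"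
    unfolding abs_mult using zw
    by (intro add_mono sum_mono mult_mono mult_left_mono abs_propagator_le_1)
       (auto simp: space_bead_reference)
  finally show "\<bar>corr_kernel z w\<bar> \<le> 1 + (\<Sum>i<p. \<Sum>j<p. \<bar>T i j\<bar> * (1 * 1))" .
qed

lemma measurable_corr_kernel:
  assumes "f \<in> M \<rightarrow>\<^sub>M ref" "g \<in> M \<rightarrow>\<^sub>M ref"
  shows "(\<lambda>x. corr_kernel (f x) (g x)) \<in> borel_measurable M"
  unfolding corr_kernel_def
  using measurable_bead_referenceD[OF assms(1)] measurable_bead_referenceD[OF assms(2)]
  by (intro borel_measurable_add borel_measurable_uminus borel_measurable_sum borel_measurable_times
      measurable_propagator) auto

lemma measurable_corr_det [measurable]:
  "corr_det n \<in> borel_measurable (Pi\<^sub>M {..<n} (\<lambda>_. ref))"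
proof -
  have "(\<lambda>Y. corr_kernel (Y i) (Y (\<pi> i))) \<in> borel_measurable (Pi\<^sub>M {..<n} (\<lambda>_. ref))"
    if "\<pi> permutes {..<n}" "i < n" for \<pi> i
    using that permutes_in_image[OF that(1), of i]
    by (intro measurable_corr_kernel measurable_component_singleton) auto
  then show ?thesis unfolding corr_det_def[abs_def]
    by (intro borel_measurable_sum borel_measurable_times borel_measurable_prod) auto
qed

lemma corr_det_bounded:
  obtains B where "\<And>Y. Y \<in> space (Pi\<^sub>M {..<n} (\<lambda>_. ref)) \<Longrightarrow> \<bar>corr_det n Y\<bar> \<le> B"
proof -
  obtain B where B: "\<And>z w. z \<in> space ref \<Longrightarrow> w \<in> space ref \<Longrightarrow> \<bar>corr_kernel z w\<bar> \<le> B"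
    by (rule corr_kernel_bounded) blast
  show thesis
  proof
    fix Y assume "Y \<in> space (Pi\<^sub>M {..<n} (\<lambda>_. ref))"
    then have Y: "Y i \<in> space ref" if "i < n" for i using that by (auto simp: space_PiM PiE_iff)
    have "\<bar>corr_det n Y\<bar> \<le> (\<Sum>\<pi> | \<pi> permutes {..<n}. \<bar>of_int (sign \<pi>) * (\<Prod>i<n. corr_kernel (Y i) (Y (\<pi> i)))\<bar>)"
      unfolding corr_det_def by (rule sum_abs)
    also have "\<dots> \<le> (\<Sum>\<pi> | \<pi> permutes {..<n}. (\<Prod>i<n. B))"
    proof (intro sum_mono)
      fix \<pi> assume "\<pi> \<in> {\<pi>. \<pi> permutes {..<n}}"
      then have \<pi>: "\<pi> permutes {..<n}" by simp
      have "\<bar>of_int (sign \<pi>) * (\<Prod>i<n. corr_kernel (Y i) (Y (\<pi> i)))\<bar> =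
         (\<Prod>i<n. \<bar>corr_kernel (Y i) (Y (\<pi> i))\<bar>)"
        by (simp add: abs_mult sign_def abs_prod)
      also have "\<dots> \<le> (\<Prod>i<n. B)"
        using permutes_in_image[OF \<pi>] by (intro prod_mono conjI B Y) auto
      finally show "\<bar>of_int (sign \<pi>) * (\<Prod>i<n. corr_kernel (Y i) (Y (\<pi> i)))\<bar> \<le> (\<Prod>i<n. B)" .
    qed
    finally show "\<bar>corr_det n Y\<bar> \<le> (\<Sum>\<pi> | \<pi> permutes {..<n}. (\<Prod>i<n. B))" .
  qed
qed


section \<open>Support of the bordered determinant\<close>

definition row_point :: "nat \<Rightarrow> (nat \<Rightarrow> nat \<times> real) \<Rightarrow> nat \<Rightarrow> nat \<times> real" where
  "row_point n Y a = (if a < n then Y a else (a - n, 0))"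

definition col_point :: "nat \<Rightarrow> (nat \<Rightarrow> nat \<times> real) \<Rightarrow> nat \<Rightarrow> nat \<times> real" where
  "col_point n Y b = (if b < n then Y b else (p + q - (b - n), 1))"

definition extended_det :: "nat \<Rightarrow> (nat \<Rightarrow> nat \<times> real) \<Rightarrow> real" where
  "extended_det n Y = (\<Sum>\<pi> | \<pi> permutes {..<n + p}. of_int (sign \<pi>) *
     (\<Prod>a<n + p. propagator (row_point n Y a) (col_point n Y (\<pi> a))))"

definition gram_det :: real where
  "gram_det = Determinant.det (Matrix.mat p p (\<lambda>(j, i). gram j i))"

lemma gram_det_nonzero: "gram_det \<noteq> 0"
proof -
  let ?G = "Matrix.mat p p (\<lambda>(j, i). gram j i)" and ?T = "Matrix.mat p p (\<lambda>(i, l). T i l)"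
  have "?G * ?T = 1\<^sub>m p"
    by (rule eq_matI) (auto simp: scalar_prod_def atLeast0LessThan gram_T)
  then have "Determinant.det ?G * Determinant.det ?T = 1"
    by (metis det_mult det_one mat_carrier)
  then show ?thesis by (auto simp: gram_det_def)
qed

text \<open>Column operations turn the bordered matrix into a block triangular one.\<close>

lemma corr_det_gram_det: "corr_det n Y * gram_det = (- 1) ^ n * extended_det n Y"
proof -
  \<comment> \<open>Rows of actual points are negated so that the Schur complement is
    \<open>K\<close> itself; this is the origin of \<open>(- 1) ^ n\<close>.\<close>
  define A where "A = Matrix.mat n n (\<lambda>(a, b). - propagator (Y a) (Y b))"
  define B where "B = Matrix.mat n p (\<lambda>(a, i). - propagator (Y a) (p + q - i, 1))"
  define C where "C = Matrix.mat p n (\<lambda>(j, b). propagator (j, 0) (Y b))"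
  define D where "D = Matrix.mat p p (\<lambda>(j, i). gram j i)"
  define F where "F = Matrix.mat p n (\<lambda>(i, b). - (\<Sum>j<p. T i j * propagator (j, 0) (Y b)))"
  have carr: "A \<in> carrier_mat n n" "B \<in> carrier_mat n p" "C \<in> carrier_mat p n"
    "D \<in> carrier_mat p p" "F \<in> carrier_mat p n"
    by (auto simp: A_def B_def C_def D_def F_def)
  \<comment> \<open>Unit lower triangular; \<open>F = - T C\<close> is chosen to clear the block
    \<open>C\<close>.\<close>
  let ?E = "four_block_mat (1\<^sub>m n) (0\<^sub>m n p) F (1\<^sub>m p)"
  let ?X = "four_block_mat A B C D"
  have "A * 1\<^sub>m n + B * F = Matrix.mat n n (\<lambda>(i, j). corr_kernel (Y i) (Y j))"
    using carr
    by (intro eq_matI)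
       (auto simp: A_def B_def F_def corr_kernel_def scalar_prod_def atLeast0LessThan
         sum_distrib_left sum_negf mult_ac)
  moreover have "C * 1\<^sub>m n + D * F = 0\<^sub>m p n"
  proof (intro eq_matI)
    fix j b assume jb: "j < dim_row (0\<^sub>m p n)" "b < dim_col (0\<^sub>m p n)"
    have "(\<Sum>i<p. gram j i * (\<Sum>l<p. T i l * propagator (l, 0) (Y b))) =
      (\<Sum>l<p. (\<Sum>i<p. gram j i * T i l) * propagator (l, 0) (Y b))"
      unfolding sum_distrib_left sum_distrib_right by (subst sum.swap) (simp add: mult_ac)
    also have "\<dots> = (\<Sum>l<p. if j = l then propagator (l, 0) (Y b) else 0)"
      using jb by (intro sum.cong) (auto simp: gram_T)
    also have "\<dots> = propagator (j, 0) (Y b)" using jb by simp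
    finally show "(C * 1\<^sub>m n + D * F) $$ (j, b) = 0\<^sub>m p n $$ (j, b)"
      using jb carr
      by (simp add: C_def D_def F_def scalar_prod_def atLeast0LessThan sum_negf)
  qed (use carr in auto)
  moreover have "A * 0\<^sub>m n p + B * 1\<^sub>m p = B" "C * 0\<^sub>m n p + D * 1\<^sub>m p = D"
    using carr by auto
  ultimately have "?X * ?E =
      four_block_mat (Matrix.mat n n (\<lambda>(i, j). corr_kernel (Y i) (Y j))) B (0\<^sub>m p n) D"
    using carr by (subst mult_four_block_mat[of _ n n _ p _ p _ _ n _ p]) auto
  then have "Determinant.det (?X * ?E) = corr_det n Y * gram_det"
    using carr
    by (simp add: corr_det_eq_det gram_det_def D_def[symmetric]
        det_four_block_mat_lower_left_zero[OF _ carr(2) refl carr(4)])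
  moreover have "Determinant.det (?X * ?E) = Determinant.det ?X * Determinant.det ?E"
    using carr by (intro det_mult[of _ "n + p"]) auto
  moreover have "Determinant.det ?E = 1"
    using carr by (subst det_four_block_mat_upper_right_zero[of _ n _ p]) auto
  moreover have "?X = Matrix.mat (n + p) (n + p) (\<lambda>(a, b). (if a < n then - 1 else 1) *
      propagator (row_point n Y a) (col_point n Y b))"
    using carr by (intro eq_matI) (auto simp: A_def B_def C_def D_def row_point_def col_point_def
        bead_gram_def)
  moreover have "Determinant.det (Matrix.mat (n + p) (n + p) (\<lambda>(a, b). (if a < n then - 1 else 1) *
      propagator (row_point n Y a) (col_point n Y b))) = (- 1) ^ n * extended_det n Y"
  proof -
    have "(\<Prod>a<n + m. if a < n then - 1 else (1::real)) = (- 1) ^ n" for m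
      by (induction m) auto
    then show ?thesis
      unfolding det_mat_Leibniz extended_det_def prod.distrib
      by (simp add: sum_distrib_left mult_ac)
  qed
  ultimately show ?thesis by simp
qed

lemma corr_det_eq_extended_det: "corr_det n Y = (- 1) ^ n / gram_det * extended_det n Y"
  using corr_det_gram_det[of n Y] gram_det_nonzero by (simp add: field_simps)

text \<open>A nonzero propagator leads from a row to a column on a strictly later line. This total
  and the one for the columns differ by \<open>p * q - n\<close>, the slack that all entries of a
  permutation share.\<close>

lemma sum_row_lines:
  "(\<Sum>a<n + p. Suc (fst (row_point n Y a))) = (\<Sum>i<n. fst (Y i)) + n + (\<Sum>j<p. Suc j)"
  by (simp add: sum_lessThan_add row_point_def sum.distrib sum_Suc)

lemma sum_col_lines:
  "(\<Sum>b<n + p. fst (col_point n Y b)) = (\<Sum>i<n. fst (Y i)) + p * q + (\<Sum>j<p. Suc j)"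
proof -
  have "(\<Sum>j<m. m + q - j) = m * q + (\<Sum>j<m. Suc j)" for m
  proof (induction m)
    case (Suc m)
    have "(\<Sum>j<m. Suc m + q - j) = (\<Sum>j<m. Suc (m + q - j))"
      by (intro sum.cong) auto
    then have "(\<Sum>j<Suc m. Suc m + q - j) = (\<Sum>j<m. m + q - j) + m + Suc q"
      by (simp add: sum_Suc)
    with Suc.IH show ?case by simp
  qed simp
  then show ?thesis by (simp add: sum_lessThan_add col_point_def)
qed

definition supported_perm :: "nat \<Rightarrow> (nat \<Rightarrow> nat \<times> real) \<Rightarrow> (nat \<Rightarrow> nat) \<Rightarrow> bool" where
  "supported_perm n Y \<pi> \<longleftrightarrow> \<pi> permutes {..<n + p} \<and>
     (\<forall>a<n + p. propagator (row_point n Y a) (col_point n Y (\<pi> a)) \<noteq> 0)"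

lemma extended_det_nonzero:
  assumes "extended_det n Y \<noteq> 0"
  obtains \<pi> where "supported_perm n Y \<pi>"
proof -
  obtain \<pi> where "\<pi> permutes {..<n + p}"
    "(\<Prod>a<n + p. propagator (row_point n Y a) (col_point n Y (\<pi> a))) \<noteq> 0"
    using assms unfolding extended_det_def by (auto elim!: sum.not_neutral_contains_not_neutral)
  then show thesis by (intro that[of \<pi>]) (auto simp: supported_perm_def)
qed

lemma supported_perm_le:
  assumes "supported_perm n Y \<pi>" "a < n + p"
  shows "Suc (fst (row_point n Y a)) \<le> fst (col_point n Y (\<pi> a))"
    "snd (row_point n Y a) < snd (col_point n Y (\<pi> a))"
proof -
  have "propagator (row_point n Y a) (col_point n Y (\<pi> a)) \<noteq> 0"
    using assms by (simp add: supported_perm_def)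
  then show "Suc (fst (row_point n Y a)) \<le> fst (col_point n Y (\<pi> a))"
    "snd (row_point n Y a) < snd (col_point n Y (\<pi> a))"
    by (simp_all add: propagator_def split: if_splits)
qed

lemma supported_perm_size:
  assumes "supported_perm n Y \<pi>"
  shows "n \<le> p * q"
proof -
  have \<pi>: "\<pi> permutes {..<n + p}" using assms by (simp add: supported_perm_def)
  have "(\<Sum>a<n + p. Suc (fst (row_point n Y a))) \<le> (\<Sum>a<n + p. fst (col_point n Y (\<pi> a)))"
    by (intro sum_mono supported_perm_le[OF assms]) auto
  also have "\<dots> = (\<Sum>b<n + p. fst (col_point n Y b))"
    using sum.permute[OF \<pi>, of "\<lambda>b. fst (col_point n Y b)"] by (simp add: o_def)
  finally show ?thesis unfolding sum_row_lines sum_col_lines by simp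
qed

text \<open>With \<open>p * q\<close> points there is no slack, so each row is matched into the next
  line. This is what makes the matrix block structured.\<close>

lemma supported_perm_lines:
  assumes "supported_perm (p * q) Y \<pi>" "a < p * q + p"
  shows "fst (col_point (p * q) Y (\<pi> a)) = Suc (fst (row_point (p * q) Y a))"
proof -
  let ?n = "p * q"
  have \<pi>: "\<pi> permutes {..<?n + p}" using assms by (simp add: supported_perm_def)
  have "(\<Sum>a<?n + p. Suc (fst (row_point ?n Y a))) = (\<Sum>a<?n + p. fst (col_point ?n Y (\<pi> a)))"
    using sum.permute[OF \<pi>, of "\<lambda>b. fst (col_point ?n Y b)"]
    by (simp add: o_def sum_row_lines sum_col_lines)
  from sum_mono_inv[OF this] show ?thesis
    using supported_perm_le[OF assms(1)] assms(2) by auto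
qed

lemma card_index_split:
  "card {a. a < n + p \<and> P a} = card {a. a < n \<and> P a} + card {j. j < p \<and> P (n + j)}"
proof -
  have "{a. a < n + p \<and> P a} = {a. a < n \<and> P a} \<union> (\<lambda>j. n + j) ` {j. j < p \<and> P (n + j)}"
    by (auto simp: image_iff) (metis add_diff_inverse_nat nat_add_left_cancel_less)
  moreover have "card ({a. a < n \<and> P a} \<union> (\<lambda>j. n + j) ` {j. j < p \<and> P (n + j)}) =
      card {a. a < n \<and> P a} + card ((\<lambda>j. n + j) ` {j. j < p \<and> P (n + j)})"
    by (rule card_Un_disjoint) auto
  moreover have "card ((\<lambda>j. n + j) ` {j. j < p \<and> P (n + j)}) = card {j. j < p \<and> P (n + j)}"
    by (intro card_image) auto
  ultimately show ?thesis by simp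
qed

text \<open>Rows on lines \<open>\<ge> t\<close> are matched injectively to columns on lines
  \<open>> t\<close>. The auxiliary points contribute \<open>p - t\<close> rows and
  \<open>min p (p + q - t)\<close> columns; the difference bounds the number of points on line
  \<open>t\<close>.\<close>

lemma supported_perm_card_line:
  assumes "supported_perm n Y \<pi>" "1 \<le> t" "t \<le> p + q - 1"
  shows "card {i. i < n \<and> fst (Y i) = t} \<le> num_particles p q t"
proof -
  have \<pi>: "\<pi> permutes {..<n + p}" using assms by (simp add: supported_perm_def)
  let ?A = "{a. a < n + p \<and> t \<le> fst (row_point n Y a)}"
  let ?B = "{b. b < n + p \<and> t < fst (col_point n Y b)}"
  have "card ?A \<le> card ?B"
  proof (rule card_inj_on_le)
    show "inj_on \<pi> ?A" using permutes_inj[OF \<pi>] by (rule inj_on_subset) simp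
    show "\<pi> ` ?A \<subseteq> ?B"
      using supported_perm_le(1)[OF assms(1)] permutes_in_image[OF \<pi>] by fastforce
  qed simp
  moreover have "card ?A = card {i. i < n \<and> t \<le> fst (Y i)} + (p - t)"
  proof -
    have "{i. i < n \<and> t \<le> fst (row_point n Y i)} = {i. i < n \<and> t \<le> fst (Y i)}"
      "{j. j < p \<and> t \<le> fst (row_point n Y (n + j))} = {t..<p}"
      by (auto simp: row_point_def)
    then show ?thesis by (simp add: card_index_split)
  qed
  moreover have "card ?B = card {i. i < n \<and> t < fst (Y i)} + min p (p + q - t)"
  proof -
    have "{i. i < n \<and> t < fst (col_point n Y i)} = {i. i < n \<and> t < fst (Y i)}"
      "{j. j < p \<and> t < fst (col_point n Y (n + j))} = {..<min p (p + q - t)}"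
      by (auto simp: col_point_def)
    then show ?thesis by (simp add: card_index_split)
  qed
  moreover have "card {i. i < n \<and> t \<le> fst (Y i)} =
      card {i. i < n \<and> t < fst (Y i)} + card {i. i < n \<and> fst (Y i) = t}"
  proof -
    have "{i. i < n \<and> t \<le> fst (Y i)} = {i. i < n \<and> t < fst (Y i)} \<union> {i. i < n \<and> fst (Y i) = t}"
      by auto
    moreover have "card ({i. i < n \<and> t < fst (Y i)} \<union> {i. i < n \<and> fst (Y i) = t}) =
        card {i. i < n \<and> t < fst (Y i)} + card {i. i < n \<and> fst (Y i) = t}"
      by (rule card_Un_disjoint) auto
    ultimately show ?thesis by simp
  qed
  ultimately show ?thesis using assms(2,3) p_le_q by (auto simp: num_particles_def)
qed

lemma corr_det_nonzero:
  assumes "corr_det n Y \<noteq> 0"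
  obtains \<pi> where "supported_perm n Y \<pi>"
proof -
  have "extended_det n Y \<noteq> 0" using assms by (auto simp: corr_det_eq_extended_det)
  then show thesis using that by (rule extended_det_nonzero)
qed

lemma corr_det_eq_0_if_large:
  assumes "p * q < n"
  shows "corr_det n Y = 0"
proof (rule ccontr)
  assume "corr_det n Y \<noteq> 0"
  then obtain \<pi> where "supported_perm n Y \<pi>" by (rule corr_det_nonzero)
  from supported_perm_size[OF this] assms show False by simp
qed

lemma corr_det_nonzero_card_line:
  assumes "corr_det n Y \<noteq> 0" "1 \<le> t" "t \<le> p + q - 1"
  shows "card {i. i < n \<and> fst (Y i) = t} \<le> num_particles p q t"
proof -
  obtain \<pi> where "supported_perm n Y \<pi>" using assms(1) by (rule corr_det_nonzero)
  then show ?thesis using assms(2,3) by (rule supported_perm_card_line)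
qed

abbreviation "labels \<equiv> particle_labels p q"

section \<open>Particle labels and the blocks of the bordered matrix\<close>

lemma finite_labels: "finite labels"
  by (auto simp: particle_labels_def)

lemma card_labels: "card labels = p * q"
proof -
  have "card labels = (\<Sum>t = 1..p + q - 1. num_particles p q t)"
    unfolding particle_labels_def by (simp add: card_SigmaI)
  \<comment> \<open>A line carries as many particles as there are \<open>j < p\<close> with
    \<open>j < t < p + q - j\<close>; swapping the sums leaves the interval sizes
    \<open>p + q - 1 - 2 j\<close>.\<close>
  also have "\<dots> = (\<Sum>t = 1..p + q - 1. \<Sum>j<p. if j < t \<and> t < p + q - j then 1 else 0)"
  proof (intro sum.cong refl)
    fix t assume t: "t \<in> {1..p + q - 1}"
    have "(\<Sum>j<p. if j < t \<and> t < p + q - j then 1 else 0 :: nat) =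
      (\<Sum>j\<in>{..<min (min t p) (p + q - t)}. 1)"
      by (rule sum.mono_neutral_cong_right) auto
    with t p_le_q show "num_particles p q t = (\<Sum>j<p. if j < t \<and> t < p + q - j then 1 else 0)"
      by (auto simp: num_particles_def)
  qed
  also have "\<dots> = (\<Sum>j<p. \<Sum>t = 1..p + q - 1. if j < t \<and> t < p + q - j then 1 else 0)"
    by (rule sum.swap)
  also have "\<dots> = (\<Sum>j<p. p + q - j - Suc j)"
  proof (intro sum.cong refl)
    fix j assume "j \<in> {..<p}"
    have "(\<Sum>t = 1..p + q - 1. if j < t \<and> t < p + q - j then 1 else 0 :: nat) = (\<Sum>t\<in>{j<..<p + q - j}. 1)"
      by (rule sum.mono_neutral_cong_right) auto
    then show "(\<Sum>t = 1..p + q - 1. if j < t \<and> t < p + q - j then 1 else 0) = p + q - j - Suc j"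
      by simp
  qed
  also have "\<dots> = p * q"
  proof -
    have "(\<Sum>j<p. p + q - j - Suc j) + (\<Sum>j<p. Suc j) = (\<Sum>j<p. p + q - j)"
      unfolding sum.distrib[symmetric] using p_le_q by (intro sum.cong) auto
    also have "\<dots> = p * q + (\<Sum>j<p. Suc j)"
      using sum_col_lines[of 0 "\<lambda>_. undefined"] by (simp add: col_point_def)
    finally show ?thesis by simp
  qed
  finally show ?thesis .
qed


text \<open>Size of block \<open>t\<close>. Its rows are the particles of line \<open>t - 1\<close>,
  with an auxiliary 0 if \<open>t \<le> p\<close>; its columns are those of line \<open>t\<close>,
  with an auxiliary 1 if \<open>q < t\<close>. Both counts agree, and there is one block more than
  there are lines.\<close>

definition rank_bound :: "nat \<Rightarrow> nat" where
  "rank_bound t = min t (min p (p + q + 1 - t))"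

definition ranks :: "(nat \<times> nat) set" where
  "ranks = (SIGMA t:{1..p + q}. {1..rank_bound t})"

text \<open>
  Block \<open>t\<close> of the bordered matrix has the points of line \<open>t - 1\<close> as rows and those of line \<open>t\<close>
  as columns, each completed by at most one auxiliary point (\<open>0\<close> or \<open>1\<close>) and sorted decreasingly.
\<close>

definition row_rank :: "(nat \<Rightarrow> nat \<times> nat) \<Rightarrow> nat \<Rightarrow> nat \<times> nat" where
  "row_rank \<sigma> a = (if a < p * q then (Suc (fst (\<sigma> a)), snd (\<sigma> a))
     else (Suc (a - p * q), Suc (a - p * q)))"

definition col_rank :: "(nat \<Rightarrow> nat \<times> nat) \<Rightarrow> nat \<Rightarrow> nat \<times> nat" where
  "col_rank \<sigma> b = (if b < p * q
     then (fst (\<sigma> b), if fst (\<sigma> b) \<le> q then snd (\<sigma> b) else Suc (snd (\<sigma> b)))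
     else (p + q - (b - p * q), 1))"

definition row_position :: "(nat \<times> nat \<Rightarrow> real) \<Rightarrow> nat \<Rightarrow> nat \<Rightarrow> real" where
  "row_position x t i = (if t \<le> p \<and> i = t then 0 else x (t - 1, i))"

definition col_position :: "(nat \<times> nat \<Rightarrow> real) \<Rightarrow> nat \<Rightarrow> nat \<Rightarrow> real" where
  "col_position x t i = (if t \<le> q then x (t, i) else if i = 1 then 1 else x (t, i - 1))"

definition sorted_config :: "(nat \<times> nat \<Rightarrow> real) \<Rightarrow> bool" where
  "sorted_config x \<longleftrightarrow> (\<forall>t \<in> {1..p + q - 1}. \<forall>i \<in> {1..num_particles p q t}.
     \<forall>j \<in> {1..num_particles p q t}. i < j \<longrightarrow> x (t, j) < x (t, i))"

text \<open>The propagator between adjacent lines tests a strict inequality, so vanishing entries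
  satisfy the weak opposite one. With this mixture the determinant formula holds at every sorted
  configuration, ties between lines included.\<close>

definition weakly_interlaced :: "(nat \<times> nat \<Rightarrow> real) \<Rightarrow> bool" where
  "weakly_interlaced x \<longleftrightarrow> (\<forall>t \<in> {1..p + q}. \<forall>i \<in> {1..rank_bound t}.
     row_position x t i < col_position x t i \<and>
     (i < rank_bound t \<longrightarrow> col_position x t (Suc i) \<le> row_position x t i))"

definition labelled :: "(nat \<Rightarrow> nat \<times> nat) \<Rightarrow> (nat \<times> nat \<Rightarrow> real) \<Rightarrow> nat \<Rightarrow> nat \<times> real" where
  "labelled \<sigma> x i = (fst (\<sigma> i), x (\<sigma> i))"

lemma mem_labels: "(t, i) \<in> labels \<longleftrightarrow> 1 \<le> t \<and> t < p + q \<and> 1 \<le> i \<and> i \<le> num_particles p q t"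
  using p_pos by (auto simp: particle_labels_def)

lemma bij_betw_row_rank:
  assumes \<sigma>: "bij_betw \<sigma> {..<p * q} labels"
  shows "bij_betw (row_rank \<sigma>) {..<p * q + p} ranks"
proof (rule bij_betw_imageI)
  have lab: "\<sigma> a \<in> labels" if "a < p * q" for a using bij_betwE[OF \<sigma>] that by auto
  \<comment> \<open>Line \<open>t - 1\<close> carries at most \<open>t - 1\<close> particles, so
    rank \<open>t\<close> in block \<open>t \<le> p\<close> is free for the auxiliary 0.\<close>
  have fresh: "snd (\<sigma> a) < Suc (fst (\<sigma> a)) \<or> p < Suc (fst (\<sigma> a))" if "a < p * q" for a
    using lab[OF that] by (cases "\<sigma> a") (auto simp: mem_labels num_particles_def split: if_splits)
  show "inj_on (row_rank \<sigma>) {..<p * q + p}"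
  proof (rule inj_onI)
    fix a b assume ab: "a \<in> {..<p * q + p}" "b \<in> {..<p * q + p}" and eq: "row_rank \<sigma> a = row_rank \<sigma> b"
    consider "a < p * q" "b < p * q" | "\<not> a < p * q" "\<not> b < p * q" | "a < p * q" "\<not> b < p * q"
      | "\<not> a < p * q" "b < p * q" by blast
    then show "a = b"
    proof cases
      case 1
      then have "\<sigma> a = \<sigma> b" using eq by (auto simp: row_rank_def prod_eq_iff)
      with 1 show ?thesis using bij_betw_imp_inj_on[OF \<sigma>] by (auto dest: inj_onD)
    qed (use eq ab fresh[of a] fresh[of b] in \<open>auto simp: row_rank_def\<close>)
  qed
  show "row_rank \<sigma> ` {..<p * q + p} = ranks"
  proof (intro equalityI subsetI)
    fix d assume "d \<in> row_rank \<sigma> ` {..<p * q + p}"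
    then obtain a where a: "a < p * q + p" "d = row_rank \<sigma> a" by auto
    show "d \<in> ranks"
    proof (cases "a < p * q")
      case True
      with lab[OF True] a p_le_q show ?thesis
        by (cases "\<sigma> a") (auto simp: row_rank_def ranks_def rank_bound_def mem_labels num_particles_def split: if_splits)
    next
      case False
      with a p_le_q show ?thesis by (auto simp: row_rank_def ranks_def rank_bound_def)
    qed
  next
    fix d assume "d \<in> ranks"
    then obtain t i where d: "d = (t, i)" "1 \<le> t" "t \<le> p + q" "1 \<le> i" "i \<le> rank_bound t"
      by (auto simp: ranks_def)
    show "d \<in> row_rank \<sigma> ` {..<p * q + p}"
    proof (cases "t \<le> p \<and> i = t")
      case True
      with d have "d = row_rank \<sigma> (p * q + (t - 1))" "p * q + (t - 1) < p * q + p"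
        by (auto simp: row_rank_def)
      then show ?thesis by blast
    next
      case False
      with d p_le_q have "(t - 1, i) \<in> labels"
        by (auto simp: mem_labels num_particles_def rank_bound_def)
      then obtain a where a: "a < p * q" "\<sigma> a = (t - 1, i)"
        using bij_betw_imp_surj_on[OF \<sigma>] by (metis imageE lessThan_iff)
      then have "d = row_rank \<sigma> a" using d by (auto simp: row_rank_def)
      with a show ?thesis by auto
    qed
  qed
qed

text \<open>On lines beyond \<open>q\<close> the ranks of particles are raised by one because the
  auxiliary 1 is the largest column.\<close>

lemma bij_betw_col_rank:
  assumes \<sigma>: "bij_betw \<sigma> {..<p * q} labels"
  shows "bij_betw (col_rank \<sigma>) {..<p * q + p} ranks"
proof (rule bij_betw_imageI)
  have lab: "\<sigma> a \<in> labels" if "a < p * q" for a using bij_betwE[OF \<sigma>] that by auto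
  have fresh: "1 \<le> snd (\<sigma> a)" if "a < p * q" for a
    using lab[OF that] by (cases "\<sigma> a") (auto simp: mem_labels)
  show "inj_on (col_rank \<sigma>) {..<p * q + p}"
  proof (rule inj_onI)
    fix a b assume ab: "a \<in> {..<p * q + p}" "b \<in> {..<p * q + p}" and eq: "col_rank \<sigma> a = col_rank \<sigma> b"
    consider "a < p * q" "b < p * q" | "\<not> a < p * q" "\<not> b < p * q" | "a < p * q" "\<not> b < p * q"
      | "\<not> a < p * q" "b < p * q" by blast
    then show "a = b"
    proof cases
      case 1
      then have "\<sigma> a = \<sigma> b" using eq by (auto simp: col_rank_def prod_eq_iff split: if_splits)
      with 1 show ?thesis using bij_betw_imp_inj_on[OF \<sigma>] by (auto dest: inj_onD)
    qed (use eq ab fresh[of a] fresh[of b] in \<open>auto simp: col_rank_def split: if_splits\<close>)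
  qed
  show "col_rank \<sigma> ` {..<p * q + p} = ranks"
  proof (intro equalityI subsetI)
    fix d assume "d \<in> col_rank \<sigma> ` {..<p * q + p}"
    then obtain a where a: "a < p * q + p" "d = col_rank \<sigma> a" by auto
    show "d \<in> ranks"
    proof (cases "a < p * q")
      case True
      with lab[OF True] a p_le_q show ?thesis
        by (cases "\<sigma> a") (auto simp: col_rank_def ranks_def rank_bound_def mem_labels num_particles_def split: if_splits)
    next
      case False
      with a p_le_q show ?thesis by (auto simp: col_rank_def ranks_def rank_bound_def)
    qed
  next
    fix d assume "d \<in> ranks"
    then obtain t i where d: "d = (t, i)" "1 \<le> t" "t \<le> p + q" "1 \<le> i" "i \<le> rank_bound t"
      by (auto simp: ranks_def)
    show "d \<in> col_rank \<sigma> ` {..<p * q + p}"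
    proof (cases "q < t \<and> i = 1")
      case True
      with d have "d = col_rank \<sigma> (p * q + (p + q - t))" "p * q + (p + q - t) < p * q + p"
        by (auto simp: col_rank_def)
      then show ?thesis by blast
    next
      case False
      with d p_le_q have "(t, if t \<le> q then i else i - 1) \<in> labels"
        by (auto simp: mem_labels num_particles_def rank_bound_def)
      then obtain a where a: "a < p * q" "\<sigma> a = (t, if t \<le> q then i else i - 1)"
        using bij_betw_imp_surj_on[OF \<sigma>] by (metis imageE lessThan_iff)
      then have "d = col_rank \<sigma> a" using d by (auto simp: col_rank_def)
      with a show ?thesis by auto
    qed
  qed
qed

lemma row_point_labelled:
  assumes "bij_betw \<sigma> {..<p * q} labels" "a < p * q + p"
  shows "Suc (fst (row_point (p * q) (labelled \<sigma> x) a)) = fst (row_rank \<sigma> a)"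
    "snd (row_point (p * q) (labelled \<sigma> x) a) = row_position x (fst (row_rank \<sigma> a)) (snd (row_rank \<sigma> a))"
proof -
  have "\<sigma> a \<in> labels" if "a < p * q" using bij_betwE[OF assms(1)] that by auto
  then show "Suc (fst (row_point (p * q) (labelled \<sigma> x) a)) = fst (row_rank \<sigma> a)"
    "snd (row_point (p * q) (labelled \<sigma> x) a) = row_position x (fst (row_rank \<sigma> a)) (snd (row_rank \<sigma> a))"
    using assms(2)
    by (cases "\<sigma> a"; auto simp: row_point_def row_rank_def labelled_def row_position_def mem_labels
          num_particles_def split: if_splits)+
qed

lemma col_point_labelled:
  assumes "bij_betw \<sigma> {..<p * q} labels" "b < p * q + p"
  shows "fst (col_point (p * q) (labelled \<sigma> x) b) = fst (col_rank \<sigma> b)"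
    "snd (col_point (p * q) (labelled \<sigma> x) b) = col_position x (fst (col_rank \<sigma> b)) (snd (col_rank \<sigma> b))"
proof -
  have "\<sigma> b \<in> labels" if "b < p * q" using bij_betwE[OF assms(1)] that by auto
  then show "fst (col_point (p * q) (labelled \<sigma> x) b) = fst (col_rank \<sigma> b)"
    "snd (col_point (p * q) (labelled \<sigma> x) b) = col_position x (fst (col_rank \<sigma> b)) (snd (col_rank \<sigma> b))"
    using assms(2)
    by (cases "\<sigma> b"; auto simp: col_point_def col_rank_def labelled_def col_position_def mem_labels
          num_particles_def split: if_splits)+
qed

lemma row_position_decreasing:
  assumes x: "sorted_config x" "\<And>l. l \<in> labels \<Longrightarrow> 0 < x l"
    and "1 \<le> t" "t \<le> p + q" "1 \<le> i" "i < j" "j \<le> rank_bound t"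
  shows "row_position x t j < row_position x t i"
proof (cases "t \<le> p \<and> j = t")
  case True
  then have "(t - 1, i) \<in> labels" using assms(3-) by (auto simp: mem_labels num_particles_def)
  with True assms(6) x(2) show ?thesis by (auto simp: row_position_def)
next
  case False
  with assms(3-) p_le_q have "t - 1 \<in> {1..p + q - 1}" "i \<in> {1..num_particles p q (t - 1)}"
    "j \<in> {1..num_particles p q (t - 1)}"
    by (auto simp: num_particles_def rank_bound_def)
  with x(1) \<open>i < j\<close> have "x (t - 1, j) < x (t - 1, i)" unfolding sorted_config_def by blast
  moreover have "\<not> (t \<le> p \<and> i = t)" using assms(6,7) by (auto simp: rank_bound_def)
  ultimately show ?thesis using False by (auto simp: row_position_def)
qed

lemma col_position_decreasing:
  assumes x: "sorted_config x" "\<And>l. l \<in> labels \<Longrightarrow> x l < 1"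
    and "1 \<le> t" "t \<le> p + q" "1 \<le> i" "i < j" "j \<le> rank_bound t"
  shows "col_position x t j < col_position x t i"
proof (cases "q < t \<and> i = 1")
  case True
  then have "(t, j - 1) \<in> labels" using assms(3-) p_le_q
    by (auto simp: mem_labels num_particles_def rank_bound_def)
  with True assms(6) x(2) show ?thesis by (auto simp: col_position_def)
next
  case False
  let ?k = "\<lambda>i. if t \<le> q then i else i - 1"
  from False assms(3-) p_le_q have "t \<in> {1..p + q - 1}" "?k i \<in> {1..num_particles p q t}"
    "?k j \<in> {1..num_particles p q t}" "?k i < ?k j"
    by (auto simp: num_particles_def rank_bound_def)
  with x(1) have "x (t, ?k j) < x (t, ?k i)" unfolding sorted_config_def by blast
  with False assms(5,6) show ?thesis by (auto simp: col_position_def split: if_splits)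
qed

text \<open>Matches rows and columns of equal block and rank, so it is the diagonal of every block.
  For an interlaced configuration no other permutation contributes.\<close>

definition matching_perm :: "(nat \<Rightarrow> nat \<times> nat) \<Rightarrow> nat \<Rightarrow> nat" where
  "matching_perm \<sigma> a = (if a < p * q + p then inv_into {..<p * q + p} (col_rank \<sigma>) (row_rank \<sigma> a) else a)"

lemma matching_perm:
  assumes \<sigma>: "bij_betw \<sigma> {..<p * q} labels"
  shows "matching_perm \<sigma> permutes {..<p * q + p}"
    and "a < p * q + p \<Longrightarrow> col_rank \<sigma> (matching_perm \<sigma> a) = row_rank \<sigma> a"
proof -
  have "bij_betw (inv_into {..<p * q + p} (col_rank \<sigma>) \<circ> row_rank \<sigma>) {..<p * q + p} {..<p * q + p}"
    by (rule bij_betw_trans[OF bij_betw_row_rank[OF \<sigma>] bij_betw_inv_into[OF bij_betw_col_rank[OF \<sigma>]]])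
  then have "bij_betw (matching_perm \<sigma>) {..<p * q + p} {..<p * q + p}"
    by (rule bij_betw_cong[THEN iffD1, rotated]) (simp add: matching_perm_def)
  then show "matching_perm \<sigma> permutes {..<p * q + p}"
    by (rule bij_imp_permutes) (simp add: matching_perm_def)
  show "col_rank \<sigma> (matching_perm \<sigma> a) = row_rank \<sigma> a" if "a < p * q + p"
    using that bij_betwE[OF bij_betw_row_rank[OF \<sigma>]] bij_betw_imp_surj_on[OF bij_betw_col_rank[OF \<sigma>]]
    by (auto simp: matching_perm_def intro!: f_inv_into_f)
qed

lemma matching_perm_unique:
  assumes \<sigma>: "bij_betw \<sigma> {..<p * q} labels" and \<pi>: "\<pi> permutes {..<p * q + p}"
    and eq: "\<And>a. a < p * q + p \<Longrightarrow> col_rank \<sigma> (\<pi> a) = row_rank \<sigma> a"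
  shows "\<pi> = matching_perm \<sigma>"
proof
  fix a
  show "\<pi> a = matching_perm \<sigma> a"
  proof (cases "a < p * q + p")
    case True
    then have "col_rank \<sigma> (\<pi> a) = col_rank \<sigma> (matching_perm \<sigma> a)"
      using eq matching_perm(2)[OF \<sigma>] by simp
    moreover have "\<pi> a \<in> {..<p * q + p}" "matching_perm \<sigma> a \<in> {..<p * q + p}"
      using permutes_in_image[OF \<pi>] permutes_in_image[OF matching_perm(1)[OF \<sigma>]] True by auto
    ultimately show ?thesis using bij_betw_imp_inj_on[OF bij_betw_col_rank[OF \<sigma>]] by (auto dest: inj_onD)
  next
    case False
    then show ?thesis using permutes_not_in[OF \<pi>] permutes_not_in[OF matching_perm(1)[OF \<sigma>]] by auto
  qed
qed

text \<open>Relabelling the points by \<open>\<tau>\<close> conjugates the matching permutation.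
  Hence the sign in the top determinant does not depend on the order in which the points are
  listed.\<close>

lemma sign_matching_perm:
  assumes \<sigma>: "bij_betw \<sigma> {..<p * q} labels" and \<sigma>': "bij_betw \<sigma>' {..<p * q} labels"
  shows "sign (matching_perm \<sigma>') = sign (matching_perm \<sigma>)"
proof -
  let ?I = "{..<p * q}" and ?J = "{..<p * q + p}"
  define \<tau> where "\<tau> = (\<lambda>a. if a < p * q then inv_into ?I \<sigma> (\<sigma>' a) else a)"
  have "bij_betw (inv_into ?I \<sigma> \<circ> \<sigma>') ?I ?I"
    by (rule bij_betw_trans[OF \<sigma>' bij_betw_inv_into[OF \<sigma>]])
  then have "bij_betw \<tau> ?I ?I"
    by (rule bij_betw_cong[THEN iffD1, rotated]) (simp add: \<tau>_def)
  then have \<tau>: "\<tau> permutes ?I" by (rule bij_imp_permutes) (simp add: \<tau>_def)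
  then have \<tau>J: "\<tau> permutes ?J" by (rule permutes_subset) auto
  have \<sigma>\<tau>: "\<sigma> (\<tau> a) = \<sigma>' a" if "a < p * q" for a
    using that bij_betwE[OF \<sigma>'] bij_betw_imp_surj_on[OF \<sigma>]
    by (auto simp: \<tau>_def intro!: f_inv_into_f)
  have lt: "\<tau> a < p * q \<longleftrightarrow> a < p * q" for a using permutes_in_image[OF \<tau>] by simp
  have r: "row_rank \<sigma>' a = row_rank \<sigma> (\<tau> a)" "col_rank \<sigma>' a = col_rank \<sigma> (\<tau> a)" for a
    using \<sigma>\<tau>[of a] lt[of a] by (auto simp: row_rank_def col_rank_def \<tau>_def)
  note m = matching_perm(1)[OF \<sigma>] matching_perm(1)[OF \<sigma>']
  have "matching_perm \<sigma> = \<tau> \<circ> matching_perm \<sigma>' \<circ> Hilbert_Choice.inv \<tau>"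
  proof (rule matching_perm_unique[OF \<sigma>, symmetric])
    show "\<tau> \<circ> matching_perm \<sigma>' \<circ> Hilbert_Choice.inv \<tau> permutes ?J"
      by (intro permutes_compose permutes_inv \<tau>J m)
    fix a assume "a < p * q + p"
    then have "Hilbert_Choice.inv \<tau> a < p * q + p" using permutes_in_image[OF permutes_inv[OF \<tau>J]] by auto
    then show "col_rank \<sigma> ((\<tau> \<circ> matching_perm \<sigma>' \<circ> Hilbert_Choice.inv \<tau>) a) = row_rank \<sigma> a"
      using matching_perm(2)[OF \<sigma>'] by (simp add: r(2)[symmetric] r(1) permutes_inverses[OF \<tau>])
  qed
  moreover have "permutation \<tau>" "permutation (matching_perm \<sigma>')" "permutation (Hilbert_Choice.inv \<tau>)"
    using \<tau>J m(2) permutes_inv[OF \<tau>J] unfolding permutation_permutes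
    by (auto intro!: exI[of _ ?J])
  ultimately have "sign (matching_perm \<sigma>) = sign \<tau> * sign (matching_perm \<sigma>') * sign \<tau>"
    by (simp add: sign_compose permutation_compose sign_inverse)
  then show ?thesis by (simp add: sign_def split: if_splits)
qed

text \<open>The entries differ, as the propagator also connects distant lines, but the products
  agree: a nonzero product of propagators uses neighbouring lines only, where the propagator is the
  step function, and a vanishing propagator makes the corresponding indicator vanish.\<close>

lemma prod_propagator_eq_indicator:
  assumes \<sigma>: "bij_betw \<sigma> {..<p * q} labels" and \<pi>: "\<pi> permutes {..<p * q + p}"
  shows "(\<Prod>a<p * q + p. propagator (row_point (p * q) (labelled \<sigma> x) a) (col_point (p * q) (labelled \<sigma> x) (\<pi> a))) =
    (\<Prod>a<p * q + p. if fst (row_rank \<sigma> a) = fst (col_rank \<sigma> (\<pi> a)) \<and>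
        row_position x (fst (row_rank \<sigma> a)) (snd (row_rank \<sigma> a))
          < col_position x (fst (col_rank \<sigma> (\<pi> a))) (snd (col_rank \<sigma> (\<pi> a))) then 1 else 0)"
    (is "prod ?f _ = prod ?g _")
proof (cases "supported_perm (p * q) (labelled \<sigma> x) \<pi>")
  case True
  have "?f a = 1 \<and> ?g a = 1" if "a < p * q + p" for a
  proof -
    have \<pi>a: "\<pi> a < p * q + p" using permutes_in_image[OF \<pi>, of a] that by simp
    have "fst (col_point (p * q) (labelled \<sigma> x) (\<pi> a)) = Suc (fst (row_point (p * q) (labelled \<sigma> x) a))"
      "snd (row_point (p * q) (labelled \<sigma> x) a) < snd (col_point (p * q) (labelled \<sigma> x) (\<pi> a))"
      using supported_perm_lines[OF True that] supported_perm_le(2)[OF True that] .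
    moreover have "fst (row_point (p * q) (labelled \<sigma> x) a) < fst (row_rank \<sigma> a)"
      "fst (row_rank \<sigma> a) - fst (row_point (p * q) (labelled \<sigma> x) a) - 1 = 0"
      using row_point_labelled(1)[OF \<sigma> that, of x] by simp_all
    ultimately show ?thesis
      by (simp add: row_point_labelled[OF \<sigma> that] col_point_labelled[OF \<sigma> \<pi>a] propagator_def)
  qed
  then show ?thesis by simp
next
  case False
  then obtain a where a: "a < p * q + p" "?f a = 0"
    using \<pi> by (auto simp: supported_perm_def)
  have \<pi>a: "\<pi> a < p * q + p" using permutes_in_image[OF \<pi>, of a] a(1) by simp
  have "?g a = 0"
    using a(2) row_point_labelled[OF \<sigma> a(1), of x] col_point_labelled[OF \<sigma> \<pi>a, of x]
    by (auto simp: propagator_def split: if_splits)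
  then have "prod ?g {..<p * q + p} = 0"
    using a(1) by (intro prod_zero) (simp, rule bexI[of _ a], assumption, simp)
  moreover have "prod ?f {..<p * q + p} = 0"
    using a by (intro prod_zero) auto
  ultimately show ?thesis by (simp only:)
qed

text \<open>Interlacing makes each block triangular in the ranks, with ones on the diagonal.\<close>

lemma extended_det_interlaced:
  assumes \<sigma>: "bij_betw \<sigma> {..<p * q} labels" and x: "sorted_config x"
    "\<And>l. l \<in> labels \<Longrightarrow> x l < 1" and inter: "weakly_interlaced x"
  shows "extended_det (p * q) (labelled \<sigma> x) = of_int (sign (matching_perm \<sigma>))"
proof -
  let ?J = "{..<p * q + p}"
  let ?f = "\<lambda>\<pi> a. propagator (row_point (p * q) (labelled \<sigma> x) a) (col_point (p * q) (labelled \<sigma> x) (\<pi> a))"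
  note m = matching_perm[OF \<sigma>]
  have "\<pi> = matching_perm \<sigma>" if sup: "supported_perm (p * q) (labelled \<sigma> x) \<pi>" for \<pi>
  proof -
    have \<pi>: "\<pi> permutes ?J" using sup by (simp add: supported_perm_def)
    have \<pi>a: "\<pi> a < p * q + p" if "a < p * q + p" for a using permutes_in_image[OF \<pi>, of a] that by simp
    have fst_eq: "fst (col_rank \<sigma> (\<pi> a)) = fst (row_rank \<sigma> a)" if "a < p * q + p" for a
      using supported_perm_lines[OF sup that]
      by (simp add: row_point_labelled(1)[OF \<sigma> that] col_point_labelled(1)[OF \<sigma> \<pi>a[OF that]])
    have le: "snd (col_rank \<sigma> (\<pi> a)) \<le> snd (row_rank \<sigma> a)" if a: "a < p * q + p" for a
    proof (rule ccontr)
      obtain t i j where t: "row_rank \<sigma> a = (t, i)" "col_rank \<sigma> (\<pi> a) = (t, j)"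
        using fst_eq[OF a] by (metis prod.collapse)
      assume "\<not> ?thesis"
      then have "i < j" using t by simp
      have "(t, i) \<in> ranks" "(t, j) \<in> ranks"
        using bij_betwE[OF bij_betw_row_rank[OF \<sigma>], rule_format, of a] a t(1)
          bij_betwE[OF bij_betw_col_rank[OF \<sigma>], rule_format, of "\<pi> a"] \<pi>a[OF a] t(2) by auto
      then have ti: "1 \<le> t" "t \<le> p + q" "1 \<le> i" "j \<le> rank_bound t" by (auto simp: ranks_def)
      have "col_position x t j \<le> col_position x t (Suc i)"
      proof (cases "j = Suc i")
        case False
        then show ?thesis
          using col_position_decreasing[OF x, of t "Suc i" j] ti \<open>i < j\<close> by auto
      qed simp
      also have "\<dots> \<le> row_position x t i" using inter ti \<open>i < j\<close> by (auto simp: weakly_interlaced_def)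
      finally show False
        using supported_perm_le(2)[OF sup a] row_point_labelled(2)[OF \<sigma> a, of x]
          col_point_labelled(2)[OF \<sigma> \<pi>a[OF a], of x] t by simp
    qed
    \<comment> \<open>Row and column ranks both run through \<open>ranks\<close>, so their totals
      agree and the inequalities \<open>le\<close> are equalities.\<close>
    have "(\<Sum>a\<in>?J. snd (col_rank \<sigma> (\<pi> a))) = (\<Sum>a\<in>?J. snd (row_rank \<sigma> a))"
      using sum.permute[OF \<pi>, of "\<lambda>a. snd (col_rank \<sigma> a)"]
        sum.reindex_bij_betw[OF bij_betw_row_rank[OF \<sigma>], of snd]
        sum.reindex_bij_betw[OF bij_betw_col_rank[OF \<sigma>], of snd] by (simp add: o_def)
    from sum_mono_inv[OF this] le
    have "snd (col_rank \<sigma> (\<pi> a)) = snd (row_rank \<sigma> a)" if "a < p * q + p" for a using that by auto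
    with fst_eq show ?thesis by (intro matching_perm_unique[OF \<sigma> \<pi>]) (auto simp: prod_eq_iff)
  qed
  then have zero: "prod (?f \<pi>) ?J = 0" if "\<pi> permutes ?J" "\<pi> \<noteq> matching_perm \<sigma>" for \<pi>
    using that by (auto simp: supported_perm_def intro!: prod_zero)
  have "extended_det (p * q) (labelled \<sigma> x) = (\<Sum>\<pi>\<in>{matching_perm \<sigma>}. of_int (sign \<pi>) * prod (?f \<pi>) ?J)"
    unfolding extended_det_def
  proof (rule sum.mono_neutral_right)
    show "finite {\<pi>. \<pi> permutes ?J}" by (rule finite_permutations) simp
    show "{matching_perm \<sigma>} \<subseteq> {\<pi>. \<pi> permutes ?J}" using m(1) by simp
    show "\<forall>\<pi>\<in>{\<pi>. \<pi> permutes ?J} - {matching_perm \<sigma>}. of_int (sign \<pi>) * prod (?f \<pi>) ?J = 0"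
      using zero by simp
  qed
  also have "\<dots> = of_int (sign (matching_perm \<sigma>)) * prod (?f (matching_perm \<sigma>)) ?J" by simp
  also have "prod (?f (matching_perm \<sigma>)) ?J = 1"
    unfolding prod_propagator_eq_indicator[OF \<sigma> m(1)]
  proof (rule prod.neutral, rule ballI)
    fix a assume a: "a \<in> ?J"
    obtain t i where ti: "row_rank \<sigma> a = (t, i)" by fastforce
    have "(t, i) \<in> ranks" using bij_betwE[OF bij_betw_row_rank[OF \<sigma>], rule_format, of a] a ti by simp
    then have "row_position x t i < col_position x t i"
      using inter by (auto simp: weakly_interlaced_def ranks_def)
    then show "(if fst (row_rank \<sigma> a) = fst (col_rank \<sigma> (matching_perm \<sigma> a)) \<and>
        row_position x (fst (row_rank \<sigma> a)) (snd (row_rank \<sigma> a))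
          < col_position x (fst (col_rank \<sigma> (matching_perm \<sigma> a))) (snd (col_rank \<sigma> (matching_perm \<sigma> a)))
        then 1 else 0) = (1::real)"
      using a m(2) ti by simp
  qed
  finally show ?thesis by simp
qed

text \<open>
  In a block that is not interlaced, the sets of columns that exceed the successive rows cannot grow
  by exactly one element each time.
\<close>

lemma not_interlaced_rows:
  assumes x: "sorted_config x" "\<forall>l\<in>labels. 0 < x l \<and> x l < 1"
    and not: "\<not> weakly_interlaced x"
  obtains t where "1 \<le> t" "t \<le> p + q" "1 \<le> rank_bound t"
      "\<And>j. j \<in> {1..rank_bound t} \<Longrightarrow> \<not> row_position x t 1 < col_position x t j"
  | t i where "1 \<le> t" "t \<le> p + q" "1 \<le> i" "i < rank_bound t"
      "\<And>j. j \<in> {1..rank_bound t} \<Longrightarrow>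
        row_position x t i < col_position x t j \<longleftrightarrow> row_position x t (Suc i) < col_position x t j"
proof -
  obtain t i0 where t: "1 \<le> t" "t \<le> p + q" and i0: "1 \<le> i0" "i0 \<le> rank_bound t"
    and bad: "\<not> (row_position x t i0 < col_position x t i0 \<and>
       (i0 < rank_bound t \<longrightarrow> col_position x t (Suc i0) \<le> row_position x t i0))"
    using not by (auto simp: weakly_interlaced_def)
  define r where "r = rank_bound t"
  define S where "S i = {j \<in> {1..r}. row_position x t i < col_position x t j}" for i
  have fin: "finite (S i)" for i by (simp add: S_def)
  show thesis
  proof (cases "S 1 = {} \<or> (\<exists>i. 1 \<le> i \<and> i < r \<and> S i = S (Suc i))")
    case True
    then show thesis
    proof
      assume "S 1 = {}"
      then show thesis using that(1)[of t] t i0 by (auto simp: S_def r_def)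
    next
      assume "\<exists>i. 1 \<le> i \<and> i < r \<and> S i = S (Suc i)"
      then obtain i where i: "1 \<le> i" "i < r" "S i = S (Suc i)" by blast
      then have "row_position x t i < col_position x t j \<longleftrightarrow> row_position x t (Suc i) < col_position x t j"
        if "j \<in> {1..r}" for j using that by (auto simp: S_def)
      then show thesis using that(2)[of t i] t i by (auto simp: r_def)
    qed
  next
    case False
    have step: "card (S i) < card (S (Suc i))" if "1 \<le> i" "i < r" for i
    proof (rule psubset_card_mono[OF fin])
      have "S i \<subseteq> S (Suc i)"
        using row_position_decreasing[OF x(1), of t i "Suc i"] x(2) t that
        by (auto simp: S_def r_def intro: less_trans)
      with False that show "S i \<subset> S (Suc i)" by blast
    qed
    have lower: "i \<le> card (S i)" if "1 \<le> i" "i \<le> r" for i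
      using that
    proof (induction i rule: nat_induct_at_least)
      case base
      with False fin show ?case by (auto simp: Suc_le_eq card_gt_0_iff)
    next
      case (Suc i)
      then show ?case using step[of i] by simp
    qed
    have upper: "card (S i) + k \<le> card (S (i + k))" if "1 \<le> i" "i + k \<le> r" for i k
      using that
    proof (induction k)
      case (Suc k)
      then show ?case using step[of "i + k"] by simp
    qed simp
    have "card (S r) \<le> card {1..r}" by (rule card_mono) (auto simp: S_def)
    \<comment> \<open>Going from at least one element to at most \<open>r\<close> in
      \<open>r - 1\<close> strict steps leaves no slack.\<close>
    then have card_eq: "card (S i) = i" if "1 \<le> i" "i \<le> r" for i
      using upper[of i "r - i"] lower[of i] that by simp
    \<comment> \<open>Columns decrease, so each \<open>S i\<close> is an initial segment, hence
      \<open>{1..i}\<close>. At \<open>i0\<close> this is interlacing and contradicts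
      \<open>bad\<close>.\<close>
    have down: "{1..j} \<subseteq> S i" if "j \<in> S i" for i j
    proof
      fix k assume k: "k \<in> {1..j}"
      show "k \<in> S i"
      proof (cases "k = j")
        case False
        then have "col_position x t j < col_position x t k"
          using col_position_decreasing[OF x(1), of t k j] x(2) t k that by (auto simp: S_def r_def)
        then show ?thesis using k that by (auto simp: S_def)
      qed (use that in simp)
    qed
    have ir: "1 \<le> i0" "i0 \<le> r" using i0 by (auto simp: r_def)
    have "i0 \<in> S i0"
    proof (rule ccontr)
      assume "i0 \<notin> S i0"
      have "k < i0" if "k \<in> S i0" for k
      proof (rule ccontr)
        assume "\<not> k < i0"
        then have "i0 \<in> {1..k}" using ir by simp
        with down[OF that] \<open>i0 \<notin> S i0\<close> show False by blast
      qed
      then have "S i0 \<subseteq> {1..<i0}" by (auto simp: S_def)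
      then have "card (S i0) \<le> i0 - 1" using card_mono[of "{1..<i0}" "S i0"] by simp
      with card_eq[OF ir] ir show False by simp
    qed
    moreover have "Suc i0 \<notin> S i0"
    proof
      assume "Suc i0 \<in> S i0"
      from card_mono[OF fin down[OF this]] card_eq[OF ir] show False by simp
    qed
    ultimately show thesis using bad by (auto simp: S_def r_def)
  qed
qed

text \<open>A block that is not interlaced produces either a zero row or two equal rows of the
  indicator matrix.\<close>

lemma extended_det_not_interlaced:
  assumes \<sigma>: "bij_betw \<sigma> {..<p * q} labels" and x: "sorted_config x"
    "\<And>l. l \<in> labels \<Longrightarrow> 0 < x l \<and> x l < 1" and not: "\<not> weakly_interlaced x"
  shows "extended_det (p * q) (labelled \<sigma> x) = 0"
proof -
  let ?J = "{..<p * q + p}"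
  \<comment> \<open>Two rows agree for the indicators only, not for the propagators, hence the
    passage to \<open>g\<close>.\<close>
  define g :: "nat \<Rightarrow> nat \<Rightarrow> real" where "g = (\<lambda>a b. if fst (row_rank \<sigma> a) = fst (col_rank \<sigma> b) \<and>
        row_position x (fst (row_rank \<sigma> a)) (snd (row_rank \<sigma> a))
          < col_position x (fst (col_rank \<sigma> b)) (snd (col_rank \<sigma> b)) then 1 else 0)"
  let ?A = "Matrix.mat (p * q + p) (p * q + p) (\<lambda>(a, b). g a b)"
  have ext: "extended_det (p * q) (labelled \<sigma> x) = Determinant.det ?A"
    unfolding extended_det_def det_mat_Leibniz g_def
    by (intro sum.cong refl) (simp add: prod_propagator_eq_indicator[OF \<sigma>])
  have rows: "\<exists>a<p * q + p. row_rank \<sigma> a = (t, i)" if "1 \<le> t" "t \<le> p + q" "1 \<le> i" "i \<le> rank_bound t" for t i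
  proof -
    have "(t, i) \<in> row_rank \<sigma> ` ?J"
      using bij_betw_imp_surj_on[OF bij_betw_row_rank[OF \<sigma>]] that by (auto simp: ranks_def)
    then show ?thesis by (metis imageE lessThan_iff)
  qed
  have cols: "snd (col_rank \<sigma> b) \<in> {1..rank_bound (fst (col_rank \<sigma> b))}" if "b < p * q + p" for b
    using bij_betwE[OF bij_betw_col_rank[OF \<sigma>], rule_format, of b] that
    by (cases "col_rank \<sigma> b") (auto simp: ranks_def)
  have "\<forall>l\<in>labels. 0 < x l \<and> x l < 1" using x(2) by blast
  from not_interlaced_rows[OF x(1) this not] show ?thesis
  proof cases
    case (1 t)
    obtain a where a: "a < p * q + p" "row_rank \<sigma> a = (t, 1)" using rows[of t 1] 1 by auto
    have "g a b = 0" if "b < p * q + p" for b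
      using 1(4) cols[OF that] by (auto simp: g_def a(2))
    then have "(\<Prod>i<p * q + p. g i (\<pi> i)) = 0" if "\<pi> permutes ?J" for \<pi>
      using a(1) permutes_in_image[OF that, of a] by (auto intro!: prod_zero bexI[of _ a])
    then show ?thesis unfolding ext det_mat_Leibniz
      by (intro sum.neutral ballI) (simp only: mem_Collect_eq mult_zero_right)
  next
    case (2 t i)
    obtain a where a: "a < p * q + p" "row_rank \<sigma> a = (t, i)" using rows[of t i] 2 by auto
    obtain a' where a': "a' < p * q + p" "row_rank \<sigma> a' = (t, Suc i)" using rows[of t "Suc i"] 2 by auto
    have "g a b = g a' b" if "b < p * q + p" for b
      using 2(5) cols[OF that] by (auto simp: g_def a(2) a'(2))
    then have "row ?A a = row ?A a'" using a(1) a'(1) by (intro eq_vecI) auto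
    moreover have "a \<noteq> a'" using a(2) a'(2) by auto
    ultimately show ?thesis unfolding ext
      using a(1) a'(1) by (intro det_identical_rows[of _ "p * q + p" a a']) auto
  qed
qed

text \<open>By \<open>sign_matching_perm\<close> the choice of \<open>\<sigma>\<close> is
  immaterial. The value is identified only through the total mass, in
  \<open>top_constant_total_weight\<close>.\<close>

definition top_constant :: real where
  "top_constant = (- 1) ^ (p * q) / gram_det *
     of_int (sign (matching_perm (SOME \<sigma>. bij_betw \<sigma> {..<p * q} labels)))"

lemma corr_det_labelled:
  assumes \<sigma>: "bij_betw \<sigma> {..<p * q} labels" and x: "sorted_config x"
    "\<And>l. l \<in> labels \<Longrightarrow> 0 < x l \<and> x l < 1"
  shows "corr_det (p * q) (labelled \<sigma> x) = top_constant * (if weakly_interlaced x then 1 else 0)"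
proof -
  have "sign (matching_perm (SOME \<sigma>. bij_betw \<sigma> {..<p * q} labels)) = sign (matching_perm \<sigma>)"
    by (rule sign_matching_perm[OF \<sigma> someI[of "\<lambda>\<sigma>. bij_betw \<sigma> {..<p * q} labels", OF \<sigma>]])
  then show ?thesis
    using extended_det_interlaced[OF \<sigma> x(1)] extended_det_not_interlaced[OF \<sigma> x] x(2)
    by (auto simp: corr_det_eq_extended_det top_constant_def)
qed

end

section \<open>The weight as a determinant\<close>

lemma nth_largest_image:
  assumes "\<And>i j. 1 \<le> i \<Longrightarrow> i < j \<Longrightarrow> j \<le> m \<Longrightarrow> f j < f i" "1 \<le> k" "k \<le> m"
  shows "nth_largest (f ` {1..m}) k = f k"
proof -
  let ?xs = "rev (map f [1..<Suc m])"
  have "sorted_wrt (<) ?xs"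
    unfolding sorted_wrt_rev using assms(1) by (auto simp: sorted_wrt_iff_nth_less simp del: upt_Suc)
  then have "sorted_list_of_set (set ?xs) = ?xs"
    by (intro sorted_list_of_set.idem_if_sorted_distinct) (auto simp: strict_sorted_iff)
  moreover have "set ?xs = f ` {1..m}" by auto
  ultimately have "sorted_list_of_set (f ` {1..m}) = ?xs" by simp
  then have "nth_largest (f ` {1..m}) k = map f [1..<Suc m] ! (k - 1)"
    by (simp add: nth_largest_def)
  also have "\<dots> = f k" using assms(2,3) by (subst nth_map) (auto simp del: upt_Suc)
  finally show ?thesis .
qed

lemma chi_image:
  assumes f: "\<And>i j. 1 \<le> i \<Longrightarrow> i < j \<Longrightarrow> j \<le> m \<Longrightarrow> f j < f i"
    and g: "\<And>i j. 1 \<le> i \<Longrightarrow> i < j \<Longrightarrow> j \<le> Suc m \<Longrightarrow> g j < g i"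
  shows "chi (f ` {1..m}) (g ` {1..Suc m}) =
    (if \<forall>k\<in>{1..m}. g (Suc k) < f k \<and> f k < g k then 1 else 0)"
proof -
  have inj: "inj_on h {1..n}" if "\<And>i j. 1 \<le> i \<Longrightarrow> i < j \<Longrightarrow> j \<le> n \<Longrightarrow> h j < h i" for h :: "nat \<Rightarrow> real" and n
  proof (rule inj_onI)
    fix i j assume "i \<in> {1..n}" "j \<in> {1..n}" "h i = h j"
    then show "i = j" using that[of i j] that[of j i] by (cases i j rule: linorder_cases) auto
  qed
  have c: "card (f ` {1..m}) = m" "card (g ` {1..Suc m}) = Suc m"
    using card_image[OF inj[of m f]] card_image[OF inj[of "Suc m" g]] f g by auto
  have "nth_largest (g ` {1..Suc m}) (k + 1) = g (Suc k)" "nth_largest (g ` {1..Suc m}) k = g k"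
    "nth_largest (f ` {1..m}) k = f k" if "k \<in> {1..m}" for k
    using that nth_largest_image[of "Suc m" g "Suc k", OF g] nth_largest_image[of "Suc m" g k, OF g]
      nth_largest_image[of m f k, OF f] by auto
  then show ?thesis unfolding chi_def c by auto
qed

text \<open>Tonelli, integrating the exceptional set over the coordinates \<open>i\<close> and
  \<open>j\<close> first. The factors are only sigma-finite, so the projection to two coordinates
  need not preserve measure.\<close>

lemma (in product_sigma_finite) AE_PiM_two_components:
  assumes I: "finite I" "i \<in> I" "j \<in> I" "i \<noteq> j"
    and P: "{z \<in> space (M i \<Otimes>\<^sub>M M j). P (fst z) (snd z)} \<in> sets (M i \<Otimes>\<^sub>M M j)"
    and ae: "AE z in M i \<Otimes>\<^sub>M M j. P (fst z) (snd z)"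
  shows "AE x in Pi\<^sub>M I M. P (x i) (x j)"
proof -
  interpret pair_sigma_finite "M i" "M j" ..
  define K where "K = I - {i, j}"
  have K: "finite K" "j \<notin> K" "i \<notin> insert j K" and I_eq: "I = insert i (insert j K)"
    using I by (auto simp: K_def)
  define N where "N = {z \<in> space (M i \<Otimes>\<^sub>M M j). \<not> P (fst z) (snd z)}"
  have N: "N \<in> sets (M i \<Otimes>\<^sub>M M j)"
    unfolding N_def using P by (rule sets.sets_Collect_neg)
  have N0: "emeasure (M i \<Otimes>\<^sub>M M j) N = 0"
    using ae N unfolding N_def by (subst (asm) AE_iff_measurable[OF _ refl]) auto
  have pr: "(\<lambda>x. (x i, x j)) \<in> Pi\<^sub>M I M \<rightarrow>\<^sub>M (M i \<Otimes>\<^sub>M M j)"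
    using I by (intro measurable_Pair measurable_component_singleton) auto
  have meas: "(\<lambda>x. indicator N (x i, x j) :: ennreal) \<in> borel_measurable (Pi\<^sub>M I M)"
    by (rule measurable_compose[OF pr borel_measurable_indicator[OF N]])
  have meas': "(\<lambda>x. \<integral>\<^sup>+a. indicator N (a, x j) \<partial>M i) \<in> borel_measurable (Pi\<^sub>M (insert j K) M)"
  proof -
    have "(\<lambda>z. (snd z, fst z)) \<in> M j \<Otimes>\<^sub>M M i \<rightarrow>\<^sub>M M i \<Otimes>\<^sub>M M j"
      by measurable
    from measurable_compose[OF this borel_measurable_indicator[OF N]]
    have "(\<lambda>b. \<integral>\<^sup>+a. indicator N (a, b) \<partial>M i) \<in> borel_measurable (M j)"
      by (intro sigma_finite_measure.borel_measurable_nn_integral[OF sigma_finite_measures])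
         (simp add: case_prod_beta')
    then show ?thesis
      by (rule measurable_compose[rotated]) (auto intro: measurable_component_singleton)
  qed
  have "(\<integral>\<^sup>+x. indicator N (x i, x j) \<partial>Pi\<^sub>M I M) =
    (\<integral>\<^sup>+x. (\<integral>\<^sup>+a. indicator N (a, x j) \<partial>M i) \<partial>Pi\<^sub>M (insert j K) M)"
    unfolding I_eq using K I(4)
    by (subst product_nn_integral_insert) (use meas in \<open>auto simp: I_eq\<close>)
  also have "\<dots> = (\<integral>\<^sup>+x. (\<integral>\<^sup>+b. (\<integral>\<^sup>+a. indicator N (a, b) \<partial>M i) \<partial>M j) \<partial>Pi\<^sub>M K M)"
    using K by (subst product_nn_integral_insert[OF _ _ meas']) auto
  also have "(\<integral>\<^sup>+b. (\<integral>\<^sup>+a. indicator N (a, b) \<partial>M i) \<partial>M j) = emeasure (M i \<Otimes>\<^sub>M M j) N"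
    using N by (subst nn_integral_snd) (auto simp: nn_integral_indicator)
  finally have "(\<integral>\<^sup>+x. indicator N (x i, x j) \<partial>Pi\<^sub>M I M) = 0" by (simp add: N0)
  then have "AE x in Pi\<^sub>M I M. (indicator N (x i, x j) :: ennreal) = 0"
    using meas by (subst (asm) nn_integral_0_iff_AE) auto
  moreover have "AE x in Pi\<^sub>M I M. (x i, x j) \<in> space (M i \<Otimes>\<^sub>M M j)"
    using measurable_space[OF pr] by (intro AE_I2) auto
  ultimately show ?thesis
    by eventually_elim (auto simp: N_def indicator_def split: if_splits)
qed

lemma AE_unit_lebesgue_neq: "AE b in unit_lebesgue. a \<noteq> b"
  unfolding unit_lebesgue_def
  using AE_lborel_singleton[of a] by (subst AE_restrict_space_iff) auto

lemma AE_pair_unit_lebesgue_neq: "AE z in unit_lebesgue \<Otimes>\<^sub>M unit_lebesgue. fst z \<noteq> snd z"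
proof -
  interpret U: prob_space unit_lebesgue by (rule prob_space_unit_lebesgue)
  interpret pair_sigma_finite unit_lebesgue unit_lebesgue ..
  note [measurable] = measurable_unit_lebesgue_ident
  have [measurable]: "fst \<in> borel_measurable (unit_lebesgue \<Otimes>\<^sub>M unit_lebesgue)"
    "snd \<in> borel_measurable (unit_lebesgue \<Otimes>\<^sub>M unit_lebesgue)"
    using measurable_compose[OF measurable_fst measurable_unit_lebesgue_ident]
      measurable_compose[OF measurable_snd measurable_unit_lebesgue_ident] by auto
  show ?thesis
  proof (rule AE_pair_measure)
    show "{z \<in> space (unit_lebesgue \<Otimes>\<^sub>M unit_lebesgue). fst z \<noteq> snd z} \<in> sets (unit_lebesgue \<Otimes>\<^sub>M unit_lebesgue)"
      by (rule borel_measurable_neq) fact+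
  qed (simp add: AE_unit_lebesgue_neq)
qed

context gram_inverse
begin

text \<open>\<open>col_position\<close> already includes the 1 that \<open>chi\<close> adjoins. This
  adds the 0, adjoined from line \<open>p\<close> on, at the rank after the last column.\<close>

definition ext_position :: "(nat \<times> nat \<Rightarrow> real) \<Rightarrow> nat \<Rightarrow> nat \<Rightarrow> real" where
  "ext_position x t k = (if k \<le> rank_bound t then col_position x t k else 0)"

definition interlaced :: "(nat \<times> nat \<Rightarrow> real) \<Rightarrow> bool" where
  "interlaced x \<longleftrightarrow> (\<forall>t \<in> {1..p + q - 1}. \<forall>k \<in> {1..num_particles p q t}.
     ext_position x (Suc t) (Suc k) < x (t, k) \<and> x (t, k) < ext_position x (Suc t) k)"

lemma sorted_configD:
  assumes "sorted_config x" "1 \<le> t" "t < p + q" "1 \<le> i" "i < j" "j \<le> num_particles p q t"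
  shows "x (t, j) < x (t, i)"
  using assms unfolding sorted_config_def by (auto simp: Ball_def)

lemma ext_position_decreasing:
  assumes x: "sorted_config x" "\<And>l. l \<in> labels \<Longrightarrow> 0 < x l \<and> x l < 1"
    and t: "1 \<le> t" "t < p + q" and ij: "1 \<le> i" "i < j" "j \<le> Suc (num_particles p q t)"
  shows "ext_position x (Suc t) j < ext_position x (Suc t) i"
proof (cases "j \<le> rank_bound (Suc t)")
  case True
  then show ?thesis
    using col_position_decreasing[OF x(1), of "Suc t" i j] x(2) t ij by (auto simp: ext_position_def)
next
  case False
  then have i: "i \<le> rank_bound (Suc t)" "p \<le> t"
    using t ij p_le_q by (auto simp: rank_bound_def num_particles_def split: if_splits)
  have "0 < col_position x (Suc t) i"
  proof (cases "q < Suc t \<and> i = 1")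
    case False
    then have "(Suc t, if Suc t \<le> q then i else i - 1) \<in> labels"
      using i t ij p_le_q by (auto simp: mem_labels num_particles_def rank_bound_def)
    then show ?thesis using x(2) False by (auto simp: col_position_def)
  qed (simp add: col_position_def)
  then show ?thesis using False i by (simp add: ext_position_def)
qed

lemma line_positions_ext:
  assumes t: "1 \<le> t" "t < p + q"
  shows "ext_position x (Suc t) ` {1..Suc (num_particles p q t)} =
    line_positions p q x (t + 1) \<union> (if t < p then {} else if t < q then {0} else {0, 1})"
proof -
  have up: "{1..Suc n} = insert (Suc n) {1..n}" and down: "{1..Suc n} = insert 1 (Suc ` {1..n})" for n
    by (auto simp: image_iff)
  consider "t < p" | "p \<le> t" "t < q" | "q \<le> t" using p_le_q by linarith
  then show ?thesis
  proof cases
    case 1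
    then have "num_particles p q (t + 1) = Suc (num_particles p q t)" "rank_bound (Suc t) = Suc (num_particles p q t)"
      using p_le_q by (auto simp: num_particles_def rank_bound_def)
    then show ?thesis using 1 p_le_q
      by (auto simp: line_positions_def ext_position_def col_position_def intro!: image_cong)
  next
    case 2
    then have "num_particles p q (t + 1) = num_particles p q t" "rank_bound (Suc t) = num_particles p q t"
      using p_le_q by (auto simp: num_particles_def rank_bound_def)
    then show ?thesis using 2
      unfolding up image_insert
      by (auto simp: line_positions_def ext_position_def col_position_def)
  next
    case 3
    then have n: "num_particles p q t = Suc (num_particles p q (t + 1))" "rank_bound (Suc t) = num_particles p q t"
      using p_le_q t by (auto simp: num_particles_def rank_bound_def)
    let ?m = "num_particles p q (t + 1)"
    have "{1..Suc (num_particles p q t)} = insert 1 (insert (Suc (num_particles p q t)) (Suc ` {1..?m}))"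
      unfolding up[of "num_particles p q t"] unfolding n(1) down[of ?m] by auto
    moreover have "ext_position x (Suc t) (Suc k) = x (Suc t, k)" if "k \<in> {1..?m}" for k
      using 3 n that by (auto simp: ext_position_def col_position_def)
    moreover have "ext_position x (Suc t) 1 = 1" "ext_position x (Suc t) (Suc (num_particles p q t)) = 0"
      using 3 n by (auto simp: ext_position_def col_position_def)
    ultimately have "ext_position x (Suc t) ` {1..Suc (num_particles p q t)} =
        insert 1 (insert 0 ((\<lambda>k. x (Suc t, k)) ` {1..?m}))"
      by (simp only: image_insert image_image cong: image_cong)
    then show ?thesis using 3 p_le_q by (auto simp: line_positions_def)
  qed
qed

text \<open>Once the adjoined points are absorbed into \<open>ext_position\<close>, the three
  products of the density have factors of the same form.\<close>

lemma bead_weight_eq: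
  assumes x: "\<And>l. l \<in> labels \<Longrightarrow> 0 < x l \<and> x l < 1"
  shows "bead_weight p q x = (if sorted_config x \<and> interlaced x then 1 else 0)"
proof (cases "sorted_config x")
  case True
  let ?C = "\<lambda>t. (if \<forall>k \<in> {1..num_particles p q t}.
     ext_position x (Suc t) (Suc k) < x (t, k) \<and> x (t, k) < ext_position x (Suc t) k then 1 else (0::real))"
  have chi: "chi (line_positions p q x t) (line_positions p q x (t + 1) \<union>
      (if t < p then {} else if t < q then {0} else {0, 1})) = ?C t" if t: "1 \<le> t" "t < p + q" for t
  proof -
    have "chi ((\<lambda>i. x (t, i)) ` {1..num_particles p q t})
      (ext_position x (Suc t) ` {1..Suc (num_particles p q t)}) = ?C t"
      by (rule chi_image) (use sorted_configD[OF True t] ext_position_decreasing[OF True x t] in blast)+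
    then show ?thesis by (simp only: line_positions_ext[OF t] line_positions_def[of p q x t])
  qed
  have "bead_weight p q x = (\<Prod>t = 1..p - 1. ?C t) * (\<Prod>t = p..<q. ?C t) * (\<Prod>t = q..p + q - 1. ?C t)"
  proof -
    have "(\<Prod>t = 1..p - 1. chi (line_positions p q x t) (line_positions p q x (t + 1))) = (\<Prod>t = 1..p - 1. ?C t)"
    proof (intro prod.cong refl)
      fix t assume "t \<in> {1..p - 1}"
      then have t: "1 \<le> t" "t < p + q" "t < p" using p_pos p_le_q by auto
      show "chi (line_positions p q x t) (line_positions p q x (t + 1)) = ?C t"
        using chi[OF t(1,2)] t(3-) by simp
    qed
    moreover have "(\<Prod>t = p..<q. chi (line_positions p q x t) (line_positions p q x (t + 1) \<union> {0})) = (\<Prod>t = p..<q. ?C t)"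
    proof (intro prod.cong refl)
      fix t assume "t \<in> {p..<q}"
      then have t: "1 \<le> t" "t < p + q" "p \<le> t" "t < q" using p_pos p_le_q by auto
      show "chi (line_positions p q x t) (line_positions p q x (t + 1) \<union> {0}) = ?C t"
        using chi[OF t(1,2)] t(3-) by simp
    qed
    moreover have "(\<Prod>t = q..p + q - 1. chi (line_positions p q x t) (line_positions p q x (t + 1) \<union> {0, 1})) = (\<Prod>t = q..p + q - 1. ?C t)"
    proof (intro prod.cong refl)
      fix t assume "t \<in> {q..p + q - 1}"
      then have t: "1 \<le> t" "t < p + q" "p \<le> t" "q \<le> t" using p_pos p_le_q by auto
      show "chi (line_positions p q x t) (line_positions p q x (t + 1) \<union> {0, 1}) = ?C t"
        using chi[OF t(1,2)] t(3-) by simp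
    qed
    ultimately show ?thesis
      using True unfolding bead_weight_def sorted_config_def by simp
  qed
  also have "\<dots> = (\<Prod>t = 1..p + q - 1. ?C t)"
  proof -
    have "{1..p + q - 1} = ({1..p - 1} \<union> {p..<q}) \<union> {q..p + q - 1}" using p_pos p_le_q by auto
    then show ?thesis using p_pos p_le_q
      by (simp only:) (subst prod.union_disjoint; (subst prod.union_disjoint)?; auto)
  qed
  also have "\<dots> = (if interlaced x then 1 else 0)"
  proof (cases "interlaced x")
    case False
    then obtain t where t: "t \<in> {1..p + q - 1}" and ne: "\<not> (\<forall>k \<in> {1..num_particles p q t}.
       ext_position x (Suc t) (Suc k) < x (t, k) \<and> x (t, k) < ext_position x (Suc t) k)"
      unfolding interlaced_def by blast
    have "?C t = 0" by (simp only: ne if_False)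
    with t have "(\<Prod>t = 1..p + q - 1. ?C t) = 0" by (intro prod_zero) (simp, blast)
    with False show ?thesis by simp
  qed (auto simp: interlaced_def intro!: prod.neutral)
  finally show ?thesis using True by simp
next
  case False
  then have "bead_weight p q x = 0" unfolding bead_weight_def sorted_config_def by (rule if_not_P)
  with False show ?thesis by simp
qed

text \<open>Strict and weak inequalities differ only when two particles share a position, which
  \<open>inj\<close> excludes; comparisons with 0 and 1 hold because all positions are
  interior.\<close>

lemma interlaced_iff_weakly_interlaced:
  assumes x: "\<And>l. l \<in> labels \<Longrightarrow> 0 < x l \<and> x l < 1" and inj: "inj_on x labels"
  shows "interlaced x \<longleftrightarrow> weakly_interlaced x"
proof
  assume i: "interlaced x"
  show "weakly_interlaced x" unfolding weakly_interlaced_def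
  proof (intro ballI)
    fix t i assume t: "t \<in> {1..p + q}" and i': "i \<in> {1..rank_bound t}"
    show "row_position x t i < col_position x t i \<and>
       (i < rank_bound t \<longrightarrow> col_position x t (Suc i) \<le> row_position x t i)"
    \<comment> \<open>The auxiliary 0 lies below every column and has the last rank of its block, so
      both parts hold at once.\<close>
    proof (cases "t \<le> p \<and> i = t")
      case True
      then have "(t, i) \<in> labels" using t i' p_pos p_le_q by (auto simp: mem_labels num_particles_def)
      then show ?thesis using True x p_le_q by (auto simp: row_position_def col_position_def rank_bound_def)
    next
      case False
      then obtain s where s: "t = Suc s" "s \<in> {1..p + q - 1}" "i \<in> {1..num_particles p q s}"
        using t i' p_le_q by (cases t) (auto simp: rank_bound_def num_particles_def)
      then have "ext_position x (Suc s) (Suc i) < x (s, i) \<and> x (s, i) < ext_position x (Suc s) i"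
        using i unfolding interlaced_def by blast
      with False s(1) i' show ?thesis by (auto simp: row_position_def ext_position_def)
    qed
  qed
next
  assume w: "weakly_interlaced x"
  show "interlaced x" unfolding interlaced_def
  proof (intro ballI)
    fix t k assume t: "t \<in> {1..p + q - 1}" and k: "k \<in> {1..num_particles p q t}"
    then have tk: "(t, k) \<in> labels" by (auto simp: mem_labels)
    have r: "Suc t \<in> {1..p + q}" "k \<in> {1..rank_bound (Suc t)}"
      using t k p_le_q by (auto simp: rank_bound_def num_particles_def split: if_splits)
    have row: "row_position x (Suc t) k = x (t, k)"
      using t k by (auto simp: row_position_def num_particles_def)
    have wk: "x (t, k) < col_position x (Suc t) k"
      "k < rank_bound (Suc t) \<Longrightarrow> col_position x (Suc t) (Suc k) \<le> x (t, k)"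
      using w r unfolding weakly_interlaced_def row[symmetric] by blast+
    have "ext_position x (Suc t) (Suc k) < x (t, k)"
    proof (cases "k < rank_bound (Suc t)")
      case True
      let ?l = "(Suc t, if Suc t \<le> q then Suc k else k)"
      have "?l \<in> labels" using True t k p_le_q by (auto simp: mem_labels num_particles_def rank_bound_def split: if_splits)
      moreover have "col_position x (Suc t) (Suc k) = x ?l" using k by (auto simp: col_position_def)
      ultimately have "col_position x (Suc t) (Suc k) \<noteq> x (t, k)"
        using inj tk by (auto dest: inj_onD)
      with True wk(2) show ?thesis by (auto simp: ext_position_def)
    qed (use x[OF tk] in \<open>simp add: ext_position_def\<close>)
    with wk(1) r show "ext_position x (Suc t) (Suc k) < x (t, k) \<and> x (t, k) < ext_position x (Suc t) k"
      by (simp add: ext_position_def)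
  qed
qed

lemma space_bead_base: "space (bead_base p q) = labels \<rightarrow>\<^sub>E {0<..<1}"
  by (simp add: bead_base_def space_PiM)

lemma bead_base_range: "x \<in> space (bead_base p q) \<Longrightarrow> l \<in> labels \<Longrightarrow> 0 < x l \<and> x l < 1"
  by (auto simp: space_bead_base PiE_iff)

lemma measurable_bead_base_component:
  "l \<in> labels \<Longrightarrow> (\<lambda>x. x l) \<in> borel_measurable (bead_base p q)"
  unfolding bead_base_def
  by (rule measurable_compose[OF measurable_component_singleton[of l] measurable_unit_lebesgue_ident])

lemma AE_bead_base_inj: "AE x in bead_base p q. inj_on x labels"
proof -
  interpret U: prob_space unit_lebesgue by (rule prob_space_unit_lebesgue)
  interpret product_sigma_finite "\<lambda>_::nat \<times> nat. unit_lebesgue" ..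
  have [measurable]: "fst \<in> borel_measurable (unit_lebesgue \<Otimes>\<^sub>M unit_lebesgue)"
    "snd \<in> borel_measurable (unit_lebesgue \<Otimes>\<^sub>M unit_lebesgue)"
    using measurable_compose[OF measurable_fst measurable_unit_lebesgue_ident]
      measurable_compose[OF measurable_snd measurable_unit_lebesgue_ident] by auto
  have "AE x in bead_base p q. x a \<noteq> x b" if "a \<in> labels" "b \<in> labels" "a \<noteq> b" for a b
    unfolding bead_base_def
    by (rule AE_PiM_two_components) (use that finite_labels AE_pair_unit_lebesgue_neq in \<open>auto simp: measurable\<close>)
  then have "AE x in bead_base p q. \<forall>a\<in>labels. \<forall>b\<in>labels. a \<noteq> b \<longrightarrow> x a \<noteq> x b"
    using finite_labels by (intro AE_finite_allI) auto
  then show ?thesis by eventually_elim (auto simp: inj_on_def)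
qed

lemma measurable_sorted_config: "Measurable.pred (bead_base p q) sorted_config"
  unfolding sorted_config_def[abs_def]
  by (intro pred_intros_finite pred_intros_imp' borel_measurable_pred_less measurable_bead_base_component finite)
     (auto simp: mem_labels)

lemma measurable_ext_position:
  assumes "t \<in> {1..p + q - 1}" "k \<in> {1..Suc (num_particles p q t)}"
  shows "(\<lambda>x. ext_position x (Suc t) k) \<in> borel_measurable (bead_base p q)"
proof (cases "k \<le> rank_bound (Suc t) \<and> \<not> (q < Suc t \<and> k = 1)")
  case True
  then have "(Suc t, if Suc t \<le> q then k else k - 1) \<in> labels"
    using assms p_le_q by (auto simp: mem_labels num_particles_def rank_bound_def split: if_splits)
  from measurable_bead_base_component[OF this] True show ?thesis
    by (cases "Suc t \<le> q") (auto simp: ext_position_def col_position_def)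
next
  case False
  then show ?thesis
    by (cases "k \<le> rank_bound (Suc t)") (auto simp: ext_position_def col_position_def)
qed

lemma measurable_interlaced: "Measurable.pred (bead_base p q) interlaced"
  unfolding interlaced_def[abs_def]
  by (intro pred_intros_finite pred_intros_logic borel_measurable_pred_less
      measurable_bead_base_component measurable_ext_position finite)
     (auto simp: mem_labels)

lemma measurable_bead_weight: "bead_weight p q \<in> borel_measurable (bead_base p q)"
proof -
  have "(\<lambda>x. if sorted_config x \<and> interlaced x then 1 else (0::real)) \<in> borel_measurable (bead_base p q)"
    using measurable_sorted_config measurable_interlaced by measurable
  then show ?thesis
    by (rule measurable_cong[THEN iffD1, rotated]) (simp add: bead_weight_eq bead_base_range)
qed

end

lemma nn_integral_bead_reference:
  assumes f: "f \<in> borel_measurable (bead_reference p q)"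
  shows "(\<integral>\<^sup>+z. f z \<partial>bead_reference p q) = (\<Sum>t = 1..p + q - 1. \<integral>\<^sup>+v. f (t, v) \<partial>unit_lebesgue)"
proof -
  interpret U: prob_space unit_lebesgue by (rule prob_space_unit_lebesgue)
  have "(\<integral>\<^sup>+z. f z \<partial>bead_reference p q) =
    (\<integral>\<^sup>+t. (\<integral>\<^sup>+v. f (t, v) \<partial>unit_lebesgue) \<partial>count_space {1..p + q - 1})"
    unfolding bead_reference_def
    by (rule U.nn_integral_fst[symmetric]) (use f in \<open>simp add: bead_reference_def\<close>)
  also have "\<dots> = (\<Sum>t = 1..p + q - 1. \<integral>\<^sup>+v. f (t, v) \<partial>unit_lebesgue)"
    by (rule nn_integral_count_space_finite) simp
  finally show ?thesis .
qed

lemma measurable_tag: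
  assumes "\<And>i. i \<in> I \<Longrightarrow> \<tau> i \<in> {1..p + q - 1}"
  shows "(\<lambda>v. \<lambda>i\<in>I. (\<tau> i, v i)) \<in> Pi\<^sub>M I (\<lambda>_. unit_lebesgue) \<rightarrow>\<^sub>M Pi\<^sub>M I (\<lambda>_. bead_reference p q)"
proof (rule measurable_restrict)
  fix i assume i: "i \<in> I"
  have "(\<lambda>v. v i) \<in> Pi\<^sub>M I (\<lambda>_. unit_lebesgue) \<rightarrow>\<^sub>M unit_lebesgue"
    using measurable_component_singleton[OF i, of "\<lambda>_. unit_lebesgue"] .
  then show "(\<lambda>v. (\<tau> i, v i)) \<in> Pi\<^sub>M I (\<lambda>_. unit_lebesgue) \<rightarrow>\<^sub>M bead_reference p q"
    unfolding bead_reference_def using assms[OF i]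
    by (intro measurable_Pair measurable_const) auto
qed

text \<open>The counting measure on lines becomes a finite sum over assignments
  \<open>\<tau>\<close> of lines to points, leaving Lebesgue integrals over the positions. The
  induction peels off the last point.\<close>

lemma nn_integral_PiM_bead_reference:
  fixes n :: nat
  assumes "g \<in> borel_measurable (Pi\<^sub>M {..<n} (\<lambda>_. bead_reference p q))"
  shows "(\<integral>\<^sup>+Y. g Y \<partial>Pi\<^sub>M {..<n} (\<lambda>_. bead_reference p q)) =
    (\<Sum>\<tau>\<in>{..<n} \<rightarrow>\<^sub>E {1..p + q - 1}.
      \<integral>\<^sup>+v. g (\<lambda>i\<in>{..<n}. (\<tau> i, v i)) \<partial>Pi\<^sub>M {..<n} (\<lambda>_. unit_lebesgue))"
  using assms
proof (induction n arbitrary: g)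
  case 0
  show ?case by (simp add: nn_integral_empty PiM_empty nn_integral_count_space_finite restrict_def)
next
  case (Suc n)
  let ?R = "bead_reference p q" and ?U = "unit_lebesgue" and ?L = "{1..p + q - 1}"
  interpret U: prob_space unit_lebesgue by (rule prob_space_unit_lebesgue)
  interpret R: finite_measure ?R by (rule finite_measure_bead_reference)
  interpret PU: product_sigma_finite "\<lambda>_::nat. unit_lebesgue" ..
  interpret PR: product_sigma_finite "\<lambda>_::nat. ?R" ..
  have ins: "{..<Suc n} = insert n {..<n}" by auto
  have g[measurable]: "g \<in> borel_measurable (Pi\<^sub>M (insert n {..<n}) (\<lambda>_. ?R))"
    using Suc.prems by (simp add: ins)
  have upd: "(\<lambda>z. Y(n := z)) \<in> ?R \<rightarrow>\<^sub>M Pi\<^sub>M (insert n {..<n}) (\<lambda>_. ?R)"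
    if "Y \<in> space (Pi\<^sub>M {..<n} (\<lambda>_. ?R))" for Y
    by (rule measurable_component_update[OF that]) simp
  have G: "(\<lambda>Y. \<integral>\<^sup>+z. g (Y(n := z)) \<partial>?R) \<in> borel_measurable (Pi\<^sub>M {..<n} (\<lambda>_. ?R))"
    by measurable
  have "(\<integral>\<^sup>+Y. g Y \<partial>Pi\<^sub>M {..<Suc n} (\<lambda>_. ?R)) =
      (\<integral>\<^sup>+Y. (\<integral>\<^sup>+z. g (Y(n := z)) \<partial>?R) \<partial>Pi\<^sub>M {..<n} (\<lambda>_. ?R))"
    unfolding ins by (rule PR.product_nn_integral_insert) (use g in auto)
  also have "\<dots> = (\<Sum>\<tau>\<in>{..<n} \<rightarrow>\<^sub>E ?L. \<integral>\<^sup>+v. (\<integral>\<^sup>+z. g ((\<lambda>i\<in>{..<n}. (\<tau> i, v i))(n := z)) \<partial>?R)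
      \<partial>Pi\<^sub>M {..<n} (\<lambda>_. ?U))"
    by (rule Suc.IH[OF G])
  also have "\<dots> = (\<Sum>\<tau>\<in>{..<n} \<rightarrow>\<^sub>E ?L. \<Sum>t\<in>?L.
      \<integral>\<^sup>+v. g (\<lambda>i\<in>{..<Suc n}. ((\<tau>(n := t)) i, v i)) \<partial>Pi\<^sub>M {..<Suc n} (\<lambda>_. ?U))"
  proof (intro sum.cong refl)
    fix \<tau> assume \<tau>: "\<tau> \<in> {..<n} \<rightarrow>\<^sub>E ?L"
    have tagn: "(\<lambda>v. \<lambda>i\<in>{..<n}. (\<tau> i, v i)) \<in> Pi\<^sub>M {..<n} (\<lambda>_. ?U) \<rightarrow>\<^sub>M Pi\<^sub>M {..<n} (\<lambda>_. ?R)"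
      by (rule measurable_tag) (rule PiE_mem[OF \<tau>])
    have tagS: "(\<lambda>v. g (\<lambda>i\<in>insert n {..<n}. ((\<tau>(n := t)) i, v i)))
        \<in> borel_measurable (Pi\<^sub>M (insert n {..<n}) (\<lambda>_. ?U))" if "t \<in> ?L" for t
    proof (rule measurable_compose[OF measurable_tag g])
      fix i assume "i \<in> insert n {..<n}"
      then show "(\<tau>(n := t)) i \<in> ?L" using that PiE_mem[OF \<tau>, of i] by (cases "i = n") auto
    qed
    have eq: "(\<lambda>i\<in>{..<n}. (\<tau> i, v i))(n := (t, w)) =
        (\<lambda>i\<in>insert n {..<n}. ((\<tau>(n := t)) i, (v(n := w)) i))" for v :: "nat \<Rightarrow> real" and t w
      by (auto simp: fun_eq_iff)
    have meas_w: "(\<lambda>v. \<integral>\<^sup>+w. g ((\<lambda>i\<in>{..<n}. (\<tau> i, v i))(n := (t, w))) \<partial>?U)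
        \<in> borel_measurable (Pi\<^sub>M {..<n} (\<lambda>_. ?U))" if "t \<in> ?L" for t
      unfolding eq
    proof -
      note tagS[OF that, measurable]
      show "(\<lambda>v. \<integral>\<^sup>+w. g (\<lambda>i\<in>insert n {..<n}. ((\<tau>(n := t)) i, (v(n := w)) i)) \<partial>?U)
        \<in> borel_measurable (Pi\<^sub>M {..<n} (\<lambda>_. ?U))"
      proof (rule U.borel_measurable_nn_integral)
        have "(\<lambda>z. (fst z)(n := snd z)) \<in> Pi\<^sub>M {..<n} (\<lambda>_. ?U) \<Otimes>\<^sub>M ?U \<rightarrow>\<^sub>M Pi\<^sub>M (insert n {..<n}) (\<lambda>_. ?U)"
          using measurable_add_dim[of n "{..<n}" "\<lambda>_. ?U"] by (simp add: case_prod_beta')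
        from measurable_compose[OF this tagS[OF that]]
        show "(\<lambda>(v, w). g (\<lambda>i\<in>insert n {..<n}. ((\<tau>(n := t)) i, (v(n := w)) i)))
          \<in> borel_measurable (Pi\<^sub>M {..<n} (\<lambda>_. ?U) \<Otimes>\<^sub>M ?U)"
          by (simp add: case_prod_beta')
      qed
    qed
    have "(\<integral>\<^sup>+v. (\<integral>\<^sup>+z. g ((\<lambda>i\<in>{..<n}. (\<tau> i, v i))(n := z)) \<partial>?R) \<partial>Pi\<^sub>M {..<n} (\<lambda>_. ?U)) =
      (\<integral>\<^sup>+v. (\<Sum>t\<in>?L. \<integral>\<^sup>+w. g ((\<lambda>i\<in>{..<n}. (\<tau> i, v i))(n := (t, w))) \<partial>?U) \<partial>Pi\<^sub>M {..<n} (\<lambda>_. ?U))"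
    proof (rule nn_integral_cong)
      fix v assume "v \<in> space (Pi\<^sub>M {..<n} (\<lambda>_. ?U))"
      then have "(\<lambda>i\<in>{..<n}. (\<tau> i, v i)) \<in> space (Pi\<^sub>M {..<n} (\<lambda>_. ?R))"
        by (rule measurable_space[OF tagn])
      from measurable_compose[OF upd[OF this] g]
      show "(\<integral>\<^sup>+z. g ((\<lambda>i\<in>{..<n}. (\<tau> i, v i))(n := z)) \<partial>?R) =
        (\<Sum>t\<in>?L. \<integral>\<^sup>+w. g ((\<lambda>i\<in>{..<n}. (\<tau> i, v i))(n := (t, w))) \<partial>?U)"
        by (rule nn_integral_bead_reference)
    qed
    also have "\<dots> = (\<Sum>t\<in>?L. \<integral>\<^sup>+v. (\<integral>\<^sup>+w. g ((\<lambda>i\<in>{..<n}. (\<tau> i, v i))(n := (t, w))) \<partial>?U) \<partial>Pi\<^sub>M {..<n} (\<lambda>_. ?U))"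
      by (rule nn_integral_sum) (rule meas_w)
    also have "\<dots> = (\<Sum>t\<in>?L. \<integral>\<^sup>+v. g (\<lambda>i\<in>{..<Suc n}. ((\<tau>(n := t)) i, v i)) \<partial>Pi\<^sub>M {..<Suc n} (\<lambda>_. ?U))"
      unfolding ins eq
      by (intro sum.cong refl PU.product_nn_integral_insert[symmetric]) (use tagS in auto)
    finally show "(\<integral>\<^sup>+v. (\<integral>\<^sup>+z. g ((\<lambda>i\<in>{..<n}. (\<tau> i, v i))(n := z)) \<partial>?R) \<partial>Pi\<^sub>M {..<n} (\<lambda>_. ?U)) =
      (\<Sum>t\<in>?L. \<integral>\<^sup>+v. g (\<lambda>i\<in>{..<Suc n}. ((\<tau>(n := t)) i, v i)) \<partial>Pi\<^sub>M {..<Suc n} (\<lambda>_. ?U))" .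
  qed
  also have "\<dots> = (\<Sum>(t, \<tau>)\<in>?L \<times> ({..<n} \<rightarrow>\<^sub>E ?L).
      \<integral>\<^sup>+v. g (\<lambda>i\<in>{..<Suc n}. ((\<tau>(n := t)) i, v i)) \<partial>Pi\<^sub>M {..<Suc n} (\<lambda>_. ?U))"
    by (subst sum.swap) (simp add: sum.cartesian_product)
  also have "\<dots> = (\<Sum>\<tau>\<in>{..<Suc n} \<rightarrow>\<^sub>E ?L.
      \<integral>\<^sup>+v. g (\<lambda>i\<in>{..<Suc n}. (\<tau> i, v i)) \<partial>Pi\<^sub>M {..<Suc n} (\<lambda>_. ?U))"
    unfolding ins PiE_insert_eq
    by (subst sum.reindex[OF inj_combinator]) (simp_all add: case_prod_beta')
  finally show ?case .
qed

context gram_inverse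
begin

section \<open>Ordered tuples and labelled configurations\<close>

definition injections :: "nat \<Rightarrow> (nat \<Rightarrow> nat \<times> nat) set" where
  "injections n = {\<sigma> \<in> {..<n} \<rightarrow>\<^sub>E labels. inj_on \<sigma> {..<n}}"

definition tuple :: "nat \<Rightarrow> (nat \<Rightarrow> nat \<times> nat) \<Rightarrow> (nat \<times> nat \<Rightarrow> real) \<Rightarrow> nat \<Rightarrow> nat \<times> real" where
  "tuple n \<sigma> x = (\<lambda>i\<in>{..<n}. labelled \<sigma> x i)"

lemma finite_injections: "finite (injections n)"
  by (rule finite_subset[of _ "{..<n} \<rightarrow>\<^sub>E labels"])
     (auto simp: injections_def intro!: finite_PiE finite_labels)

lemma injections_bij: "\<sigma> \<in> injections (p * q) \<Longrightarrow> bij_betw \<sigma> {..<p * q} labels"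
proof (rule bij_betw_imageI)
  assume \<sigma>: "\<sigma> \<in> injections (p * q)"
  then show inj: "inj_on \<sigma> {..<p * q}" by (simp add: injections_def)
  show "\<sigma> ` {..<p * q} = labels"
  proof (rule card_subset_eq[OF finite_labels])
    show "\<sigma> ` {..<p * q} \<subseteq> labels"
      using \<sigma> unfolding injections_def by (blast dest: PiE_mem)
    show "card (\<sigma> ` {..<p * q}) = card labels" by (simp add: card_image[OF inj] card_labels)
  qed
qed

lemma injections_empty: "p * q < n \<Longrightarrow> injections n = {}"
proof (rule ccontr)
  assume n: "p * q < n" and "injections n \<noteq> {}"
  then obtain \<sigma> where "inj_on \<sigma> {..<n}" "\<sigma> ` {..<n} \<subseteq> labels"
    by (auto simp: injections_def)
  from card_inj_on_le[OF this finite_labels] n show False by (simp add: card_labels)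
qed

lemma measurable_tuple:
  assumes "\<sigma> \<in> injections n"
  shows "tuple n \<sigma> \<in> bead_base p q \<rightarrow>\<^sub>M Pi\<^sub>M {..<n} (\<lambda>_. ref)"
  unfolding tuple_def[abs_def] labelled_def
proof (rule measurable_restrict)
  fix i assume "i \<in> {..<n}"
  then have l: "\<sigma> i \<in> labels" using assms by (auto simp: injections_def)
  have "(\<lambda>x. x (\<sigma> i)) \<in> bead_base p q \<rightarrow>\<^sub>M unit_lebesgue"
    unfolding bead_base_def using measurable_component_singleton[OF l, of "\<lambda>_. unit_lebesgue"] .
  then show "(\<lambda>x. (fst (\<sigma> i), x (\<sigma> i))) \<in> bead_base p q \<rightarrow>\<^sub>M ref"
    unfolding bead_reference_def using l
    by (intro measurable_Pair measurable_const) (cases "\<sigma> i"; auto simp: mem_labels)+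
qed

lemma measurable_row_position:
  assumes "t \<in> {1..p + q}" "i \<in> {1..rank_bound t}"
  shows "(\<lambda>x. row_position x t i) \<in> borel_measurable (bead_base p q)"
proof (cases "t \<le> p \<and> i = t")
  case False
  then have "(t - 1, i) \<in> labels"
    using assms p_le_q by (auto simp: mem_labels num_particles_def rank_bound_def)
  from measurable_bead_base_component[OF this] False show ?thesis by (auto simp: row_position_def)
qed (simp add: row_position_def)

lemma measurable_col_position:
  assumes "t \<in> {1..p + q}" "i \<in> {1..rank_bound t}"
  shows "(\<lambda>x. col_position x t i) \<in> borel_measurable (bead_base p q)"
proof (cases "q < t \<and> i = 1")
  case False
  then have "(t, if t \<le> q then i else i - 1) \<in> labels"
    using assms p_le_q by (auto simp: mem_labels num_particles_def rank_bound_def)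
  from measurable_bead_base_component[OF this] False show ?thesis
    by (cases "t \<le> q") (auto simp: col_position_def)
qed (simp add: col_position_def)

lemma measurable_weakly_interlaced: "Measurable.pred (bead_base p q) weakly_interlaced"
proof -
  have *: "Measurable.pred (bead_base p q) (\<lambda>x. row_position x t i < col_position x t i \<and>
     (i < rank_bound t \<longrightarrow> col_position x t (Suc i) \<le> row_position x t i))"
    if t: "t \<in> {1..p + q}" and i: "i \<in> {1..rank_bound t}" for t i
  proof (rule pred_intros_logic(3))
    show "Measurable.pred (bead_base p q) (\<lambda>x. row_position x t i < col_position x t i)"
      by (intro borel_measurable_pred_less measurable_row_position measurable_col_position t i)
    show "Measurable.pred (bead_base p q) (\<lambda>x. i < rank_bound t \<longrightarrow> col_position x t (Suc i) \<le> row_position x t i)"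
    proof (cases "i < rank_bound t")
      case True
      then have "Suc i \<in> {1..rank_bound t}" by auto
      from borel_measurable_le[OF measurable_col_position[OF t this] measurable_row_position[OF t i]]
      show ?thesis using True by (simp add: pred_def)
    qed simp
  qed
  show ?thesis unfolding weakly_interlaced_def[abs_def]
    by (intro pred_intros_finite finite_atLeastAtMost) (rule *)
qed

definition weak_weight :: "(nat \<times> nat \<Rightarrow> real) \<Rightarrow> real" where
  "weak_weight x = (if sorted_config x \<and> weakly_interlaced x then 1 else 0)"

lemma measurable_weak_weight: "weak_weight \<in> borel_measurable (bead_base p q)"
proof -
  have "Measurable.pred (bead_base p q) (\<lambda>x. sorted_config x \<and> weakly_interlaced x)"
    by (intro pred_intros_logic measurable_sorted_config measurable_weakly_interlaced)
  then show ?thesis unfolding weak_weight_def[abs_def]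
    by (intro measurable_If borel_measurable_const) (simp add: pred_def)
qed

lemma AE_bead_weight_eq_weak_weight: "AE x in bead_base p q. bead_weight p q x = weak_weight x"
  using AE_bead_base_inj AE_space
proof eventually_elim
  case (elim x)
  have "0 < x l \<and> x l < 1" if "l \<in> labels" for l by (rule bead_base_range[OF elim(2) that])
  from bead_weight_eq[OF this] interlaced_iff_weakly_interlaced[OF this] elim(1) show ?case
    by (simp add: weak_weight_def)
qed

text \<open>Inverse of \<open>tuple\<close> on tuples of full length. It forgets the lines of
  \<open>Y\<close>, which is why \<open>compatible\<close> tests them separately.\<close>

definition unlabel :: "(nat \<Rightarrow> nat \<times> nat) \<Rightarrow> (nat \<Rightarrow> nat \<times> real) \<Rightarrow> nat \<times> nat \<Rightarrow> real" where
  "unlabel \<sigma> Y = (\<lambda>l\<in>labels. snd (Y (inv_into {..<p * q} \<sigma> l)))"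

definition compatible :: "(nat \<Rightarrow> nat \<times> nat) \<Rightarrow> (nat \<Rightarrow> nat \<times> real) \<Rightarrow> bool" where
  "compatible \<sigma> Y \<longleftrightarrow> (\<forall>i<p * q. fst (\<sigma> i) = fst (Y i))"

lemma unlabel_label:
  assumes "\<sigma> \<in> injections (p * q)" "i < p * q"
  shows "unlabel \<sigma> Y (\<sigma> i) = snd (Y i)"
proof -
  have "inv_into {..<p * q} \<sigma> (\<sigma> i) = i"
    using assms by (intro inv_into_f_f) (auto simp: injections_def)
  moreover have "\<sigma> i \<in> labels" using assms by (auto simp: injections_def)
  ultimately show ?thesis by (simp add: unlabel_def)
qed

lemma labelled_unlabel:
  assumes "\<sigma> \<in> injections (p * q)" "compatible \<sigma> Y" "i < p * q"
  shows "labelled \<sigma> (unlabel \<sigma> Y) i = Y i"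
proof (rule prod_eqI)
  show "fst (labelled \<sigma> (unlabel \<sigma> Y) i) = fst (Y i)"
    using assms(2,3) by (simp add: labelled_def compatible_def)
  show "snd (labelled \<sigma> (unlabel \<sigma> Y) i) = snd (Y i)"
    using unlabel_label[OF assms(1,3)] by (simp add: labelled_def)
qed

lemma corr_det_cong:
  assumes "\<And>i. i < n \<Longrightarrow> Y i = Y' i"
  shows "corr_det n Y = corr_det n Y'"
proof -
  have "\<pi> i < n" if "\<pi> permutes {..<n}" "i < n" for \<pi> i
    using permutes_in_image[OF that(1), of i] that(2) by simp
  with assms show ?thesis unfolding corr_det_def by (intro sum.cong refl) (auto intro!: prod.cong)
qed

definition rank_of :: "(nat \<Rightarrow> nat \<times> real) \<Rightarrow> nat \<Rightarrow> nat" where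
  "rank_of Y i = card {j. j < p * q \<and> fst (Y j) = fst (Y i) \<and> snd (Y i) \<le> snd (Y j)}"

text \<open>\<open>\<sigma>\<close> maps the points on the line of \<open>Y i\<close> that are not
  below it onto the labels of ranks \<open>1\<close> to \<open>snd (\<sigma> i)\<close>. So
  \<open>Y\<close> determines its sorting labelling, which gives uniqueness in
  \<open>corr_det_top\<close>.\<close>

lemma sorted_unlabel_rank:
  assumes \<sigma>: "\<sigma> \<in> injections (p * q)" "compatible \<sigma> Y" "sorted_config (unlabel \<sigma> Y)" and i: "i < p * q"
  shows "\<sigma> i = (fst (Y i), rank_of Y i)"
proof -
  let ?S = "{j. j < p * q \<and> fst (Y j) = fst (Y i) \<and> snd (Y i) \<le> snd (Y j)}"
  have bij: "bij_betw \<sigma> {..<p * q} labels" by (rule injections_bij[OF \<sigma>(1)])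
  have lab: "\<sigma> j \<in> labels" if "j < p * q" for j using bij_betwE[OF bij] that by auto
  have le: "snd (Y i) \<le> snd (Y j) \<longleftrightarrow> snd (\<sigma> j) \<le> snd (\<sigma> i)"
    if jlt: "j < p * q" and same: "fst (\<sigma> j) = fst (\<sigma> i)" for j
  proof -
    obtain t a b where t: "\<sigma> i = (t, a)" "\<sigma> j = (t, b)" using same by (metis prod.collapse)
    have m: "1 \<le> t" "t < p + q" "1 \<le> a" "a \<le> num_particles p q t" "1 \<le> b" "b \<le> num_particles p q t"
      using lab[OF i] lab[OF jlt] t by (auto simp: mem_labels)
    have "unlabel \<sigma> Y (t, a) = snd (Y i)" "unlabel \<sigma> Y (t, b) = snd (Y j)"
      using unlabel_label[OF \<sigma>(1) i, of Y] unlabel_label[OF \<sigma>(1) jlt, of Y] t by auto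
    then show ?thesis
      using sorted_configD[OF \<sigma>(3) m(1,2), of a b] sorted_configD[OF \<sigma>(3) m(1,2), of b a] m t
      by (cases a b rule: linorder_cases) auto
  qed
  have "\<sigma> ` ?S = {fst (\<sigma> i)} \<times> {1..snd (\<sigma> i)}"
  proof (intro equalityI subsetI)
    fix d assume "d \<in> \<sigma> ` ?S"
    then obtain j where j: "j < p * q" "fst (Y j) = fst (Y i)" "snd (Y i) \<le> snd (Y j)" "d = \<sigma> j" by auto
    then have "fst (\<sigma> j) = fst (\<sigma> i)" using \<sigma>(2) i by (auto simp: compatible_def)
    with le[of j] j lab[of j] show "d \<in> {fst (\<sigma> i)} \<times> {1..snd (\<sigma> i)}"
      by (cases "\<sigma> j") (auto simp: mem_labels)
  next
    fix d assume d: "d \<in> {fst (\<sigma> i)} \<times> {1..snd (\<sigma> i)}"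
    then have "d \<in> labels" using lab[OF i] by (cases "\<sigma> i") (auto simp: mem_labels)
    then obtain j where j: "j < p * q" "d = \<sigma> j"
      unfolding bij_betw_imp_surj_on[OF bij, symmetric] by auto
    then have "fst (\<sigma> j) = fst (\<sigma> i)" "snd (\<sigma> j) \<le> snd (\<sigma> i)" using d by auto
    with le[of j] j i \<sigma>(2) have "j \<in> ?S" by (auto simp: compatible_def)
    with j show "d \<in> \<sigma> ` ?S" by blast
  qed
  moreover have "card (\<sigma> ` ?S) = card ?S"
    by (rule card_image) (use bij in \<open>auto simp: bij_betw_def intro: inj_on_subset\<close>)
  ultimately have "rank_of Y i = snd (\<sigma> i)" by (simp add: rank_of_def)
  then show ?thesis using \<sigma>(2) i by (auto simp: compatible_def prod_eq_iff)
qed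

lemma corr_det_nonzero_inj:
  assumes "corr_det n Y \<noteq> 0"
  shows "inj_on Y {..<n}"
proof (rule inj_onI, rule ccontr)
  fix i j assume ij: "i \<in> {..<n}" "j \<in> {..<n}" "Y i = Y j" "i \<noteq> j"
  let ?A = "Matrix.mat n n (\<lambda>(i, j). corr_kernel (Y i) (Y j))"
  have "row ?A i = row ?A j" using ij by (intro eq_vecI) auto
  then have "Determinant.det ?A = 0"
    using ij by (intro det_identical_rows[of ?A n i j]) auto
  with assms show False by (simp add: corr_det_eq_det)
qed

text \<open>A nonzero determinant supplies what ranking needs: the points are distinct, as rows
  would coincide otherwise, and line \<open>t\<close> has at most \<open>num_particles p q t\<close>
  of them. With \<open>p * q\<close> points the ranks then exhaust the labels.\<close>

lemma exists_sorting:
  assumes Y: "\<And>i. i < p * q \<Longrightarrow> Y i \<in> space ref" and nz: "corr_det (p * q) Y \<noteq> 0"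
  shows "\<exists>\<sigma>\<in>injections (p * q). compatible \<sigma> Y \<and> sorted_config (unlabel \<sigma> Y)"
proof -
  let ?S = "\<lambda>i. {j. j < p * q \<and> fst (Y j) = fst (Y i) \<and> snd (Y i) \<le> snd (Y j)}"
  define \<sigma> where "\<sigma> = (\<lambda>i\<in>{..<p * q}. (fst (Y i), rank_of Y i))"
  have Yinj: "inj_on Y {..<p * q}" by (rule corr_det_nonzero_inj[OF nz])
  have less: "rank_of Y j < rank_of Y i"
    if "i < p * q" "j < p * q" "fst (Y i) = fst (Y j)" "snd (Y i) < snd (Y j)" for i j
    unfolding rank_of_def
  proof (rule psubset_card_mono)
    have "i \<in> ?S i" "i \<notin> ?S j" "?S j \<subseteq> ?S i" using that by auto
    then show "?S j \<subset> ?S i" by blast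
  qed simp
  have le: "rank_of Y j \<le> rank_of Y i"
    if "i < p * q" "j < p * q" "fst (Y i) = fst (Y j)" "snd (Y i) \<le> snd (Y j)" for i j
    unfolding rank_of_def using that by (intro card_mono) auto
  have "\<sigma> i \<in> labels" if i: "i < p * q" for i
  proof -
    have t: "1 \<le> fst (Y i)" "fst (Y i) \<le> p + q - 1" using Y[OF i] by (auto simp: space_bead_reference)
    have "rank_of Y i \<le> card {j. j < p * q \<and> fst (Y j) = fst (Y i)}"
      unfolding rank_of_def by (intro card_mono) auto
    also have "\<dots> \<le> num_particles p q (fst (Y i))"
      by (rule corr_det_nonzero_card_line[OF nz t])
    finally have "rank_of Y i \<le> num_particles p q (fst (Y i))" .
    moreover have "1 \<le> rank_of Y i"
      unfolding rank_of_def Suc_le_eq One_nat_def using i by (subst card_gt_0_iff) auto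
    ultimately show ?thesis using t i by (simp add: \<sigma>_def mem_labels)
  qed
  moreover have "inj_on \<sigma> {..<p * q}"
  proof (rule inj_onI)
    fix i j assume ij: "i \<in> {..<p * q}" "j \<in> {..<p * q}" "\<sigma> i = \<sigma> j"
    then have "fst (Y i) = fst (Y j)" "rank_of Y i = rank_of Y j" by (auto simp: \<sigma>_def)
    with ij less[of i j] less[of j i] have "Y i = Y j"
      by (cases "snd (Y i)" "snd (Y j)" rule: linorder_cases) (auto simp: prod_eq_iff)
    with ij Yinj show "i = j" by (auto dest: inj_onD)
  qed
  ultimately have inj: "\<sigma> \<in> injections (p * q)" by (auto simp: injections_def \<sigma>_def)
  have comp: "compatible \<sigma> Y" by (auto simp: compatible_def \<sigma>_def)
  have "sorted_config (unlabel \<sigma> Y)" unfolding sorted_config_def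
  proof (intro ballI impI)
    fix t a b assume tab: "t \<in> {1..p + q - 1}" "a \<in> {1..num_particles p q t}" "b \<in> {1..num_particles p q t}" "a < b"
    then have "(t, a) \<in> labels" "(t, b) \<in> labels" by (auto simp: mem_labels)
    then obtain i j where ij: "i < p * q" "\<sigma> i = (t, a)" "j < p * q" "\<sigma> j = (t, b)"
      unfolding bij_betw_imp_surj_on[OF injections_bij[OF inj], symmetric] by auto
    then have "fst (Y i) = fst (Y j)" "rank_of Y i < rank_of Y j" using tab(4) by (auto simp: \<sigma>_def)
    with le[of i j] ij have "snd (Y j) < snd (Y i)" by (meson not_le)
    then show "unlabel \<sigma> Y (t, b) < unlabel \<sigma> Y (t, a)"
      using unlabel_label[OF inj ij(1), of Y] unlabel_label[OF inj ij(3), of Y] ij by simp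
  qed
  with inj comp show ?thesis by blast
qed

text \<open>At most one labelling sorts \<open>Y\<close>; if none does, both sides are zero. The
  weak inequalities make this an identity at every \<open>Y\<close> rather than at almost every
  one.\<close>

lemma corr_det_top:
  assumes Y: "Y \<in> space (Pi\<^sub>M {..<p * q} (\<lambda>_. ref))"
  shows "corr_det (p * q) Y =
    top_constant * (\<Sum>\<sigma>\<in>injections (p * q). if compatible \<sigma> Y then weak_weight (unlabel \<sigma> Y) else 0)"
proof -
  let ?f = "\<lambda>\<sigma>. if compatible \<sigma> Y then weak_weight (unlabel \<sigma> Y) else 0"
  have Yi: "Y i \<in> space ref" if "i < p * q" for i using Y that by (auto simp: space_PiM PiE_iff)
  show ?thesis
  proof (cases "\<exists>\<sigma>\<in>injections (p * q). compatible \<sigma> Y \<and> sorted_config (unlabel \<sigma> Y)")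
    case False
    then have "corr_det (p * q) Y = 0" using exists_sorting[of Y] Yi by blast
    moreover have "?f \<sigma> = 0" if "\<sigma> \<in> injections (p * q)" for \<sigma>
      using False that by (auto simp: weak_weight_def)
    ultimately show ?thesis by simp
  next
    case True
    then obtain \<sigma> where \<sigma>: "\<sigma> \<in> injections (p * q)" "compatible \<sigma> Y" "sorted_config (unlabel \<sigma> Y)" by blast
    have bij: "bij_betw \<sigma> {..<p * q} labels" by (rule injections_bij[OF \<sigma>(1)])
    have pos: "0 < unlabel \<sigma> Y l \<and> unlabel \<sigma> Y l < 1" if l: "l \<in> labels" for l
    proof -
      obtain i where i: "i < p * q" "l = \<sigma> i"
        using l unfolding bij_betw_imp_surj_on[OF bij, symmetric] by auto
      have "unlabel \<sigma> Y l = snd (Y i)" using unlabel_label[OF \<sigma>(1) i(1)] i(2) by simp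
      then show ?thesis using Yi[OF i(1)] by (auto simp: space_bead_reference)
    qed
    have "\<sigma>' = \<sigma>" if "\<sigma>' \<in> injections (p * q)" "?f \<sigma>' \<noteq> 0" for \<sigma>'
    proof -
      have "compatible \<sigma>' Y" "sorted_config (unlabel \<sigma>' Y)"
        using that(2) by (auto simp: weak_weight_def split: if_splits)
      then have "\<sigma>' i = \<sigma> i" if "i < p * q" for i
        using sorted_unlabel_rank[OF \<open>\<sigma>' \<in> injections (p * q)\<close>] sorted_unlabel_rank[OF \<sigma>] that by simp
      then show ?thesis using that(1) \<sigma>(1)
        by (intro PiE_ext[of \<sigma>' "{..<p * q}" "\<lambda>_. labels"]) (auto simp: injections_def)
    qed
    then have zero: "\<forall>\<sigma>'\<in>injections (p * q) - {\<sigma>}. ?f \<sigma>' = 0" by blast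
    have "(\<Sum>\<sigma>\<in>injections (p * q). ?f \<sigma>) = (\<Sum>\<sigma>\<in>{\<sigma>}. ?f \<sigma>)"
      by (rule sum.mono_neutral_right[OF finite_injections _ zero]) (use \<sigma>(1) in simp)
    also have "\<dots> = (if weakly_interlaced (unlabel \<sigma> Y) then 1 else 0)"
      using \<sigma> by (simp add: weak_weight_def)
    finally have "top_constant * (\<Sum>\<sigma>\<in>injections (p * q). ?f \<sigma>) = corr_det (p * q) (labelled \<sigma> (unlabel \<sigma> Y))"
      using corr_det_labelled[OF bij \<sigma>(3) pos] by simp
    also have "\<dots> = corr_det (p * q) Y"
      by (rule corr_det_cong) (rule labelled_unlabel[OF \<sigma>(1,2)])
    finally show ?thesis by simp
  qed
qed

lemma measurable_unlabel:
  assumes "\<sigma> \<in> injections (p * q)"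
  shows "unlabel \<sigma> \<in> Pi\<^sub>M {..<p * q} (\<lambda>_. ref) \<rightarrow>\<^sub>M bead_base p q"
  unfolding unlabel_def[abs_def] bead_base_def
proof (rule measurable_restrict)
  fix l assume "l \<in> labels"
  then have "inv_into {..<p * q} \<sigma> l \<in> {..<p * q}"
    using bij_betw_imp_surj_on[OF injections_bij[OF assms]] inv_into_into[of l \<sigma> "{..<p * q}"]
    by blast
  then show "(\<lambda>Y. snd (Y (inv_into {..<p * q} \<sigma> l))) \<in> Pi\<^sub>M {..<p * q} (\<lambda>_. ref) \<rightarrow>\<^sub>M unit_lebesgue"
    unfolding bead_reference_def
    by (intro measurable_compose[OF measurable_component_singleton[of "inv_into {..<p * q} \<sigma> l"] measurable_snd])
qed

lemma measurable_compatible: "Measurable.pred (Pi\<^sub>M {..<p * q} (\<lambda>_. ref)) (compatible \<sigma>)"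
proof -
  have "Measurable.pred (Pi\<^sub>M {..<p * q} (\<lambda>_. ref)) (\<lambda>Y. fst (\<sigma> i) = fst (Y i))" if "i < p * q" for i
  proof -
    have "(\<lambda>Y. fst (Y i)) \<in> Pi\<^sub>M {..<p * q} (\<lambda>_. ref) \<rightarrow>\<^sub>M count_space UNIV"
      using that by (intro measurable_compose[OF measurable_component_singleton[of i] bead_reference_measurable_fst]) auto
    then show ?thesis by measurable
  qed
  then have "Measurable.pred (Pi\<^sub>M {..<p * q} (\<lambda>_. ref)) (\<lambda>Y. \<forall>i\<in>{..<p * q}. fst (\<sigma> i) = fst (Y i))"
    by (intro pred_intros_finite) auto
  moreover have "compatible \<sigma> = (\<lambda>Y. \<forall>i\<in>{..<p * q}. fst (\<sigma> i) = fst (Y i))"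
    by (rule ext) (simp add: compatible_def Ball_def)
  ultimately show ?thesis by (simp only:)
qed

lemma measurable_compatible_weight:
  assumes "\<sigma> \<in> injections (p * q)"
  shows "(\<lambda>Y. if compatible \<sigma> Y then weak_weight (unlabel \<sigma> Y) else 0) \<in> borel_measurable (Pi\<^sub>M {..<p * q} (\<lambda>_. ref))"
  by (intro measurable_If borel_measurable_const
      measurable_compose[OF measurable_unlabel[OF assms] measurable_weak_weight])
     (use measurable_compatible[of \<sigma>] in \<open>simp add: pred_def\<close>)

text \<open>Among all line assignments only that of \<open>\<sigma>\<close> is compatible. On it
  \<open>\<sigma>\<close> merely reindexes independent coordinates with the same law, which carries
  the integral over to labelled configurations.\<close>

lemma nn_integral_compatible_weight:
  assumes \<sigma>: "\<sigma> \<in> injections (p * q)" and B: "B \<in> sets (Pi\<^sub>M {..<p * q} (\<lambda>_. ref))"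
  shows "(\<integral>\<^sup>+Y. ennreal ((if compatible \<sigma> Y then weak_weight (unlabel \<sigma> Y) else 0) * indicator B Y)
      \<partial>Pi\<^sub>M {..<p * q} (\<lambda>_. ref)) =
    (\<integral>\<^sup>+x. ennreal (weak_weight x * indicator B (tuple (p * q) \<sigma> x)) \<partial>bead_base p q)"
proof -
  let ?N = "p * q" and ?U = "Pi\<^sub>M {..<p * q} (\<lambda>_. unit_lebesgue)"
  interpret U: prob_space unit_lebesgue by (rule prob_space_unit_lebesgue)
  let ?g = "\<lambda>Y. ennreal ((if compatible \<sigma> Y then weak_weight (unlabel \<sigma> Y) else 0) * indicator B Y)"
  let ?tag = "\<lambda>\<tau> v. \<lambda>i\<in>{..<?N}. (\<tau> i, v i)"
  have bij: "bij_betw \<sigma> {..<?N} labels" by (rule injections_bij[OF \<sigma>])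
  have lab: "\<sigma> i \<in> labels" if "i < ?N" for i using bij_betwE[OF bij] that by auto
  define \<tau> where "\<tau> = (\<lambda>i\<in>{..<?N}. fst (\<sigma> i))"
  have \<tau>: "\<tau> \<in> {..<?N} \<rightarrow>\<^sub>E {1..p + q - 1}"
  proof (intro PiE_I)
    fix i assume "i \<in> {..<?N}"
    then have "\<sigma> i \<in> labels" "\<tau> i = fst (\<sigma> i)" using lab by (auto simp: \<tau>_def)
    then show "\<tau> i \<in> {1..p + q - 1}" by (cases "\<sigma> i") (auto simp: particle_labels_def)
  qed (simp add: \<tau>_def)
  have g: "?g \<in> borel_measurable (Pi\<^sub>M {..<?N} (\<lambda>_. ref))"
    using measurable_compatible_weight[OF \<sigma>] B by measurable
  have pull: "(\<lambda>x. \<lambda>i\<in>{..<?N}. x (\<sigma> i)) \<in> bead_base p q \<rightarrow>\<^sub>M ?U"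
    unfolding bead_base_def
  proof (rule measurable_restrict)
    fix i assume "i \<in> {..<?N}"
    then show "(\<lambda>x. x (\<sigma> i)) \<in> Pi\<^sub>M labels (\<lambda>_. unit_lebesgue) \<rightarrow>\<^sub>M unit_lebesgue"
      using measurable_component_singleton[of "\<sigma> i" labels "\<lambda>_. unit_lebesgue"] lab by simp
  qed
  have tagU: "?tag \<tau> \<in> ?U \<rightarrow>\<^sub>M Pi\<^sub>M {..<?N} (\<lambda>_. ref)"
    by (rule measurable_tag) (rule PiE_mem[OF \<tau>])
  have gU: "(\<lambda>v. ?g (?tag \<tau> v)) \<in> borel_measurable ?U"
    by (rule measurable_compose[OF tagU g])
  have "(\<integral>\<^sup>+Y. ?g Y \<partial>Pi\<^sub>M {..<?N} (\<lambda>_. ref)) =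
    (\<Sum>\<tau>'\<in>{..<?N} \<rightarrow>\<^sub>E {1..p + q - 1}. \<integral>\<^sup>+v. ?g (?tag \<tau>' v) \<partial>?U)"
    by (rule nn_integral_PiM_bead_reference[OF g])
  also have "\<dots> = (\<Sum>\<tau>'\<in>{\<tau>}. \<integral>\<^sup>+v. ?g (?tag \<tau>' v) \<partial>?U)"
  proof (rule sum.mono_neutral_right)
    show "finite ({..<?N} \<rightarrow>\<^sub>E {1..p + q - 1})" by (intro finite_PiE) auto
    show "{\<tau>} \<subseteq> {..<?N} \<rightarrow>\<^sub>E {1..p + q - 1}" using \<tau> by simp
    show "\<forall>\<tau>'\<in>({..<?N} \<rightarrow>\<^sub>E {1..p + q - 1}) - {\<tau>}. (\<integral>\<^sup>+v. ?g (?tag \<tau>' v) \<partial>?U) = 0"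
    proof
      fix \<tau>' assume \<tau>': "\<tau>' \<in> ({..<?N} \<rightarrow>\<^sub>E {1..p + q - 1}) - {\<tau>}"
      have "\<not> compatible \<sigma> (?tag \<tau>' v)" for v :: "nat \<Rightarrow> real"
      proof
        assume "compatible \<sigma> (?tag \<tau>' v)"
        then have "\<tau>' i = \<tau> i" if "i < ?N" for i using that by (auto simp: compatible_def \<tau>_def)
        then have "\<tau>' = \<tau>" using \<tau> \<tau>' by (intro PiE_ext[of \<tau>' "{..<?N}" "\<lambda>_. {1..p + q - 1}"]) auto
        with \<tau>' show False by simp
      qed
      then show "(\<integral>\<^sup>+v. ?g (?tag \<tau>' v) \<partial>?U) = 0" by simp
    qed
  qed
  also have "\<dots> = (\<integral>\<^sup>+v. ?g (?tag \<tau> v) \<partial>?U)" by simp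
  also have "\<dots> = (\<integral>\<^sup>+v. ?g (?tag \<tau> v) \<partial>distr (bead_base p q) ?U (\<lambda>x. \<lambda>i\<in>{..<?N}. x (\<sigma> i)))"
    unfolding bead_base_def using bij prob_space_unit_lebesgue
    by (subst distr_PiM_reindex) (auto simp: bij_betw_def)
  also have "\<dots> = (\<integral>\<^sup>+x. ?g (?tag \<tau> (\<lambda>i\<in>{..<?N}. x (\<sigma> i))) \<partial>bead_base p q)"
    by (rule nn_integral_distr[OF pull]) (simp only: measurable_distr_eq1 gU)
  also have "\<dots> = (\<integral>\<^sup>+x. ennreal (weak_weight x * indicator B (tuple ?N \<sigma> x)) \<partial>bead_base p q)"
  proof (rule nn_integral_cong)
    fix x assume x: "x \<in> space (bead_base p q)"
    have e: "?tag \<tau> (\<lambda>i\<in>{..<?N}. x (\<sigma> i)) = tuple ?N \<sigma> x"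
      by (rule ext) (simp add: tuple_def labelled_def \<tau>_def)
    have c: "compatible \<sigma> (tuple ?N \<sigma> x)" by (simp add: compatible_def tuple_def labelled_def)
    have u: "unlabel \<sigma> (tuple ?N \<sigma> x) = x"
    proof
      fix l show "unlabel \<sigma> (tuple ?N \<sigma> x) l = x l"
      proof (cases "l \<in> labels")
        case True
        then obtain i where "i < ?N" "l = \<sigma> i"
          unfolding bij_betw_imp_surj_on[OF bij, symmetric] by auto
        then show ?thesis using unlabel_label[OF \<sigma>] by (simp add: tuple_def labelled_def)
      next
        case False
        then show ?thesis using PiE_arb[OF x[unfolded space_bead_base] False] by (simp add: unlabel_def)
      qed
    qed
    show "?g (?tag \<tau> (\<lambda>i\<in>{..<?N}. x (\<sigma> i))) = ennreal (weak_weight x * indicator B (tuple ?N \<sigma> x))"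
      unfolding e u by (simp only: c if_True)
  qed
  finally show ?thesis .
qed


section \<open>Factorial moments by descent from the top order\<close>

abbreviation refs :: "nat \<Rightarrow> (nat \<Rightarrow> nat \<times> real) measure" where
  "refs n \<equiv> Pi\<^sub>M {..<n} (\<lambda>_. ref)"

lemma finite_measure_refs: "finite_measure (refs n)"
proof -
  interpret R: finite_measure ref by (rule finite_measure_bead_reference)
  interpret PR: product_sigma_finite "\<lambda>_::nat. ref" ..
  have "emeasure (refs n) (space (refs n)) = (\<Prod>i<n. emeasure ref (space ref))"
    unfolding space_PiM by (rule PR.emeasure_PiM) auto
  also have "\<dots> \<noteq> \<infinity>"
    by (simp add: R.emeasure_eq_measure ennreal_power[symmetric] power_eq_top_ennreal)
  finally show ?thesis by (rule finite_measureI)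
qed

lemma prob_space_bead_base: "prob_space (bead_base p q)"
  unfolding bead_base_def by (intro prob_space_PiM prob_space_unit_lebesgue)

lemma integrable_corr_det_indicator:
  assumes "B \<in> sets (refs n)"
  shows "integrable (refs n) (\<lambda>Y. corr_det n Y * indicator B Y)"
proof -
  interpret finite_measure "refs n" by (rule finite_measure_refs)
  obtain C where C: "\<And>Y. Y \<in> space (refs n) \<Longrightarrow> \<bar>corr_det n Y\<bar> \<le> C" by (rule corr_det_bounded) blast
  show ?thesis
  proof (rule integrable_const_bound[where B = C])
    show "AE Y in refs n. norm (corr_det n Y * indicator B Y) \<le> C"
    proof (rule AE_I2)
      fix Y assume "Y \<in> space (refs n)"
      from C[OF this] show "norm (corr_det n Y * indicator B Y) \<le> C"
        by (auto simp: abs_mult split: split_indicator)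
    qed
    show "(\<lambda>Y. corr_det n Y * indicator B Y) \<in> borel_measurable (refs n)"
      by (intro borel_measurable_times measurable_corr_det borel_measurable_indicator assms)
  qed
qed

text \<open>The factorial moment measure before normalisation: injections list the ordered tuples of
  distinct particles.\<close>

definition moment :: "nat \<Rightarrow> (nat \<Rightarrow> nat \<times> real) set \<Rightarrow> real" where
  "moment n B = (\<Sum>\<sigma>\<in>injections n. \<integral>x. bead_weight p q x * indicator B (tuple n \<sigma> x) \<partial>bead_base p q)"

lemma measurable_indicator_tuple:
  "\<sigma> \<in> injections n \<Longrightarrow> B \<in> sets (refs n) \<Longrightarrow>
    (\<lambda>x. indicator B (tuple n \<sigma> x) :: real) \<in> borel_measurable (bead_base p q)"
  by (rule measurable_compose[OF measurable_tuple borel_measurable_indicator])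

lemma bead_weight_cases: "x \<in> space (bead_base p q) \<Longrightarrow> bead_weight p q x = 0 \<or> bead_weight p q x = 1"
proof -
  assume "x \<in> space (bead_base p q)"
  then have "0 < x l \<and> x l < 1" if "l \<in> labels" for l using bead_base_range that by blast
  from bead_weight_eq[OF this] show ?thesis by simp
qed

lemma corr_det_integral_top:
  assumes B: "B \<in> sets (refs (p * q))"
  shows "(\<integral>Y. corr_det (p * q) Y * indicator B Y \<partial>refs (p * q)) = top_constant * moment (p * q) B"
proof -
  let ?f = "\<lambda>\<sigma> Y. (if compatible \<sigma> Y then weak_weight (unlabel \<sigma> Y) else 0) * indicator B Y"
  interpret finite_measure "refs (p * q)" by (rule finite_measure_refs)
  have int: "integrable (refs (p * q)) (?f \<sigma>)" if "\<sigma> \<in> injections (p * q)" for \<sigma>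
  proof (rule integrable_const_bound[where B = 1])
    show "?f \<sigma> \<in> borel_measurable (refs (p * q))"
      by (intro borel_measurable_times measurable_compatible_weight that borel_measurable_indicator B)
  qed (auto simp: weak_weight_def split: split_indicator)
  have "(\<integral>Y. corr_det (p * q) Y * indicator B Y \<partial>refs (p * q)) =
    (\<integral>Y. top_constant * (\<Sum>\<sigma>\<in>injections (p * q). ?f \<sigma> Y) \<partial>refs (p * q))"
    by (intro Bochner_Integration.integral_cong refl) (simp only: corr_det_top mult.assoc sum_distrib_right)
  also have "\<dots> = top_constant * (\<Sum>\<sigma>\<in>injections (p * q). \<integral>Y. ?f \<sigma> Y \<partial>refs (p * q))"
    using int by (simp add: Bochner_Integration.integral_sum)
  also have "(\<Sum>\<sigma>\<in>injections (p * q). \<integral>Y. ?f \<sigma> Y \<partial>refs (p * q)) = moment (p * q) B"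
    unfolding moment_def
  proof (intro sum.cong refl)
    fix \<sigma> assume \<sigma>: "\<sigma> \<in> injections (p * q)"
    let ?g = "\<lambda>x. weak_weight x * indicator B (tuple (p * q) \<sigma> x) :: real"
    have gm: "?g \<in> borel_measurable (bead_base p q)"
      by (intro borel_measurable_times measurable_weak_weight measurable_indicator_tuple \<sigma> B)
    have "(\<integral>Y. ?f \<sigma> Y \<partial>refs (p * q)) = enn2real (\<integral>\<^sup>+Y. ennreal (?f \<sigma> Y) \<partial>refs (p * q))"
      using int[OF \<sigma>] by (intro integral_eq_nn_integral borel_measurable_integrable)
        (auto simp: weak_weight_def split: split_indicator)
    also have "\<dots> = enn2real (\<integral>\<^sup>+x. ennreal (?g x) \<partial>bead_base p q)"
      by (simp only: nn_integral_compatible_weight[OF \<sigma> B])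
    also have "\<dots> = (\<integral>x. ?g x \<partial>bead_base p q)"
      by (intro integral_eq_nn_integral[symmetric] gm) (auto simp: weak_weight_def split: split_indicator)
    also have "\<dots> = (\<integral>x. bead_weight p q x * indicator B (tuple (p * q) \<sigma> x) \<partial>bead_base p q)"
    proof (rule integral_cong_AE[OF gm])
      show "(\<lambda>x. bead_weight p q x * indicator B (tuple (p * q) \<sigma> x)) \<in> borel_measurable (bead_base p q)"
        by (intro borel_measurable_times measurable_bead_weight measurable_indicator_tuple \<sigma> B)
      show "AE x in bead_base p q. ?g x = bead_weight p q x * indicator B (tuple (p * q) \<sigma> x)"
        using AE_bead_weight_eq_weak_weight by eventually_elim simp
    qed
    finally show "(\<integral>Y. ?f \<sigma> Y \<partial>refs (p * q)) =
      (\<integral>x. bead_weight p q x * indicator B (tuple (p * q) \<sigma> x) \<partial>bead_base p q)" .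
  qed
  finally show ?thesis .
qed

text \<open>Leaving the last point free multiplies both the integral of \<open>corr_det\<close> and
  the \<open>moment\<close> by \<open>p * q - n\<close>; comparing them on cylinders drives the
  descent.\<close>

definition cylinder :: "nat \<Rightarrow> (nat \<Rightarrow> nat \<times> real) set \<Rightarrow> (nat \<Rightarrow> nat \<times> real) set" where
  "cylinder n B = {Y \<in> space (refs (Suc n)). restrict Y {..<n} \<in> B}"

lemma sets_cylinder:
  assumes "B \<in> sets (refs n)"
  shows "cylinder n B \<in> sets (refs (Suc n))"
proof -
  have "(\<lambda>Y. restrict Y {..<n}) \<in> refs (Suc n) \<rightarrow>\<^sub>M refs n"
    by (rule measurable_restrict_subset) auto
  from measurable_sets[OF this assms] show ?thesis
    by (simp add: cylinder_def vimage_def Int_def conj_commute)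
qed

lemma corr_det_integral_cylinder:
  assumes B: "B \<in> sets (refs n)"
  shows "(\<integral>Y. corr_det (Suc n) Y * indicator (cylinder n B) Y \<partial>refs (Suc n)) =
    (real (p * q) - real n) * (\<integral>Y. corr_det n Y * indicator B Y \<partial>refs n)"
proof -
  interpret R: finite_measure ref by (rule finite_measure_bead_reference)
  interpret PR: product_sigma_finite "\<lambda>_::nat. ref" ..
  have ins: "{..<Suc n} = insert n {..<n}" by auto
  have "(\<integral>Y. corr_det (Suc n) Y * indicator (cylinder n B) Y \<partial>refs (Suc n)) =
    (\<integral>Y. (\<integral>z. corr_det (Suc n) (Y(n := z)) * indicator (cylinder n B) (Y(n := z)) \<partial>ref) \<partial>refs n)"
    using integrable_corr_det_indicator[OF sets_cylinder[OF B]]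
    unfolding ins by (intro PR.product_integral_insert) auto
  also have "\<dots> = (\<integral>Y. (real (p * q) - real n) * (corr_det n Y * indicator B Y) \<partial>refs n)"
  proof (intro Bochner_Integration.integral_cong refl)
    fix Y assume Y: "Y \<in> space (refs n)"
    have "indicator (cylinder n B) (Y(n := z)) = (indicator B Y :: real)" if "z \<in> space ref" for z
    proof -
      have "restrict (Y(n := z)) {..<n} = Y"
        using Y by (auto simp: space_PiM PiE_iff extensional_def fun_eq_iff)
      moreover have "Y(n := z) \<in> space (refs (Suc n))"
        using Y that unfolding ins space_PiM by (intro PiE_fun_upd) auto
      ultimately show ?thesis by (simp add: cylinder_def indicator_def)
    qed
    then have "(\<integral>z. corr_det (Suc n) (Y(n := z)) * indicator (cylinder n B) (Y(n := z)) \<partial>ref) =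
      (\<integral>z. corr_det (Suc n) (Y(n := z)) * indicator B Y \<partial>ref)"
      by (intro Bochner_Integration.integral_cong refl) simp
    also have "\<dots> = (\<integral>z. corr_det (Suc n) (Y(n := z)) \<partial>ref) * indicator B Y" by simp
    also have "(\<integral>z. corr_det (Suc n) (Y(n := z)) \<partial>ref) = (real (p * q) - real n) * corr_det n Y"
      by (rule has_bochner_integral_integral_eq[OF corr_det_integrate_last])
         (use Y in \<open>auto simp: space_PiM PiE_iff\<close>)
    finally show "(\<integral>z. corr_det (Suc n) (Y(n := z)) * indicator (cylinder n B) (Y(n := z)) \<partial>ref) =
      (real (p * q) - real n) * (corr_det n Y * indicator B Y)" by (simp only: mult.assoc)
  qed
  finally show ?thesis by simp
qed

text \<open>The last value of an extended injection can be any of the \<open>p * q - n\<close>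
  labels not yet taken.\<close>

lemma sum_injections_Suc:
  fixes F :: "(nat \<Rightarrow> nat \<times> nat) \<Rightarrow> real"
  assumes "n \<le> p * q"
  shows "(\<Sum>\<sigma>\<in>injections (Suc n). F (restrict \<sigma> {..<n})) = (real (p * q) - real n) * (\<Sum>\<sigma>\<in>injections n. F \<sigma>)"
proof -
  let ?D = "SIGMA \<sigma>:injections n. labels - \<sigma> ` {..<n}"
  have ins: "{..<Suc n} = insert n {..<n}" by auto
  have restr: "restrict (\<sigma>(n := l)) {..<n} = \<sigma>" if "\<sigma> \<in> injections n" for \<sigma> l
    using that by (auto simp: injections_def PiE_iff extensional_def fun_eq_iff)
  have restr': "restrict \<sigma> {..<n} = \<sigma>" if "\<sigma> \<in> injections n" for \<sigma>
    using that by (auto simp: injections_def intro: PiE_restrict)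
  have bij: "bij_betw (\<lambda>(\<sigma>, l). \<sigma>(n := l)) ?D (injections (Suc n))"
  proof (rule bij_betw_imageI)
    show "inj_on (\<lambda>(\<sigma>, l). \<sigma>(n := l)) ?D"
    proof (rule inj_onI)
      fix u v assume uv: "u \<in> ?D" "v \<in> ?D" "(\<lambda>(\<sigma>, l). \<sigma>(n := l)) u = (\<lambda>(\<sigma>, l). \<sigma>(n := l)) v"
      obtain \<sigma> l \<sigma>' l' where e: "u = (\<sigma>, l)" "v = (\<sigma>', l')" by (cases u; cases v)
      have h: "\<sigma> \<in> injections n" "\<sigma>' \<in> injections n" "\<sigma>(n := l) = \<sigma>'(n := l')"
        using uv by (auto simp: e)
      have "\<sigma> = \<sigma>'" using restr[OF h(1), of l] restr[OF h(2), of l'] h(3) by simp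
      moreover have "l = l'" using fun_cong[OF h(3), of n] by simp
      ultimately show "u = v" by (simp add: e)
    qed
    show "(\<lambda>(\<sigma>, l). \<sigma>(n := l)) ` ?D = injections (Suc n)"
    proof (intro equalityI subsetI)
      fix \<rho> assume "\<rho> \<in> (\<lambda>(\<sigma>, l). \<sigma>(n := l)) ` ?D"
      then obtain \<sigma> l where \<sigma>: "\<sigma> \<in> {..<n} \<rightarrow>\<^sub>E labels" "inj_on \<sigma> {..<n}" and l: "l \<in> labels" "l \<notin> \<sigma> ` {..<n}"
        and \<rho>: "\<rho> = \<sigma>(n := l)"
        by (auto simp: injections_def)
      have "\<rho> \<in> {..<Suc n} \<rightarrow>\<^sub>E labels" unfolding \<rho> ins by (rule PiE_fun_upd[OF l(1) \<sigma>(1)])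
      moreover have "inj_on \<rho> {..<Suc n}"
        unfolding \<rho> ins by (intro inj_on_fun_updI[THEN inj_on_insert[THEN iffD2, OF conjI]]) (use \<sigma>(2) l(2) in auto)
      ultimately show "\<rho> \<in> injections (Suc n)" by (simp add: injections_def)
    next
      fix \<rho> assume "\<rho> \<in> injections (Suc n)"
      then have \<rho>: "\<rho> \<in> {..<Suc n} \<rightarrow>\<^sub>E labels" "inj_on \<rho> {..<Suc n}" by (auto simp: injections_def)
      have "restrict \<rho> {..<n} \<in> injections n"
      proof -
        have "restrict \<rho> {..<n} \<in> {..<n} \<rightarrow>\<^sub>E labels"
          by (rule restrict_PiE[THEN iffD2]) (use PiE_mem[OF \<rho>(1)] in simp)
        moreover have "inj_on (restrict \<rho> {..<n}) {..<n}"
          unfolding inj_on_restrict_eq by (rule inj_on_subset[OF \<rho>(2)]) simp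
        ultimately show ?thesis by (simp add: injections_def)
      qed
      moreover have "\<rho> n \<in> labels - restrict \<rho> {..<n} ` {..<n}"
      proof -
        have "\<rho> n \<noteq> \<rho> i" if "i < n" for i
          using inj_onD[OF \<rho>(2), of n i] that by auto
        then show ?thesis using PiE_mem[OF \<rho>(1), of n] by (simp add: image_iff)
      qed
      moreover have "(restrict \<rho> {..<n})(n := \<rho> n) = \<rho>"
      proof
        fix i show "((restrict \<rho> {..<n})(n := \<rho> n)) i = \<rho> i"
          using PiE_arb[OF \<rho>(1), of i] by (cases "i < n"; cases "i = n") auto
      qed
      ultimately show "\<rho> \<in> (\<lambda>(\<sigma>, l). \<sigma>(n := l)) ` ?D"
        by (intro image_eqI[of _ _ "(restrict \<rho> {..<n}, \<rho> n)"]) auto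
    qed
  qed
  have "(\<Sum>\<sigma>\<in>injections (Suc n). F (restrict \<sigma> {..<n})) = (\<Sum>(\<sigma>, l)\<in>?D. F \<sigma>)"
    unfolding sum.reindex_bij_betw[OF bij, symmetric] by (intro sum.cong) (auto simp: restr restr')
  also have "\<dots> = (\<Sum>\<sigma>\<in>injections n. \<Sum>l\<in>labels - \<sigma> ` {..<n}. F \<sigma>)"
    by (subst sum.Sigma) (auto simp: finite_injections finite_labels)
  also have "\<dots> = (\<Sum>\<sigma>\<in>injections n. (real (p * q) - real n) * F \<sigma>)"
  proof (intro sum.cong refl)
    fix \<sigma> assume \<sigma>: "\<sigma> \<in> injections n"
    then have "\<sigma> ` {..<n} \<subseteq> labels" "card (\<sigma> ` {..<n}) = n"
    proof -
      show "\<sigma> ` {..<n} \<subseteq> labels" using \<sigma> unfolding injections_def by (blast dest: PiE_mem)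
      show "card (\<sigma> ` {..<n}) = n" using \<sigma> by (simp add: injections_def card_image)
    qed
    then have "card (labels - \<sigma> ` {..<n}) = p * q - n"
      by (subst card_Diff_subset) (auto simp: card_labels)
    then show "(\<Sum>l\<in>labels - \<sigma> ` {..<n}. F \<sigma>) = (real (p * q) - real n) * F \<sigma>"
      using assms by (simp add: of_nat_diff)
  qed
  finally show ?thesis by (simp add: sum_distrib_left)
qed

lemma moment_cylinder:
  assumes B: "B \<in> sets (refs n)" and n: "n \<le> p * q"
  shows "moment (Suc n) (cylinder n B) = (real (p * q) - real n) * moment n B"
proof -
  let ?F = "\<lambda>\<sigma>. \<integral>x. bead_weight p q x * indicator B (tuple n \<sigma> x) \<partial>bead_base p q"
  have "moment (Suc n) (cylinder n B) = (\<Sum>\<sigma>\<in>injections (Suc n). ?F (restrict \<sigma> {..<n}))"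
    unfolding moment_def
  proof (intro sum.cong refl Bochner_Integration.integral_cong)
    fix \<sigma> x assume \<sigma>: "\<sigma> \<in> injections (Suc n)" and x: "x \<in> space (bead_base p q)"
    have "tuple (Suc n) \<sigma> x \<in> space (refs (Suc n))" by (rule measurable_space[OF measurable_tuple[OF \<sigma>] x])
    moreover have "restrict (tuple (Suc n) \<sigma> x) {..<n} = tuple n (restrict \<sigma> {..<n}) x"
      by (auto simp: tuple_def labelled_def fun_eq_iff)
    ultimately show "bead_weight p q x * indicator (cylinder n B) (tuple (Suc n) \<sigma> x) =
      bead_weight p q x * indicator B (tuple n (restrict \<sigma> {..<n}) x)"
      by (simp add: cylinder_def indicator_def)
  qed
  also have "\<dots> = (real (p * q) - real n) * (\<Sum>\<sigma>\<in>injections n. ?F \<sigma>)"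
    by (rule sum_injections_Suc[OF n])
  finally show ?thesis by (simp add: moment_def)
qed

text \<open>Both sides satisfy the same recursion on cylinders, and below the top order the factor
  \<open>p * q - n\<close> can be cancelled.\<close>

lemma corr_det_integral:
  assumes "n \<le> p * q" "B \<in> sets (refs n)"
  shows "(\<integral>Y. corr_det n Y * indicator B Y \<partial>refs n) = top_constant * moment n B"
  using assms
proof (induction n arbitrary: B rule: inc_induct)
  case base
  then show ?case by (rule corr_det_integral_top)
next
  case (step n)
  have "(real (p * q) - real n) * (\<integral>Y. corr_det n Y * indicator B Y \<partial>refs n) =
    top_constant * moment (Suc n) (cylinder n B)"
    using step.IH[OF sets_cylinder[OF step.prems]] corr_det_integral_cylinder[OF step.prems] by simp
  also have "\<dots> = (real (p * q) - real n) * (top_constant * moment n B)"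
    using step.hyps by (simp add: moment_cylinder[OF step.prems])
  finally have "(real (p * q) - real n) * (\<integral>Y. corr_det n Y * indicator B Y \<partial>refs n) =
    (real (p * q) - real n) * (top_constant * moment n B)" .
  moreover have "real (p * q) - real n \<noteq> 0" using step.hyps by (simp del: of_nat_mult)
  ultimately show ?case by (metis mult_left_cancel)
qed

definition total_weight :: real where
  "total_weight = (\<integral>x. bead_weight p q x \<partial>bead_base p q)"

text \<open>The case of no points: the determinant is 1 and the moment is the total mass. In
  particular the total mass is not zero, so the process is properly normalised.\<close>

lemma top_constant_total_weight: "top_constant * total_weight = 1"
proof -
  have inj0: "injections 0 = {\<lambda>_. undefined}" by (auto simp: injections_def)
  have "moment 0 (space (refs 0)) = total_weight"
    unfolding moment_def inj0 total_weight_def by (simp add: tuple_def space_PiM restrict_def)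
  moreover have "(\<integral>Y. corr_det 0 Y * indicator (space (refs 0)) Y \<partial>refs 0) = 1"
    by (simp add: corr_det_def PiM_empty lebesgue_integral_count_space_finite)
  ultimately show ?thesis using corr_det_integral[of 0 "space (refs 0)"] by simp
qed

lemma total_weight_pos: "0 < total_weight" and top_constant_pos: "0 < top_constant"
proof -
  have "0 \<le> bead_weight p q x" if "x \<in> space (bead_base p q)" for x
    using bead_weight_cases[OF that] by auto
  then have "0 \<le> total_weight"
    unfolding total_weight_def by (intro integral_nonneg_AE AE_I2)
  moreover have "total_weight \<noteq> 0" using top_constant_total_weight by auto
  ultimately show "0 < total_weight" by simp
  then show "0 < top_constant"
    using zero_less_mult_pos2[of top_constant total_weight] top_constant_total_weight by simp
qed

text \<open>By descent: the integral of the next determinant over its last variable is a positive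
  multiple of this one, and the top one is a positive constant times a sum of indicators.\<close>

lemma corr_det_nonneg:
  assumes "Y \<in> space (refs n)"
  shows "0 \<le> corr_det n Y"
proof (cases "n \<le> p * q")
  case True
  then show ?thesis using assms
  proof (induction n arbitrary: Y rule: inc_induct)
    case base
    then show ?case using top_constant_pos
      by (auto simp: corr_det_top weak_weight_def intro!: mult_nonneg_nonneg sum_nonneg)
  next
    case (step n)
    have Y: "Y i \<in> space ref" if "i < n" for i using step.prems that by (auto simp: space_PiM PiE_iff)
    have ins: "{..<Suc n} = insert n {..<n}" by auto
    have "0 \<le> (\<integral>v. corr_det (Suc n) (Y(n := v)) \<partial>ref)"
    proof (intro integral_nonneg_AE AE_I2 step.IH)
      fix v assume "v \<in> space ref"
      then show "Y(n := v) \<in> space (refs (Suc n))"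
        using step.prems unfolding ins space_PiM by (intro PiE_fun_upd)
    qed
    also have "\<dots> = (real (p * q) - real n) * corr_det n Y"
      by (rule has_bochner_integral_integral_eq[OF corr_det_integrate_last[OF Y]])
    finally have "0 \<le> (real (p * q) - real n) * corr_det n Y" .
    moreover have "0 < real (p * q) - real n" using step.hyps by (simp del: of_nat_mult)
    ultimately show ?case using mult_pos_neg[of "real (p * q) - real n" "corr_det n Y"] by linarith
  qed
qed (simp add: corr_det_eq_0_if_large)

text \<open>Nonzero weight forces sortedness, so distinct labels give distinct points and tuples of
  distinct points correspond to injections into the labels.\<close>

lemma card_tuples:
  assumes x: "x \<in> space (bead_base p q)" and w: "bead_weight p q x \<noteq> 0" and B: "B \<in> sets (refs n)"
  shows "of_nat (card {Y \<in> B. Y \<in> {..<n} \<rightarrow>\<^sub>E bead_points p q x \<and> inj_on Y {..<n}}) =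
    (\<Sum>\<sigma>\<in>injections n. indicator B (tuple n \<sigma> x) :: ennreal)"
proof -
  have "0 < x l \<and> x l < 1" if "l \<in> labels" for l using bead_base_range[OF x that] .
  from bead_weight_eq[OF this] w have sorted: "sorted_config x" by (auto split: if_splits)
  define pt where "pt l = (fst l, x l)" for l :: "nat \<times> nat"
  have inj_pt: "inj_on pt labels"
  proof (rule inj_onI)
    fix l l' assume l: "l \<in> labels" "l' \<in> labels" "pt l = pt l'"
    obtain t i j where e: "l = (t, i)" "l' = (t, j)" using l(3) by (cases l; cases l') (auto simp: pt_def)
    then show "l = l'"
      using l sorted_configD[OF sorted, of t i j] sorted_configD[OF sorted, of t j i]
      by (cases i j rule: linorder_cases) (auto simp: mem_labels pt_def)
  qed
  have img: "pt ` labels = bead_points p q x"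
    by (auto simp: pt_def bead_points_def line_positions_def particle_labels_def image_iff intro!: bexI)
  have tup: "tuple n \<sigma> x = (\<lambda>i\<in>{..<n}. pt (\<sigma> i))" for \<sigma>
    by (simp add: tuple_def labelled_def pt_def)
  let ?A = "{\<sigma> \<in> injections n. tuple n \<sigma> x \<in> B}"
  have "bij_betw (\<lambda>\<sigma>. tuple n \<sigma> x) ?A {Y \<in> B. Y \<in> {..<n} \<rightarrow>\<^sub>E bead_points p q x \<and> inj_on Y {..<n}}"
  proof (rule bij_betw_imageI)
    show "inj_on (\<lambda>\<sigma>. tuple n \<sigma> x) ?A"
    proof (rule inj_onI)
      fix \<sigma> \<rho> assume h: "\<sigma> \<in> ?A" "\<rho> \<in> ?A" "tuple n \<sigma> x = tuple n \<rho> x"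
      then have P: "\<sigma> \<in> {..<n} \<rightarrow>\<^sub>E labels" "\<rho> \<in> {..<n} \<rightarrow>\<^sub>E labels" by (auto simp: injections_def)
      show "\<sigma> = \<rho>"
      proof (rule PiE_ext[OF P])
        fix i assume i: "i \<in> {..<n}"
        have "pt (\<sigma> i) = pt (\<rho> i)" using fun_cong[OF h(3), of i] i by (simp add: tup)
        then show "\<sigma> i = \<rho> i" using inj_pt PiE_mem[OF P(1) i] PiE_mem[OF P(2) i] by (auto dest: inj_onD)
      qed
    qed
    show "(\<lambda>\<sigma>. tuple n \<sigma> x) ` ?A = {Y \<in> B. Y \<in> {..<n} \<rightarrow>\<^sub>E bead_points p q x \<and> inj_on Y {..<n}}"
    proof (intro equalityI subsetI)
      fix Y assume "Y \<in> (\<lambda>\<sigma>. tuple n \<sigma> x) ` ?A"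
      then obtain \<sigma> where \<sigma>: "\<sigma> \<in> {..<n} \<rightarrow>\<^sub>E labels" "inj_on \<sigma> {..<n}" "Y \<in> B" "Y = (\<lambda>i\<in>{..<n}. pt (\<sigma> i))"
        by (auto simp: injections_def tup)
      have "Y \<in> {..<n} \<rightarrow>\<^sub>E bead_points p q x"
        using PiE_mem[OF \<sigma>(1)] unfolding \<sigma>(4) img[symmetric] by auto
      moreover have "inj_on Y {..<n}"
      proof (rule inj_onI)
        fix i j assume ij: "i \<in> {..<n}" "j \<in> {..<n}" "Y i = Y j"
        then have "pt (\<sigma> i) = pt (\<sigma> j)" by (simp add: \<sigma>(4))
        then have "\<sigma> i = \<sigma> j"
          using inj_pt PiE_mem[OF \<sigma>(1) ij(1)] PiE_mem[OF \<sigma>(1) ij(2)] by (auto dest: inj_onD)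
        then show "i = j" using \<sigma>(2) ij by (auto dest: inj_onD)
      qed
      ultimately show "Y \<in> {Y \<in> B. Y \<in> {..<n} \<rightarrow>\<^sub>E bead_points p q x \<and> inj_on Y {..<n}}" using \<sigma>(3) by simp
    next
      fix Y assume "Y \<in> {Y \<in> B. Y \<in> {..<n} \<rightarrow>\<^sub>E bead_points p q x \<and> inj_on Y {..<n}}"
      then have Y: "Y \<in> B" "Y \<in> {..<n} \<rightarrow>\<^sub>E pt ` labels" "inj_on Y {..<n}" by (auto simp: img)
      define \<sigma> where "\<sigma> = (\<lambda>i\<in>{..<n}. inv_into labels pt (Y i))"
      have \<sigma>: "\<sigma> i \<in> labels" "pt (\<sigma> i) = Y i" if "i \<in> {..<n}" for i
        using PiE_mem[OF Y(2) that] that by (auto simp: \<sigma>_def inv_into_into f_inv_into_f)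
      have Yeq: "tuple n \<sigma> x = Y"
        unfolding tup using \<sigma>(2) PiE_arb[OF Y(2)] by (auto simp: fun_eq_iff)
      have "inj_on \<sigma> {..<n}"
      proof (rule inj_onI)
        fix i j assume ij: "i \<in> {..<n}" "j \<in> {..<n}" "\<sigma> i = \<sigma> j"
        then have "Y i = Y j" using \<sigma>(2)[OF ij(1)] \<sigma>(2)[OF ij(2)] by simp
        then show "i = j" using Y(3) ij by (auto dest: inj_onD)
      qed
      moreover have "\<sigma> \<in> {..<n} \<rightarrow>\<^sub>E labels" using \<sigma>(1) by (auto simp: \<sigma>_def)
      ultimately have "\<sigma> \<in> ?A" using Y(1) Yeq by (simp add: injections_def)
      then show "Y \<in> (\<lambda>\<sigma>. tuple n \<sigma> x) ` ?A" using Yeq by blast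
    qed
  qed
  then have "card {Y \<in> B. Y \<in> {..<n} \<rightarrow>\<^sub>E bead_points p q x \<and> inj_on Y {..<n}} = card ?A"
    by (rule bij_betw_same_card[symmetric])
  also have "of_nat (card ?A) = (\<Sum>\<sigma>\<in>?A. 1 :: ennreal)" by simp
  also have "\<dots> = (\<Sum>\<sigma>\<in>injections n. indicator B (tuple n \<sigma> x))"
    by (rule sum.mono_neutral_cong_left) (auto simp: finite_injections indicator_def)
  finally show ?thesis by simp
qed

theorem corr_det_is_correlation_function:
  "is_correlation_function (bead_process p q) (bead_points p q) ref n (corr_det n)"
  unfolding is_correlation_function_def
proof (intro conjI ballI)
  show "corr_det n \<in> borel_measurable (refs n)" by (rule measurable_corr_det)
  show "AE Y in refs n. 0 \<le> corr_det n Y" by (rule AE_I2) (rule corr_det_nonneg)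
  fix B assume B: "B \<in> sets (refs n)"
  interpret BB: prob_space "bead_base p q" by (rule prob_space_bead_base)
  let ?c = "\<lambda>x. of_nat (card {Y \<in> B. Y \<in> {..<n} \<rightarrow>\<^sub>E bead_points p q x \<and> inj_on Y {..<n}}) :: ennreal"
  let ?w = "\<lambda>x. ennreal (bead_weight p q x)"
  have int: "integrable (bead_base p q) (\<lambda>x. bead_weight p q x * h x)"
    if "h \<in> borel_measurable (bead_base p q)" "\<And>x. \<bar>h x\<bar> \<le> 1" for h
  proof (rule BB.integrable_const_bound[where B = 1])
    show "AE x in bead_base p q. norm (bead_weight p q x * h x) \<le> 1"
      using that(2) bead_weight_cases by (intro AE_I2) fastforce
    show "(\<lambda>x. bead_weight p q x * h x) \<in> borel_measurable (bead_base p q)"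
      by (intro borel_measurable_times measurable_bead_weight that)
  qed
  have nonneg: "AE x in bead_base p q. 0 \<le> bead_weight p q x"
    by (rule AE_I2) (use bead_weight_cases in fastforce)
  have Z: "(\<integral>\<^sup>+x. ?w x \<partial>bead_base p q) = ennreal total_weight"
    using int[of "\<lambda>_. 1"] nonneg unfolding total_weight_def by (subst nn_integral_eq_integral) auto
  have w_meas: "?w \<in> borel_measurable (bead_base p q)"
    by (rule measurable_compose[OF measurable_bead_weight measurable_ennreal])
  have weight_term: "(\<integral>\<^sup>+x. ?w x * indicator B (tuple n \<sigma> x) \<partial>bead_base p q) =
      ennreal (\<integral>x. bead_weight p q x * indicator B (tuple n \<sigma> x) \<partial>bead_base p q)"
    if \<sigma>: "\<sigma> \<in> injections n" for \<sigma>
  proof -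
    have "(\<integral>\<^sup>+x. ?w x * indicator B (tuple n \<sigma> x) \<partial>bead_base p q) =
      (\<integral>\<^sup>+x. ennreal (bead_weight p q x * indicator B (tuple n \<sigma> x)) \<partial>bead_base p q)"
      by (intro nn_integral_cong) (auto simp: indicator_def)
    also have "\<dots> = ennreal (\<integral>x. bead_weight p q x * indicator B (tuple n \<sigma> x) \<partial>bead_base p q)"
      by (rule nn_integral_eq_integral[OF int[OF measurable_indicator_tuple[OF \<sigma> B]]])
         (use nonneg in \<open>auto simp: indicator_def elim!: eventually_mono\<close>)
    finally show ?thesis .
  qed
  have term_nonneg: "0 \<le> (\<integral>x. bead_weight p q x * indicator B (tuple n \<sigma> x) \<partial>bead_base p q)" for \<sigma>
    by (intro integral_nonneg_AE) (use nonneg in \<open>auto simp: indicator_def elim!: eventually_mono\<close>)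
  have meas_term: "(\<lambda>x. ?w x * indicator B (tuple n \<sigma> x)) \<in> borel_measurable (bead_base p q)"
    if "\<sigma> \<in> injections n" for \<sigma>
    by (intro borel_measurable_times_ennreal w_meas measurable_compose[OF measurable_tuple[OF that]]
        borel_measurable_indicator B)
  have "(\<integral>\<^sup>+x. ?c x \<partial>bead_process p q) = (\<integral>\<^sup>+x. (\<Sum>\<sigma>\<in>injections n. indicator B (tuple n \<sigma> x)) \<partial>bead_process p q)"
    unfolding bead_process_def Z
  \<comment> \<open>Only configurations of positive density matter, and there
    \<open>card_tuples\<close> applies.\<close>
  proof (rule nn_integral_cong_AE, subst AE_density)
    show "(\<lambda>x. ?w x / ennreal total_weight) \<in> borel_measurable (bead_base p q)"
      by (intro borel_measurable_divide_ennreal w_meas) simp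
    show "AE x in bead_base p q. 0 < ?w x / ennreal total_weight \<longrightarrow>
      ?c x = (\<Sum>\<sigma>\<in>injections n. indicator B (tuple n \<sigma> x))"
    proof (intro AE_I2 impI)
      fix x assume x: "x \<in> space (bead_base p q)" and pos: "0 < ?w x / ennreal total_weight"
      then have "bead_weight p q x \<noteq> 0" by auto
      then show "?c x = (\<Sum>\<sigma>\<in>injections n. indicator B (tuple n \<sigma> x))"
        by (rule card_tuples[OF x _ B])
    qed
  qed
  also have "\<dots> = (\<integral>\<^sup>+x. (?w x / ennreal total_weight) * (\<Sum>\<sigma>\<in>injections n. indicator B (tuple n \<sigma> x)) \<partial>bead_base p q)"
    unfolding bead_process_def Z
  proof (rule nn_integral_density)
    show "(\<lambda>x. ?w x / ennreal total_weight) \<in> borel_measurable (bead_base p q)"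
      by (intro borel_measurable_divide_ennreal w_meas) simp
    show "(\<lambda>x. \<Sum>\<sigma>\<in>injections n. indicator B (tuple n \<sigma> x) :: ennreal) \<in> borel_measurable (bead_base p q)"
      by (intro borel_measurable_sum measurable_compose[OF measurable_tuple] borel_measurable_indicator B)
  qed
  also have "\<dots> = (\<integral>\<^sup>+x. (1 / ennreal total_weight) * (\<Sum>\<sigma>\<in>injections n. ?w x * indicator B (tuple n \<sigma> x)) \<partial>bead_base p q)"
    by (intro nn_integral_cong) (simp add: sum_distrib_left[symmetric] divide_ennreal_def mult_ac)
  also have "\<dots> = (1 / ennreal total_weight) * (\<Sum>\<sigma>\<in>injections n. \<integral>\<^sup>+x. ?w x * indicator B (tuple n \<sigma> x) \<partial>bead_base p q)"
    by (subst nn_integral_cmult) (use meas_term in \<open>auto simp: nn_integral_sum\<close>)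
  also have "(\<Sum>\<sigma>\<in>injections n. \<integral>\<^sup>+x. ?w x * indicator B (tuple n \<sigma> x) \<partial>bead_base p q) = ennreal (moment n B)"
    unfolding moment_def using term_nonneg by (simp add: weight_term sum_ennreal)
  also have "1 / ennreal total_weight * ennreal (moment n B) = ennreal (top_constant * moment n B)"
  proof -
    have "top_constant = 1 / total_weight"
      using top_constant_total_weight total_weight_pos by (simp add: field_simps)
    moreover have "1 / ennreal total_weight = ennreal (1 / total_weight)"
      using total_weight_pos divide_ennreal[of 1 total_weight] by simp
    moreover have "0 \<le> moment n B" unfolding moment_def by (intro sum_nonneg term_nonneg)
    ultimately show ?thesis using top_constant_pos by (simp only: ennreal_mult'' )
  qed
  also have "top_constant * moment n B = (\<integral>Y. corr_det n Y * indicator B Y \<partial>refs n)"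
  proof (cases "n \<le> p * q")
    case True
    then show ?thesis by (rule corr_det_integral[OF _ B, symmetric])
  next
    case False
    then show ?thesis by (simp add: moment_def injections_empty corr_det_eq_0_if_large)
  qed
  also have "ennreal \<dots> = (\<integral>\<^sup>+Y. ennreal (corr_det n Y * indicator B Y) \<partial>refs n)"
    by (rule nn_integral_eq_integral[OF integrable_corr_det_indicator[OF B], symmetric], rule AE_I2)
       (simp add: corr_det_nonneg)
  also have "\<dots> = (\<integral>\<^sup>+Y. ennreal (corr_det n Y) * indicator B Y \<partial>refs n)"
    by (intro nn_integral_cong) (simp add: indicator_def)
  finally show "(\<integral>\<^sup>+x. ?c x \<partial>bead_process p q) = (\<integral>\<^sup>+Y. ennreal (corr_det n Y) * indicator B Y \<partial>refs n)" .
qed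

end

section \<open>Jacobi polynomials\<close>

text \<open>The Jacobi polynomial at \<open>1 - 2 x\<close>, as the Leibniz rule expands the
  Rodrigues formula. Free of denominators, it makes sense on the whole real line, and every term has
  total degree \<open>n\<close> in \<open>x\<close> and \<open>1 - x\<close>.\<close>

definition jacobi_sum :: "nat \<Rightarrow> nat \<Rightarrow> nat \<Rightarrow> real \<Rightarrow> real" where
  "jacobi_sum n a b x = (\<Sum>k\<le>n. real (n + a choose k) * real (n + b choose (n - k)) * (- 1) ^ (n - k) *
     (x ^ (n - k) * (1 - x) ^ k))"

lemma jacobi_sum_0 [simp]: "jacobi_sum 0 a b x = 1"
  by (simp add: jacobi_sum_def)

lemma DERIV_power_product:
  "((\<lambda>x::real. x ^ i * (1 - x) ^ j) has_real_derivative
     real i * (x ^ (i - 1) * (1 - x) ^ j) - real j * (x ^ i * (1 - x) ^ (j - 1))) (at x)"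
  by (auto intro!: derivative_eq_intros simp: algebra_simps)

lemma sum_shift_combine:
  fixes u v g :: "nat \<Rightarrow> real"
  shows "(\<Sum>k\<le>n. u k * g (Suc k)) + (\<Sum>k\<le>n. v k * g k) =
    (\<Sum>k\<le>Suc n. ((case k of 0 \<Rightarrow> 0 | Suc j \<Rightarrow> u j) + (if k \<le> n then v k else 0)) * g k)"
proof -
  have "(\<Sum>k\<le>Suc n. (case k of 0 \<Rightarrow> 0 | Suc j \<Rightarrow> u j) * g k) = (\<Sum>k\<le>n. u k * g (Suc k))"
    by (subst sum.atMost_Suc_shift) simp
  moreover have "(\<Sum>k\<le>Suc n. (if k \<le> n then v k else 0) * g k) = (\<Sum>k\<le>n. v k * g k)"
    by simp
  ultimately show ?thesis by (simp add: distrib_right sum.distrib del: sum.atMost_Suc)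
qed

lemma binomial_step: "real (Suc k) * real (m choose Suc k) = (real m - real k) * real (m choose k)"
proof (cases "k \<le> m")
  case True
  have "Suc k * (m choose Suc k) = (m - k) * (m choose k)"
    by (simp only: binomial_absorption binomial_absorb_comp)
  then show ?thesis using True by (metis of_nat_diff of_nat_mult)
qed (simp add: binomial_eq_0)

lemma binomial_absorb_real:
  "real (Suc k) * real (Suc m choose Suc k) = real (Suc m) * real (m choose k)"
  using Suc_times_binomial[of k m] by (metis of_nat_mult)

lemma binomial_absorb_comp_real:
  "(real (Suc m) - real k) * real (Suc m choose k) = real (Suc m) * real (m choose k)"
  using binomial_step[of k "Suc m"] binomial_absorb_real[of k m] by simp

text \<open>
  The three differentiation rules below move the first parameter pair of a Jacobi polynomial towards
  (or away from) zero; each is verified coefficientwise in the homogeneous basis \<open>x\<^sup>i (1 - x)\<^sup>j\<close>.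
\<close>

lemma DERIV_jacobi_lower:
  "((\<lambda>x. x ^ Suc a * (1 - x) ^ Suc b * jacobi_sum n (Suc a) (Suc b) x) has_real_derivative
     real (Suc n) * (x ^ a * (1 - x) ^ b * jacobi_sum (Suc n) a b x)) (at x)"
proof -
  define c where "c k = real (n + Suc a choose k) * real (n + Suc b choose (n - k)) * (- 1) ^ (n - k)" for k
  define d where "d k = real (Suc n + a choose k) * real (Suc n + b choose (Suc n - k)) * (- 1) ^ (Suc n - k)" for k
  let ?g = "\<lambda>k. x ^ (Suc n - k + a) * (1 - x) ^ (k + b)"
  have "((\<lambda>x. \<Sum>k\<le>n. c k * (x ^ (n - k + Suc a) * (1 - x) ^ (k + Suc b))) has_real_derivative
     (\<Sum>k\<le>n. c k * (real (n - k + Suc a) * (x ^ (n - k + Suc a - 1) * (1 - x) ^ (k + Suc b))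
        - real (k + Suc b) * (x ^ (n - k + Suc a) * (1 - x) ^ (k + Suc b - 1))))) (at x)"
    by (intro DERIV_sum DERIV_cmult DERIV_power_product)
  also have "(\<lambda>x. \<Sum>k\<le>n. c k * (x ^ (n - k + Suc a) * (1 - x) ^ (k + Suc b))) =
      (\<lambda>x. x ^ Suc a * (1 - x) ^ Suc b * jacobi_sum n (Suc a) (Suc b) x)"
    unfolding jacobi_sum_def c_def sum_distrib_left
    by (intro ext sum.cong refl) (simp only: power_add mult_ac)
  also have "(\<Sum>k\<le>n. c k * (real (n - k + Suc a) * (x ^ (n - k + Suc a - 1) * (1 - x) ^ (k + Suc b))
        - real (k + Suc b) * (x ^ (n - k + Suc a) * (1 - x) ^ (k + Suc b - 1)))) =
     (\<Sum>k\<le>n. c k * real (n - k + Suc a) * ?g (Suc k)) + (\<Sum>k\<le>n. - (c k * real (k + Suc b)) * ?g k)"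
    unfolding sum.distrib[symmetric]
    by (intro sum.cong refl) (auto simp: Suc_diff_le algebra_simps)
  also have "\<dots> = (\<Sum>k\<le>Suc n. ((case k of 0 \<Rightarrow> 0 | Suc j \<Rightarrow> c j * real (n - j + Suc a)) +
      (if k \<le> n then - (c k * real (k + Suc b)) else 0)) * ?g k)"
    by (rule sum_shift_combine)
  also have "\<dots> = (\<Sum>k\<le>Suc n. real (Suc n) * d k * ?g k)"
  proof (intro sum.cong refl arg_cong2[where f = "(*)"])
    fix k assume k: "k \<in> {..Suc n}"
    \<comment> \<open>The two halves of the product rule give \<open>k\<close> and
      \<open>n + 1 - k\<close> times the same coefficient \<open>d k\<close>.\<close>
    have 1: "(case k of 0 \<Rightarrow> 0 | Suc j \<Rightarrow> c j * real (n - j + Suc a)) = real k * d k"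
    proof (cases k)
      case (Suc j)
      then have "c j * real (n - j + Suc a) =
         ((real (n + Suc a) - real j) * real (n + Suc a choose j)) * real (n + Suc b choose (n - j)) * (- 1) ^ (n - j)"
        using k by (simp add: c_def of_nat_diff)
      also have "\<dots> = real k * d k" unfolding binomial_step[symmetric] by (simp add: d_def Suc)
      finally show ?thesis by (simp add: Suc)
    qed simp
    have 2: "(if k \<le> n then - (c k * real (k + Suc b)) else 0) = (real (Suc n) - real k) * d k"
    proof (cases "k \<le> n")
      case True
      have "c k * real (k + Suc b) = real (n + Suc a choose k) *
         ((real (n + Suc b) - real (n - k)) * real (n + Suc b choose (n - k))) * (- 1) ^ (n - k)"
        using True by (simp add: c_def of_nat_diff)
      also have "\<dots> = - ((real (Suc n) - real k) * d k)"
        unfolding binomial_step[symmetric] using True by (simp add: d_def Suc_diff_le of_nat_diff)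
      finally show ?thesis using True by simp
    qed (use k in auto)
    show "(case k of 0 \<Rightarrow> 0 | Suc j \<Rightarrow> c j * real (n - j + Suc a)) +
      (if k \<le> n then - (c k * real (k + Suc b)) else 0) = real (Suc n) * d k"
      unfolding 1 2 by (simp add: algebra_simps)
  qed
  also have "\<dots> = real (Suc n) * (x ^ a * (1 - x) ^ b * jacobi_sum (Suc n) a b x)"
    unfolding jacobi_sum_def d_def sum_distrib_left
    by (intro sum.cong refl) (simp only: power_add mult_ac)
  finally show ?thesis .
qed

lemma DERIV_jacobi_mixed:
  "((\<lambda>x. (1 - x) ^ Suc b * jacobi_sum n a (Suc b) x) has_real_derivative
     - real (n + Suc b) * ((1 - x) ^ b * jacobi_sum n (Suc a) b x)) (at x)"
proof -
  define c where "c k = real (n + a choose k) * real (n + Suc b choose (n - k)) * (- 1) ^ (n - k)" for k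
  define d where "d k = real (n + Suc a choose k) * real (n + b choose (n - k)) * (- 1) ^ (n - k)" for k
  let ?g = "\<lambda>k. x ^ (n - k) * (1 - x) ^ (k + b)"
  have "((\<lambda>x. \<Sum>k\<le>n. c k * (x ^ (n - k) * (1 - x) ^ (k + Suc b))) has_real_derivative
     (\<Sum>k\<le>n. c k * (real (n - k) * (x ^ (n - k - 1) * (1 - x) ^ (k + Suc b))
        - real (k + Suc b) * (x ^ (n - k) * (1 - x) ^ (k + Suc b - 1))))) (at x)"
    by (intro DERIV_sum DERIV_cmult DERIV_power_product)
  also have "(\<lambda>x. \<Sum>k\<le>n. c k * (x ^ (n - k) * (1 - x) ^ (k + Suc b))) =
      (\<lambda>x. (1 - x) ^ Suc b * jacobi_sum n a (Suc b) x)"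
    unfolding jacobi_sum_def c_def sum_distrib_left
    by (intro ext sum.cong refl) (simp only: power_add mult_ac)
  also have "(\<Sum>k\<le>n. c k * (real (n - k) * (x ^ (n - k - 1) * (1 - x) ^ (k + Suc b))
        - real (k + Suc b) * (x ^ (n - k) * (1 - x) ^ (k + Suc b - 1)))) =
     (\<Sum>k\<le>n. c k * real (n - k) * ?g (Suc k)) + (\<Sum>k\<le>n. - (c k * real (k + Suc b)) * ?g k)"
    unfolding sum.distrib[symmetric]
    by (intro sum.cong refl) (auto simp: algebra_simps)
  also have "\<dots> = (\<Sum>k\<le>Suc n. ((case k of 0 \<Rightarrow> 0 | Suc j \<Rightarrow> c j * real (n - j)) +
      (if k \<le> n then - (c k * real (k + Suc b)) else 0)) * ?g k)"
    by (rule sum_shift_combine)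
  also have "\<dots> = (\<Sum>k\<le>n. ((case k of 0 \<Rightarrow> 0 | Suc j \<Rightarrow> c j * real (n - j)) +
      (- (c k * real (k + Suc b)))) * ?g k)"
    by (subst sum.atMost_Suc) (auto intro!: sum.cong)
  also have "\<dots> = (\<Sum>k\<le>n. - real (n + Suc b) * d k * ?g k)"
  proof (intro sum.cong refl arg_cong2[where f = "(*)"])
    fix k assume k: "k \<in> {..n}"
    have 2: "c k * real (k + Suc b) =
        real (n + Suc b) * real (n + a choose k) * real (n + b choose (n - k)) * (- 1) ^ (n - k)"
    proof -
      have "c k * real (k + Suc b) = real (n + a choose k) *
         ((real (Suc (n + b)) - real (n - k)) * real (Suc (n + b) choose (n - k))) * (- 1) ^ (n - k)"
        using k by (simp add: c_def of_nat_diff)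
      then show ?thesis unfolding binomial_absorb_comp_real by simp
    qed
    \<comment> \<open>Both contributions share the factor \<open>n + b + 1\<close>; Pascal's rule
      merges \<open>n + a choose (k - 1)\<close> and \<open>n + a choose k\<close>.\<close>
    show "(case k of 0 \<Rightarrow> 0 | Suc j \<Rightarrow> c j * real (n - j)) + - (c k * real (k + Suc b)) = - real (n + Suc b) * d k"
    proof (cases k)
      case 0
      then show ?thesis unfolding 2 by (simp add: d_def algebra_simps)
    next
      case (Suc j)
      then obtain m where m: "n - j = Suc m" "n - k = m" using k by (metis Suc_diff_Suc Suc_le_lessD atMost_iff)
      have "c j * real (n - j) = real (n + a choose j) * (real (Suc m) * real (Suc (n + b) choose Suc m)) * (- 1) ^ Suc m"
        by (simp add: c_def m)
      also have "\<dots> = - (real (n + Suc b) * real (n + a choose j) * real (n + b choose (n - k)) * (- 1) ^ (n - k))"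
        unfolding binomial_absorb_real m by simp
      finally show ?thesis unfolding 2 by (simp add: Suc d_def algebra_simps)
    qed
  qed
  also have "\<dots> = - real (n + Suc b) * ((1 - x) ^ b * jacobi_sum n (Suc a) b x)"
    unfolding jacobi_sum_def d_def sum_distrib_left
    by (intro sum.cong refl) (simp add: power_add mult_ac)
  finally show ?thesis .
qed

lemma DERIV_jacobi_raise:
  "(jacobi_sum (Suc n) a b has_real_derivative
     - real (n + a + b + 2) * jacobi_sum n (Suc a) (Suc b) x) (at x)"
proof -
  define c where "c k = real (Suc n + a choose k) * real (Suc n + b choose (Suc n - k)) * (- 1) ^ (Suc n - k)" for k
  define d where "d k = real (n + Suc a choose k) * real (n + Suc b choose (n - k)) * (- 1) ^ (n - k)" for k
  let ?g = "\<lambda>k. x ^ (n - k) * (1 - x) ^ k"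
  have "((\<lambda>x. \<Sum>k\<le>Suc n. c k * (x ^ (Suc n - k) * (1 - x) ^ k)) has_real_derivative
     (\<Sum>k\<le>Suc n. c k * (real (Suc n - k) * (x ^ (Suc n - k - 1) * (1 - x) ^ k)
        - real k * (x ^ (Suc n - k) * (1 - x) ^ (k - 1))))) (at x)"
    by (intro DERIV_sum DERIV_cmult DERIV_power_product)
  also have "(\<lambda>x. \<Sum>k\<le>Suc n. c k * (x ^ (Suc n - k) * (1 - x) ^ k)) = jacobi_sum (Suc n) a b"
    by (rule ext) (simp add: jacobi_sum_def c_def del: sum.atMost_Suc)
  also have "(\<Sum>k\<le>Suc n. c k * (real (Suc n - k) * (x ^ (Suc n - k - 1) * (1 - x) ^ k)
        - real k * (x ^ (Suc n - k) * (1 - x) ^ (k - 1)))) =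
     (\<Sum>k\<le>Suc n. c k * real (Suc n - k) * (x ^ (Suc n - k - 1) * (1 - x) ^ k)) -
     (\<Sum>k\<le>Suc n. c k * real k * (x ^ (Suc n - k) * (1 - x) ^ (k - 1)))"
    unfolding sum_subtractf[symmetric] by (intro sum.cong refl) (simp add: algebra_simps)
  also have "(\<Sum>k\<le>Suc n. c k * real (Suc n - k) * (x ^ (Suc n - k - 1) * (1 - x) ^ k)) =
      (\<Sum>k\<le>n. c k * real (Suc n - k) * ?g k)"
    by (simp add: diff_commute)
  also have "(\<Sum>k\<le>Suc n. c k * real k * (x ^ (Suc n - k) * (1 - x) ^ (k - 1))) =
      (\<Sum>k\<le>n. c (Suc k) * real (Suc k) * ?g k)"
    by (subst sum.atMost_Suc_shift) simp
  also have "(\<Sum>k\<le>n. c k * real (Suc n - k) * ?g k) - (\<Sum>k\<le>n. c (Suc k) * real (Suc k) * ?g k) =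
      (\<Sum>k\<le>n. - real (n + a + b + 2) * d k * ?g k)"
    unfolding sum_subtractf[symmetric]
  proof (intro sum.cong refl)
    fix k assume "k \<in> {..n}"
    then have k: "k \<le> n" by simp
    have "c k * real (Suc n - k) = - (real (Suc n + a choose k) *
        (real (Suc (n - k)) * real (n + Suc b choose Suc (n - k))) * (- 1) ^ (n - k))"
      using k by (simp add: c_def Suc_diff_le)
    also have "\<dots> = - ((real k + real b + 1) * d k)"
      unfolding binomial_step using k by (simp add: d_def of_nat_diff)
    finally have 1: "c k * real (Suc n - k) = - ((real k + real b + 1) * d k)" .
    have "c (Suc k) * real (Suc k) =
        (real (Suc k) * real (n + Suc a choose Suc k)) * real (n + Suc b choose (n - k)) * (- 1) ^ (n - k)"
      by (simp add: c_def)
    also have "\<dots> = (real n + real a + 1 - real k) * d k"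
      unfolding binomial_step by (simp add: d_def)
    finally have 2: "c (Suc k) * real (Suc k) = (real n + real a + 1 - real k) * d k" .
    \<comment> \<open>The factors \<open>k + b + 1\<close> and \<open>n + a + 1 - k\<close> add up
      to \<open>n + a + b + 2\<close>.\<close>
    show "c k * real (Suc n - k) * ?g k - c (Suc k) * real (Suc k) * ?g k = - real (n + a + b + 2) * d k * ?g k"
      unfolding 1 2 by (simp add: algebra_simps)
  qed
  also have "\<dots> = - real (n + a + b + 2) * jacobi_sum n (Suc a) (Suc b) x"
    unfolding jacobi_sum_def d_def sum_distrib_left by (intro sum.cong refl) simp
  finally show ?thesis .
qed

lemma Rodrigues:
  "(deriv ^^ n) (\<lambda>u::real. u ^ (n + a) * (1 - u) ^ (n + b)) =
    (\<lambda>x. fact n * (x ^ a * (1 - x) ^ b * jacobi_sum n a b x))"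
proof (induction n arbitrary: a b)
  case (Suc n)
  have "(deriv ^^ Suc n) (\<lambda>u::real. u ^ (Suc n + a) * (1 - u) ^ (Suc n + b)) =
    deriv ((deriv ^^ n) (\<lambda>u::real. u ^ (n + Suc a) * (1 - u) ^ (n + Suc b)))"
    by (simp del: power_Suc)
  also have "\<dots> = deriv (\<lambda>x. fact n * (x ^ Suc a * (1 - x) ^ Suc b * jacobi_sum n (Suc a) (Suc b) x))"
    by (simp only: Suc.IH)
  also have "\<dots> = (\<lambda>x. fact n * (real (Suc n) * (x ^ a * (1 - x) ^ b * jacobi_sum (Suc n) a b x)))"
    by (intro ext DERIV_imp_deriv DERIV_cmult DERIV_jacobi_lower)
  finally show ?case by (simp add: mult_ac)
qed simp

lemma jacobi01_eq_jacobi_sum: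
  assumes "0 < x" "x < 1"
  shows "jacobi01 a b (int n) x = jacobi_sum n a b x"
  using assms by (simp add: jacobi01_def Rodrigues)

lemma jacobi_sum_reflect: "jacobi_sum n a b (1 - x) = (- 1) ^ n * jacobi_sum n b a x"
proof -
  have "jacobi_sum n a b (1 - x) = (\<Sum>k\<le>n. real (n + a choose (n - k)) * real (n + b choose k) * (- 1) ^ k *
     ((1 - x) ^ k * x ^ (n - k)))"
    unfolding jacobi_sum_def
    by (rule sum.reindex_bij_witness[of _ "\<lambda>k. n - k" "\<lambda>k. n - k"]) auto
  also have "\<dots> = (\<Sum>k\<le>n. (- 1) ^ n * (real (n + b choose k) * real (n + a choose (n - k)) * (- 1) ^ (n - k) *
     (x ^ (n - k) * (1 - x) ^ k)))"
  proof (intro sum.cong refl)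
    fix k assume "k \<in> {..n}"
    then have "n + (n - k) = 2 * (n - k) + k" by simp
    then have "(- 1 :: real) ^ n * (- 1) ^ (n - k) = (- 1) ^ (2 * (n - k) + k)"
      by (simp only: power_add[symmetric])
    then have "(- 1 :: real) ^ k = (- 1) ^ n * (- 1) ^ (n - k)"
      by (simp add: power_add power_mult)
    then show "real (n + a choose (n - k)) * real (n + b choose k) * (- 1) ^ k * ((1 - x) ^ k * x ^ (n - k)) =
      (- 1) ^ n * (real (n + b choose k) * real (n + a choose (n - k)) * (- 1) ^ (n - k) * (x ^ (n - k) * (1 - x) ^ k))"
      by simp
  qed
  finally show ?thesis by (simp add: jacobi_sum_def sum_distrib_left)
qed

text \<open>
  With \<open>u = p - l\<close>, \<open>v = q - l\<close> and \<open>k = s - l\<close> this is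
  \<open>C\<^sub>l a\<^sub>s Q\<^sub>l\<close> on line \<open>s\<close>; up to a constant it is the \<open>k\<close>-th derivative of
  \<open>y\<^sup>u (1 - y)\<^sup>v\<close>.
\<close>

definition line_poly :: "nat \<Rightarrow> nat \<Rightarrow> nat \<Rightarrow> real \<Rightarrow> real" where
  "line_poly u v k y =
    (if k \<le> u then (- 1) ^ (u - k) * (fact k / fact u) * (y ^ (u - k) * (1 - y) ^ (v - k) * jacobi_sum k (u - k) (v - k) y)
     else if k \<le> v then fact v / fact (u + v - k) * ((1 - y) ^ (v - k) * jacobi_sum u (k - u) (v - k) y)
     else if k \<le> u + v then fact k / fact u * jacobi_sum (u + v - k) (k - u) (k - v) y
     else 0)"

lemma line_poly_mid:
  "u \<le> k \<Longrightarrow> k \<le> v \<Longrightarrow>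
    line_poly u v k y = fact v / fact (u + v - k) * ((1 - y) ^ (v - k) * jacobi_sum u (k - u) (v - k) y)"
  by (cases "k = u") (auto simp: line_poly_def)

lemma line_poly_high:
  "u \<le> v \<Longrightarrow> v \<le> k \<Longrightarrow> k \<le> u + v \<Longrightarrow>
    line_poly u v k y = fact k / fact u * jacobi_sum (u + v - k) (k - u) (k - v) y"
  by (cases "k = v") (auto simp: line_poly_mid line_poly_def)

text \<open>The constants of \<open>line_poly\<close> absorb those of the three differentiation
  rules. Neighbouring formulas agree at \<open>k = u\<close> and \<open>k = v\<close>, so each rule
  applies up to the border of its range. After \<open>u + v\<close> steps a constant remains, then
  zero.\<close>

lemma DERIV_line_poly:
  assumes "u \<le> v"
  shows "(line_poly u v k has_real_derivative - line_poly u v (Suc k) y) (at y)"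
proof -
  consider "k < u" | "u \<le> k" "k < v" | "v \<le> k" "k < u + v" | "k = u + v" | "u + v < k" by linarith
  then show ?thesis
  proof cases
    case 1
    then obtain a b where ab: "u - k = Suc a" "v - k = Suc b" "u - Suc k = a" "v - Suc k = b"
      using assms by (metis Suc_diff_Suc less_le_trans)
    have "((\<lambda>y. (- 1) ^ Suc a * (fact k / fact u) * (y ^ Suc a * (1 - y) ^ Suc b * jacobi_sum k (Suc a) (Suc b) y))
      has_real_derivative (- 1) ^ Suc a * (fact k / fact u) *
        (real (Suc k) * (y ^ a * (1 - y) ^ b * jacobi_sum (Suc k) a b y))) (at y)"
      by (intro DERIV_cmult DERIV_jacobi_lower)
    moreover have "line_poly u v k =
      (\<lambda>y. (- 1) ^ Suc a * (fact k / fact u) * (y ^ Suc a * (1 - y) ^ Suc b * jacobi_sum k (Suc a) (Suc b) y))"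
      using 1 by (intro ext) (simp only: line_poly_def ab if_True less_imp_le)
    moreover have "- line_poly u v (Suc k) y = (- 1) ^ Suc a * (fact k / fact u) *
        (real (Suc k) * (y ^ a * (1 - y) ^ b * jacobi_sum (Suc k) a b y))"
      using 1 by (simp add: line_poly_def ab del: of_nat_Suc)
    ultimately show ?thesis by (simp only:)
  next
    case 2
    then obtain b where b: "v - k = Suc b" "v - Suc k = b" by (metis Suc_diff_Suc)
    let ?a = "k - u"
    have "((\<lambda>y. fact v / fact (u + v - k) * ((1 - y) ^ Suc b * jacobi_sum u ?a (Suc b) y))
      has_real_derivative fact v / fact (u + v - k) *
        (- real (u + Suc b) * ((1 - y) ^ b * jacobi_sum u (Suc ?a) b y))) (at y)"
      by (intro DERIV_cmult DERIV_jacobi_mixed)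
    moreover have "line_poly u v k = (\<lambda>y. fact v / fact (u + v - k) * ((1 - y) ^ Suc b * jacobi_sum u ?a (Suc b) y))"
      using 2 by (intro ext) (simp only: line_poly_mid less_imp_le b)
    moreover have "- line_poly u v (Suc k) y = fact v / fact (u + v - k) *
        (- real (u + Suc b) * ((1 - y) ^ b * jacobi_sum u (Suc ?a) b y))"
    proof -
      have e: "u + v - k = Suc (u + b)" "u + v - Suc k = u + b" "Suc k - u = Suc ?a" using 2 b by auto
      have "line_poly u v (Suc k) y = fact v / fact (u + b) * ((1 - y) ^ b * jacobi_sum u (Suc ?a) b y)"
        using 2 by (subst line_poly_mid) (simp_all add: e b)
      then show ?thesis by (simp add: e fact_Suc del: of_nat_Suc of_nat_add)
    qed
    ultimately show ?thesis by (simp only:)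
  next
    case 3
    then obtain n where n: "u + v - k = Suc n" "u + v - Suc k = n" by (metis Suc_diff_Suc)
    have "((\<lambda>y. fact k / fact u * jacobi_sum (Suc n) (k - u) (k - v) y) has_real_derivative
       fact k / fact u * (- real (n + (k - u) + (k - v) + 2) * jacobi_sum n (Suc (k - u)) (Suc (k - v)) y)) (at y)"
      by (intro DERIV_cmult DERIV_jacobi_raise)
    moreover have "line_poly u v k = (\<lambda>y. fact k / fact u * jacobi_sum (Suc n) (k - u) (k - v) y)"
      using 3 assms by (intro ext) (simp add: line_poly_high n)
    moreover have "- line_poly u v (Suc k) y =
       fact k / fact u * (- real (n + (k - u) + (k - v) + 2) * jacobi_sum n (Suc (k - u)) (Suc (k - v)) y)"
    proof -
      have e: "n + (k - u) + (k - v) + 2 = Suc k" using 3 n assms by auto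
      have "line_poly u v (Suc k) y = fact (Suc k) / fact u * jacobi_sum n (Suc (k - u)) (Suc (k - v)) y"
        using 3 assms by (subst line_poly_high) (simp_all add: n Suc_diff_le del: fact_Suc)
      then show ?thesis unfolding e by (simp add: fact_Suc del: of_nat_Suc)
    qed
    ultimately show ?thesis by (simp only:)
  next
    case 4
    then have "line_poly u v k = (\<lambda>y. fact k / fact u)"
      using assms by (intro ext) (simp add: line_poly_high)
    moreover have "line_poly u v (Suc k) y = 0" using 4 by (simp add: line_poly_def)
    ultimately show ?thesis by simp
  next
    case 5
    then have "line_poly u v k = (\<lambda>y. 0)" "line_poly u v (Suc k) y = 0"
      by (auto simp: line_poly_def)
    then show ?thesis by simp
  qed
qed

lemma isCont_line_poly: "u \<le> v \<Longrightarrow> isCont (line_poly u v k) y"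
  by (rule DERIV_isCont[OF DERIV_line_poly])

lemma line_poly_at_1: "u \<le> v \<Longrightarrow> k < v \<Longrightarrow> line_poly u v k 1 = 0"
  by (auto simp: line_poly_def)

lemma line_poly_at_0: "k < u \<Longrightarrow> line_poly u v k 0 = 0"
  by (auto simp: line_poly_def)

lemma line_poly_beyond: "u \<le> v \<Longrightarrow> u + v < k \<Longrightarrow> line_poly u v k y = 0"
  by (auto simp: line_poly_def)

section \<open>Pairings of line polynomials and their orthogonality\<close>

definition line_pairing :: "nat \<Rightarrow> nat \<Rightarrow> nat \<Rightarrow> nat \<Rightarrow> nat \<Rightarrow> nat \<Rightarrow> real" where
  "line_pairing u v k u' v' k' = (\<integral>x. line_poly u v k x * line_poly u' v' k' (1 - x) \<partial>unit_lebesgue)"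

lemma isCont_line_poly_product:
  "u \<le> v \<Longrightarrow> u' \<le> v' \<Longrightarrow> isCont (\<lambda>x. line_poly u v k x * line_poly u' v' k' (1 - x)) y"
  by (intro continuous_mult isCont_line_poly isCont_o2[OF _ isCont_line_poly] continuous_intros)

text \<open>Integration by parts; in every case one factor of each boundary term vanishes.\<close>

lemma line_pairing_shift:
  assumes le: "u \<le> v" "u' \<le> v'" and eq: "u + v' = u' + v" and k: "Suc (k + m) = u + v'"
  shows "line_pairing u v (Suc k) u' v' m = line_pairing u v k u' v' (Suc m)"
proof -
  let ?A = "\<lambda>x. line_poly u v k x * line_poly u' v' (Suc m) (1 - x)"
  let ?B = "\<lambda>x. line_poly u v (Suc k) x * line_poly u' v' m (1 - x)"
  have d': "((\<lambda>x. line_poly u' v' m (1 - x)) has_real_derivative line_poly u' v' (Suc m) (1 - x)) (at x)" for x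
  proof -
    have "((\<lambda>x. 1 - x) has_real_derivative - 1) (at x)" by (auto intro!: derivative_eq_intros)
    from DERIV_chain2[where f = "line_poly u' v' m" and g = "\<lambda>x. 1 - x", OF DERIV_line_poly[OF le(2)] this]
    show ?thesis by simp
  qed
  have "((\<lambda>x. line_poly u v k x * line_poly u' v' m (1 - x)) has_real_derivative (?A x - ?B x)) (at x)" for x
    using DERIV_mult[OF DERIV_line_poly[OF le(1), of k x] d'[of x]] by (simp add: algebra_simps)
  then have "(\<integral>x. ?A x - ?B x \<partial>unit_lebesgue) =
      line_poly u v k 1 * line_poly u' v' m 0 - line_poly u v k 0 * line_poly u' v' m 1"
    using isCont_line_poly_product[OF le] by (subst integral_unit_lebesgue_FTC) auto
  \<comment> \<open>The orders satisfy \<open>k + m = u + v' - 1 = u' + v - 1\<close>, so at each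
    endpoint one of the factors is still below its order of vanishing.\<close>
  also have "line_poly u v k 1 * line_poly u' v' m 0 = 0"
  proof (cases "k < v")
    case False
    then have "m < u'" using k eq by linarith
    then show ?thesis by (simp add: line_poly_at_0)
  qed (simp add: line_poly_at_1 le)
  also have "line_poly u v k 0 * line_poly u' v' m 1 = 0"
  proof (cases "k < u")
    case False
    then have "m < v'" using k eq by linarith
    then show ?thesis by (simp add: line_poly_at_1 le)
  qed (simp add: line_poly_at_0)
  finally show ?thesis
    unfolding line_pairing_def
    using isCont_line_poly_product[OF le]
    by (subst (asm) Bochner_Integration.integral_diff) (auto intro!: integrable_unit_lebesgue_continuous)
qed

text \<open>Only the sum of the two orders matters, so all derivatives may be moved to one
  factor.\<close>

lemma line_pairing_const:
  assumes "u \<le> v" "u' \<le> v'" "u + v' = u' + v" "k \<le> u + v'"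
  shows "line_pairing u v k u' v' (u + v' - k) = line_pairing u v 0 u' v' (u + v')"
  using assms(4)
proof (induction k)
  case (Suc k)
  then have "u + v' - k = Suc (u + v' - Suc k)" by simp
  with Suc show ?case using line_pairing_shift[OF assms(1-3), of k "u + v' - Suc k"] by simp
qed simp

text \<open>Moving all derivatives onto the polynomial of smaller degree annihilates it.\<close>

lemma line_pairing_orthogonal:
  assumes "u \<le> v" "u' \<le> v'" "u + v' = u' + v" "k \<le> u + v'" "u \<noteq> u'"
  shows "line_pairing u v k u' v' (u + v' - k) = 0"
proof (cases "u' < u")
  case True
  then have "u' + v' < u + v'" by simp
  then show ?thesis unfolding line_pairing_const[OF assms(1-4)]
    using line_poly_beyond[OF assms(2)] by (simp add: line_pairing_def)
next
  case False
  have "line_pairing u v k u' v' (u + v' - k) = line_pairing u v (u + v') u' v' (u + v' - (u + v'))"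
    using line_pairing_const[OF assms(1-4)] line_pairing_const[OF assms(1-3), of "u + v'"] by simp
  moreover have "u + v < u + v'" using False assms(3,5) by simp
  ultimately show ?thesis using line_poly_beyond[OF assms(1)] by (simp add: line_pairing_def)
qed

definition line_norm :: "nat \<Rightarrow> nat \<Rightarrow> real" where
  "line_norm u v = line_pairing u v 0 u v (u + v)"

lemma line_pairing_self:
  assumes "u \<le> v" "k \<le> u + v"
  shows "line_pairing u v k u v (u + v - k) = line_norm u v"
  using line_pairing_const[of u v u v k] assms by (simp add: line_norm_def)

lemma integral_unit_lebesgue_pos:
  fixes f :: "real \<Rightarrow> real"
  assumes "integrable unit_lebesgue f" "\<And>x. 0 < x \<Longrightarrow> x < 1 \<Longrightarrow> 0 < f x"
  shows "0 < (\<integral>x. f x \<partial>unit_lebesgue)"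
proof -
  interpret U: prob_space unit_lebesgue by (rule prob_space_unit_lebesgue)
  have nn: "AE x in unit_lebesgue. 0 \<le> f x" 
  proof (rule AE_I2)
    fix x assume "x \<in> space unit_lebesgue"
    then have "0 < f x" using assms(2) by simp
    then show "0 \<le> f x" by simp
  qed
  have "(\<integral>x. f x \<partial>unit_lebesgue) \<noteq> 0"
  proof
    assume "(\<integral>x. f x \<partial>unit_lebesgue) = 0"
    then have "AE x in unit_lebesgue. f x = 0"
      using integral_nonneg_eq_0_iff_AE[OF assms(1) nn] by simp
    then have "AE x in unit_lebesgue. False"
      using AE_space by eventually_elim (use assms(2) in force)
    then show False by (simp add: U.emeasure_space_1)
  qed
  moreover have "0 \<le> (\<integral>x. f x \<partial>unit_lebesgue)" by (rule integral_nonneg_AE[OF nn])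
  ultimately show ?thesis by simp
qed

text \<open>With all derivatives on one factor the pairing is a nonzero constant times a Beta
  integral.\<close>

lemma line_norm_nonzero:
  assumes "u \<le> v"
  shows "line_norm u v \<noteq> 0"
proof -
  have "line_norm u v = (\<integral>x. ((- 1) ^ u / fact u * (fact (u + v) / fact u)) * (x ^ u * (1 - x) ^ v) \<partial>unit_lebesgue)"
    unfolding line_norm_def line_pairing_def using assms
    by (intro Bochner_Integration.integral_cong refl)
       (simp add: line_poly_high line_poly_def[of u v 0])
  also have "\<dots> = ((- 1) ^ u / fact u * (fact (u + v) / fact u)) * (\<integral>x. x ^ u * (1 - x) ^ v \<partial>unit_lebesgue)"
    by (rule integral_mult_right_zero)
  also have "\<dots> \<noteq> 0"
  proof -
    have "0 < (\<integral>x. x ^ u * (1 - x) ^ v \<partial>unit_lebesgue)"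
      by (intro integral_unit_lebesgue_pos integrable_unit_lebesgue_continuous)
         (auto intro!: continuous_intros)
    then show ?thesis by simp
  qed
  finally show ?thesis .
qed

lemma real_fun_eqI:
  fixes f g :: "real \<Rightarrow> real"
  assumes "\<And>x. (f has_real_derivative h x) (at x)" "\<And>x. (g has_real_derivative h x) (at x)" "f c = g c"
  shows "f = g"
proof
  fix x
  have "((\<lambda>x. f x - g x) has_real_derivative 0) (at x)" for x
    using DERIV_diff[OF assms(1,2)] by simp
  then have "f x - g x = f c - g c" by (rule DERIV_isconst_all[rule_format]) 
  then show "f x = g x" using assms(3) by simp
qed

text \<open>Taylor's formula at 1, since \<open>line_poly u v m\<close> is up to sign a derivative
  of \<open>line_poly u v k\<close>. For \<open>y < 1\<close> each term is a multiple of a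
  propagator that ends at an auxiliary point.\<close>

lemma line_poly_Taylor:
  assumes "u \<le> v" "k \<le> Suc (u + v)"
  shows "line_poly u v k = (\<lambda>y. \<Sum>m\<le>u + v. if k \<le> m then line_poly u v m 1 * ((1 - y) ^ (m - k) / fact (m - k)) else 0)"
  using assms(2)
proof (induction k rule: inc_induct)
  case base
  show ?case using line_poly_beyond[OF assms(1)] by (intro ext) auto
next
  case (step k)
  let ?S = "\<lambda>k y. \<Sum>m\<le>u + v. if k \<le> m then line_poly u v m 1 * ((1 - y) ^ (m - k) / fact (m - k)) else 0"
  show ?case
  proof (rule real_fun_eqI)
    show "(line_poly u v k has_real_derivative - line_poly u v (Suc k) y) (at y)" for y
      by (rule DERIV_line_poly[OF assms(1)])
    show "(?S k has_real_derivative - line_poly u v (Suc k) y) (at y)" for y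
      unfolding step.IH sum_negf[symmetric]
    proof (rule DERIV_sum)
      fix m
      show "((\<lambda>y. if k \<le> m then line_poly u v m 1 * ((1 - y) ^ (m - k) / fact (m - k)) else 0) has_real_derivative
        - (if Suc k \<le> m then line_poly u v m 1 * ((1 - y) ^ (m - Suc k) / fact (m - Suc k)) else 0)) (at y)"
      proof (cases "Suc k \<le> m")
        case True
        then have e: "m - k = Suc (m - Suc k)" by simp
        have "((\<lambda>y. line_poly u v m 1 * ((1 - y) ^ Suc (m - Suc k) / fact (Suc (m - Suc k)))) has_real_derivative
          line_poly u v m 1 * - ((1 - y) ^ (m - Suc k) / fact (m - Suc k))) (at y)"
          by (intro DERIV_cmult DERIV_divided_power_right)
        then show ?thesis using True by (simp add: e del: power_Suc fact_Suc)
      next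
        case False
        then consider "m = k" | "m < k" by linarith
        then show ?thesis by cases auto
      qed
    qed
    show "line_poly u v k 1 = ?S k 1"
    proof -
      have "?S k 1 = (\<Sum>m\<le>u + v. if m = k then line_poly u v k 1 else 0)"
        by (intro sum.cong refl) auto
      also have "\<dots> = line_poly u v k 1" using step.hyps by simp
      finally show ?thesis by simp
    qed
  qed
qed

lemma C_coeff_nonzero: "C_coeff p q t l \<noteq> 0"
  by (simp add: C_coeff_def)

lemma a_fun_eq: "a_fun p q t y = (- y) ^ (p - t) * (1 - y) ^ (q - t)"
  by (auto simp: a_fun_def)

lemma b_fun_eq: "b_fun p q t x = (- 1) ^ (p - t) * x ^ (t - p) * (1 - x) ^ (t - q)" if "p \<le> q"
  using that by (auto simp: b_fun_def)

section \<open>Inverting the Gram matrix by Jacobi polynomials\<close>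

locale bead_lines =
  fixes p q :: nat
  assumes p_pos: "1 \<le> p" and p_le_q: "p \<le> q"
begin

text \<open>One of the two truncated differences is always zero, so \<open>exp0 t\<close> and
  \<open>exp1 t\<close> are the distances of \<open>t\<close> from \<open>p\<close> and from
  \<open>q\<close>: the Jacobi parameters in all three ranges of lines.\<close>

definition exp0 :: "nat \<Rightarrow> nat" where "exp0 t = (p - t) + (t - p)"
definition exp1 :: "nat \<Rightarrow> nat" where "exp1 t = (q - t) + (t - q)"

lemma Q_fun_eq:
  assumes "l \<le> int (num_particles p q t)" "t \<le> p + q" "0 < x" "x < 1"
  shows "Q_fun p q t l x = jacobi_sum (nat (int (num_particles p q t) - l)) (exp0 t) (exp1 t) x"
proof -
  consider "t \<le> p" | "p < t" "t \<le> q" | "q < t" by linarith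
  then show ?thesis
  proof cases
    case 1
    then show ?thesis using assms p_le_q jacobi01_eq_jacobi_sum[OF assms(3,4), of "p - t" "q - t" "nat (int t - l)"]
      by (simp add: Q_fun_def num_particles_def exp0_def exp1_def)
  next
    case 2
    then show ?thesis using assms jacobi01_eq_jacobi_sum[OF assms(3,4), of "t - p" "q - t" "nat (int p - l)"]
      by (simp add: Q_fun_def num_particles_def exp0_def exp1_def)
  next
    case 3
    then show ?thesis using assms p_le_q
      jacobi01_eq_jacobi_sum[OF assms(3,4), of "t - p" "t - q" "nat (int p + int q - int t - l)"]
      by (simp add: Q_fun_def num_particles_def exp0_def exp1_def of_nat_diff)
  qed
qed

lemma line_poly_eq_left:
  assumes l: "l \<le> int (num_particles p q t)" and t: "t \<le> p + q" and y: "0 < y" "y < 1"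
  shows "C_coeff p q t l * (a_fun p q t y * Q_fun p q t l y) =
    line_poly (nat (int p - l)) (nat (int q - l)) (nat (int t - l)) y"
proof -
  consider "t \<le> p" | "p < t" "t \<le> q" | "q < t" by linarith
  then show ?thesis
  proof cases
    case 1
    define k where "k = nat (int t - l)"
    have e: "nat (int p - l) = k + (p - t)" "nat (int q - l) = k + (q - t)" "nat (int t - l) = k"
      using 1 l p_le_q by (auto simp: k_def num_particles_def)
    have "Q_fun p q t l y = jacobi_sum k (p - t) (q - t) y"
      using Q_fun_eq[OF l t y] 1 p_le_q by (simp add: num_particles_def exp0_def exp1_def k_def)
    moreover have "C_coeff p q t l = fact k / fact (k + (p - t))"
      using 1 by (simp add: C_coeff_def e)
    ultimately show ?thesis unfolding e
      by (simp add: line_poly_def a_fun_eq power_minus[of y])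
  next
    case 2
    define u where "u = nat (int p - l)"
    have e: "nat (int p - l) = u" "nat (int q - l) = u + (q - p)" "nat (int t - l) = u + (t - p)"
      "nat (int p + int q - int t - l) = u + (q - t)"
      using 2 l by (auto simp: u_def num_particles_def)
    have "Q_fun p q t l y = jacobi_sum u (t - p) (q - t) y"
      using Q_fun_eq[OF l t y] 2 by (simp add: num_particles_def exp0_def exp1_def u_def)
    moreover have "C_coeff p q t l = fact (u + (q - p)) / fact (u + (q - t))"
      using 2 by (simp add: C_coeff_def e)
    moreover have "u + (u + (q - p)) - (u + (t - p)) = u + (q - t)" "u + (q - p) - (u + (t - p)) = q - t"
      using 2 by auto
    ultimately show ?thesis unfolding e using 2
      by (subst line_poly_mid) (simp_all add: a_fun_eq)
  next
    case 3
    define n where "n = nat (int p + int q - int t - l)"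
    have e: "nat (int p - l) = n + (t - q)" "nat (int q - l) = n + (t - p)"
      "nat (int t - l) = n + (t - q) + (t - p)" "nat (int (p + q - t) - l) = n"
      using 3 l t p_le_q by (auto simp: n_def num_particles_def)
    have "Q_fun p q t l y = jacobi_sum n (t - p) (t - q) y"
      using Q_fun_eq[OF l t y] 3 p_le_q e(4) by (simp add: num_particles_def exp0_def exp1_def)
    moreover have "C_coeff p q t l = fact (n + (t - q) + (t - p)) / fact (n + (t - q))"
      using 3 p_le_q by (simp add: C_coeff_def e)
    ultimately show ?thesis unfolding e using 3 p_le_q
      by (subst line_poly_high) (simp_all add: a_fun_eq)
  qed
qed

lemma num_particles_reflect: "t \<le> p + q \<Longrightarrow> num_particles p q (p + q - t) = num_particles p q t"
  using p_le_q by (auto simp: num_particles_def)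

text \<open>Replacing \<open>t\<close> by \<open>p + q - t\<close> and \<open>x\<close> by
  \<open>1 - x\<close> interchanges \<open>exp0\<close> and \<open>exp1\<close> and turns
  \<open>b_fun\<close> into \<open>a_fun\<close> up to sign. So right functions are left functions
  of the mirrored line, and the signs collect to \<open>(- 1) ^ nat (int p - l)\<close>.\<close>

lemma line_poly_eq_right:
  assumes l: "l \<le> int (num_particles p q t)" and t: "t \<le> p + q" and x: "0 < x" "x < 1"
  shows "(- 1) ^ nat (int p - l) * C_coeff p q (p + q - t) l * (b_fun p q t x * Q_fun p q t l x) =
    line_poly (nat (int p - l)) (nat (int q - l)) (nat (int p + int q - int t - l)) (1 - x)"
proof -
  let ?t = "p + q - t" and ?n = "nat (int (num_particles p q t) - l)"
  have ex: "p - ?t = t - q" "q - ?t = t - p" "?t - p = q - t" "?t - q = p - t" using t by auto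
  have l': "l \<le> int (num_particles p q ?t)" using l t by (simp add: num_particles_reflect)
  have par: "nat (int p - l) = ?n + (p - t) + (t - q)"
    using l t p_le_q by (auto simp: num_particles_def)
  have "Q_fun p q ?t l (1 - x) = jacobi_sum ?n (exp0 ?t) (exp1 ?t) (1 - x)"
    using Q_fun_eq[OF l', of "1 - x"] x t by (simp add: num_particles_reflect)
  also have "\<dots> = (- 1) ^ ?n * jacobi_sum ?n (exp0 t) (exp1 t) x"
    unfolding jacobi_sum_reflect by (simp add: exp0_def exp1_def ex add.commute)
  also have "jacobi_sum ?n (exp0 t) (exp1 t) x = Q_fun p q t l x"
    by (rule Q_fun_eq[OF l t x, symmetric])
  finally have Q: "Q_fun p q ?t l (1 - x) = (- 1) ^ ?n * Q_fun p q t l x" .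
  have a: "a_fun p q ?t (1 - x) = (- 1) ^ (t - q) * (1 - x) ^ (t - q) * x ^ (t - p)"
    by (simp only: a_fun_eq ex power_minus[of "1 - x"]) simp
  have sgn: "(- 1 :: real) ^ nat (int p - l) * (- 1) ^ (p - t) = (- 1) ^ (t - q) * (- 1) ^ ?n"
    unfolding par by (simp add: power_add mult_ac)
  have "line_poly (nat (int p - l)) (nat (int q - l)) (nat (int ?t - l)) (1 - x) =
    C_coeff p q ?t l * (a_fun p q ?t (1 - x) * Q_fun p q ?t l (1 - x))"
    using line_poly_eq_left[OF l', of "1 - x"] x t by simp
  also have "\<dots> = C_coeff p q ?t l * (((- 1) ^ (t - q) * (- 1) ^ ?n) * ((1 - x) ^ (t - q) * x ^ (t - p) * Q_fun p q t l x))"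
    unfolding Q a by (simp add: mult_ac)
  also have "\<dots> = (- 1) ^ nat (int p - l) * C_coeff p q ?t l * (b_fun p q t x * Q_fun p q t l x)"
    unfolding sgn[symmetric] b_fun_eq[OF p_le_q] by (simp add: mult_ac)
  finally show ?thesis using t by (simp add: of_nat_diff)
qed

lemma a_fun_b_fun: "a_fun p q t x * b_fun p q t x = x ^ exp0 t * (1 - x) ^ exp1 t"
proof -
  have "(- x) ^ (p - t) * (- 1) ^ (p - t) = x ^ (p - t)"
    by (simp add: power_mult_distrib[symmetric])
  moreover have "a_fun p q t x * b_fun p q t x =
      ((- x) ^ (p - t) * (- 1) ^ (p - t)) * x ^ (t - p) * ((1 - x) ^ (q - t) * (1 - x) ^ (t - q))"
    unfolding a_fun_eq b_fun_eq[OF p_le_q] by (simp only: mult_ac)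
  ultimately show ?thesis by (simp only: exp0_def exp1_def power_add)
qed

lemma N_norm_eq:
  assumes l: "l \<le> int (num_particles p q t)" and t: "t \<le> p + q"
  shows "N_norm p q t l = (\<integral>x. x ^ exp0 t * (1 - x) ^ exp1 t * (Q_fun p q t l x)\<^sup>2 \<partial>unit_lebesgue)"
proof -
  have "N_norm p q t l = (LINT x:{0<..<1}|lborel. x ^ exp0 t * (1 - x) ^ exp1 t * (Q_fun p q t l x)\<^sup>2)"
    using p_le_q by (auto simp: N_norm_def jacobi01_norm_def Q_fun_def exp0_def exp1_def)
  also have "\<dots> = (\<integral>x. x ^ exp0 t * (1 - x) ^ exp1 t * (Q_fun p q t l x)\<^sup>2 \<partial>unit_lebesgue)"
    unfolding unit_lebesgue_def set_lebesgue_integral_def by (subst integral_restrict_space) auto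
  finally show ?thesis .
qed

lemma nat_uv: "l \<le> int (num_particles p q t) \<Longrightarrow> nat (int p - l) \<le> nat (int q - l)"
  using p_le_q by auto

lemma nat_k:
  "l \<le> int (num_particles p q t) \<Longrightarrow> t \<le> p + q \<Longrightarrow>
    nat (int t - l) \<le> nat (int p - l) + nat (int q - l) \<and>
    nat (int p + int q - int t - l) = nat (int p - l) + nat (int q - l) - nat (int t - l)"
proof -
  assume "l \<le> int (num_particles p q t)" "t \<le> p + q"
  then have "l \<le> int p" "l \<le> int q" "l \<le> int t" "l \<le> int p + int q - int t"
    using p_le_q by (auto simp: num_particles_def split: if_splits)
  then show ?thesis by linarith
qed

text \<open>The left side is the pairing at level \<open>t - l\<close>, and the pairing is the same
  at all levels. So norms of different lines differ only by the constants.\<close>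

lemma C_coeff_N_norm:
  assumes l: "l \<le> int (num_particles p q t)" and t: "t \<le> p + q"
  shows "(- 1) ^ nat (int p - l) * C_coeff p q (p + q - t) l * (C_coeff p q t l * N_norm p q t l) =
    line_norm (nat (int p - l)) (nat (int q - l))"
proof -
  let ?u = "nat (int p - l)" and ?v = "nat (int q - l)" and ?k = "nat (int t - l)"
  note k = nat_k[OF l t]
  have "line_norm ?u ?v = line_pairing ?u ?v ?k ?u ?v (?u + ?v - ?k)"
    using line_pairing_self[OF nat_uv[OF l]] k by simp
  also have "\<dots> = (\<integral>x. ((- 1) ^ ?u * C_coeff p q (p + q - t) l * C_coeff p q t l) *
      (x ^ exp0 t * (1 - x) ^ exp1 t * (Q_fun p q t l x)\<^sup>2) \<partial>unit_lebesgue)"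
    unfolding line_pairing_def
  proof (intro Bochner_Integration.integral_cong refl)
    fix x assume "x \<in> space unit_lebesgue"
    then have x: "0 < x" "x < 1" by auto
    show "line_poly ?u ?v ?k x * line_poly ?u ?v (?u + ?v - ?k) (1 - x) =
      ((- 1) ^ ?u * C_coeff p q (p + q - t) l * C_coeff p q t l) *
      (x ^ exp0 t * (1 - x) ^ exp1 t * (Q_fun p q t l x)\<^sup>2)"
      unfolding k[THEN conjunct2, symmetric] line_poly_eq_left[OF l t x, symmetric] line_poly_eq_right[OF l t x, symmetric]
        a_fun_b_fun[symmetric] power2_eq_square
      by (simp only: mult_ac)
  qed
  also have "\<dots> = ((- 1) ^ ?u * C_coeff p q (p + q - t) l * C_coeff p q t l) * N_norm p q t l"
    by (simp only: integral_mult_right_zero N_norm_eq[OF l t])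
  finally show ?thesis by (simp only: mult.assoc)
qed

text \<open>The factors \<open>C\<^sub>l / C\<^sub>l\<close> and \<open>N\<^sub>l\<close> of the kernel combine to a norm that does not depend on the line.\<close>

lemma kernel_term_eq:
  assumes ls: "l \<le> int (num_particles p q s)" and lt: "l \<le> int (num_particles p q t)"
    and st: "s \<le> p + q" "t \<le> p + q" and y: "0 < y" "y < 1" and x: "0 < x" "x < 1"
  shows "a_fun p q s y * b_fun p q t x * kernel_term p q s y t x l =
    line_poly (nat (int p - l)) (nat (int q - l)) (nat (int s - l)) y *
    line_poly (nat (int p - l)) (nat (int q - l)) (nat (int p + int q - int t - l)) (1 - x) /
    line_norm (nat (int p - l)) (nat (int q - l))"
proof -
  let ?g = "(- 1) ^ nat (int p - l) * C_coeff p q (p + q - t) l"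
  have g: "?g \<noteq> 0" by (simp add: C_coeff_nonzero)
  have "line_poly (nat (int p - l)) (nat (int q - l)) (nat (int s - l)) y *
    line_poly (nat (int p - l)) (nat (int q - l)) (nat (int p + int q - int t - l)) (1 - x) /
    line_norm (nat (int p - l)) (nat (int q - l)) =
    (C_coeff p q s l * (a_fun p q s y * Q_fun p q s l y)) * (?g * (b_fun p q t x * Q_fun p q t l x)) /
    (?g * (C_coeff p q t l * N_norm p q t l))"
    by (simp only: line_poly_eq_left[OF ls st(1) y] line_poly_eq_right[OF lt st(2) x] C_coeff_N_norm[OF lt st(2)])
  also have "\<dots> = (C_coeff p q s l * (a_fun p q s y * Q_fun p q s l y)) * (b_fun p q t x * Q_fun p q t l x) /
    (C_coeff p q t l * N_norm p q t l)"
  proof -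
    have "X * (h * Y) / (h * Z) = X * Y / Z" if "h \<noteq> 0" for X Y Z h :: real
      using that by simp
    from this[OF g] show ?thesis .
  qed
  finally show ?thesis by (simp add: kernel_term_def)
qed

text \<open>Index \<open>\<kappa>\<close> stands for \<open>l = \<kappa> + 1\<close>. The order
  \<open>p + q - 2 - \<kappa> - i\<close> is the one whose Taylor term ends at
  \<open>(p + q - i, 1)\<close>. Only orders from \<open>q - l\<close> to \<open>p + q - 2 l\<close>
  can be nonzero at 1, that is \<open>\<kappa> \<le> i < p\<close>, whence the test.\<close>

definition taylor_coeff :: "nat \<Rightarrow> nat \<Rightarrow> real" where
  "taylor_coeff \<kappa> i = (if \<kappa> \<le> i then line_poly (p - Suc \<kappa>) (q - Suc \<kappa>) (p + q - 2 - \<kappa> - i) 1 else 0)"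

definition left_fun :: "nat \<Rightarrow> nat \<Rightarrow> real \<Rightarrow> real" where
  "left_fun \<kappa> s y = (\<Sum>i<p. taylor_coeff \<kappa> i * propagator (s, y) (p + q - i, 1))"

definition right_fun :: "nat \<Rightarrow> nat \<Rightarrow> real \<Rightarrow> real" where
  "right_fun \<kappa> t x = (\<Sum>j<p. taylor_coeff \<kappa> j * propagator (j, 0) (t, x))"

text \<open>Taylor expansion at 1 with its terms renumbered by endpoints. The condition on
  \<open>s\<close> makes the level \<open>s - l\<close> nonnegative; \<open>y < 1\<close> is the
  support condition of the propagators.\<close>

lemma left_fun_eq:
  assumes \<kappa>: "\<kappa> < p" "Suc \<kappa> \<le> s" and y: "y < 1"
  shows "left_fun \<kappa> s y = line_poly (p - Suc \<kappa>) (q - Suc \<kappa>) (s - Suc \<kappa>) y"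
proof -
  let ?u = "p - Suc \<kappa>" and ?v = "q - Suc \<kappa>" and ?k = "s - Suc \<kappa>"
  have uv: "?u \<le> ?v" using p_le_q by simp
  have "left_fun \<kappa> s y = (\<Sum>i\<in>{\<kappa>..<p}. taylor_coeff \<kappa> i * propagator (s, y) (p + q - i, 1))"
    unfolding left_fun_def by (rule sum.mono_neutral_right) (auto simp: taylor_coeff_def)
  also have "\<dots> = (\<Sum>m\<in>{?v..?u + ?v}. if ?k \<le> m then line_poly ?u ?v m 1 * ((1 - y) ^ (m - ?k) / fact (m - ?k)) else 0)"
  proof (rule sum.reindex_bij_witness[of _ "\<lambda>m. p + q - 2 - \<kappa> - m" "\<lambda>i. p + q - 2 - \<kappa> - i"])
    fix i assume i: "i \<in> {\<kappa>..<p}"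
    have "(s < p + q - i) = (?k \<le> p + q - 2 - \<kappa> - i)" "p + q - i - s - 1 = p + q - 2 - \<kappa> - i - ?k"
      using i \<kappa> p_le_q by auto
    then show "(if ?k \<le> p + q - 2 - \<kappa> - i then line_poly ?u ?v (p + q - 2 - \<kappa> - i) 1 *
        ((1 - y) ^ (p + q - 2 - \<kappa> - i - ?k) / fact (p + q - 2 - \<kappa> - i - ?k)) else 0) =
      taylor_coeff \<kappa> i * propagator (s, y) (p + q - i, 1)"
      using i y by (auto simp: taylor_coeff_def propagator_def)
  qed (use \<kappa> p_le_q in auto)
  also have "\<dots> = (\<Sum>m\<le>?u + ?v. if ?k \<le> m then line_poly ?u ?v m 1 * ((1 - y) ^ (m - ?k) / fact (m - ?k)) else 0)"
    by (rule sum.mono_neutral_left) (use line_poly_at_1[OF uv] in auto)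
  also have "\<dots> = line_poly ?u ?v ?k y"
  proof (cases "?k \<le> Suc (?u + ?v)")
    case True
    from line_poly_Taylor[OF uv this] show ?thesis by (simp add: fun_eq_iff)
  next
    case False
    then show ?thesis using line_poly_beyond[OF uv, of ?k y] by (auto intro!: sum.neutral)
  qed
  finally show ?thesis .
qed

lemma right_fun_eq_left_fun:
  assumes "t \<le> p + q" "\<kappa> < p"
  shows "right_fun \<kappa> t x = left_fun \<kappa> (p + q - t) (1 - x)"
proof -
  have "propagator (j, 0) (t, x) = propagator (p + q - t, 1 - x) (p + q - j, 1)" if "j < p" for j
  proof -
    have "(j < t) = (p + q - t < p + q - j)" "t - j - 1 = p + q - j - (p + q - t) - 1"
      using assms that by auto
    then show ?thesis by (simp add: propagator_def)
  qed
  then show ?thesis unfolding right_fun_def left_fun_def by (intro sum.cong) auto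
qed

lemma right_fun_eq:
  assumes "\<kappa> < p" "t + Suc \<kappa> \<le> p + q" "0 < x"
  shows "right_fun \<kappa> t x = line_poly (p - Suc \<kappa>) (q - Suc \<kappa>) (p + q - t - Suc \<kappa>) (1 - x)"
proof -
  have "right_fun \<kappa> t x = left_fun \<kappa> (p + q - t) (1 - x)"
    using assms by (intro right_fun_eq_left_fun) auto
  also have "\<dots> = line_poly (p - Suc \<kappa>) (q - Suc \<kappa>) (p + q - t - Suc \<kappa>) (1 - x)"
    using assms by (intro left_fun_eq) auto
  finally show ?thesis .
qed

text \<open>Every endpoint with \<open>i \<ge> \<kappa>\<close> lies on or before line
  \<open>s\<close>. Together with the next fact this cuts the sum over \<open>\<kappa> < p\<close>
  down to the upper limit \<open>Min {p + q - s, t, p}\<close> of the kernel.\<close>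

lemma left_fun_eq_0: "p + q < s + Suc \<kappa> \<Longrightarrow> left_fun \<kappa> s y = 0"
  unfolding left_fun_def by (intro sum.neutral) (auto simp: taylor_coeff_def propagator_def)

lemma right_fun_eq_0: "t \<le> \<kappa> \<Longrightarrow> right_fun \<kappa> t x = 0"
  unfolding right_fun_def by (intro sum.neutral) (auto simp: taylor_coeff_def propagator_def)

definition index_norm :: "nat \<Rightarrow> real" where
  "index_norm \<kappa> = line_norm (p - Suc \<kappa>) (q - Suc \<kappa>)"

lemma index_norm_nonzero: "index_norm \<kappa> \<noteq> 0"
  unfolding index_norm_def using p_le_q by (intro line_norm_nonzero) simp

text \<open>The restrictions on \<open>\<kappa>\<close> and \<open>\<mu>\<close> say that both functions are genuine Jacobi functions on line \<open>t\<close>.\<close>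

lemma left_right_biorthogonal:
  assumes \<kappa>: "\<kappa> < p" "Suc \<kappa> \<le> t" and \<mu>: "\<mu> < p" "t + Suc \<mu> \<le> p + q"
  shows "(\<integral>x. left_fun \<kappa> t x * right_fun \<mu> t x \<partial>unit_lebesgue) = (if \<kappa> = \<mu> then index_norm \<kappa> else 0)"
proof -
  let ?u = "p - Suc \<kappa>" and ?v = "q - Suc \<kappa>" and ?u' = "p - Suc \<mu>" and ?v' = "q - Suc \<mu>"
  have uv: "?u \<le> ?v" "?u' \<le> ?v'" "?u + ?v' = ?u' + ?v" using \<kappa> \<mu> p_le_q by auto
  have "(\<integral>x. left_fun \<kappa> t x * right_fun \<mu> t x \<partial>unit_lebesgue) =
    line_pairing ?u ?v (t - Suc \<kappa>) ?u' ?v' (p + q - t - Suc \<mu>)"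
    unfolding line_pairing_def
  proof (intro Bochner_Integration.integral_cong refl)
    fix x assume "x \<in> space unit_lebesgue"
    then have x: "0 < x" "x < 1" by auto
    show "left_fun \<kappa> t x * right_fun \<mu> t x =
      line_poly ?u ?v (t - Suc \<kappa>) x * line_poly ?u' ?v' (p + q - t - Suc \<mu>) (1 - x)"
      by (simp only: left_fun_eq[OF \<kappa> x(2)] right_fun_eq[OF \<mu> x(1)])
  qed
  also have "p + q - t - Suc \<mu> = ?u + ?v' - (t - Suc \<kappa>)" using \<kappa> \<mu> p_le_q by auto
  also have "line_pairing ?u ?v (t - Suc \<kappa>) ?u' ?v' (?u + ?v' - (t - Suc \<kappa>)) =
    (if \<kappa> = \<mu> then index_norm \<kappa> else 0)"
  proof (cases "\<kappa> = \<mu>")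
    case True
    then show ?thesis using line_pairing_self[OF uv(1), of "t - Suc \<kappa>"] \<kappa> \<mu> by (simp add: index_norm_def)
  next
    case False
    have "t - Suc \<kappa> \<le> ?u + ?v'" "?u \<noteq> ?u'" using \<kappa> \<mu> p_le_q False by auto
    then show ?thesis using line_pairing_orthogonal[OF uv] False by simp
  qed
  finally show ?thesis .
qed

text \<open>The matrix \<open>taylor_coeff\<close> diagonalises the Gram matrix as a bilinear form,
  with diagonal \<open>index_norm\<close>; undoing this gives the inverse.\<close>

definition inv_gram :: "nat \<Rightarrow> nat \<Rightarrow> real" where
  "inv_gram i l = (\<Sum>\<kappa><p. taylor_coeff \<kappa> i * taylor_coeff \<kappa> l / index_norm \<kappa>)"

lemma propagator_gram:
  assumes "i < p" "j < p"
  shows "(\<integral>v. propagator (p, v) (p + q - i, 1) * propagator (j, 0) (p, v) \<partial>unit_lebesgue) = bead_gram p q j i"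
  using propagator_convolution[of 0 1 j p "p + q - i"] assms p_le_q
  by (simp add: bead_gram_def mult.commute)

lemma integrable_propagator_line:
  assumes "0 \<le> snd a" "snd b \<le> 1"
  shows "integrable unit_lebesgue (\<lambda>v. propagator (s, v) b * propagator a (t, v))"
proof (rule integrable_unit_lebesgue_bounded[where B = 1])
  show "(\<lambda>v. propagator (s, v) b * propagator a (t, v)) \<in> borel_measurable unit_lebesgue"
    by (intro borel_measurable_times measurable_propagator) (auto intro: measurable_unit_lebesgue_ident)
  show "\<bar>propagator (s, x) b * propagator a (t, x)\<bar> \<le> 1" if "0 < x" "x < 1" for x
    unfolding abs_mult using that assms by (intro mult_le_one abs_propagator_le_1) auto
qed

text \<open>Biorthogonality read on line \<open>p\<close>: all functions of index below
  \<open>p\<close> are Jacobi functions there, and propagators through that line compose to the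
  entries of the Gram matrix.\<close>

lemma taylor_coeff_gram:
  assumes "\<kappa> < p" "\<mu> < p"
  shows "(\<Sum>j<p. taylor_coeff \<mu> j * (\<Sum>i<p. bead_gram p q j i * taylor_coeff \<kappa> i)) =
    (if \<kappa> = \<mu> then index_norm \<kappa> else 0)"
proof -
  have "(\<integral>x. left_fun \<kappa> p x * right_fun \<mu> p x \<partial>unit_lebesgue) =
    (\<integral>x. (\<Sum>i<p. \<Sum>j<p. taylor_coeff \<kappa> i * taylor_coeff \<mu> j *
      (propagator (p, x) (p + q - i, 1) * propagator (j, 0) (p, x))) \<partial>unit_lebesgue)"
    unfolding left_fun_def right_fun_def sum_product by (simp add: mult_ac)
  also have "\<dots> = (\<Sum>i<p. \<Sum>j<p. taylor_coeff \<kappa> i * taylor_coeff \<mu> j * bead_gram p q j i)"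
    using integrable_propagator_line by (simp add: Bochner_Integration.integral_sum propagator_gram)
  also have "\<dots> = (\<Sum>j<p. taylor_coeff \<mu> j * (\<Sum>i<p. bead_gram p q j i * taylor_coeff \<kappa> i))"
    by (subst sum.swap) (simp add: sum_distrib_left mult_ac)
  finally show ?thesis using left_right_biorthogonal[of \<kappa> p \<mu>] assms p_le_q by simp
qed

lemma bead_gram_sym: "i < p \<Longrightarrow> j < p \<Longrightarrow> bead_gram p q i j = bead_gram p q j i"
  using p_le_q by (simp add: bead_gram_def propagator_def add.commute)

lemma inv_gram_sym: "inv_gram i l = inv_gram l i"
  by (simp add: inv_gram_def mult.commute)

lemma gram_inv_gram:
  assumes "j < p" "l < p"
  shows "(\<Sum>i<p. bead_gram p q j i * inv_gram i l) = (if j = l then 1 else 0)"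
proof -
  define A where "A = Matrix.mat p p (\<lambda>(\<kappa>, j). taylor_coeff \<kappa> j)"
  define H where "H j \<kappa> = (\<Sum>i<p. bead_gram p q j i * taylor_coeff \<kappa> i)" for j \<kappa>
  define B where "B = Matrix.mat p p (\<lambda>(j, \<kappa>). H j \<kappa> / index_norm \<kappa>)"
  have carr: "A \<in> carrier_mat p p" "B \<in> carrier_mat p p" by (auto simp: A_def B_def)
  have "A * B = 1\<^sub>m p"
  proof (rule eq_matI)
    fix \<mu> \<kappa> assume "\<mu> < dim_row (1\<^sub>m p)" "\<kappa> < dim_col (1\<^sub>m p)"
    then have lt: "\<mu> < p" "\<kappa> < p" by auto
    have "(A * B) $$ (\<mu>, \<kappa>) = (\<Sum>j<p. taylor_coeff \<mu> j * H j \<kappa>) / index_norm \<kappa>"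
      using lt by (simp add: A_def B_def scalar_prod_def atLeast0LessThan sum_divide_distrib)
    then show "(A * B) $$ (\<mu>, \<kappa>) = 1\<^sub>m p $$ (\<mu>, \<kappa>)"
      using lt index_norm_nonzero by (auto simp: H_def taylor_coeff_gram)
  qed (use carr in auto)
  \<comment> \<open>Biorthogonality gives one order of the product only; for square matrices the
    other follows, and it is the Gram matrix times \<open>inv_gram\<close>.\<close>
  then have BA: "B * A = 1\<^sub>m p" by (rule mat_mult_left_right_inverse[OF carr])
  have "(\<Sum>i<p. bead_gram p q j i * inv_gram i l) =
    (\<Sum>i<p. \<Sum>\<kappa><p. bead_gram p q j i * taylor_coeff \<kappa> i / index_norm \<kappa> * taylor_coeff \<kappa> l)"
    by (simp add: inv_gram_def sum_distrib_left mult_ac)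
  also have "\<dots> = (\<Sum>\<kappa><p. H j \<kappa> / index_norm \<kappa> * taylor_coeff \<kappa> l)"
    by (subst sum.swap) (simp add: H_def sum_distrib_right sum_divide_distrib)
  also have "\<dots> = (B * A) $$ (j, l)"
    using assms by (simp add: A_def B_def scalar_prod_def atLeast0LessThan)
  finally show ?thesis using assms by (simp add: BA)
qed

sublocale gram_inverse p q inv_gram
proof
  show "(\<Sum>j<p. inv_gram i j * bead_gram p q j l) = (if i = l then 1 else 0)" if "i < p" "l < p" for i l
  proof -
    have "(\<Sum>j<p. inv_gram i j * bead_gram p q j l) = (\<Sum>j<p. bead_gram p q l j * inv_gram j i)"
      using that by (intro sum.cong refl) (simp add: inv_gram_sym[of i] bead_gram_sym[of l] mult.commute)
    then show ?thesis using gram_inv_gram[OF that(2,1)] by auto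
  qed
qed (use p_pos p_le_q gram_inv_gram in auto)

lemma corr_kernel_eq:
  "corr_kernel (s, y) (t, x) = - propagator (s, y) (t, x) +
     (\<Sum>\<kappa><p. left_fun \<kappa> s y * right_fun \<kappa> t x / index_norm \<kappa>)"
proof -
  have "(\<Sum>i<p. \<Sum>j<p. inv_gram i j * (propagator (s, y) (p + q - i, 1) * propagator (j, 0) (t, x))) =
    (\<Sum>i<p. \<Sum>j<p. \<Sum>\<kappa><p. (taylor_coeff \<kappa> i * propagator (s, y) (p + q - i, 1)) *
       (taylor_coeff \<kappa> j * propagator (j, 0) (t, x)) / index_norm \<kappa>)"
    by (simp add: inv_gram_def sum_distrib_right sum_distrib_left mult_ac)
  also have "\<dots> = (\<Sum>i<p. \<Sum>\<kappa><p. \<Sum>j<p. (taylor_coeff \<kappa> i * propagator (s, y) (p + q - i, 1)) *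
       (taylor_coeff \<kappa> j * propagator (j, 0) (t, x)) / index_norm \<kappa>)"
    by (intro sum.cong refl sum.swap)
  also have "\<dots> = (\<Sum>\<kappa><p. \<Sum>i<p. \<Sum>j<p. (taylor_coeff \<kappa> i * propagator (s, y) (p + q - i, 1)) *
       (taylor_coeff \<kappa> j * propagator (j, 0) (t, x)) / index_norm \<kappa>)"
    by (rule sum.swap)
  also have "\<dots> = (\<Sum>\<kappa><p. left_fun \<kappa> s y * right_fun \<kappa> t x / index_norm \<kappa>)"
    unfolding left_fun_def right_fun_def sum_product sum_divide_distrib ..
  finally show ?thesis by (simp add: corr_kernel_def)
qed

text \<open>For \<open>t \<le> s\<close> the propagator part vanishes, and what remains is the
  finite sum, exactly and at all interior positions.\<close>

lemma bead_kernel_eq_corr_kernel: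
  assumes s: "1 \<le> s" "s < p + q" and t: "1 \<le> t" "t \<le> s" and y: "0 < y" "y < 1" and x: "0 < x" "x < 1"
  shows "bead_kernel p q s y t x = corr_kernel (s, y) (t, x)"
proof -
  define m where "m = Min {p + q - s, t, p}"
  have m: "m \<le> p + q - s" "m \<le> t" "m \<le> p" by (auto simp: m_def)
  have "bead_kernel p q s y t x = (\<Sum>l = 1..int m. a_fun p q s y * b_fun p q t x * kernel_term p q s y t x l)"
    using t by (simp add: bead_kernel_def m_def sum_distrib_left)
  also have "\<dots> = (\<Sum>\<kappa><m. a_fun p q s y * b_fun p q t x * kernel_term p q s y t x (1 + int \<kappa>))"
    by (rule sum.reindex_bij_witness[of _ "\<lambda>\<kappa>. 1 + int \<kappa>" "\<lambda>l. nat (l - 1)"]) auto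
  also have "\<dots> = (\<Sum>\<kappa><m. left_fun \<kappa> s y * right_fun \<kappa> t x / index_norm \<kappa>)"
  proof (intro sum.cong refl)
    fix \<kappa> assume "\<kappa> \<in> {..<m}"
    then have k: "\<kappa> < p" "Suc \<kappa> \<le> t" "Suc \<kappa> \<le> s" "s + Suc \<kappa> \<le> p + q" "t + Suc \<kappa> \<le> p + q" using m t by auto
    then have n: "1 + int \<kappa> \<le> int (num_particles p q s)" "1 + int \<kappa> \<le> int (num_particles p q t)"
      by (auto simp: num_particles_def)
    have e: "nat (int p - (1 + int \<kappa>)) = p - Suc \<kappa>" "nat (int q - (1 + int \<kappa>)) = q - Suc \<kappa>"
      "nat (int s - (1 + int \<kappa>)) = s - Suc \<kappa>" "nat (int p + int q - int t - (1 + int \<kappa>)) = p + q - t - Suc \<kappa>"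
      using k p_le_q by auto
    show "a_fun p q s y * b_fun p q t x * kernel_term p q s y t x (1 + int \<kappa>) =
      left_fun \<kappa> s y * right_fun \<kappa> t x / index_norm \<kappa>"
      using kernel_term_eq[OF n _ _ y x] s t unfolding e
      by (simp add: left_fun_eq[OF k(1,3) y(2)] right_fun_eq[OF k(1,5) x(1)] index_norm_def)
  qed
  also have "\<dots> = (\<Sum>\<kappa><p. left_fun \<kappa> s y * right_fun \<kappa> t x / index_norm \<kappa>)"
  proof (rule sum.mono_neutral_left)
    show "\<forall>\<kappa>\<in>{..<p} - {..<m}. left_fun \<kappa> s y * right_fun \<kappa> t x / index_norm \<kappa> = 0"
    proof
      fix \<kappa> assume "\<kappa> \<in> {..<p} - {..<m}"
      then have "p + q < s + Suc \<kappa> \<or> t \<le> \<kappa>" by (auto simp: m_def)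
      then show "left_fun \<kappa> s y * right_fun \<kappa> t x / index_norm \<kappa> = 0"
        using left_fun_eq_0 right_fun_eq_0 by auto
    qed
  qed (use m in auto)
  also have "\<dots> = corr_kernel (s, y) (t, x)"
    using t by (simp add: corr_kernel_eq propagator_def)
  finally show ?thesis .
qed

end

section \<open>Orthogonal series\<close>

lemma AE_summable:
  fixes f :: "nat \<Rightarrow> 'a \<Rightarrow> real"
  assumes int: "\<And>k. integrable M (f k)" and nn: "\<And>k x. 0 \<le> f k x"
    and sum: "summable (\<lambda>k. \<integral>x. f k x \<partial>M)"
  shows "AE x in M. summable (\<lambda>k. f k x)"
proof -
  have [measurable]: "f k \<in> borel_measurable M" for k using int by auto
  have "(\<integral>\<^sup>+x. (\<Sum>k. ennreal (f k x)) \<partial>M) = (\<Sum>k. \<integral>\<^sup>+x. ennreal (f k x) \<partial>M)"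
    by (rule nn_integral_suminf) measurable
  also have "\<dots> = (\<Sum>k. ennreal (\<integral>x. f k x \<partial>M))"
    using int nn by (simp add: nn_integral_eq_integral)
  also have "\<dots> = ennreal (\<Sum>k. \<integral>x. f k x \<partial>M)"
    by (rule suminf_ennreal2[OF _ sum]) (simp add: nn)
  finally have "(\<integral>\<^sup>+x. (\<Sum>k. ennreal (f k x)) \<partial>M) \<noteq> \<infinity>" by simp
  then have "AE x in M. (\<Sum>k. ennreal (f k x)) \<noteq> \<infinity>"
    by (intro nn_integral_PInf_AE) measurable
  then show ?thesis
    by eventually_elim (use nn in \<open>auto intro: summable_suminf_not_top\<close>)
qed

lemma cube_block:
  obtains k :: nat where "k ^ 3 \<le> m" "m < Suc k ^ 3"
proof -
  define k where "k = (LEAST k. m < Suc k ^ 3)"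
  have "m < Suc m ^ 3" using self_le_power[of "Suc m" 3] by linarith
  then have k: "m < Suc k ^ 3" unfolding k_def by (rule LeastI)
  have "k ^ 3 \<le> m"
  proof (cases k)
    case (Suc j)
    then have "\<not> m < Suc j ^ 3" using not_less_Least[of j "\<lambda>k. m < Suc k ^ 3"] by (simp add: k_def)
    then show ?thesis by (simp only: Suc not_less)
  qed simp
  with k show thesis by (rule that[rotated])
qed

lemma sum_cube_blocks:
  fixes f :: "nat \<Rightarrow> real"
  shows "(\<Sum>j<k. \<Sum>l = j ^ 3..<Suc j ^ 3. f l) = (\<Sum>l<k ^ 3. f l)"
proof (induction k)
  case (Suc k)
  have le: "k ^ 3 \<le> Suc k ^ 3" by (rule power_mono) auto
  have "(\<Sum>l<Suc k ^ 3. f l) = (\<Sum>l<k ^ 3. f l) + (\<Sum>l = k ^ 3..<Suc k ^ 3. f l)"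
    unfolding ivl_disj_un_one(2)[OF le, symmetric] by (rule sum.union_disjoint) auto
  with Suc.IH show ?case by (simp only: sum.lessThan_Suc)
qed simp

text \<open>A partial sum differs from the one at the preceding cube by at most one absolute block
  sum.\<close>

lemma sums_by_blocks:
  fixes A :: "nat \<Rightarrow> real"
  assumes D: "(\<lambda>k. \<Sum>l = k ^ 3..<Suc k ^ 3. A l) sums S"
    and U: "(\<lambda>k. \<Sum>l = k ^ 3..<Suc k ^ 3. \<bar>A l\<bar>) \<longlonglongrightarrow> 0"
  shows "A sums S"
proof -
  show ?thesis unfolding sums_def
  proof (rule LIMSEQ_I)
    fix e :: real assume e: "0 < e"
    obtain K1 where K1: "\<And>k. k \<ge> K1 \<Longrightarrow> \<bar>(\<Sum>l<k ^ 3. A l) - S\<bar> < e / 2"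
      using LIMSEQ_D[OF D[unfolded sums_def], of "e / 2"] e by (auto simp: sum_cube_blocks)
    obtain K2 where K2: "\<And>k. k \<ge> K2 \<Longrightarrow> \<bar>\<Sum>l = k ^ 3..<Suc k ^ 3. \<bar>A l\<bar>\<bar> < e / 2"
      using LIMSEQ_D[OF U, of "e / 2"] e by auto
    show "\<exists>no. \<forall>n\<ge>no. norm ((\<Sum>l<n. A l) - S) < e"
    proof (intro exI allI impI)
      fix n assume n: "n \<ge> max K1 K2 ^ 3"
      obtain k where k: "k ^ 3 \<le> n" "n < Suc k ^ 3" by (rule cube_block)
      have "max K1 K2 < Suc k"
        using n k(2) power_less_imp_less_base[of "max K1 K2" 3 "Suc k"] by linarith
      then have kk: "k \<ge> K1" "k \<ge> K2" by auto
      have "(\<Sum>l<n. A l) = (\<Sum>l<k ^ 3. A l) + (\<Sum>l = k ^ 3..<n. A l)"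
        unfolding ivl_disj_un_one(2)[OF k(1), symmetric] by (rule sum.union_disjoint) auto
      moreover have "\<bar>\<Sum>l = k ^ 3..<n. A l\<bar> \<le> (\<Sum>l = k ^ 3..<Suc k ^ 3. \<bar>A l\<bar>)"
        using k(2) by (intro order_trans[OF sum_abs] sum_mono2) auto
      ultimately show "norm ((\<Sum>l<n. A l) - S) < e"
        using K1[OF kk(1)] K2[OF kk(2)] by (simp add: abs_if split: if_splits)
    qed
  qed
qed

lemma card_cube_block: "real (card {k ^ 3..<Suc k ^ 3}) \<le> 3 * (real k + 1)\<^sup>2"
proof -
  have "card {k ^ 3..<Suc k ^ 3} = 3 * k ^ 2 + 3 * k + 1"
    by (simp add: power3_eq_cube power2_eq_square algebra_simps)
  then have "real (card {k ^ 3..<Suc k ^ 3}) = 3 * (real k)\<^sup>2 + 3 * real k + 1" by simp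
  also have "\<dots> \<le> 3 * (real k + 1)\<^sup>2" by (simp add: power2_eq_square algebra_simps)
  finally show ?thesis .
qed

lemma summable_inverse_square: "summable (\<lambda>k. 1 / (real k + 1)\<^sup>2)"
  using inverse_power_summable[of 2, where 'a = real, THEN summable_Suc_iff[THEN iffD2]]
  by (simp add: field_simps)

text \<open>
  Cutting the series into the blocks \<open>k\<^sup>3 \<le> l < (k + 1)\<^sup>3\<close> makes the block sums absolutely
  summable almost everywhere and the fluctuation inside a block negligible.
\<close>

lemma orthogonal_series_AE:
  fixes A :: "nat \<Rightarrow> 'a \<Rightarrow> real"
  assumes prob: "prob_space M"
    and meas: "\<And>m. A m \<in> borel_measurable M"
    and bdd: "\<And>m. \<exists>C. \<forall>y\<in>space M. \<bar>A m y\<bar> \<le> C"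
    and orth: "\<And>m n. m \<noteq> n \<Longrightarrow> (\<integral>y. A m y * A n y \<partial>M) = 0"
    and summ: "summable (\<lambda>k. (real k + 1)\<^sup>2 * (\<Sum>l = k ^ 3..<Suc k ^ 3. \<integral>y. (A l y)\<^sup>2 \<partial>M))"
  obtains S where "integrable M S" "AE y in M. (\<lambda>m. A m y) sums S y"
    "\<And>g C. g \<in> borel_measurable M \<Longrightarrow> (\<And>y. y \<in> space M \<Longrightarrow> \<bar>g y\<bar> \<le> C) \<Longrightarrow>
      (\<lambda>k. \<integral>y. (\<Sum>l<k ^ 3. A l y) * g y \<partial>M) \<longlonglongrightarrow> (\<integral>y. S y * g y \<partial>M)"
proof -
  interpret prob_space M by (rule prob)
  note [measurable] = meas
  have int_prod: "integrable M (\<lambda>y. A m y * A n y)" for m n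
  proof -
    obtain C D where C: "\<forall>y\<in>space M. \<bar>A m y\<bar> \<le> C" and D: "\<forall>y\<in>space M. \<bar>A n y\<bar> \<le> D"
      using bdd by blast
    have "norm (A m y * A n y) \<le> C * D" if "y \<in> space M" for y
      using C D that unfolding real_norm_def abs_mult by (intro mult_mono) (auto intro: order_trans[OF abs_ge_zero])
    then show ?thesis by (intro integrable_const_bound[where B = "C * D"] AE_I2) auto
  qed
  define D where "D k y = (\<Sum>l = k ^ 3..<Suc k ^ 3. A l y)" for k y
  have [measurable]: "D k \<in> borel_measurable M" for k unfolding D_def by measurable
  \<comment> \<open>Up to the factor 3 the weight is the length of the block, so by Cauchy-Schwarz
    this dominates the square of the absolute block sum.\<close>
  define V where "V k y = (real k + 1)\<^sup>2 * (\<Sum>l = k ^ 3..<Suc k ^ 3. (A l y)\<^sup>2)" for k y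
  have D2: "(D k y)\<^sup>2 = (\<Sum>l = k ^ 3..<Suc k ^ 3. \<Sum>j = k ^ 3..<Suc k ^ 3. A l y * A j y)" for k y
    by (simp add: D_def power2_eq_square sum_product)
  have intD2: "integrable M (\<lambda>y. (D k y)\<^sup>2)" for k
    unfolding D2 using int_prod by (intro Bochner_Integration.integrable_sum)
  have intV: "integrable M (V k)" for k
    unfolding V_def power2_eq_square using int_prod
    by (intro integrable_mult_right Bochner_Integration.integrable_sum)
  have D2_eq: "(\<integral>y. (D k y)\<^sup>2 \<partial>M) = (\<Sum>l = k ^ 3..<Suc k ^ 3. \<integral>y. (A l y)\<^sup>2 \<partial>M)" for k
  proof -
    have "(\<integral>y. (D k y)\<^sup>2 \<partial>M) = (\<Sum>l = k ^ 3..<Suc k ^ 3. \<Sum>j = k ^ 3..<Suc k ^ 3. \<integral>y. A l y * A j y \<partial>M)"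
      unfolding D2 using int_prod by (simp add: Bochner_Integration.integral_sum Bochner_Integration.integrable_sum)
    also have "\<dots> = (\<Sum>l = k ^ 3..<Suc k ^ 3. \<Sum>j = k ^ 3..<Suc k ^ 3. if j = l then \<integral>y. (A l y)\<^sup>2 \<partial>M else 0)"
      by (intro sum.cong refl) (auto simp: orth power2_eq_square)
    also have "\<dots> = (\<Sum>l = k ^ 3..<Suc k ^ 3. \<integral>y. (A l y)\<^sup>2 \<partial>M)"
      by (intro sum.cong refl) simp
    finally show ?thesis .
  qed
  have AE_V: "AE y in M. summable (\<lambda>k. V k y)"
  proof (rule AE_summable[OF intV])
    have "(\<integral>y. V k y \<partial>M) = (real k + 1)\<^sup>2 * (\<Sum>l = k ^ 3..<Suc k ^ 3. \<integral>y. (A l y)\<^sup>2 \<partial>M)" for k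
      unfolding V_def power2_eq_square using int_prod by (simp add: Bochner_Integration.integral_sum)
    then show "summable (\<lambda>k. \<integral>y. V k y \<partial>M)" using summ by simp
  qed (simp add: V_def sum_nonneg)
  \<comment> \<open>Arithmetic-geometric mean: the integrals of \<open>W k\<close> are summable
    although only squares of \<open>D k\<close> are controlled. The sum of all \<open>W k\<close> is
    an integrable bound for the partial sums at cubes.\<close>
  define W where "W k y = ((real k + 1)\<^sup>2 * (D k y)\<^sup>2 + 1 / (real k + 1)\<^sup>2) / 2" for k y
  have D_W: "\<bar>D k y\<bar> \<le> W k y" for k y
  proof -
    have "0 \<le> ((real k + 1) * \<bar>D k y\<bar> - 1 / (real k + 1))\<^sup>2" by simp
    also have "\<dots> = (real k + 1)\<^sup>2 * (D k y)\<^sup>2 + 1 / (real k + 1)\<^sup>2 - 2 * \<bar>D k y\<bar>"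
      by (simp add: power2_diff power_mult_distrib power_divide)
    finally show ?thesis by (simp add: W_def)
  qed
  have intW: "integrable M (W k)" for k
    unfolding W_def using intD2
    by (intro integrable_divide Bochner_Integration.integrable_add integrable_mult_right integrable_const)
  have AE_W: "AE y in M. summable (\<lambda>k. W k y)" and sumW: "summable (\<lambda>k. \<integral>y. norm (W k y) \<partial>M)"
  proof -
    have eq: "(\<integral>y. W k y \<partial>M) = ((real k + 1)\<^sup>2 * (\<Sum>l = k ^ 3..<Suc k ^ 3. \<integral>y. (A l y)\<^sup>2 \<partial>M) + 1 / (real k + 1)\<^sup>2) / 2" for k
      unfolding W_def using intD2 by (simp add: D2_eq prob_space)
    have s: "summable (\<lambda>k. \<integral>y. W k y \<partial>M)"
      unfolding eq by (intro summable_divide summable_add summ summable_inverse_square)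
    have W0: "0 \<le> W k y" for k y by (simp add: W_def)
    show "AE y in M. summable (\<lambda>k. W k y)" by (rule AE_summable[OF intW W0 s])
    show "summable (\<lambda>k. \<integral>y. norm (W k y) \<partial>M)" using s W0 by simp
  qed
  have intG: "integrable M (\<lambda>y. \<Sum>k. W k y)"
  proof (rule integrable_suminf[OF intW _ sumW])
    show "AE y in M. summable (\<lambda>k. norm (W k y))"
      using AE_W by eventually_elim (simp add: W_def)
  qed
  define S where "S y = (\<Sum>k. D k y)" for y
  have [measurable]: "S \<in> borel_measurable M" unfolding S_def by measurable
  have AE_D: "AE y in M. (\<lambda>k. D k y) sums S y \<and> summable (\<lambda>k. W k y)"
    using AE_W
  proof eventually_elim
    case (elim y)
    have "summable (\<lambda>k. D k y)"
      by (rule summable_comparison_test'[OF elim, of 0]) (simp add: D_W)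
    with elim show ?case by (simp add: S_def summable_sums)
  qed
  have cubes: "(\<Sum>j<k. D j y) = (\<Sum>l<k ^ 3. A l y)" for k y
    unfolding D_def by (rule sum_cube_blocks)
  have part_W: "\<bar>\<Sum>j<k. D j y\<bar> \<le> (\<Sum>k. W k y)" if "summable (\<lambda>k. W k y)" for k y
  proof -
    have "\<bar>\<Sum>j<k. D j y\<bar> \<le> (\<Sum>j<k. W j y)"
      using D_W by (intro order_trans[OF sum_abs] sum_mono) auto
    also have "\<dots> \<le> (\<Sum>k. W k y)"
      by (rule sum_le_suminf[OF that]) (auto simp: W_def)
    finally show ?thesis .
  qed
  have lim: "(\<lambda>k. \<integral>y. (\<Sum>l<k ^ 3. A l y) * g y \<partial>M) \<longlonglongrightarrow> (\<integral>y. S y * g y \<partial>M)"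
    if g[measurable]: "g \<in> borel_measurable M" and C: "\<And>y. y \<in> space M \<Longrightarrow> \<bar>g y\<bar> \<le> C" for g C
    unfolding cubes[symmetric]
  proof (rule integral_dominated_convergence[where w = "\<lambda>y. (\<Sum>k. W k y) * C"])
    show "integrable M (\<lambda>y. (\<Sum>k. W k y) * C)" using intG by simp
    show "AE y in M. (\<lambda>k. (\<Sum>j<k. D j y) * g y) \<longlonglongrightarrow> S y * g y"
      using AE_D by eventually_elim (auto simp: sums_def intro: tendsto_mult_right)
    show "AE y in M. norm ((\<Sum>j<k. D j y) * g y) \<le> (\<Sum>k. W k y) * C" for k
      using AE_D AE_space
    proof eventually_elim
      case (elim y)
      have "norm ((\<Sum>j<k. D j y) * g y) = \<bar>\<Sum>j<k. D j y\<bar> * \<bar>g y\<bar>" by (simp add: abs_mult)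
      also have "\<dots> \<le> (\<Sum>k. W k y) * C"
        using part_W[of y k] C[OF elim(2)] elim(1)
        by (intro mult_mono) (auto intro: order_trans[OF abs_ge_zero])
      finally show ?case .
    qed
  qed measurable
  have intS: "integrable M S"
  proof (rule Bochner_Integration.integrable_bound[OF intG])
    show "AE y in M. norm (S y) \<le> norm (\<Sum>k. W k y)"
      using AE_D
    proof eventually_elim
      case (elim y)
      then have "(\<lambda>k. \<bar>\<Sum>j<k. D j y\<bar>) \<longlonglongrightarrow> \<bar>S y\<bar>" by (auto simp: sums_def intro: tendsto_rabs)
      then have "\<bar>S y\<bar> \<le> (\<Sum>k. W k y)"
        by (rule LIMSEQ_le_const2) (use part_W elim in auto)
      then show ?case by simp
    qed
  qed measurable
  have "AE y in M. (\<lambda>m. A m y) sums S y"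
    using AE_D AE_V
  proof eventually_elim
    case (elim y)
    show ?case
    proof (rule sums_by_blocks)
      show "(\<lambda>k. \<Sum>l = k ^ 3..<Suc k ^ 3. A l y) sums S y" using elim by (simp add: D_def)
      have V0: "(\<lambda>k. 3 * V k y) \<longlonglongrightarrow> 0"
        using tendsto_mult_right_zero[OF summable_LIMSEQ_zero[OF elim(2)]] .
      have le: "(\<Sum>l = k ^ 3..<Suc k ^ 3. \<bar>A l y\<bar>)\<^sup>2 \<le> 3 * V k y" for k
      proof -
        have "(\<Sum>l = k ^ 3..<Suc k ^ 3. \<bar>A l y\<bar> * 1)\<^sup>2 \<le>
          (\<Sum>l = k ^ 3..<Suc k ^ 3. \<bar>A l y\<bar>\<^sup>2) * (\<Sum>l = k ^ 3..<Suc k ^ 3. 1\<^sup>2)"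
          by (rule Cauchy_Schwarz_ineq_sum)
        also have "\<dots> \<le> (\<Sum>l = k ^ 3..<Suc k ^ 3. \<bar>A l y\<bar>\<^sup>2) * (3 * (real k + 1)\<^sup>2)"
          using card_cube_block[of k] by (intro mult_left_mono sum_nonneg) (auto simp del: card_atLeastLessThan)
        finally show ?thesis by (simp add: V_def mult_ac)
      qed
      have "(\<lambda>k. (\<Sum>l = k ^ 3..<Suc k ^ 3. \<bar>A l y\<bar>)\<^sup>2) \<longlonglongrightarrow> 0"
        by (rule tendsto_sandwich[OF _ _ tendsto_const V0]) (use le in auto)
      from tendsto_real_sqrt[OF this]
      show "(\<lambda>k. \<Sum>l = k ^ 3..<Suc k ^ 3. \<bar>A l y\<bar>) \<longlonglongrightarrow> 0"
        by (simp add: abs_of_nonneg sum_nonneg)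
    qed
  qed
  from that[OF intS this lim] show thesis .
qed

text \<open>Bernstein approximation is uniform, which suits an \<open>h\<close> that is merely
  integrable: the polynomial moment drops out and the error is at most \<open>e\<close> times the
  norm of \<open>h\<close>.\<close>

lemma moments_zero_continuous:
  fixes h g :: "real \<Rightarrow> real"
  assumes h: "integrable unit_lebesgue h"
    and mom: "\<And>P :: real poly. (\<integral>x. h x * poly P x \<partial>unit_lebesgue) = 0"
    and g: "continuous_on UNIV g"
  shows "(\<integral>x. h x * g x \<partial>unit_lebesgue) = 0"
proof -
  have bound: "\<bar>\<integral>x. h x * g x \<partial>unit_lebesgue\<bar> \<le> e * (\<integral>x. \<bar>h x\<bar> \<partial>unit_lebesgue)" if e: "0 < e" for e
  proof -
    have "continuous_on {0..1} g" by (rule continuous_on_subset[OF g]) simp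
    from Bernstein_Weierstrass[OF this e] obtain n where
      n: "\<And>x. x \<in> {0..1} \<Longrightarrow> \<bar>g x - (\<Sum>k\<le>n. g (real k / real n) * Bernstein n k x)\<bar> < e" by blast
    define P where "P = (\<Sum>k\<le>n. Polynomial.smult (g (real k / real n) * real (n choose k)) ([:0, 1:] ^ k * [:1, - 1:] ^ (n - k)))"
    have P: "poly P x = (\<Sum>k\<le>n. g (real k / real n) * Bernstein n k x)" for x
      by (simp add: P_def poly_sum poly_power Bernstein_def mult_ac)
    have gm: "g \<in> borel_measurable unit_lebesgue"
      by (intro measurable_unit_lebesgueI borel_measurable_continuous_onI g)
    have Pm: "(\<lambda>x. poly P x) \<in> borel_measurable unit_lebesgue"
      by (intro measurable_unit_lebesgueI borel_measurable_continuous_onI continuous_intros)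
    have diff: "integrable unit_lebesgue (\<lambda>x. h x * (g x - poly P x))"
    proof (rule Bochner_Integration.integrable_bound[OF integrable_mult_right[OF h, of e]])
      show "(\<lambda>x. h x * (g x - poly P x)) \<in> borel_measurable unit_lebesgue"
        using gm Pm h by (intro borel_measurable_times borel_measurable_diff) auto
      show "AE x in unit_lebesgue. norm (h x * (g x - poly P x)) \<le> norm (e * h x)"
      proof (rule AE_I2)
        fix x assume "x \<in> space unit_lebesgue"
        then have "\<bar>g x - poly P x\<bar> \<le> e" using n[of x] by (simp add: P)
        then have "\<bar>h x\<bar> * \<bar>g x - poly P x\<bar> \<le> \<bar>h x\<bar> * e" by (intro mult_left_mono) auto
        then show "norm (h x * (g x - poly P x)) \<le> norm (e * h x)" using e by (simp add: abs_mult mult.commute)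
      qed
    qed
    have hP: "integrable unit_lebesgue (\<lambda>x. h x * poly P x)"
    proof -
      have "continuous_on UNIV (poly P)" by (intro continuous_intros)
      then obtain C where C: "\<forall>x\<in>{0..1}. \<bar>poly P x\<bar> \<le> C" by (rule continuous_bounded_unit_interval)
      show ?thesis
      proof (rule Bochner_Integration.integrable_bound[OF integrable_mult_right[OF h, of C]])
        show "(\<lambda>x. h x * poly P x) \<in> borel_measurable unit_lebesgue"
          using Pm h by (intro borel_measurable_times) auto
        show "AE x in unit_lebesgue. norm (h x * poly P x) \<le> norm (C * h x)"
        proof (rule AE_I2)
          fix x assume "x \<in> space unit_lebesgue"
          then have "\<bar>poly P x\<bar> \<le> C" using C by simp
          then have "\<bar>h x\<bar> * \<bar>poly P x\<bar> \<le> \<bar>h x\<bar> * \<bar>C\<bar>" by (intro mult_left_mono) auto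
          then show "norm (h x * poly P x) \<le> norm (C * h x)" by (simp add: abs_mult mult.commute)
        qed
      qed
    qed
    have "(\<integral>x. h x * g x \<partial>unit_lebesgue) = (\<integral>x. h x * (g x - poly P x) + h x * poly P x \<partial>unit_lebesgue)"
      by (simp add: algebra_simps)
    also have "\<dots> = (\<integral>x. h x * (g x - poly P x) \<partial>unit_lebesgue)"
      using diff hP mom by simp
    finally have "\<bar>\<integral>x. h x * g x \<partial>unit_lebesgue\<bar> \<le> (\<integral>x. \<bar>h x * (g x - poly P x)\<bar> \<partial>unit_lebesgue)"
      by (simp add: integral_abs_bound)
    also have "\<dots> \<le> (\<integral>x. e * \<bar>h x\<bar> \<partial>unit_lebesgue)"
    proof (rule integral_mono)
      show "integrable unit_lebesgue (\<lambda>x. \<bar>h x * (g x - poly P x)\<bar>)" using diff by (rule integrable_abs)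
      show "integrable unit_lebesgue (\<lambda>x. e * \<bar>h x\<bar>)" using h by (intro integrable_mult_right integrable_abs)
      fix x assume "x \<in> space unit_lebesgue"
      then have "\<bar>g x - poly P x\<bar> \<le> e" using n[of x] by (simp add: P)
      then show "\<bar>h x * (g x - poly P x)\<bar> \<le> e * \<bar>h x\<bar>"
        by (simp add: abs_mult mult.commute[of e] mult_left_mono)
    qed
    finally show ?thesis by simp
  qed
  let ?I = "\<integral>x. \<bar>h x\<bar> \<partial>unit_lebesgue"
  have I: "0 \<le> ?I" by simp
  show ?thesis
  proof (rule ccontr)
    assume "(\<integral>x. h x * g x \<partial>unit_lebesgue) \<noteq> 0" (is "?J \<noteq> 0")
    then have J: "0 < \<bar>?J\<bar>" by simp
    have "0 < 2 * (?I + 1)" by (intro mult_pos_pos add_nonneg_pos I) simp_all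
    \<comment> \<open>This choice of \<open>e\<close> makes the bound at most half of the value
      itself.\<close>
    then have "\<bar>?J\<bar> \<le> \<bar>?J\<bar> / (2 * (?I + 1)) * ?I" using J by (intro bound divide_pos_pos)
    also have "\<dots> \<le> \<bar>?J\<bar> / (2 * (?I + 1)) * (?I + 1)" using J I by (intro mult_left_mono) auto
    also have "\<dots> = \<bar>?J\<bar> / 2"
    proof -
      have "a / (2 * c) * c = a / 2" if "0 < 2 * c" for a c :: real using that by simp
      then show ?thesis using \<open>0 < 2 * (?I + 1)\<close> .
    qed
    finally show False using J by simp
  qed
qed

lemma moments_zero_ray:
  fixes h :: "real \<Rightarrow> real"
  assumes h: "integrable unit_lebesgue h"
    and mom: "\<And>P :: real poly. (\<integral>x. h x * poly P x \<partial>unit_lebesgue) = 0"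
  shows "(\<integral>x. h x * indicator {a<..} x \<partial>unit_lebesgue) = 0"
proof -
  \<comment> \<open>Continuous ramps that converge to the indicator of the ray.\<close>
  define g where "g j x = min 1 (max 0 (real j * (x - a)))" for j x
  have cont: "continuous_on UNIV (g j)" for j unfolding g_def by (intro continuous_intros)
  have "(\<lambda>j. \<integral>x. h x * g j x \<partial>unit_lebesgue) \<longlonglongrightarrow> (\<integral>x. h x * indicator {a<..} x \<partial>unit_lebesgue)"
  proof (rule integral_dominated_convergence[where w = "\<lambda>x. \<bar>h x\<bar>"])
    have "indicator {a<..} \<in> borel_measurable unit_lebesgue"
      by (intro measurable_unit_lebesgueI) simp
    then show "(\<lambda>x. h x * indicator {a<..} x) \<in> borel_measurable unit_lebesgue"
      using h by (intro borel_measurable_times) auto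
    show "(\<lambda>x. h x * g j x) \<in> borel_measurable unit_lebesgue" for j
      using h cont by (intro borel_measurable_times measurable_unit_lebesgueI[of "g j"] borel_measurable_continuous_onI) auto
    show "integrable unit_lebesgue (\<lambda>x. \<bar>h x\<bar>)" using h by (rule integrable_abs)
    show "AE x in unit_lebesgue. (\<lambda>j. h x * g j x) \<longlonglongrightarrow> h x * indicator {a<..} x"
    proof (rule AE_I2, rule tendsto_mult_left)
      fix x
      show "(\<lambda>j. g j x) \<longlonglongrightarrow> indicator {a<..} x"
      proof (cases "a < x")
        case True
        obtain N where N: "1 / (x - a) < real N" using reals_Archimedean2 by blast
        have "g j x = 1" if "N \<le> j" for j
        proof -
          have "1 / (x - a) \<le> real j" using N that by linarith
          then have "1 \<le> real j * (x - a)" using True by (simp add: field_simps)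
          then show ?thesis by (simp add: g_def)
        qed
        then have "eventually (\<lambda>j. g j x = 1) sequentially" by (auto simp: eventually_sequentially)
        then show ?thesis using True by (simp add: tendsto_eventually)
      next
        case False
        then have "g j x = 0" for j by (simp add: g_def mult_nonneg_nonpos)
        then show ?thesis using False by simp
      qed
    qed
    show "AE x in unit_lebesgue. norm (h x * g j x) \<le> \<bar>h x\<bar>" for j
      by (intro AE_I2) (auto simp: g_def abs_mult min_def max_def intro!: mult_left_le)
  qed
  moreover have "(\<integral>x. h x * g j x \<partial>unit_lebesgue) = 0" for j
    by (rule moments_zero_continuous[OF h mom cont])
  ultimately show ?thesis by (simp add: LIMSEQ_const_iff)
qed

text \<open>The positive and negative parts of \<open>h\<close> define measures that agree on rays,
  hence on all Borel sets. Testing them where \<open>h\<close> is positive and where it is negative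
  makes both parts vanish.\<close>

lemma moments_zero_AE:
  fixes h :: "real \<Rightarrow> real"
  assumes h: "integrable unit_lebesgue h"
    and mom: "\<And>P :: real poly. (\<integral>x. h x * poly P x \<partial>unit_lebesgue) = 0"
  shows "AE x in unit_lebesgue. h x = 0"
proof -
  have id: "(\<lambda>x. x) \<in> unit_lebesgue \<rightarrow>\<^sub>M borel" by (rule measurable_unit_lebesgue_ident)
  interpret U: prob_space unit_lebesgue by (rule prob_space_unit_lebesgue)
  have hm: "h \<in> borel_measurable unit_lebesgue" using h by simp
  define D where "D f = distr (density unit_lebesgue (\<lambda>x. ennreal (f x))) borel (\<lambda>x. x)" for f :: "real \<Rightarrow> real"
  have emD: "emeasure (D f) B = (\<integral>\<^sup>+x. ennreal (f x) * indicator B x \<partial>unit_lebesgue)"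
    if "f \<in> borel_measurable unit_lebesgue" "B \<in> sets borel" for f B
  proof -
    have "emeasure (D f) B = emeasure (density unit_lebesgue (\<lambda>x. ennreal (f x))) (B \<inter> space unit_lebesgue)"
      unfolding D_def using id that(2) by (subst emeasure_distr) (auto simp: vimage_def Int_def)
    also have "\<dots> = (\<integral>\<^sup>+x. ennreal (f x) * indicator (B \<inter> space unit_lebesgue) x \<partial>unit_lebesgue)"
      using that measurable_sets[OF id that(2)] by (subst emeasure_density) (auto simp: vimage_def)
    also have "\<dots> = (\<integral>\<^sup>+x. ennreal (f x) * indicator B x \<partial>unit_lebesgue)"
      by (intro nn_integral_cong) (auto simp: indicator_def)
    finally show ?thesis .
  qed
  let ?p = "\<lambda>x. max 0 (h x)" and ?n = "\<lambda>x. max 0 (- h x)"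
  have pm: "?p \<in> borel_measurable unit_lebesgue" "?n \<in> borel_measurable unit_lebesgue"
    using hm by auto
  have ind: "indicator {a<..} \<in> borel_measurable unit_lebesgue" for a :: real
    by (intro measurable_unit_lebesgueI) simp
  have int: "integrable unit_lebesgue (\<lambda>x. ?p x * indicator {a<..} x)"
    "integrable unit_lebesgue (\<lambda>x. ?n x * indicator {a<..} x)" for a
  proof -
    show "integrable unit_lebesgue (\<lambda>x. ?p x * indicator {a<..} x)"
      by (rule Bochner_Integration.integrable_bound[OF h borel_measurable_times[OF pm(1) ind] AE_I2])
         (simp add: indicator_def abs_ge_self)
    show "integrable unit_lebesgue (\<lambda>x. ?n x * indicator {a<..} x)"
      by (rule Bochner_Integration.integrable_bound[OF h borel_measurable_times[OF pm(2) ind] AE_I2])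
         (simp add: indicator_def abs_ge_minus_self)
  qed
  have val: "emeasure (D ?p) {a<..} = ennreal (\<integral>x. ?p x * indicator {a<..} x \<partial>unit_lebesgue)"
    "emeasure (D ?n) {a<..} = ennreal (\<integral>x. ?n x * indicator {a<..} x \<partial>unit_lebesgue)" for a
  proof -
    have "emeasure (D ?p) {a<..} = (\<integral>\<^sup>+x. ennreal (?p x * indicator {a<..} x) \<partial>unit_lebesgue)"
      by (subst emD[OF pm(1)]) (auto intro!: nn_integral_cong simp: indicator_def)
    then show "emeasure (D ?p) {a<..} = ennreal (\<integral>x. ?p x * indicator {a<..} x \<partial>unit_lebesgue)"
      using int(1)[of a] by (subst (asm) nn_integral_eq_integral) auto
    have "emeasure (D ?n) {a<..} = (\<integral>\<^sup>+x. ennreal (?n x * indicator {a<..} x) \<partial>unit_lebesgue)"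
      by (subst emD[OF pm(2)]) (auto intro!: nn_integral_cong simp: indicator_def)
    then show "emeasure (D ?n) {a<..} = ennreal (\<integral>x. ?n x * indicator {a<..} x \<partial>unit_lebesgue)"
      using int(2)[of a] by (subst (asm) nn_integral_eq_integral) auto
  qed
  have "D ?p = D ?n"
  proof (rule measure_eqI_lessThan)
    fix a :: real
    show "emeasure (D ?p) {a<..} < \<infinity>" by (simp add: val)
    have "(\<integral>x. ?p x * indicator {a<..} x \<partial>unit_lebesgue) - (\<integral>x. ?n x * indicator {a<..} x \<partial>unit_lebesgue) =
      (\<integral>x. ?p x * indicator {a<..} x - ?n x * indicator {a<..} x \<partial>unit_lebesgue)"
      using int[of a] by simp
    also have "\<dots> = (\<integral>x. h x * indicator {a<..} x \<partial>unit_lebesgue)"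
      by (intro Bochner_Integration.integral_cong refl) (auto simp: indicator_def max_def)
    also have "\<dots> = 0" by (rule moments_zero_ray[OF h mom])
    finally show "emeasure (D ?p) {a<..} = emeasure (D ?n) {a<..}" by (simp add: val)
  qed (simp_all add: D_def)
  then have eq: "(\<integral>\<^sup>+x. ennreal (?p x) * indicator B x \<partial>unit_lebesgue) = (\<integral>\<^sup>+x. ennreal (?n x) * indicator B x \<partial>unit_lebesgue)"
    if "B \<in> sets borel" for B
    using emD[OF pm(1) that] emD[OF pm(2) that] by simp
  define B where "B = {x \<in> space unit_lebesgue. 0 < h x}"
  have Bs: "B \<in> sets unit_lebesgue" unfolding B_def using hm by measurable
  then have Bb: "B \<in> sets borel"
    unfolding unit_lebesgue_def by (auto simp: sets_restrict_space)
  define B' where "B' = {x \<in> space unit_lebesgue. h x < 0}"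
  have Bs': "B' \<in> sets unit_lebesgue" unfolding B'_def using hm by measurable
  then have Bb': "B' \<in> sets borel"
    unfolding unit_lebesgue_def by (auto simp: sets_restrict_space)
  have "(\<lambda>x. ennreal (?n x) * indicator B x) = (\<lambda>_. 0)"
    by (auto simp: fun_eq_iff B_def indicator_def max_def)
  then have "(\<integral>\<^sup>+x. ennreal (?n x) * indicator B x \<partial>unit_lebesgue) = 0" by simp
  then have 1: "AE x in unit_lebesgue. ennreal (?p x) * indicator B x = 0"
    by (subst nn_integral_0_iff_AE[symmetric], intro borel_measurable_times_ennreal[OF measurable_compose[OF pm(1) measurable_ennreal] borel_measurable_indicator[OF Bs]])
       (use eq[OF Bb] in simp)
  have "(\<lambda>x. ennreal (?p x) * indicator B' x) = (\<lambda>_. 0)"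
    by (auto simp: fun_eq_iff B'_def indicator_def max_def)
  then have "(\<integral>\<^sup>+x. ennreal (?p x) * indicator B' x \<partial>unit_lebesgue) = 0" by simp
  then have 2: "AE x in unit_lebesgue. ennreal (?n x) * indicator B' x = 0"
    by (subst nn_integral_0_iff_AE[symmetric], intro borel_measurable_times_ennreal[OF measurable_compose[OF pm(2) measurable_ennreal] borel_measurable_indicator[OF Bs']])
       (use eq[OF Bb'] in simp)
  from 1 2 AE_space show ?thesis
    by eventually_elim (auto simp: B_def B'_def indicator_def ennreal_eq_0_iff split: if_splits)
qed

text \<open>The exact degree comes from \<open>DERIV_jacobi_raise\<close>: the derivative is a
  nonzero multiple of a polynomial of degree one less. This spares computing leading
  coefficients.\<close>

lemma jacobi_sum_poly: "\<exists>P :: real poly. P \<noteq> 0 \<and> degree P = n \<and> poly P = jacobi_sum n a b"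
proof (induction n arbitrary: a b)
  case 0
  show ?case by (intro exI[of _ 1]) (auto simp: fun_eq_iff)
next
  case (Suc n)
  obtain R :: "real poly" where R: "R \<noteq> 0" "degree R = n" "poly R = jacobi_sum n (Suc a) (Suc b)"
    using Suc.IH by blast
  define P :: "real poly" where "P = (\<Sum>k\<le>Suc n. Polynomial.smult (real (Suc n + a choose k) * real (Suc n + b choose (Suc n - k)) * (- 1) ^ (Suc n - k))
     ([:0, 1:] ^ (Suc n - k) * [:1, - 1:] ^ k))"
  have P: "poly P = jacobi_sum (Suc n) a b"
    unfolding P_def jacobi_sum_def by (intro ext) (simp add: poly_sum poly_power del: sum.atMost_Suc)
  have "poly (pderiv P) x = poly (Polynomial.smult (- real (n + a + b + 2)) R) x" for x
    using DERIV_unique[OF poly_DERIV[of P x]] DERIV_jacobi_raise[of n a b x] by (simp add: P R(3))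
  then have pd: "pderiv P = Polynomial.smult (- real (n + a + b + 2)) R" by (intro poly_eqI_degree poly_ext) auto
  then have "pderiv P \<noteq> 0" using R(1) by (simp add: of_nat_add[symmetric] del: of_nat_add)
  then have "degree P \<noteq> 0" by (simp add: pderiv_eq_0_iff)
  moreover have "degree P - 1 = n"
    using degree_pderiv[of P] R(2) by (simp add: pd of_nat_add[symmetric] del: of_nat_add)
  ultimately show ?case using P by (intro exI[of _ P]) auto
qed

text \<open>Having exact degrees 0, 1, 2 and so on, Jacobi polynomials span all polynomials; the
  induction eliminates the leading term.\<close>

lemma jacobi_moments_zero:
  fixes h :: "real \<Rightarrow> real"
  assumes h: "\<And>g. continuous_on UNIV g \<Longrightarrow> integrable unit_lebesgue (\<lambda>x. h x * g x)"
    and mom: "\<And>n. (\<integral>x. h x * jacobi_sum n a b x \<partial>unit_lebesgue) = 0"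
  shows "(\<integral>x. h x * poly P x \<partial>unit_lebesgue) = 0"
proof -
  have "(\<integral>x. h x * poly P x \<partial>unit_lebesgue) = 0" if "P = 0 \<or> degree P < n" for n and P :: "real poly"
    using that
  proof (induction n arbitrary: P)
    case (Suc n)
    show ?case
    proof (cases "P = 0")
      case False
      then have deg: "degree P \<le> n" using Suc.prems by simp
      obtain R :: "real poly" where R: "R \<noteq> 0" "degree R = n" "poly R = jacobi_sum n a b"
        using jacobi_sum_poly by blast
      define c where "c = coeff P n / coeff R n"
      define Q where "Q = P - Polynomial.smult c R"
      have "coeff R n \<noteq> 0" using R by auto
      then have "coeff Q n = 0" by (simp add: Q_def c_def)
      moreover have "degree Q \<le> n" unfolding Q_def
        using deg R(2) degree_smult_le[of c R] by (intro degree_diff_le) auto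
      ultimately have "Q = 0 \<or> degree Q < n" by (rule eq_zero_or_degree_less[rotated])
      then have IH: "(\<integral>x. h x * poly Q x \<partial>unit_lebesgue) = 0" by (rule Suc.IH)
      have contR: "continuous_on UNIV (jacobi_sum n a b)"
        unfolding R(3)[symmetric] by (intro continuous_intros)
      have "(\<integral>x. h x * poly P x \<partial>unit_lebesgue) = (\<integral>x. h x * poly Q x + c * (h x * jacobi_sum n a b x) \<partial>unit_lebesgue)"
        by (intro Bochner_Integration.integral_cong refl) (simp add: Q_def R(3)[symmetric] algebra_simps)
      also have "\<dots> = 0"
        using h[of "poly Q"] h[OF contR] IH mom[of n] by (simp add: continuous_intros)
      finally show ?thesis .
    qed simp
  qed simp
  from this[of P "Suc (degree P)"] show ?thesis by simp
qed

context bead_lines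
begin

section \<open>Jacobi moments of the kernel\<close>

lemma right_fun_propagator_integral:
  assumes "0 < x" "x < 1"
  shows "integrable unit_lebesgue (\<lambda>y. right_fun \<kappa> s y * propagator (s, y) (t, x))"
    "(\<integral>y. right_fun \<kappa> s y * propagator (s, y) (t, x) \<partial>unit_lebesgue) =
      (\<Sum>j<p. taylor_coeff \<kappa> j * (if j < s \<and> s < t then propagator (j, 0) (t, x) else 0))"
proof -
  have eq: "right_fun \<kappa> s y * propagator (s, y) (t, x) =
      (\<Sum>j<p. taylor_coeff \<kappa> j * (propagator (j, 0) (s, y) * propagator (s, y) (t, x)))" for y
    by (simp add: right_fun_def sum_distrib_right mult.assoc)
  have int: "integrable unit_lebesgue (\<lambda>y. propagator (j, 0) (s, y) * propagator (s, y) (t, x))" for j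
    using integrable_propagator_line[of "(j, 0)" "(t, x)" s s] assms by (simp add: mult.commute)
  show "integrable unit_lebesgue (\<lambda>y. right_fun \<kappa> s y * propagator (s, y) (t, x))"
    unfolding eq using int by (intro Bochner_Integration.integrable_sum integrable_mult_right)
  show "(\<integral>y. right_fun \<kappa> s y * propagator (s, y) (t, x) \<partial>unit_lebesgue) =
      (\<Sum>j<p. taylor_coeff \<kappa> j * (if j < s \<and> s < t then propagator (j, 0) (t, x) else 0))"
    unfolding eq using int assms by (simp add: Bochner_Integration.integral_sum propagator_convolution)
qed

text \<open>Up to line \<open>q\<close> every endpoint \<open>(p + q - i, 1)\<close> lies on a later
  line. Integrating a propagator from \<open>(j, 0)\<close> against \<open>K\<close> then puts the
  full Gram matrix next to its inverse, and the two parts of \<open>K\<close> cancel.\<close>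

lemma right_fun_moment_low:
  assumes s: "s \<le> q" "s < t" and x: "0 < x" "x < 1"
  shows "(\<integral>y. right_fun \<kappa> s y * corr_kernel (s, y) (t, x) \<partial>unit_lebesgue) = 0"
proof -
  let ?c = "\<lambda>j i l. inv_gram i l * propagator (l, 0) (t, x)"
  have int: "integrable unit_lebesgue (\<lambda>y. propagator (j, 0) (s, y) * propagator (s, y) (t', x'))"
    if "0 < x'" "x' \<le> 1" for j t' x'
    using integrable_propagator_line[of "(j, 0)" "(t', x')" s s] that by (simp add: mult.commute)
  have eq: "propagator (j, 0) (s, y) * corr_kernel (s, y) (t, x) =
      (\<Sum>i<p. \<Sum>l<p. (inv_gram i l * propagator (l, 0) (t, x)) *
        (propagator (j, 0) (s, y) * propagator (s, y) (p + q - i, 1))) -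
      propagator (j, 0) (s, y) * propagator (s, y) (t, x)" for j y
    by (simp add: corr_kernel_def sum_distrib_left algebra_simps)
  have intk: "integrable unit_lebesgue (\<lambda>y. propagator (j, 0) (s, y) * corr_kernel (s, y) (t, x))" for j
    unfolding eq using x int
    by (intro Bochner_Integration.integrable_diff Bochner_Integration.integrable_sum integrable_mult_right) auto
  have zero: "(\<integral>y. propagator (j, 0) (s, y) * corr_kernel (s, y) (t, x) \<partial>unit_lebesgue) = 0" if j: "j < p" for j
  proof -
    have "(\<integral>y. propagator (j, 0) (s, y) * corr_kernel (s, y) (t, x) \<partial>unit_lebesgue) =
      (\<Sum>i<p. \<Sum>l<p. (inv_gram i l * propagator (l, 0) (t, x)) *
        (\<integral>y. propagator (j, 0) (s, y) * propagator (s, y) (p + q - i, 1) \<partial>unit_lebesgue)) -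
      (\<integral>y. propagator (j, 0) (s, y) * propagator (s, y) (t, x) \<partial>unit_lebesgue)"
      unfolding eq using int x by (simp add: Bochner_Integration.integral_sum)
    also have "\<dots> = (if j < s then
      (\<Sum>i<p. \<Sum>l<p. (inv_gram i l * propagator (l, 0) (t, x)) * bead_gram p q j i) - propagator (j, 0) (t, x) else 0)"
    proof -
      have "(\<integral>y. propagator (j, 0) (s, y) * propagator (s, y) (p + q - i, 1) \<partial>unit_lebesgue) =
          (if j < s then bead_gram p q j i else 0)" if "i < p" for i
        using s that by (subst propagator_convolution) (auto simp: bead_gram_def)
      then have "(\<Sum>i<p. \<Sum>l<p. (inv_gram i l * propagator (l, 0) (t, x)) *
          (\<integral>y. propagator (j, 0) (s, y) * propagator (s, y) (p + q - i, 1) \<partial>unit_lebesgue)) =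
        (\<Sum>i<p. \<Sum>l<p. (inv_gram i l * propagator (l, 0) (t, x)) * (if j < s then bead_gram p q j i else 0))"
        by (intro sum.cong refl) simp
      moreover have "(\<integral>y. propagator (j, 0) (s, y) * propagator (s, y) (t, x) \<partial>unit_lebesgue) =
          (if j < s then propagator (j, 0) (t, x) else 0)"
        using s x by (subst propagator_convolution) auto
      ultimately show ?thesis by (cases "j < s") (simp_all only: if_True if_False mult_zero_right sum.neutral_const diff_0_right simp_thms)
    qed
    also have "(\<Sum>i<p. \<Sum>l<p. (inv_gram i l * propagator (l, 0) (t, x)) * bead_gram p q j i) =
      (\<Sum>l<p. (\<Sum>i<p. bead_gram p q j i * inv_gram i l) * propagator (l, 0) (t, x))"
      by (subst sum.swap) (simp add: sum_distrib_right sum_distrib_left mult_ac)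
    also have "\<dots> = (\<Sum>l<p. if l = j then propagator (l, 0) (t, x) else 0)"
      using j by (intro sum.cong refl) (auto simp: gram_inv_gram)
    also have "\<dots> = propagator (j, 0) (t, x)" using j by simp
    finally show ?thesis by simp
  qed
  have "(\<integral>y. right_fun \<kappa> s y * corr_kernel (s, y) (t, x) \<partial>unit_lebesgue) =
    (\<integral>y. (\<Sum>j<p. taylor_coeff \<kappa> j * (propagator (j, 0) (s, y) * corr_kernel (s, y) (t, x))) \<partial>unit_lebesgue)"
    by (simp add: right_fun_def sum_distrib_right mult.assoc)
  also have "\<dots> = (\<Sum>j<p. taylor_coeff \<kappa> j * (\<integral>y. propagator (j, 0) (s, y) * corr_kernel (s, y) (t, x) \<partial>unit_lebesgue))"
    using intk by (simp add: Bochner_Integration.integral_sum)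
  also have "\<dots> = 0" using zero by simp
  finally show ?thesis .
qed

lemma integrable_left_right:
  assumes "\<mu> < p" "\<kappa> < p"
  shows "integrable unit_lebesgue (\<lambda>y. right_fun \<kappa> s y * left_fun \<mu> s y)"
proof -
  have "right_fun \<kappa> s y * left_fun \<mu> s y = (\<Sum>j<p. \<Sum>i<p. (taylor_coeff \<kappa> j * taylor_coeff \<mu> i) *
      (propagator (s, y) (p + q - i, 1) * propagator (j, 0) (s, y)))" for y
    unfolding left_fun_def right_fun_def sum_product by (simp add: mult_ac)
  then show ?thesis
    using integrable_propagator_line
    by (simp only:) (intro Bochner_Integration.integrable_sum integrable_mult_right; simp)
qed

text \<open>Beyond line \<open>q\<close> some endpoints are no longer ahead. Instead every
  \<open>left_fun\<close> of index below \<open>p\<close> is a Jacobi function on line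
  \<open>s\<close>; biorthogonality selects \<open>right_fun \<kappa> t x\<close>, and the
  propagator part cancels it.\<close>

lemma right_fun_moment_high:
  assumes s: "q < s" "s < t" and \<kappa>: "\<kappa> < p" "s + Suc \<kappa> \<le> p + q" and x: "0 < x" "x < 1"
  shows "(\<integral>y. right_fun \<kappa> s y * corr_kernel (s, y) (t, x) \<partial>unit_lebesgue) = 0"
proof -
  have eq: "right_fun \<kappa> s y * corr_kernel (s, y) (t, x) =
      (\<Sum>\<mu><p. right_fun \<mu> t x / index_norm \<mu> * (right_fun \<kappa> s y * left_fun \<mu> s y)) -
      right_fun \<kappa> s y * propagator (s, y) (t, x)" for y
    unfolding corr_kernel_eq by (simp add: sum_distrib_left algebra_simps)
  have "(\<integral>y. right_fun \<kappa> s y * corr_kernel (s, y) (t, x) \<partial>unit_lebesgue) =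
      (\<Sum>\<mu><p. right_fun \<mu> t x / index_norm \<mu> * (\<integral>y. right_fun \<kappa> s y * left_fun \<mu> s y \<partial>unit_lebesgue)) -
      (\<Sum>j<p. taylor_coeff \<kappa> j * (if j < s \<and> s < t then propagator (j, 0) (t, x) else 0))"
  proof -
    have int: "integrable unit_lebesgue (\<lambda>y. right_fun \<mu> t x / index_norm \<mu> * (right_fun \<kappa> s y * left_fun \<mu> s y))"
      if "\<mu> \<in> {..<p}" for \<mu>
      using integrable_left_right \<kappa> that by (intro integrable_mult_right) auto
    show ?thesis
      unfolding eq
      by (subst Bochner_Integration.integral_diff[OF Bochner_Integration.integrable_sum[OF int]
            right_fun_propagator_integral(1)[OF x]], assumption,
          subst Bochner_Integration.integral_sum[OF int], assumption,
          simp only: right_fun_propagator_integral(2)[OF x] integral_mult_right_zero)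
  qed
  also have "(\<Sum>j<p. taylor_coeff \<kappa> j * (if j < s \<and> s < t then propagator (j, 0) (t, x) else 0)) = right_fun \<kappa> t x"
    unfolding right_fun_def using s p_le_q by (intro sum.cong refl) auto
  also have "(\<Sum>\<mu><p. right_fun \<mu> t x / index_norm \<mu> * (\<integral>y. right_fun \<kappa> s y * left_fun \<mu> s y \<partial>unit_lebesgue)) =
    (\<Sum>\<mu><p. if \<mu> = \<kappa> then right_fun \<mu> t x else 0)"
  proof (intro sum.cong refl)
    fix \<mu> assume "\<mu> \<in> {..<p}"
    then have "\<mu> < p" "Suc \<mu> \<le> s" using s p_le_q by auto
    then show "right_fun \<mu> t x / index_norm \<mu> * (\<integral>y. right_fun \<kappa> s y * left_fun \<mu> s y \<partial>unit_lebesgue) =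
      (if \<mu> = \<kappa> then right_fun \<mu> t x else 0)"
      using left_right_biorthogonal[of \<mu> s \<kappa>] \<kappa> index_norm_nonzero[of \<mu>] index_norm_nonzero[of \<kappa>] by (simp add: mult.commute)
  qed
  finally show ?thesis using \<kappa> by simp
qed

lemma right_fun_moment:
  assumes "s < t" "\<kappa> < p" "s + Suc \<kappa> \<le> p + q" "0 < x" "x < 1"
  shows "(\<integral>y. right_fun \<kappa> s y * corr_kernel (s, y) (t, x) \<partial>unit_lebesgue) = 0"
  using right_fun_moment_low right_fun_moment_high assms by (cases "s \<le> q") auto

text \<open>
  The Jacobi functions of index \<open>l\<close>, for \<open>l\<close> ranging over all integers up to the number of particles;
  positive \<open>l\<close> are those of the finite sum, the others those of the infinite one.
\<close>

definition left_poly :: "int \<Rightarrow> nat \<Rightarrow> real \<Rightarrow> real" where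
  "left_poly l s y = line_poly (nat (int p - l)) (nat (int q - l)) (nat (int s - l)) y"

definition right_poly :: "int \<Rightarrow> nat \<Rightarrow> real \<Rightarrow> real" where
  "right_poly l t x = line_poly (nat (int p - l)) (nat (int q - l)) (nat (int p + int q - int t - l)) (1 - x)"

definition poly_norm :: "int \<Rightarrow> real" where
  "poly_norm l = line_norm (nat (int p - l)) (nat (int q - l))"

lemma poly_norm_nonzero: "l \<le> int p \<Longrightarrow> poly_norm l \<noteq> 0"
  unfolding poly_norm_def using p_le_q by (intro line_norm_nonzero) simp

lemma left_right_poly_biorthogonal:
  assumes l: "l \<le> int (num_particles p q s)" and l': "l' \<le> int (num_particles p q s)" and s: "s \<le> p + q"
  shows "(\<integral>y. left_poly l s y * right_poly l' s y \<partial>unit_lebesgue) = (if l = l' then poly_norm l else 0)"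
proof -
  let ?u = "nat (int p - l)" and ?v = "nat (int q - l)" and ?u' = "nat (int p - l')" and ?v' = "nat (int q - l')"
  have b: "l \<le> int p" "l \<le> int q" "l \<le> int s" "l \<le> int p + int q - int s"
    "l' \<le> int p" "l' \<le> int q" "l' \<le> int s" "l' \<le> int p + int q - int s"
    using l l' s p_le_q by (auto simp: num_particles_def split: if_splits)
  have uv: "?u \<le> ?v" "?u' \<le> ?v'" "?u + ?v' = ?u' + ?v" "nat (int s - l) \<le> ?u + ?v'"
    "nat (int p + int q - int s - l') = ?u + ?v' - nat (int s - l)"
    using b p_le_q by auto
  have "(\<integral>y. left_poly l s y * right_poly l' s y \<partial>unit_lebesgue) =
    line_pairing ?u ?v (nat (int s - l)) ?u' ?v' (?u + ?v' - nat (int s - l))"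
    unfolding left_poly_def right_poly_def line_pairing_def uv(5) ..
  also have "\<dots> = (if l = l' then poly_norm l else 0)"
  proof (cases "l = l'")
    case True
    with uv line_pairing_self[OF uv(1), of "nat (int s - l)"] show ?thesis by (simp add: poly_norm_def)
  next
    case False
    then have "?u \<noteq> ?u'" using b by auto
    with False line_pairing_orthogonal[OF uv(1-4)] show ?thesis by simp
  qed
  finally show ?thesis .
qed

lemma continuous_right_poly: "l \<le> int p \<Longrightarrow> continuous_on A (right_poly l t)"
  unfolding right_poly_def
  by (intro continuous_at_imp_continuous_on ballI isCont_o2[OF _ isCont_line_poly] continuous_intros nat_mono)
     (use p_le_q in auto)

lemma continuous_left_poly: "continuous_on A (left_poly l t)"
  unfolding left_poly_def
  by (intro continuous_at_imp_continuous_on ballI isCont_line_poly nat_mono) (use p_le_q in auto)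

lemma measurable_reference_section:
  "s \<in> {1..p + q - 1} \<Longrightarrow> (\<lambda>y. (s, y)) \<in> unit_lebesgue \<rightarrow>\<^sub>M ref"
  unfolding bead_reference_def by (intro measurable_Pair measurable_const measurable_ident_sets refl) simp

lemma integrable_corr_kernel_section:
  assumes s: "s \<in> {1..p + q - 1}" "t \<in> {1..p + q - 1}" and x: "0 < x" "x < 1" and g: "continuous_on UNIV g"
  shows "integrable unit_lebesgue (\<lambda>y. g y * corr_kernel (s, y) (t, x))"
proof -
  obtain B where B: "\<And>z w. z \<in> space ref \<Longrightarrow> w \<in> space ref \<Longrightarrow> \<bar>corr_kernel z w\<bar> \<le> B"
    using corr_kernel_bounded by blast
  obtain C where C: "\<forall>y\<in>{0..1}. \<bar>g y\<bar> \<le> C" by (rule continuous_bounded_unit_interval[OF g])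
  show ?thesis
  proof (rule integrable_unit_lebesgue_bounded[where B = "C * B"])
    show "(\<lambda>y. g y * corr_kernel (s, y) (t, x)) \<in> borel_measurable unit_lebesgue"
      using s x by (intro borel_measurable_times measurable_unit_lebesgueI[of g] borel_measurable_continuous_onI g
          measurable_corr_kernel measurable_reference_section measurable_const) (auto simp: space_bead_reference)
    fix y :: real assume y: "0 < y" "y < 1"
    then have "\<bar>g y\<bar> \<le> C" "\<bar>corr_kernel (s, y) (t, x)\<bar> \<le> B"
      using B C s x by (auto simp: space_bead_reference)
    then show "\<bar>g y * corr_kernel (s, y) (t, x)\<bar> \<le> C * B"
      unfolding abs_mult by (intro mult_mono) auto
  qed
qed

lemma corr_kernel_shift:
  assumes s: "1 \<le> s" "s \<le> p + q" and t: "1 \<le> t" "t \<le> p + q" and y: "0 < y" "y < 1" and x: "0 < x" "x < 1"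
  shows "gram_inverse.corr_kernel (p + M) (q + M) (bead_lines.inv_gram (p + M) (q + M)) (s + M, y) (t + M, x) =
    corr_kernel (s, y) (t, x) +
    (\<Sum>m<M. left_poly (- int m) s y * right_poly (- int m) t x / poly_norm (- int m))"
proof -
  interpret S: bead_lines "p + M" "q + M"
    using p_pos p_le_q by unfold_locales auto
  let ?f = "\<lambda>\<kappa>. S.left_fun \<kappa> (s + M) y * S.right_fun \<kappa> (t + M) x / S.index_norm \<kappa>"
  \<comment> \<open>In the raised system \<open>\<kappa> = M - Suc m\<close> stands for
    \<open>l = - m\<close>. The indices from \<open>M\<close> on are the old ones moved by
    \<open>M\<close>; their data depend only on differences that the shift preserves.\<close>
  have low: "?f (M - Suc m) = left_poly (- int m) s y * right_poly (- int m) t x / poly_norm (- int m)"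
    if m: "m < M" for m
  proof -
    let ?\<kappa> = "M - Suc m"
    have le: "?\<kappa> < p + M" "Suc ?\<kappa> \<le> s + M" "t + M + Suc ?\<kappa> \<le> p + M + (q + M)"
      using m t p_pos by auto
    have e: "p + M - Suc ?\<kappa> = nat (int p - (- int m))" "q + M - Suc ?\<kappa> = nat (int q - (- int m))"
      "s + M - Suc ?\<kappa> = nat (int s - (- int m))"
      "p + M + (q + M) - (t + M) - Suc ?\<kappa> = nat (int p + int q - int t - (- int m))"
      using m t by auto
    show ?thesis
      unfolding S.left_fun_eq[OF le(1,2) y(2)] S.right_fun_eq[OF le(1,3) x(1)] S.index_norm_def e
        left_poly_def right_poly_def poly_norm_def ..
  qed
  have sum_split: "(\<Sum>i<n + M. g i) = (\<Sum>i<M. g i) + (\<Sum>i<n. g (M + i))" for n and g :: "nat \<Rightarrow> real"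
    using sum_lessThan_add[of g M n] by (simp add: add.commute)
  have coeff: "S.taylor_coeff (M + \<kappa>) (M + i) = taylor_coeff \<kappa> i" for \<kappa> i
  proof -
    have "p + M - Suc (M + \<kappa>) = p - Suc \<kappa>" "q + M - Suc (M + \<kappa>) = q - Suc \<kappa>"
      "p + M + (q + M) - 2 - (M + \<kappa>) - (M + i) = p + q - 2 - \<kappa> - i" by auto
    then show ?thesis by (simp only: S.taylor_coeff_def taylor_coeff_def add_le_cancel_left)
  qed
  have coeff0: "S.taylor_coeff (M + \<kappa>) i = 0" if "i < M" for \<kappa> i
    using that by (simp add: S.taylor_coeff_def)
  have shift: "propagator (a + M, v) (b + M, w) = propagator (a, v) (b, w)" for a b v w
    by (simp add: propagator_def)
  have shift': "propagator (M + a, v) (b + M, w) = propagator (a, v) (b, w)" for a b v w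
    using shift[of a] by (simp only: add.commute[of M])
  have left: "S.left_fun (M + \<kappa>) (s + M) y = left_fun \<kappa> s y" for \<kappa>
  proof -
    have "propagator (s + M, y) (p + M + (q + M) - (M + i), 1) = propagator (s, y) (p + q - i, 1)" if "i < p" for i
    proof -
      have "p + M + (q + M) - (M + i) = (p + q - i) + M" using that by simp
      then show ?thesis by (simp only: shift)
    qed
    then show ?thesis
      unfolding S.left_fun_def left_fun_def sum_split by (simp add: coeff coeff0)
  qed
  have right: "S.right_fun (M + \<kappa>) (t + M) x = right_fun \<kappa> t x" for \<kappa>
    unfolding S.right_fun_def right_fun_def sum_split
    by (simp add: coeff coeff0 shift')
  have norm: "S.index_norm (M + \<kappa>) = index_norm \<kappa>" for \<kappa>
  proof -
    have "p + M - Suc (M + \<kappa>) = p - Suc \<kappa>" "q + M - Suc (M + \<kappa>) = q - Suc \<kappa>" by auto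
    then show ?thesis by (simp only: S.index_norm_def index_norm_def)
  qed
  have "(\<Sum>\<kappa><M. ?f \<kappa>) = (\<Sum>m<M. left_poly (- int m) s y * right_poly (- int m) t x / poly_norm (- int m))"
    unfolding sum.nat_diff_reindex[of ?f M, symmetric] by (intro sum.cong refl low) auto
  then show ?thesis
    unfolding S.corr_kernel_eq corr_kernel_eq sum_split left right norm shift by simp
qed

text \<open>Raise the lines until \<open>l\<close> becomes an index that the raised kernel
  annihilates. The moment is then minus that of the added terms, of which biorthogonality keeps at
  most the one of index \<open>l\<close>.\<close>

lemma right_poly_moment:
  assumes l: "l \<le> int (num_particles p q s)" and st: "1 \<le> s" "s < t" "t < p + q" and x: "0 < x" "x < 1"
  shows "(\<integral>y. right_poly l s y * corr_kernel (s, y) (t, x) \<partial>unit_lebesgue) =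
    (if l \<le> 0 then - right_poly l t x else 0)"
proof -
  \<comment> \<open>The least shift with \<open>l + M \<ge> 1\<close>; for positive \<open>l\<close>
    it is zero and no terms are added.\<close>
  define M where "M = nat (1 - l)"
  define \<kappa> where "\<kappa> = nat (l + int M - 1)"
  have k: "int \<kappa> = l + int M - 1" by (simp add: \<kappa>_def M_def)
  have b: "l \<le> int p" "l \<le> int q" "l \<le> int s" "l \<le> int p + int q - int s"
    using l st p_le_q by (auto simp: num_particles_def split: if_splits)
  interpret S: bead_lines "p + M" "q + M"
    using p_pos p_le_q by unfold_locales auto
  have le: "\<kappa> < p + M" "s + M + Suc \<kappa> \<le> p + M + (q + M)" using b k by linarith+
  have e: "p + M - Suc \<kappa> = nat (int p - l)" "q + M - Suc \<kappa> = nat (int q - l)"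
    "p + M + (q + M) - (s + M) - Suc \<kappa> = nat (int p + int q - int s - l)"
    using b k by linarith+
  have right: "S.right_fun \<kappa> (s + M) y = right_poly l s y" if "0 < y" for y
    unfolding S.right_fun_eq[OF le that] e right_poly_def ..
  let ?T = "\<lambda>m y. left_poly (- int m) s y * right_poly (- int m) t x / poly_norm (- int m)"
  let ?c = "\<lambda>m. right_poly (- int m) t x / poly_norm (- int m)"
  have lm: "- int m \<le> int (num_particles p q s)" for m by simp
  have st': "s \<le> p + q" "1 \<le> t" "t \<le> p + q" using st by auto
  have cont: "continuous_on UNIV (right_poly l s)" "continuous_on UNIV (left_poly (- int m) s)" for m
    using b continuous_right_poly continuous_left_poly by auto
  have intT: "integrable unit_lebesgue (\<lambda>y. left_poly (- int m) s y * right_poly l s y)" for m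
    by (rule integrable_unit_lebesgue_continuous)
       (use cont(1) cont(2)[of m] in \<open>auto simp: continuous_on_eq_continuous_at intro!: continuous_intros\<close>)
  have intS: "integrable unit_lebesgue (\<lambda>y. right_poly l s y * S.corr_kernel (s + M, y) (t + M, x))"
    using st x by (intro S.integrable_corr_kernel_section cont(1)) auto
  have "(\<integral>y. right_poly l s y * corr_kernel (s, y) (t, x) \<partial>unit_lebesgue) =
    (\<integral>y. right_poly l s y * S.corr_kernel (s + M, y) (t + M, x) -
      (\<Sum>m<M. ?c m * (left_poly (- int m) s y * right_poly l s y)) \<partial>unit_lebesgue)"
  proof (intro Bochner_Integration.integral_cong refl)
    fix y assume "y \<in> space unit_lebesgue"
    then have y: "0 < y" "y < 1" by auto
    show "right_poly l s y * corr_kernel (s, y) (t, x) = right_poly l s y * S.corr_kernel (s + M, y) (t + M, x) -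
      (\<Sum>m<M. ?c m * (left_poly (- int m) s y * right_poly l s y))"
      unfolding corr_kernel_shift[OF st(1) st'(1-3) y x]
      by (simp add: algebra_simps sum_distrib_left)
  qed
  also have "\<dots> = (\<integral>y. right_poly l s y * S.corr_kernel (s + M, y) (t + M, x) \<partial>unit_lebesgue) -
     (\<Sum>m<M. ?c m * (\<integral>y. left_poly (- int m) s y * right_poly l s y \<partial>unit_lebesgue))"
    using intS intT by (simp add: Bochner_Integration.integral_sum Bochner_Integration.integrable_sum)
  also have "(\<integral>y. right_poly l s y * S.corr_kernel (s + M, y) (t + M, x) \<partial>unit_lebesgue) =
    (\<integral>y. S.right_fun \<kappa> (s + M) y * S.corr_kernel (s + M, y) (t + M, x) \<partial>unit_lebesgue)"
    by (intro Bochner_Integration.integral_cong refl) (simp add: right)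
  also have "\<dots> = 0" using le st x by (intro S.right_fun_moment) auto
  also have "(\<Sum>m<M. ?c m * (\<integral>y. left_poly (- int m) s y * right_poly l s y \<partial>unit_lebesgue)) =
     (\<Sum>m<M. if m = nat (- l) then (if l \<le> 0 then right_poly l t x else 0) else 0)"
  proof (intro sum.cong refl)
    fix m assume "m \<in> {..<M}"
    have "(- int m = l) = (m = nat (- l) \<and> l \<le> 0)" by auto
    then show "?c m * (\<integral>y. left_poly (- int m) s y * right_poly l s y \<partial>unit_lebesgue) =
      (if m = nat (- l) then (if l \<le> 0 then right_poly l t x else 0) else 0)"
      unfolding left_right_poly_biorthogonal[OF lm l st'(1)] using poly_norm_nonzero[of l] b by auto
  qed
  also have "\<dots> = (if l \<le> 0 then right_poly l t x else 0)"
    by (simp add: M_def)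
  finally show ?thesis by simp
qed

section \<open>The infinite series\<close>

definition jac :: "int \<Rightarrow> nat \<Rightarrow> real \<Rightarrow> real" where
  "jac l s y = jacobi_sum (nat (int (num_particles p q s) - l)) (exp0 s) (exp1 s) y"

definition weight :: "nat \<Rightarrow> real \<Rightarrow> real" where
  "weight s y = y ^ exp0 s * (1 - y) ^ exp1 s"

definition jac_norm :: "int \<Rightarrow> nat \<Rightarrow> real" where
  "jac_norm l s = (\<integral>y. (jac l s y)\<^sup>2 * weight s y \<partial>unit_lebesgue)"

definition right_coeff :: "int \<Rightarrow> nat \<Rightarrow> real" where
  "right_coeff l s = (- 1) ^ nat (int p - l) * C_coeff p q (p + q - s) l"

lemma right_coeff_nonzero: "right_coeff l s \<noteq> 0"
  by (simp add: right_coeff_def C_coeff_nonzero)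

lemma weight_pos: "0 < y \<Longrightarrow> y < 1 \<Longrightarrow> 0 < weight s y"
  by (simp add: weight_def)

lemma continuous_jac: "continuous_on A (jac l s)"
proof -
  obtain P :: "real poly" where "poly P = jac l s"
    using jacobi_sum_poly[of "nat (int (num_particles p q s) - l)" "exp0 s" "exp1 s"]
    by (auto simp: jac_def[abs_def])
  from this[symmetric] show ?thesis by (simp add: continuous_intros)
qed

lemma continuous_weight: "continuous_on A (weight s)"
  unfolding weight_def[abs_def] by (intro continuous_intros)

lemma left_poly_eq_jac:
  assumes "l \<le> int (num_particles p q s)" "s \<le> p + q" "0 < y" "y < 1"
  shows "left_poly l s y = C_coeff p q s l * (a_fun p q s y * jac l s y)"
  using line_poly_eq_left[OF assms] by (simp add: left_poly_def jac_def Q_fun_eq[OF assms])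

lemma right_poly_eq_jac:
  assumes "l \<le> int (num_particles p q s)" "s \<le> p + q" "0 < y" "y < 1"
  shows "right_poly l s y = right_coeff l s * (b_fun p q s y * jac l s y)"
  using line_poly_eq_right[OF assms] by (simp add: right_poly_def right_coeff_def jac_def Q_fun_eq[OF assms])

lemma jac_integral:
  assumes l: "l \<le> int (num_particles p q s)" and l': "l' \<le> int (num_particles p q s)" and s: "s \<le> p + q"
  shows "C_coeff p q s l * right_coeff l' s * (\<integral>y. jac l s y * jac l' s y * weight s y \<partial>unit_lebesgue) =
    (if l = l' then poly_norm l else 0)"
proof -
  have "(\<integral>y. left_poly l s y * right_poly l' s y \<partial>unit_lebesgue) =
    (\<integral>y. (C_coeff p q s l * right_coeff l' s) * (jac l s y * jac l' s y * weight s y) \<partial>unit_lebesgue)"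
  proof (intro Bochner_Integration.integral_cong refl)
    fix y assume "y \<in> space unit_lebesgue"
    then have y: "0 < y" "y < 1" by auto
    show "left_poly l s y * right_poly l' s y =
      (C_coeff p q s l * right_coeff l' s) * (jac l s y * jac l' s y * weight s y)"
      unfolding left_poly_eq_jac[OF l s y] right_poly_eq_jac[OF l' s y] weight_def a_fun_b_fun[symmetric]
      by (simp only: mult_ac)
  qed
  then show ?thesis
    unfolding left_right_poly_biorthogonal[OF assms] by (simp only: integral_mult_right_zero)
qed

lemma poly_norm_eq:
  assumes "l \<le> int (num_particles p q s)" "s \<le> p + q"
  shows "poly_norm l = C_coeff p q s l * right_coeff l s * jac_norm l s"
  using jac_integral[OF assms(1) assms] by (simp add: jac_norm_def power2_eq_square)

lemma jac_orthogonal: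
  assumes "l \<le> int (num_particles p q s)" "l' \<le> int (num_particles p q s)" "s \<le> p + q" "l \<noteq> l'"
  shows "(\<integral>y. jac l s y * jac l' s y * weight s y \<partial>unit_lebesgue) = 0"
  using jac_integral[OF assms(1-3)] assms(4) C_coeff_nonzero right_coeff_nonzero by simp

lemma jac_norm_pos:
  assumes l: "l \<le> int (num_particles p q s)" and s: "s \<le> p + q"
  shows "0 < jac_norm l s"
proof -
  have "l \<le> int p" using l p_le_q by (auto simp: num_particles_def split: if_splits)
  then have "jac_norm l s \<noteq> 0" using poly_norm_eq[OF assms] poly_norm_nonzero[of l] by auto
  moreover have "0 \<le> jac_norm l s" unfolding jac_norm_def
    by (intro Bochner_Integration.integral_nonneg_AE AE_I2) (simp add: weight_pos less_imp_le)
  ultimately show ?thesis by simp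
qed

lemma coeff_ratio:
  assumes "s \<le> p + q"
  shows "C_coeff p q s (- int m) / C_coeff p q (p + q - s) (- int m) = fact (s + m) / fact (p + q - s + m)"
proof -
  have e: "nat (int s - - int m) = s + m" "nat (int p - - int m) = p + m" "nat (int q - - int m) = q + m"
    "nat (int p + int q - int s - - int m) = p + q - s + m"
    "nat (int (p + q - s) - - int m) = p + q - s + m"
    "nat (int p + int q - int (p + q - s) - - int m) = s + m"
    using assms by auto
  show ?thesis
  proof -
    \<comment> \<open>Lines \<open>p\<close> and \<open>q\<close> are mirror images, but as borders
      they need not fall into mirrored branches of \<open>C_coeff\<close>, hence cases of their
      own.\<close>
    consider "s = p" | "s = q" | "s \<noteq> p" "s \<noteq> q" by blast
    then show ?thesis
      unfolding C_coeff_def e using assms p_le_q by cases (auto simp: field_simps)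
  qed
qed

lemma fact_ratio_le:
  assumes "i < j"
  shows "fact (i + m) / fact (j + m) \<le> 1 / (real m + 1)"
proof -
  have "(real m + 1) * fact (i + m) \<le> real (Suc (i + m)) * fact (i + m)"
    by (intro mult_right_mono) auto
  also have "\<dots> = fact (Suc (i + m))" by simp
  also have "\<dots> \<le> (fact (j + m) :: real)" using assms by (intro fact_mono) auto
  finally show ?thesis by (simp add: field_simps)
qed

text \<open>This ratio is what remains in the squared norm of a term of the series besides
  normalised functions. Since \<open>s < t\<close>, each of its two factorial quotients gains a
  factor of at least \<open>m + 1\<close> in the denominator.\<close>

lemma coeff_ratio_le:
  assumes "s < t" "t \<le> p + q"
  shows "\<bar>C_coeff p q s (- int m) * right_coeff (- int m) t / (right_coeff (- int m) s * C_coeff p q t (- int m))\<bar>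
    \<le> 1 / (real m + 1)\<^sup>2"
proof -
  let ?l = "- int m" and ?e = "(- 1 :: real) ^ nat (int p - - int m)"
  have "C_coeff p q s ?l * right_coeff ?l t / (right_coeff ?l s * C_coeff p q t ?l) =
    (?e * (C_coeff p q s ?l * C_coeff p q (p + q - t) ?l)) / (?e * (C_coeff p q (p + q - s) ?l * C_coeff p q t ?l))"
    unfolding right_coeff_def by (simp only: mult_ac)
  also have "\<dots> = (C_coeff p q s ?l * C_coeff p q (p + q - t) ?l) / (C_coeff p q (p + q - s) ?l * C_coeff p q t ?l)"
    by (subst mult_divide_mult_cancel_left) auto
  also have "\<dots> = (C_coeff p q s ?l / C_coeff p q (p + q - s) ?l) / (C_coeff p q t ?l / C_coeff p q (p + q - t) ?l)"
    by simp
  also have "\<dots> = (fact (s + m) / fact (p + q - s + m)) / (fact (t + m) / fact (p + q - t + m))"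
    using assms by (simp only: coeff_ratio)
  also have "\<dots> = (fact (s + m) / fact (t + m)) * (fact (p + q - t + m) / fact (p + q - s + m))"
    by simp
  finally have "\<bar>C_coeff p q s ?l * right_coeff ?l t / (right_coeff ?l s * C_coeff p q t ?l)\<bar> =
    (fact (s + m) / fact (t + m)) * (fact (p + q - t + m) / fact (p + q - s + m))" by simp
  also have "\<dots> \<le> 1 / (real m + 1) * (1 / (real m + 1))"
    using assms by (intro mult_mono fact_ratio_le) auto
  finally show ?thesis by (simp add: power2_eq_square)
qed

text \<open>A block has at most \<open>3 (k + 1)^2\<close> terms, each at most
  \<open>16 / (k + 1)^6\<close> because \<open>(k + 1)^3 \<le> 4 (k^3 + 1)\<close>. With the weight
  \<open>(k + 1)^2\<close> this leaves \<open>48 / (k + 1)^2\<close>.\<close>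

lemma summable_cube_blocks:
  "summable (\<lambda>k. (real k + 1)\<^sup>2 * (\<Sum>m = k ^ 3..<Suc k ^ 3. 1 / (real m + 1)\<^sup>2))"
proof (rule summable_comparison_test'[OF summable_mult[OF summable_inverse_square, of 48], of 0])
  fix k :: nat
  have nn: "0 \<le> (\<Sum>m = k ^ 3..<Suc k ^ 3. 1 / (real m + 1)\<^sup>2)" by (intro sum_nonneg) auto
  have cube: "(real k + 1) ^ 3 \<le> 4 * (real k ^ 3 + 1)"
  proof -
    have "0 \<le> 3 * ((real k + 1) * (real k - 1)\<^sup>2)" by simp
    then show ?thesis by (simp add: power2_eq_square power3_eq_cube algebra_simps)
  qed
  have "(\<Sum>m = k ^ 3..<Suc k ^ 3. 1 / (real m + 1)\<^sup>2) \<le> real (card {k ^ 3..<Suc k ^ 3}) * (1 / (real k ^ 3 + 1)\<^sup>2)"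
  proof (rule sum_bounded_above)
    fix m assume "m \<in> {k ^ 3..<Suc k ^ 3}"
    then have "k ^ 3 \<le> m" by simp
    then have "real k ^ 3 \<le> real m" by (simp only: of_nat_power[symmetric] of_nat_le_iff)
    then show "1 / (real m + 1)\<^sup>2 \<le> 1 / (real k ^ 3 + 1)\<^sup>2"
      by (intro divide_left_mono power_mono mult_pos_pos zero_less_power add_nonneg_pos) auto
  qed
  also have "\<dots> \<le> 3 * (real k + 1)\<^sup>2 * (16 / ((real k + 1) ^ 3)\<^sup>2)"
  proof (intro mult_mono card_cube_block)
    have "((real k + 1) ^ 3)\<^sup>2 \<le> (4 * (real k ^ 3 + 1))\<^sup>2" by (intro power_mono cube) auto
    also have "\<dots> = 16 * (real k ^ 3 + 1)\<^sup>2" by (simp only: power_mult_distrib) simp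
    finally have "((real k + 1) ^ 3)\<^sup>2 \<le> 16 * (real k ^ 3 + 1)\<^sup>2" .
    moreover have "0 < ((real k + 1) ^ 3)\<^sup>2" "0 < (real k ^ 3 + 1)\<^sup>2" by (intro zero_less_power add_nonneg_pos; simp)+
    moreover have "1 / b \<le> 16 / a" if "a \<le> 16 * b" "0 < a" "0 < b" for a b :: real
      using that by (simp add: field_simps)
    ultimately show "1 / (real k ^ 3 + 1)\<^sup>2 \<le> 16 / ((real k + 1) ^ 3)\<^sup>2" by blast
  qed auto
  finally have "(real k + 1)\<^sup>2 * (\<Sum>m = k ^ 3..<Suc k ^ 3. 1 / (real m + 1)\<^sup>2) \<le>
    (real k + 1)\<^sup>2 * (3 * (real k + 1)\<^sup>2 * (16 / ((real k + 1) ^ 3)\<^sup>2))" by (rule mult_left_mono) auto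
  also have "\<dots> = 48 * (1 / (real k + 1)\<^sup>2)"
  proof -
    have "c ^ 2 * (3 * c ^ 2 * (16 / (c ^ 3) ^ 2)) = 48 * (1 / c ^ 2)" if "c \<noteq> 0" for c :: real
      using that by (simp add: power2_eq_square power3_eq_cube)
    then show ?thesis by (simp add: add_eq_0_iff)
  qed
  finally show "norm ((real k + 1)\<^sup>2 * (\<Sum>m = k ^ 3..<Suc k ^ 3. 1 / (real m + 1)\<^sup>2)) \<le> 48 * (1 / (real k + 1)\<^sup>2)"
    using nn by simp
qed

text \<open>Square of the normalised Jacobi function, with integral 1. The absolute value has no
  effect on the unit interval; it secures nonnegativity at every real argument, as
  \<open>AE_summable\<close> demands.\<close>

definition jac_density :: "nat \<Rightarrow> real \<Rightarrow> nat \<Rightarrow> real" where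
  "jac_density t x m = (jac (- int m) t x)\<^sup>2 * \<bar>weight t x\<bar> / jac_norm (- int m) t"

text \<open>As the densities integrate to 1, termwise integration reduces this to
  \<open>summable_cube_blocks\<close>. It selects the \<open>x\<close> for which the series in
  \<open>y\<close> can be handled, without pointwise bounds on Jacobi polynomials.\<close>

lemma AE_summable_jac:
  assumes t: "t \<le> p + q"
  shows "AE x in unit_lebesgue. summable (\<lambda>k. (real k + 1)\<^sup>2 *
    (\<Sum>m = k ^ 3..<Suc k ^ 3. 1 / (real m + 1)\<^sup>2 * jac_density t x m))"
proof (rule AE_summable)
  have int: "integrable unit_lebesgue (\<lambda>x. jac_density t x m)" for m
    unfolding jac_density_def using continuous_jac continuous_weight
    by (intro integrable_divide integrable_continuous_UNIV continuous_intros) auto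
  have val: "(\<integral>x. jac_density t x m \<partial>unit_lebesgue) = 1" for m
  proof -
    have "(\<integral>x. jac_density t x m \<partial>unit_lebesgue) =
      (\<integral>x. (jac (- int m) t x)\<^sup>2 * weight t x / jac_norm (- int m) t \<partial>unit_lebesgue)"
      unfolding jac_density_def
      by (intro Bochner_Integration.integral_cong refl) (simp add: abs_of_pos weight_pos)
    also have "\<dots> = 1"
      using jac_norm_pos[of "- int m" t] t by (simp add: jac_norm_def[symmetric])
    finally show ?thesis .
  qed
  have nn: "0 \<le> jac_density t x m" for x m
    unfolding jac_density_def using jac_norm_pos[of "- int m" t] t by simp
  show "integrable unit_lebesgue (\<lambda>x. (real k + 1)\<^sup>2 * (\<Sum>m = k ^ 3..<Suc k ^ 3. 1 / (real m + 1)\<^sup>2 * jac_density t x m))" for k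
    using int by (intro integrable_mult_right Bochner_Integration.integrable_sum)
  show "0 \<le> (real k + 1)\<^sup>2 * (\<Sum>m = k ^ 3..<Suc k ^ 3. 1 / (real m + 1)\<^sup>2 * jac_density t x m)" for k x
    using nn by (intro mult_nonneg_nonneg sum_nonneg) auto
  have "(\<integral>x. (real k + 1)\<^sup>2 * (\<Sum>m = k ^ 3..<Suc k ^ 3. 1 / (real m + 1)\<^sup>2 * jac_density t x m) \<partial>unit_lebesgue) =
    (real k + 1)\<^sup>2 * (\<Sum>m = k ^ 3..<Suc k ^ 3. 1 / (real m + 1)\<^sup>2)" for k
    using int val by (subst integral_mult_right_zero, subst Bochner_Integration.integral_sum) (auto intro: integrable_mult_right simp del: power_Suc)
  then show "summable (\<lambda>k. \<integral>x. (real k + 1)\<^sup>2 * (\<Sum>m = k ^ 3..<Suc k ^ 3. 1 / (real m + 1)\<^sup>2 * jac_density t x m) \<partial>unit_lebesgue)"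
    using summable_cube_blocks by simp
qed

text \<open>For such \<open>x\<close> the terms, rescaled to be orthogonal for Lebesgue measure,
  satisfy the hypotheses of \<open>orthogonal_series_AE\<close>. The limit is identified by
  comparing its Jacobi moments with those of \<open>- K\<close>.\<close>

lemma tail_series:
  assumes s: "1 \<le> s" "s < t" "t < p + q" and x: "0 < x" "x < 1"
    and summ: "summable (\<lambda>k. (real k + 1)\<^sup>2 *
      (\<Sum>m = k ^ 3..<Suc k ^ 3. 1 / (real m + 1)\<^sup>2 * jac_density t x m))"
  shows "AE y in unit_lebesgue.
    (\<lambda>m. left_poly (- int m) s y * right_poly (- int m) t x / poly_norm (- int m)) sums (- corr_kernel (s, y) (t, x))"
proof -
  have st: "s \<le> p + q" "t \<le> p + q" using s by auto
  have lm: "- int m \<le> int (num_particles p q r)" "- int m \<le> int p" for m r by auto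
  define c where "c m = C_coeff p q s (- int m) * (right_poly (- int m) t x / poly_norm (- int m))" for m
  \<comment> \<open>The \<open>m\<close>-th term divided by \<open>a_fun\<close> and multiplied by
    the root of the weight, which moves the Jacobi weight into the functions.\<close>
  define A where "A m y = c m * (jac (- int m) s y * sqrt (weight s y))" for m y
  have cont_A: "continuous_on UNIV (A m)" for m
    unfolding A_def by (intro continuous_intros continuous_jac continuous_weight)
  have AA: "(\<integral>y. A m y * A n y \<partial>unit_lebesgue) =
    c m * c n * (\<integral>y. jac (- int m) s y * jac (- int n) s y * weight s y \<partial>unit_lebesgue)" for m n
  proof -
    have "(\<integral>y. A m y * A n y \<partial>unit_lebesgue) =
      (\<integral>y. c m * c n * (jac (- int m) s y * jac (- int n) s y * weight s y) \<partial>unit_lebesgue)"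
    proof (intro Bochner_Integration.integral_cong refl)
      fix y assume "y \<in> space unit_lebesgue"
      then have w: "sqrt (weight s y) * sqrt (weight s y) = weight s y"
        using weight_pos[of y s] by simp
      have "A m y * A n y = c m * c n * (jac (- int m) s y * jac (- int n) s y * (sqrt (weight s y) * sqrt (weight s y)))"
        unfolding A_def by (simp only: mult_ac)
      then show "A m y * A n y = c m * c n * (jac (- int m) s y * jac (- int n) s y * weight s y)"
        by (simp only: w)
    qed
    then show ?thesis by (simp only: integral_mult_right_zero)
  qed
  define B where "B = (b_fun p q t x)\<^sup>2 / weight t x"
  have B: "0 \<le> B" using weight_pos[OF x, of t] by (simp add: B_def)
  have A2: "(\<integral>y. (A m y)\<^sup>2 \<partial>unit_lebesgue) \<le> B * (1 / (real m + 1)\<^sup>2 * jac_density t x m)" for m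
  proof -
    let ?l = "- int m"
    let ?C = "C_coeff p q s ?l" and ?G = "right_coeff ?l s" and ?C' = "C_coeff p q t ?l" and ?G' = "right_coeff ?l t"
    let ?R = "?C * ?G' / (?G * ?C')"
    \<comment> \<open>The norm constant is the same on both lines, so the norm on line
      \<open>s\<close> can be traded for that on line \<open>t\<close>, where it normalises
      \<open>jac_density\<close>.\<close>
    have n: "poly_norm ?l = ?C * ?G * jac_norm ?l s" "poly_norm ?l = ?C' * ?G' * jac_norm ?l t"
      using poly_norm_eq lm st by blast+
    have nz: "?C \<noteq> 0" "?G \<noteq> 0" "?C' \<noteq> 0" "?G' \<noteq> 0" "jac_norm ?l t \<noteq> 0"
      using jac_norm_pos[OF lm(1) st(2), of m] by (auto simp: C_coeff_nonzero right_coeff_nonzero)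
    have N: "jac_norm ?l s = ?C' * ?G' * jac_norm ?l t / (?C * ?G)"
      unfolding n(2)[symmetric] n(1) using nz by simp
    have "(\<integral>y. (A m y)\<^sup>2 \<partial>unit_lebesgue) = c m * c m * jac_norm ?l s"
      using AA[of m m] by (simp add: power2_eq_square jac_norm_def)
    also have "\<dots> = ?R * ((b_fun p q t x)\<^sup>2 * (jac ?l t x)\<^sup>2 / jac_norm ?l t)"
    proof -
      have "C * (G' * (b * J) / (C' * G' * N)) * (C * (G' * (b * J) / (C' * G' * N))) * (C' * G' * N / (C * G)) =
          C * G' / (G * C') * (b\<^sup>2 * J\<^sup>2 / N)"
        if "C \<noteq> 0" "G \<noteq> 0" "C' \<noteq> 0" "G' \<noteq> 0" "N \<noteq> 0" for C G C' G' N b J :: real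
        using that by (simp add: field_simps power2_eq_square)
      from this[OF nz, of "b_fun p q t x" "jac ?l t x"] show ?thesis
        unfolding c_def right_poly_eq_jac[OF lm(1) st(2) x] n(2) N .
    qed
    also have "\<dots> = ?R * (B * jac_density t x m)"
      using weight_pos[OF x, of t] by (simp add: B_def jac_density_def abs_of_pos)
    also have "\<dots> \<le> 1 / (real m + 1)\<^sup>2 * (B * jac_density t x m)"
    proof (rule mult_right_mono)
      show "?R \<le> 1 / (real m + 1)\<^sup>2" using coeff_ratio_le[OF s(2) st(2), of m] by linarith
      show "0 \<le> B * jac_density t x m"
        using B jac_norm_pos[OF lm(1) st(2), of m] by (simp add: jac_density_def)
    qed
    finally show ?thesis by (simp only: mult_ac)
  qed
  have prob: "prob_space unit_lebesgue" by (rule prob_space_unit_lebesgue)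
  have meas_A: "A m \<in> borel_measurable unit_lebesgue" for m
    by (intro measurable_unit_lebesgueI borel_measurable_continuous_onI cont_A)
  have bdd_A: "\<exists>C. \<forall>y\<in>space unit_lebesgue. \<bar>A m y\<bar> \<le> C" for m
  proof -
    obtain C where "\<forall>y\<in>{0..1}. \<bar>A m y\<bar> \<le> C" by (rule continuous_bounded_unit_interval[OF cont_A])
    then show ?thesis by (intro exI[of _ C]) auto
  qed
  have orth: "(\<integral>y. A m y * A n y \<partial>unit_lebesgue) = 0" if "m \<noteq> n" for m n
    unfolding AA using that by (simp add: jac_orthogonal lm st)
  have summ_A: "summable (\<lambda>k. (real k + 1)\<^sup>2 * (\<Sum>m = k ^ 3..<Suc k ^ 3. \<integral>y. (A m y)\<^sup>2 \<partial>unit_lebesgue))"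
  proof (rule summable_comparison_test'[OF summable_mult[OF summ, of B], of 0])
    fix k :: nat
    have "0 \<le> (real k + 1)\<^sup>2 * (\<Sum>m = k ^ 3..<Suc k ^ 3. \<integral>y. (A m y)\<^sup>2 \<partial>unit_lebesgue)"
      by (intro mult_nonneg_nonneg sum_nonneg Bochner_Integration.integral_nonneg_AE AE_I2) auto
    moreover have "(real k + 1)\<^sup>2 * (\<Sum>m = k ^ 3..<Suc k ^ 3. \<integral>y. (A m y)\<^sup>2 \<partial>unit_lebesgue) \<le>
      (real k + 1)\<^sup>2 * (\<Sum>m = k ^ 3..<Suc k ^ 3. B * (1 / (real m + 1)\<^sup>2 * jac_density t x m))"
      by (intro mult_left_mono sum_mono A2) auto
    ultimately show "norm ((real k + 1)\<^sup>2 * (\<Sum>m = k ^ 3..<Suc k ^ 3. \<integral>y. (A m y)\<^sup>2 \<partial>unit_lebesgue)) \<le>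
      B * ((real k + 1)\<^sup>2 * (\<Sum>m = k ^ 3..<Suc k ^ 3. 1 / (real m + 1)\<^sup>2 * jac_density t x m))"
      by (simp only: real_norm_def abs_of_nonneg sum_distrib_left[symmetric] mult.left_commute[of "(real k + 1)\<^sup>2" B])
  qed
  obtain S where S: "integrable unit_lebesgue S" "AE y in unit_lebesgue. (\<lambda>m. A m y) sums S y"
    and lim: "\<And>g C. g \<in> borel_measurable unit_lebesgue \<Longrightarrow> (\<And>y. y \<in> space unit_lebesgue \<Longrightarrow> \<bar>g y\<bar> \<le> C) \<Longrightarrow>
      (\<lambda>k. \<integral>y. (\<Sum>l<k ^ 3. A l y) * g y \<partial>unit_lebesgue) \<longlonglongrightarrow> (\<integral>y. S y * g y \<partial>unit_lebesgue)"
    using orthogonal_series_AE[OF prob meas_A bdd_A orth summ_A] by blast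
  let ?K = "\<lambda>y. corr_kernel (s, y) (t, x)"
  define b where "b y = (- 1 :: real) ^ (p - s) * y ^ (s - p) * (1 - y) ^ (s - q)" for y
  have b: "b_fun p q s y = b y" for y by (simp add: b_def b_fun_eq[OF p_le_q])
  have cont_b: "continuous_on UNIV b" unfolding b_def by (intro continuous_intros)
  have cont_w: "continuous_on UNIV (\<lambda>y. sqrt (weight s y))" by (intro continuous_intros continuous_weight)
  have intK: "integrable unit_lebesgue (\<lambda>y. g y * ?K y)" if "continuous_on UNIV g" for g
    using s x that by (intro integrable_corr_kernel_section) auto
  have intS: "integrable unit_lebesgue (\<lambda>y. S y * g y)" if g: "continuous_on UNIV g" for g
  proof -
    obtain C where C: "\<forall>y\<in>{0..1}. \<bar>g y\<bar> \<le> C" by (rule continuous_bounded_unit_interval[OF g])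
    show ?thesis
    proof (rule Bochner_Integration.integrable_bound[OF integrable_mult_left[OF S(1), of C]])
      show "(\<lambda>y. S y * g y) \<in> borel_measurable unit_lebesgue"
        using S(1) by (intro borel_measurable_times measurable_unit_lebesgueI[of g] borel_measurable_continuous_onI g) auto
      show "AE y in unit_lebesgue. norm (S y * g y) \<le> norm (S y * C)"
      proof (rule AE_I2)
        fix y assume "y \<in> space unit_lebesgue"
        then have "\<bar>g y\<bar> \<le> C" using C by auto
        then have "\<bar>g y\<bar> \<le> \<bar>C\<bar>" by linarith
        then show "norm (S y * g y) \<le> norm (S y * C)" by (simp add: abs_mult mult_left_mono)
      qed
    qed
  qed
  \<comment> \<open>Rescaled like the terms, \<open>- K\<close> becomes
    \<open>- b K / sqrt w\<close>, with \<open>w\<close> the weight on line \<open>s\<close>.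
    Multiplying its difference from \<open>S\<close> by \<open>sqrt w\<close> clears the
    denominator, and the claim is that the result vanishes.\<close>
  define h where "h y = - (b y * ?K y) - S y * sqrt (weight s y)" for y
  have h_split: "h y * g y = - ((b y * g y) * ?K y) - S y * (sqrt (weight s y) * g y)" for g y
    by (simp add: h_def algebra_simps)
  have int_h: "integrable unit_lebesgue (\<lambda>y. h y * g y)" if "continuous_on UNIV g" for g
    unfolding h_split using that cont_b cont_w
    by (intro Bochner_Integration.integrable_diff Bochner_Integration.integrable_minus intK intS continuous_on_mult) auto
  have moment: "(\<integral>y. h y * jac l s y \<partial>unit_lebesgue) = 0" if l: "l \<le> int (num_particles p q s)" for l
  proof -
    let ?\<theta> = "if l \<le> 0 then right_poly l t x / right_coeff l s else 0"
    have cj: "continuous_on UNIV (\<lambda>y. b y * jac l s y)" "continuous_on UNIV (\<lambda>y. sqrt (weight s y) * jac l s y)"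
      by (intro continuous_on_mult cont_b cont_w continuous_jac)+
    have "(if l \<le> 0 then - right_poly l t x else 0) = (\<integral>y. right_poly l s y * ?K y \<partial>unit_lebesgue)"
      using right_poly_moment[OF l s x] by simp
    also have "\<dots> = (\<integral>y. right_coeff l s * ((b y * jac l s y) * ?K y) \<partial>unit_lebesgue)"
      by (intro Bochner_Integration.integral_cong refl) (simp add: right_poly_eq_jac[OF l st(1)] b mult.assoc)
    also have "\<dots> = right_coeff l s * (\<integral>y. (b y * jac l s y) * ?K y \<partial>unit_lebesgue)"
      by (rule integral_mult_right_zero)
    finally have I1: "(\<integral>y. (b y * jac l s y) * ?K y \<partial>unit_lebesgue) = - ?\<theta>"
      using right_coeff_nonzero[of l s] by (auto simp: field_simps split: if_splits)
    \<comment> \<open>By orthogonality a partial sum meets index \<open>l\<close> at most once, at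
      \<open>m = - l\<close>, so its moments are eventually constant along the cubes and the limit
      can be read off.\<close>
    have part: "(\<integral>y. (\<Sum>m<k. A m y) * (sqrt (weight s y) * jac l s y) \<partial>unit_lebesgue) =
        (\<Sum>m<k. if m = nat (- l) then ?\<theta> else 0)" for k
    proof -
      have "(\<integral>y. (\<Sum>m<k. A m y) * (sqrt (weight s y) * jac l s y) \<partial>unit_lebesgue) =
        (\<integral>y. (\<Sum>m<k. c m * (jac (- int m) s y * jac l s y * weight s y)) \<partial>unit_lebesgue)"
      proof (intro Bochner_Integration.integral_cong refl)
        fix y assume "y \<in> space unit_lebesgue"
        then have w: "sqrt (weight s y) * sqrt (weight s y) = weight s y"
          using weight_pos[of y s] by simp
        have "A m y * (sqrt (weight s y) * jac l s y) =
          c m * (jac (- int m) s y * jac l s y * (sqrt (weight s y) * sqrt (weight s y)))" for m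
          unfolding A_def by (simp only: mult_ac)
        then show "(\<Sum>m<k. A m y) * (sqrt (weight s y) * jac l s y) =
          (\<Sum>m<k. c m * (jac (- int m) s y * jac l s y * weight s y))"
          by (simp only: sum_distrib_right w)
      qed
      also have "\<dots> = (\<Sum>m<k. c m * (\<integral>y. jac (- int m) s y * jac l s y * weight s y \<partial>unit_lebesgue))"
      proof -
        have "integrable unit_lebesgue (\<lambda>y. jac (- int m) s y * jac l s y * weight s y)" for m
          by (intro integrable_continuous_UNIV continuous_on_mult continuous_jac continuous_weight)
        then show ?thesis by (simp add: Bochner_Integration.integral_sum)
      qed
      also have "\<dots> = (\<Sum>m<k. if m = nat (- l) then ?\<theta> else 0)"
      proof (intro sum.cong refl)
        fix m
        show "c m * (\<integral>y. jac (- int m) s y * jac l s y * weight s y \<partial>unit_lebesgue) = (if m = nat (- l) then ?\<theta> else 0)"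
        proof (cases "- int m = l")
          case True
          then have m: "m = nat (- l)" "l \<le> 0" by auto
          have "(\<integral>y. jac l s y * jac l s y * weight s y \<partial>unit_lebesgue) = jac_norm l s"
            by (simp add: jac_norm_def power2_eq_square)
          moreover have "C_coeff p q s l * (right_poly l t x / poly_norm l) * jac_norm l s = right_poly l t x / right_coeff l s"
            unfolding poly_norm_eq[OF l st(1)]
            using C_coeff_nonzero[of p q s l] right_coeff_nonzero[of l s] jac_norm_pos[OF l st(1)] by simp
          ultimately show ?thesis by (simp only: c_def True m(1)[symmetric] m(2) if_True simp_thms)
        next
          case False
          then have "m \<noteq> nat (- l) \<or> \<not> l \<le> 0" by auto
          then show ?thesis using jac_orthogonal[OF lm(1) l st(1) False] by auto
        qed
      qed
      finally show ?thesis .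
    qed
    obtain C where C: "\<forall>y\<in>{0..1}. \<bar>sqrt (weight s y) * jac l s y\<bar> \<le> C"
      by (rule continuous_bounded_unit_interval[OF cj(2)])
    have "(\<lambda>k. \<integral>y. (\<Sum>m<k ^ 3. A m y) * (sqrt (weight s y) * jac l s y) \<partial>unit_lebesgue)
      \<longlonglongrightarrow> (\<integral>y. S y * (sqrt (weight s y) * jac l s y) \<partial>unit_lebesgue)"
      using C by (intro lim[of _ C] measurable_unit_lebesgueI borel_measurable_continuous_onI cj(2)) auto
    moreover have "(\<lambda>k. \<integral>y. (\<Sum>m<k ^ 3. A m y) * (sqrt (weight s y) * jac l s y) \<partial>unit_lebesgue) \<longlonglongrightarrow> ?\<theta>"
    proof (rule tendsto_eventually, rule eventually_sequentiallyI[of "Suc (nat (- l))"])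
      fix k assume "Suc (nat (- l)) \<le> k"
      moreover have "k \<le> k ^ 3" by (cases "k = 0") (auto intro: self_le_power)
      ultimately have "nat (- l) < k ^ 3" by linarith
      then show "(\<integral>y. (\<Sum>m<k ^ 3. A m y) * (sqrt (weight s y) * jac l s y) \<partial>unit_lebesgue) = ?\<theta>"
        unfolding part by (simp only: sum.delta finite_lessThan lessThan_iff if_True)
    qed
    ultimately have I2: "(\<integral>y. S y * (sqrt (weight s y) * jac l s y) \<partial>unit_lebesgue) = ?\<theta>"
      by (rule LIMSEQ_unique)
    show ?thesis
      unfolding h_split
      by (subst Bochner_Integration.integral_diff[OF Bochner_Integration.integrable_minus[OF intK[OF cj(1)]] intS[OF cj(2)]])
         (use I1 I2 in simp)
  qed
  have "AE y in unit_lebesgue. h y = 0"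
  proof (rule moments_zero_AE)
    show "integrable unit_lebesgue h" using int_h[of "\<lambda>_. 1"] by simp
    show "(\<integral>y. h y * poly P y \<partial>unit_lebesgue) = 0" for P
    proof (rule jacobi_moments_zero[OF int_h])
      fix n
      \<comment> \<open>The function of index \<open>num_particles p q s - n\<close> has degree
        \<open>n\<close>, so all degrees are covered.\<close>
      show "(\<integral>y. h y * jacobi_sum n (exp0 s) (exp1 s) y \<partial>unit_lebesgue) = 0"
        using moment[of "int (num_particles p q s) - int n"] by (simp add: jac_def)
    qed
  qed
  then show ?thesis
    using S(2) AE_space
  proof eventually_elim
    case (elim y)
    then have y: "0 < y" "y < 1" by auto
    let ?w = "weight s y" and ?a = "a_fun p q s y"
    have w: "0 < ?w" using y by (rule weight_pos)
    have ab: "?a * b y = ?w" unfolding b[symmetric] a_fun_b_fun weight_def ..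
    have "(\<lambda>m. A m y * (?a / sqrt ?w)) sums (S y * (?a / sqrt ?w))"
      using elim(2) by (rule sums_mult2)
    moreover have "A m y * (?a / sqrt ?w) = left_poly (- int m) s y * right_poly (- int m) t x / poly_norm (- int m)" for m
      unfolding A_def c_def left_poly_eq_jac[OF lm(1) st(1) y] using w by simp
    moreover have "S y * (?a / sqrt ?w) = - ?K y"
    proof -
      have "S y * (?a / sqrt ?w) = (S y * sqrt ?w) * ?a / (sqrt ?w * sqrt ?w)"
      proof -
        have "u * (a / r) = (u * r) * a / (r * r)" if "r \<noteq> 0" for u a r :: real using that by simp
        from this[of "sqrt ?w"] show ?thesis using w less_imp_neq[of 0 "sqrt ?w"] real_sqrt_gt_zero[of ?w] by metis
      qed
      also have "S y * sqrt ?w = - (b y * ?K y)" using elim(1) by (simp add: h_def)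
      also have "- (b y * ?K y) * ?a / (sqrt ?w * sqrt ?w) = - (?K y * (?a * b y)) / ?w" using w by simp
      also have "\<dots> = - ?K y" unfolding ab using w by simp
      finally show ?thesis .
    qed
    ultimately show ?case by simp
  qed
qed

text \<open>At interior points the prefactor of the kernel is not zero and can be divided out of the
  series.\<close>

lemma bead_kernel_eq_corr_kernel_if_sums:
  assumes s: "1 \<le> s" "s < t" "t < p + q" and y: "0 < y" "y < 1" and x: "0 < x" "x < 1"
    and sums: "(\<lambda>m. left_poly (- int m) s y * right_poly (- int m) t x / poly_norm (- int m)) sums (- corr_kernel (s, y) (t, x))"
  shows "bead_kernel p q s y t x = corr_kernel (s, y) (t, x)"
proof -
  let ?ab = "a_fun p q s y * b_fun p q t x"
  have ab: "?ab \<noteq> 0" using y x by (simp add: a_fun_eq b_fun_eq[OF p_le_q])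
  have eq: "?ab * kernel_term p q s y t x (- int m) =
    left_poly (- int m) s y * right_poly (- int m) t x / poly_norm (- int m)" for m
    unfolding left_poly_def right_poly_def poly_norm_def using s y x by (intro kernel_term_eq) auto
  have "(\<lambda>m. ?ab * kernel_term p q s y t x (- int m) / ?ab) sums (- corr_kernel (s, y) (t, x) / ?ab)"
    unfolding eq by (rule sums_divide[OF sums])
  then have "(\<lambda>m. kernel_term p q s y t x (- int m)) sums (- corr_kernel (s, y) (t, x) / ?ab)"
    using ab by simp
  then show ?thesis
    using s ab by (simp add: bead_kernel_def sums_unique[symmetric])
qed

lemma AE_bead_kernel_eq_corr_kernel:
  assumes s: "1 \<le> s" "s < t" "t < p + q"
  shows "AE x in unit_lebesgue. AE y in unit_lebesgue. bead_kernel p q s y t x = corr_kernel (s, y) (t, x)"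
proof -
  have "t \<le> p + q" using s by simp
  from AE_summable_jac[OF this] AE_space show ?thesis
  proof eventually_elim
    case (elim x)
    then have x: "0 < x" "x < 1" by auto
    from tail_series[OF s x elim(1)] AE_space show ?case
    proof eventually_elim
      case (elim y)
      then show ?case using s x by (intro bead_kernel_eq_corr_kernel_if_sums) auto
    qed
  qed
qed

end

section \<open>Identification of the kernels\<close>

text \<open>\<open>Rodrigues\<close> replaces the iterated derivative by a polynomial at every real
  argument.\<close>

lemma measurable_jacobi01: "jacobi01 a b n \<in> borel_measurable borel"
proof -
  have "(deriv ^^ nat n) (\<lambda>u::real. u ^ (nat n + a) * (1 - u) ^ (nat n + b)) \<in> borel_measurable borel"
    unfolding Rodrigues jacobi_sum_def by measurable
  then show ?thesis
    unfolding jacobi01_def[abs_def] by measurable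
qed

lemma measurable_kernel_term:
  assumes [measurable]: "f \<in> borel_measurable N" "g \<in> borel_measurable N"
  shows "(\<lambda>x. kernel_term p q s (f x) t (g x) l) \<in> borel_measurable N"
proof -
  have [measurable]: "Q_fun p q r l \<in> borel_measurable borel" for r
    unfolding Q_fun_def[abs_def] using measurable_jacobi01 by simp
  show ?thesis unfolding kernel_term_def by measurable
qed

lemma measurable_bead_kernel:
  assumes f: "f \<in> N \<rightarrow>\<^sub>M bead_reference p q" and g: "g \<in> N \<rightarrow>\<^sub>M bead_reference p q"
  shows "(\<lambda>x. bead_kernel p q (fst (f x)) (snd (f x)) (fst (g x)) (snd (g x))) \<in> borel_measurable N"
proof -
  note [measurable] = measurable_bead_referenceD[OF f] measurable_bead_referenceD[OF g]
  have [measurable]: "(\<lambda>x. bead_kernel p q s (snd (f x)) t (snd (g x))) \<in> borel_measurable N" for s t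
  proof -
    have [measurable]: "(\<lambda>x. kernel_term p q s (snd (f x)) t (snd (g x)) l) \<in> borel_measurable N" for l
      by (intro measurable_kernel_term) measurable
    show ?thesis
      unfolding bead_kernel_def a_fun_def b_fun_def by measurable
  qed
  have "(\<lambda>x. bead_kernel p q s (snd (f x)) (fst (g x)) (snd (g x))) \<in> borel_measurable N" for s
    by (rule measurable_compose_countable[where f = "\<lambda>t x. bead_kernel p q s (snd (f x)) t (snd (g x))"]) measurable
  then show ?thesis
    by (rule measurable_compose_countable[where f = "\<lambda>s x. bead_kernel p q s (snd (f x)) (fst (g x)) (snd (g x))"]) measurable
qed

lemma AE_bead_referenceI:
  assumes "\<And>t. t \<in> {1..p + q - 1} \<Longrightarrow> AE x in unit_lebesgue. P (t, x)"
  shows "AE z in bead_reference p q. P z"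
proof -
  interpret U: prob_space unit_lebesgue by (rule prob_space_unit_lebesgue)
  let ?T = "{1..p + q - 1}"
  have "\<exists>N\<in>null_sets unit_lebesgue. {x \<in> space unit_lebesgue. \<not> P (t, x)} \<subseteq> N" if "t \<in> ?T" for t
    using assms[OF that] by (rule AE_E3) auto
  then obtain N where N: "\<And>t. t \<in> ?T \<Longrightarrow> N t \<in> null_sets unit_lebesgue"
    "\<And>t. t \<in> ?T \<Longrightarrow> {x \<in> space unit_lebesgue. \<not> P (t, x)} \<subseteq> N t" by metis
  have "(\<Union>t\<in>?T. {t} \<times> N t) \<in> null_sets (bead_reference p q)"
  proof (intro null_sets.finite_UN null_setsI)
    fix t assume t: "t \<in> ?T"
    show "{t} \<times> N t \<in> sets (bead_reference p q)"
      unfolding bead_reference_def using N(1)[OF t] t by (intro pair_measureI) auto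
    have "emeasure (bead_reference p q) ({t} \<times> N t) = emeasure (count_space ?T) {t} * emeasure unit_lebesgue (N t)"
      unfolding bead_reference_def using N(1)[OF t] t by (intro U.emeasure_pair_measure_Times) auto
    then show "emeasure (bead_reference p q) ({t} \<times> N t) = 0" using N(1)[OF t] by auto
  qed auto
  then show ?thesis
    by (rule AE_I') (use N(2) in \<open>fastforce simp: space_bead_reference\<close>)
qed

context bead_lines
begin

text \<open>The pair lists \<open>(t, x)\<close> first because the exceptional set is controlled in
  the order almost all \<open>x\<close>, then almost all \<open>y\<close>; for
  \<open>t \<le> s\<close> it is empty.\<close>

lemma AE_bead_kernel_pair:
  "AE z in ref \<Otimes>\<^sub>M ref. bead_kernel p q (fst (snd z)) (snd (snd z)) (fst (fst z)) (snd (fst z)) = corr_kernel (snd z) (fst z)"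
proof -
  interpret R: finite_measure ref by (rule finite_measure_bead_reference)
  interpret RR: pair_sigma_finite ref ref ..
  let ?P = "\<lambda>w z. bead_kernel p q (fst z) (snd z) (fst w) (snd w) = corr_kernel z w"
  have "AE w in ref. AE z in ref. ?P w z"
  proof (rule AE_bead_referenceI)
    fix t assume t: "t \<in> {1..p + q - 1}"
    have "AE x in unit_lebesgue. \<forall>s\<in>{1..p + q - 1}. AE y in unit_lebesgue. ?P (t, x) (s, y)"
    proof (subst AE_finite_all, simp, intro ballI)
      fix s assume s: "s \<in> {1..p + q - 1}"
      show "AE x in unit_lebesgue. AE y in unit_lebesgue. ?P (t, x) (s, y)"
      proof (cases "s < t")
        case True
        then show ?thesis using s t AE_bead_kernel_eq_corr_kernel[of s t] by simp
      next
        case False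
        then show ?thesis using s t
          by (intro AE_I2) (auto intro!: bead_kernel_eq_corr_kernel)
      qed
    qed
    then show "AE x in unit_lebesgue. AE z in ref. ?P (t, x) z"
      by eventually_elim (rule AE_bead_referenceI, blast)
  qed
  moreover have "(\<lambda>z. bead_kernel p q (fst (snd z)) (snd (snd z)) (fst (fst z)) (snd (fst z))) \<in> borel_measurable (ref \<Otimes>\<^sub>M ref)"
    "(\<lambda>z. corr_kernel (snd z) (fst z)) \<in> borel_measurable (ref \<Otimes>\<^sub>M ref)"
    by (intro measurable_bead_kernel measurable_corr_kernel measurable_fst measurable_snd)+
  then have "{z \<in> space (ref \<Otimes>\<^sub>M ref). ?P (fst z) (snd z)} \<in> sets (ref \<Otimes>\<^sub>M ref)" by simp
  ultimately show ?thesis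
    by (intro RR.AE_pair_measure) auto
qed

lemma AE_bead_kernel_eq_corr_kernel_tuple:
  "AE Y in Pi\<^sub>M {..<n :: nat} (\<lambda>_. ref). \<forall>i<n. \<forall>j<n.
    bead_kernel p q (fst (Y i)) (snd (Y i)) (fst (Y j)) (snd (Y j)) = corr_kernel (Y i) (Y j)"
proof -
  interpret R: finite_measure ref by (rule finite_measure_bead_reference)
  interpret PR: product_sigma_finite "\<lambda>_. ref" ..
  let ?E = "\<lambda>Y i j. bead_kernel p q (fst (Y i)) (snd (Y i)) (fst (Y j)) (snd (Y j)) = corr_kernel (Y i) (Y j)"
  have pair: "AE Y in Pi\<^sub>M {..<n} (\<lambda>_. ref). ?E Y i j" if ij: "i < n" "j < n" for i j
  \<comment> \<open>The diagonal is a null set of pairs, so the statement on pairs says nothing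
    about it; there the exact identity for \<open>t \<le> s\<close> applies.\<close>
  proof (cases "i = j")
    case True
    show ?thesis
    proof (rule AE_I2)
      fix Y assume "Y \<in> space (Pi\<^sub>M {..<n} (\<lambda>_. ref))"
      then have "Y i \<in> space ref" using ij by (auto simp: space_PiM)
      then show "?E Y i j"
        using bead_kernel_eq_corr_kernel[of "fst (Y i)" "fst (Y i)" "snd (Y i)" "snd (Y i)"] True
        by (auto simp: space_bead_reference)
    qed
  next
    case False
    have m: "(\<lambda>z. bead_kernel p q (fst (snd z)) (snd (snd z)) (fst (fst z)) (snd (fst z))) \<in> borel_measurable (ref \<Otimes>\<^sub>M ref)"
      "(\<lambda>z. corr_kernel (snd z) (fst z)) \<in> borel_measurable (ref \<Otimes>\<^sub>M ref)"
      by (intro measurable_bead_kernel measurable_corr_kernel measurable_fst measurable_snd)+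
    show ?thesis
      by (rule PR.AE_PiM_two_components[of "{..<n}" j i
          "\<lambda>w z. bead_kernel p q (fst z) (snd z) (fst w) (snd w) = corr_kernel z w"])
         (use ij False m AE_bead_kernel_pair in auto)
  qed
  have "AE Y in Pi\<^sub>M {..<n} (\<lambda>_. ref). \<forall>i\<in>{..<n}. \<forall>j\<in>{..<n}. ?E Y i j"
    by (subst AE_finite_all, simp, intro ballI, subst AE_finite_all, simp, intro ballI pair) auto
  then show ?thesis by eventually_elim auto
qed

end

lemma measurable_det_mat:
  fixes f :: "nat \<Rightarrow> nat \<Rightarrow> 'a \<Rightarrow> real"
  assumes [measurable]: "\<And>i j. i < n \<Longrightarrow> j < n \<Longrightarrow> f i j \<in> borel_measurable M"
  shows "(\<lambda>x. Determinant.det (Matrix.mat n n (\<lambda>(i, j). f i j x))) \<in> borel_measurable M"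
proof -
  have "\<pi> i < n" if "\<pi> permutes {..<n}" "i < n" for \<pi> i
    using permutes_in_image[OF that(1), of i] that(2) by simp
  then show ?thesis
    unfolding det_mat_Leibniz
    by (intro borel_measurable_sum borel_measurable_times borel_measurable_const borel_measurable_prod assms) auto
qed

lemma is_correlation_function_cong_AE:
  assumes "is_correlation_function M X \<mu> n \<rho>" "\<rho>' \<in> borel_measurable (Pi\<^sub>M {..<n} (\<lambda>_. \<mu>))"
    and "AE Y in Pi\<^sub>M {..<n} (\<lambda>_. \<mu>). \<rho>' Y = \<rho> Y"
  shows "is_correlation_function M X \<mu> n \<rho>'"
  unfolding is_correlation_function_def
proof (intro conjI ballI)
  show "AE Y in Pi\<^sub>M {..<n} (\<lambda>_. \<mu>). 0 \<le> \<rho>' Y"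
    using assms(1,3) unfolding is_correlation_function_def by (auto elim: AE_mp)
  fix B assume B: "B \<in> sets (Pi\<^sub>M {..<n} (\<lambda>_. \<mu>))"
  have "(\<integral>\<^sup>+ \<omega>. of_nat (card {Y \<in> B. Y \<in> {..<n} \<rightarrow>\<^sub>E X \<omega> \<and> inj_on Y {..<n}}) \<partial>M) =
      (\<integral>\<^sup>+ Y. ennreal (\<rho> Y) * indicator B Y \<partial>(Pi\<^sub>M {..<n} (\<lambda>_. \<mu>)))"
    using assms(1) B unfolding is_correlation_function_def by blast
  also have "\<dots> = (\<integral>\<^sup>+ Y. ennreal (\<rho>' Y) * indicator B Y \<partial>(Pi\<^sub>M {..<n} (\<lambda>_. \<mu>)))"
    using assms(3) by (intro nn_integral_cong_AE) auto
  finally show "(\<integral>\<^sup>+ \<omega>. of_nat (card {Y \<in> B. Y \<in> {..<n} \<rightarrow>\<^sub>E X \<omega> \<and> inj_on Y {..<n}}) \<partial>M) =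
      (\<integral>\<^sup>+ Y. ennreal (\<rho>' Y) * indicator B Y \<partial>(Pi\<^sub>M {..<n} (\<lambda>_. \<mu>)))" .
qed (fact assms(2))

theorem proposition5p1:
  fixes p q n :: nat
  assumes "1 \<le> p" and "p \<le> q"
  shows "is_correlation_function (bead_process p q) (bead_points p q) (bead_reference p q) n
           (\<lambda>Y. Determinant.det (Matrix.mat n n (\<lambda>(i, j).
              bead_kernel p q (fst (Y i)) (snd (Y i)) (fst (Y j)) (snd (Y j)))))"
proof -
  interpret bead_lines p q using assms by unfold_locales
  show ?thesis
  proof (rule is_correlation_function_cong_AE[OF corr_det_is_correlation_function])
    show "(\<lambda>Y. Determinant.det (Matrix.mat n n (\<lambda>(i, j).
        bead_kernel p q (fst (Y i)) (snd (Y i)) (fst (Y j)) (snd (Y j))))) \<in> borel_measurable (Pi\<^sub>M {..<n} (\<lambda>_. ref))"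
      by (intro measurable_det_mat measurable_bead_kernel measurable_component_singleton) auto
    show "AE Y in Pi\<^sub>M {..<n} (\<lambda>_. ref). Determinant.det (Matrix.mat n n (\<lambda>(i, j).
        bead_kernel p q (fst (Y i)) (snd (Y i)) (fst (Y j)) (snd (Y j)))) = corr_det n Y"
      using AE_bead_kernel_eq_corr_kernel_tuple[of n]
    proof eventually_elim
      case (elim Y)
      then show ?case unfolding corr_det_eq_det
        by (intro arg_cong[where f = Determinant.det] cong_mat) auto
    qed
  qed
qed

end
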